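(* Let $d\ge1$ be an integer, $H\in(0,1)$ and $B\in\mathbf{B}$. Let $X^{B,H}$ be a $\mathbb{T}^d$-valued subordinated fractional Brownian motion with index $H$ corresponding to $B$, let $\mu_t^{B,H}=\frac1t\int_0^t\delta_{X_s^{B,H}}\,ds$, and write $\mu_t^B=\mu_t^{B,1/2}$. (1) Assume that $H=1/2$ and $B\in\mathbf{B}_\alpha\cap\mathbf{B}^\alpha$ for some $\alpha\in[0,1]$. Then for every $p\ge1$ there exist constants $C>0$ and $t_0>1$ such that for all $t\ge t_0$, $$\mathbb{E}\big[\mathbb{W}_p(\mu_t^{B},\mathfrak{m})\big]\ge C\cdot\begin{cases} t^{-1/2}, & d<2(1+\alpha),\\ \left(\frac{\log t}{t}\right)^{1/2}, & d=2(1+\alpha),\\ t^{-\frac{1}{d-2\alpha}}, & d>2(1+\alpha).\end{cases}$$ (2) Assume that $B\in\mathbf{B}_\alpha$ for some $\alpha\in(0,1]$ and that $d>\alpha/H$. Then for every $p>0$ there exist constants $C>0$ and $t_0>1$ such that for all $t\ge t_0$, $$\mathbb{E}\big[\mathbb{W}_p(\mu_t^{B,H},\mathfrak{m})\big]\ge C\,t^{-\frac{\min\{1,p\}}{d-\alpha/H}}.$$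
   Context: $\mathbb{T}^d=\mathbb{R}^d/\mathbb{Z}^d$ is the flat torus with distance $\rho(x,y)=\min_{k\in\mathbb{Z}^d}|x-y-k|$, and $\mathfrak{m}$ is the uniform distribution (normalized Lebesgue measure) on $\mathbb{T}^d$. For Borel probability measures $\mu,\nu$ on $\mathbb{T}^d$ and $p\in(0,\infty)$, $\mathbb{W}_p(\mu,\nu)=\inf_{\pi}\big(\int_{\mathbb{T}^d\times\mathbb{T}^d}\rho(x,y)^p\,\pi(dx,dy)\big)^{\min\{1,1/p\}}$, the infimum over all couplings $\pi$ of $\mu$ and $\nu$. A Bernstein function is $B\in C([0,\infty);[0,\infty))\cap C^\infty((0,\infty);[0,\infty))$ with $(-1)^{k-1}\frac{d^k}{d\lambda^k}B(\lambda)\ge 0$ for all $k\in\mathbb{N}$, $\lambda>0$. Let $\mathbf{B}$ be the set of Bernstein functions with $B(0)=0$ and $B'(0):=\lim_{\lambda\to0^+}B'(\lambda)>0$ (possibly $+\infty$). For $\alpha\in[0,1]$ let $\mathbf{B}^\alpha=\{B\in\mathbf{B}:\liminf_{\lambda\to\infty}\lambda^{-\alpha}B(\lambda)>0\}$ and $\mathbf{B}_\alpha=\{B\in\mathbf{B}:\limsup_{\lambda\to\infty}\lambda^{-\alpha}B(\lambda)<\infty\}$. For $B\in\mathbf{B}$, $S^B=(S^B_t)_{t\ge0}$ is the subordinator (increasing process with stationary independent increments, values in $[0,\infty)$, $S_0^B=0$) with $\mathbb{E}e^{-\lambda S_t^B}=e^{-tB(\lambda)}$ for $t,\lambda\ge0$.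 For $H\in(0,1)$, the fractional Brownian motion $X^H=(X^H_t)_{t\ge0}$ on $\mathbb{R}^d$ is the centered continuous Gaussian process with covariance matrix $\frac12(s^{2H}+t^{2H}-|t-s|^{2H})I_d$; on $\mathbb{T}^d$ one takes its image under the projection $\mathbb{R}^d\to\mathbb{T}^d$. With $S^B$ independent of $X^H$, the subordinated fractional Brownian motion with index $H$ corresponding to $B$ is $X_t^{B,H}:=X^H_{S_t^B}$ (projected to $\mathbb{T}^d$ in the $\mathbb{T}^d$-valued case). *)

theory Defs
  imports "HOL-Probability.Probability"
begin

section \<open>The flat torus\<close>

definition int_vectors :: "(real ^ 'd) set" where
  "int_vectors = {k. \<forall>i. k $ i \<in> \<int>}"

lemma int_vectors_0: "0 \<in> int_vectors"
  and int_vectors_minus: "k \<in> int_vectors \<Longrightarrow> - k \<in> int_vectors"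
  and int_vectors_add: "k \<in> int_vectors \<Longrightarrow> l \<in> int_vectors \<Longrightarrow> k + l \<in> int_vectors"
  by (auto simp: int_vectors_def)

lemma int_vectors_diff: "k \<in> int_vectors \<Longrightarrow> l \<in> int_vectors \<Longrightarrow> k - l \<in> int_vectors"
  using int_vectors_add[of k "- l"] int_vectors_minus[of l] by simp

lemma closed_int_vectors: "closed (int_vectors :: (real ^ 'd) set)"
proof -
  have eq: "int_vectors = (\<Inter>i. (\<lambda>k :: real ^ 'd. k $ i) -` \<int>)"
    by (auto simp: int_vectors_def)
  have cl: "closed ((\<lambda>k :: real ^ 'd. k $ i) -` \<int>)" for i
    by (intro closed_vimage closed_Ints continuous_intros)
  show ?thesis unfolding eq using cl by (intro closed_INT ballI)
qed

quotient_type (overloaded) 'd torus = "(real, 'd::finite) vec" / "\<lambda>x y. x - y \<in> int_vectors"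
  morphisms rep_torus torus_proj
proof (rule equivpI)
  show "reflp (\<lambda>x y :: real ^ 'd. x - y \<in> int_vectors)"
    by (simp add: reflp_def int_vectors_0)
  show "symp (\<lambda>x y :: real ^ 'd. x - y \<in> int_vectors)"
    using int_vectors_minus by (force simp: symp_def)
  show "transp (\<lambda>x y :: real ^ 'd. x - y \<in> int_vectors)"
    using int_vectors_add by (force simp: transp_def)
qed

lemma torus_proj_eq_iff: "torus_proj x = torus_proj y \<longleftrightarrow> x - y \<in> int_vectors"
  by (rule torus.abs_eq_iff)

lemma torus_proj_surj: "\<exists>x. u = torus_proj x"
  by (induct u rule: torus.abs_induct) blast

instantiation torus :: (finite) metric_space
begin

lift_definition dist_torus :: "'a torus \<Rightarrow> 'a torus \<Rightarrow> real"
  is "\<lambda>x y. INF k\<in>int_vectors. norm (x - y - k)"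
proof -
  fix x x' y y' :: "real ^ 'a"
  assume *: "x - x' \<in> int_vectors" "y - y' \<in> int_vectors"
  let ?c = "(x - x') - (y - y')"
  have c: "?c \<in> int_vectors" using * by (rule int_vectors_diff)
  have "(\<lambda>k. norm (x - y - k)) ` int_vectors = (\<lambda>k. norm (x' - y' - k)) ` int_vectors"
  proof (intro equalityI image_subsetI)
    fix k :: "real ^ 'a" assume "k \<in> int_vectors"
    then have "k - ?c \<in> int_vectors" "k + ?c \<in> int_vectors"
      using c by (auto intro: int_vectors_diff int_vectors_add)
    moreover have "x - y - k = x' - y' - (k - ?c)" "x' - y' - k = x - y - (k + ?c)"
      by (simp_all add: algebra_simps)
    ultimately show "norm (x - y - k) \<in> (\<lambda>k. norm (x' - y' - k)) ` int_vectors"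
      "norm (x' - y' - k) \<in> (\<lambda>k. norm (x - y - k)) ` int_vectors"
      by (metis image_eqI)+
  qed
  then show "(INF k\<in>int_vectors. norm (x - y - k)) = (INF k\<in>int_vectors. norm (x' - y' - k))"
    by simp
qed

definition uniformity_torus :: "('a torus \<times> 'a torus) filter" where
  "uniformity_torus = (INF e\<in>{0<..}. principal {(x, y). dist x y < e})"

definition open_torus :: "'a torus set \<Rightarrow> bool" where
  "open_torus U \<longleftrightarrow> (\<forall>x\<in>U. eventually (\<lambda>(x', y). x' = x \<longrightarrow> y \<in> U) uniformity)"

lemma dist_torus_proj_le:
  assumes "k \<in> int_vectors"
  shows "dist (torus_proj x) (torus_proj y :: 'a torus) \<le> norm (x - y - k)"
  unfolding dist_torus.abs_eq
  by (rule cINF_lower) (use assms in \<open>auto intro!: bdd_belowI[of _ 0]\<close>)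

text \<open>The infimum over the lattice is a minimum.\<close>

lemma dist_torus_attained:
  obtains k where "k \<in> int_vectors"
    "dist (torus_proj x) (torus_proj y :: 'a torus) = norm (x - y - k)"
proof -
  have ne: "int_vectors \<noteq> ({} :: (real ^ 'a) set)" using int_vectors_0 by auto
  obtain k where k: "k \<in> int_vectors"
      "\<And>l. l \<in> int_vectors \<Longrightarrow> dist (x - y) k \<le> dist (x - y) l"
    using distance_attains_inf[OF closed_int_vectors ne, of "x - y"] by metis
  have "norm (x - y - k) \<le> (INF l\<in>int_vectors. norm (x - y - l))"
    using k(2) by (intro cINF_greatest ne) (simp only: dist_norm)
  then have "norm (x - y - k) \<le> dist (torus_proj x) (torus_proj y)"
    by (simp only: dist_torus.abs_eq)
  with dist_torus_proj_le[OF k(1), of x y]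
  have "dist (torus_proj x) (torus_proj y) = norm (x - y - k)" by (rule order_antisym)
  with k(1) show ?thesis by (rule that)
qed

instance
proof
  fix x y z :: "'a torus"
  obtain a b c where abc: "x = torus_proj a" "y = torus_proj b" "z = torus_proj c"
    using torus_proj_surj by metis
  show "dist x y = 0 \<longleftrightarrow> x = y"
  proof
    assume "dist x y = 0"
    then obtain k where "k \<in> int_vectors" "norm (a - b - k) = 0"
      using dist_torus_attained[of a b] abc by metis
    then show "x = y" using abc by (simp add: torus_proj_eq_iff)
  next
    assume "x = y"
    then have "dist x y \<le> 0"
      using dist_torus_proj_le[of "a - b" a b] abc by (simp add: torus_proj_eq_iff)
    moreover have "0 \<le> dist x y"
      using dist_torus_attained[of a b] abc by (metis norm_ge_zero)
    ultimately show "dist x y = 0" by simp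
  qed
  obtain k where k: "k \<in> int_vectors" "dist x z = norm (a - c - k)"
    using dist_torus_attained[of a c] abc by metis
  obtain l where l: "l \<in> int_vectors" "dist y z = norm (b - c - l)"
    using dist_torus_attained[of b c] abc by metis
  have "dist x y \<le> norm (a - b - (k - l))"
    using dist_torus_proj_le[OF int_vectors_diff[OF k(1) l(1)]] abc by simp
  also have "a - b - (k - l) = (a - c - k) - (b - c - l)"
    by (simp add: algebra_simps)
  also have "norm \<dots> \<le> norm (a - c - k) + norm (b - c - l)"
    by (rule norm_triangle_ineq4)
  finally show "dist x y \<le> dist x z + dist y z"
    using k l by simp
qed (auto simp: uniformity_torus_def open_torus_def)

end

lemma continuous_torus_proj: "continuous_on S (torus_proj :: real ^ 'd \<Rightarrow> 'd torus)"
proof (rule continuous_onI)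
  fix x :: "real ^ 'd" and e :: real assume "0 < e"
  have "dist (torus_proj x') (torus_proj x) \<le> dist x' x" for x'
    using dist_torus_proj_le[OF int_vectors_0, of x' x] by (simp add: dist_norm)
  with \<open>0 < e\<close> show "\<exists>d>0. \<forall>x'\<in>S. dist x' x < d \<longrightarrow> dist (torus_proj x') (torus_proj x) \<le> e"
    by (intro exI[of _ e]) (auto intro: order.trans less_imp_le)
qed

lemma open_image_torus_proj:
  assumes "open U"
  shows "open (torus_proj ` U :: 'd::finite torus set)"
  unfolding open_dist
proof (intro ballI)
  fix z assume "z \<in> torus_proj ` U"
  then obtain x where x: "x \<in> U" "z = torus_proj x" by blast
  obtain e where e: "e > 0" "\<And>y. dist y x < e \<Longrightarrow> y \<in> U"
    using assms x by (auto simp: open_dist)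
  have "w \<in> torus_proj ` U" if less: "dist w z < e" for w
  proof -
    obtain y where y: "w = torus_proj y" using torus_proj_surj by blast
    obtain k where k: "k \<in> int_vectors" "dist w z = norm (y - x - k)"
      using dist_torus_attained[of y x] x y by metis
    have "dist (y - k) x < e"
      using less k by (simp add: dist_norm algebra_simps)
    moreover have "w = torus_proj (y - k)"
      using k by (simp add: y torus_proj_eq_iff)
    ultimately show ?thesis using e by blast
  qed
  with e show "\<exists>e>0. \<forall>w. dist w z < e \<longrightarrow> w \<in> torus_proj ` U" by blast
qed

instance torus :: (finite) second_countable_topology
proof
  obtain B :: "(real ^ 'a) set set" where B: "countable B" "topological_basis B"
    using ex_countable_basis by blast
  have "topological_basis ((`) torus_proj ` B :: 'a torus set set)"
  proof (rule topological_basisI)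
    fix V assume "V \<in> (`) torus_proj ` B"
    then show "open V" using topological_basis_open[OF B(2)] open_image_torus_proj by blast
  next
    fix U and z :: "'a torus" assume *: "open U" "z \<in> U"
    obtain x where x: "z = torus_proj x" using torus_proj_surj by blast
    have "open (torus_proj -` U)"
      by (rule open_vimage[OF \<open>open U\<close> continuous_torus_proj])
    then obtain V where V: "V \<in> B" "x \<in> V" "V \<subseteq> torus_proj -` U"
      using topological_basisE[OF B(2), of "torus_proj -` U" x] * x by auto
    show "\<exists>W\<in>(`) torus_proj ` B. z \<in> W \<and> W \<subseteq> U"
    proof (intro bexI conjI)
      show "z \<in> torus_proj ` V" using V(2) x by (rule rev_image_eqI)
      show "torus_proj ` V \<subseteq> U" using V(3) by (simp only: image_subset_iff_subset_vimage)
      show "torus_proj ` V \<in> (`) torus_proj ` B" using V(1) by (rule imageI)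
    qed
  qed
  then have "open = generate_topology ((`) torus_proj ` B :: 'a torus set set)"
    by (rule topological_basis_imp_subbasis)
  moreover have "countable ((`) torus_proj ` B :: 'a torus set set)"
    using B(1) by (rule countable_image)
  ultimately show "\<exists>B :: 'a torus set set. countable B \<and> open = generate_topology B"
    by blast
qed

lemma measurable_torus_proj: "torus_proj \<in> borel_measurable borel"
  by (rule borel_measurable_continuous_onI[OF continuous_torus_proj])

definition torus_uniform :: "'d::finite torus measure" where
  "torus_uniform = distr (uniform_measure lborel (cbox 0 1)) borel torus_proj"


section \<open>Wasserstein distances\<close>

definition couplings :: "'d::finite torus measure \<Rightarrow> 'd torus measure \<Rightarrow> ('d torus \<times> 'd torus) measure set"
  where "couplings \<mu> \<nu> =
    {\<pi>. sets \<pi> = sets (borel \<Otimes>\<^sub>M borel) \<and> distr \<pi> borel fst = \<mu> \<and> distr \<pi> borel snd = \<nu>}"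

text \<open>For probability measures the integrals below are finite, since the torus is bounded.\<close>

definition wasserstein :: "real \<Rightarrow> 'd::finite torus measure \<Rightarrow> 'd torus measure \<Rightarrow> real" where
  "wasserstein p \<mu> \<nu> =
    (INF \<pi>\<in>couplings \<mu> \<nu>. (\<integral>z. dist (fst z) (snd z) powr p \<partial>\<pi>) powr (min 1 (1 / p)))"


section \<open>Bernstein functions\<close>

text \<open>Bernstein functions live on the half-line; the values at negative reals are irrelevant.\<close>

definition bernstein :: "(real \<Rightarrow> real) set" where
  "bernstein = {B. continuous_on {0..} B \<and> (\<forall>x\<ge>0. 0 \<le> B x)
     \<and> (\<forall>k. \<forall>x>0. (deriv ^^ k) B differentiable (at x))
     \<and> (\<forall>k\<ge>1. \<forall>x>0. 0 \<le> (- 1) ^ (k - 1) * (deriv ^^ k) B x)}"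

definition bernstein_pos :: "(real \<Rightarrow> real) set" where
  "bernstein_pos = {B \<in> bernstein. B 0 = 0
     \<and> (\<exists>L::ereal. ((\<lambda>x. ereal (deriv B x)) \<longlongrightarrow> L) (at_right 0) \<and> 0 < L)}"

definition bernstein_lower :: "real \<Rightarrow> (real \<Rightarrow> real) set" where
  "bernstein_lower \<alpha> = {B \<in> bernstein_pos. 0 < Liminf at_top (\<lambda>x. ereal (x powr (- \<alpha>) * B x))}"

definition bernstein_upper :: "real \<Rightarrow> (real \<Rightarrow> real) set" where
  "bernstein_upper \<alpha> = {B \<in> bernstein_pos. Limsup at_top (\<lambda>x. ereal (x powr (- \<alpha>) * B x)) < \<infinity>}"


section \<open>Processes\<close>

text \<open>Processes are functions on \<^typ>\<open>real\<close> of which only the restriction to times \<open>t \<ge> 0\<close> matters.\<close>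

definition subordinator :: "'w measure \<Rightarrow> (real \<Rightarrow> real) \<Rightarrow> (real \<Rightarrow> 'w \<Rightarrow> real) \<Rightarrow> bool" where
  "subordinator M B S \<longleftrightarrow> prob_space M
     \<and> (\<forall>t\<ge>0. S t \<in> borel_measurable M)
     \<and> (\<forall>\<omega>\<in>space M. S 0 \<omega> = 0 \<and> mono_on {0..} (\<lambda>t. S t \<omega>))
     \<and> (\<forall>s\<ge>0. \<forall>h\<ge>0. distr M borel (\<lambda>\<omega>. S (s + h) \<omega> - S s \<omega>) = distr M borel (S h))
     \<and> (\<forall>(n::nat) \<tau>. 0 \<le> \<tau> 0 \<and> (\<forall>i<n. \<tau> i \<le> \<tau> (Suc i)) \<longrightarrow>
          prob_space.indep_vars M (\<lambda>_. borel) (\<lambda>i \<omega>. S (\<tau> (Suc i)) \<omega> - S (\<tau> i) \<omega>) {..<n})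
     \<and> (\<forall>t\<ge>0. \<forall>l\<ge>0. prob_space.expectation M (\<lambda>\<omega>. exp (- l * S t \<omega>)) = exp (- t * B l))"

text \<open>Real Gaussian variables, including the degenerate (constant) ones.\<close>

definition gaussian_rv :: "'w measure \<Rightarrow> ('w \<Rightarrow> real) \<Rightarrow> bool" where
  "gaussian_rv M Y \<longleftrightarrow> Y \<in> borel_measurable M \<and>
     (\<exists>m. distr M borel Y = return borel m
        \<or> (\<exists>\<sigma>>0. distributed M lborel Y (normal_density m \<sigma>)))"

definition gaussian_process :: "'w measure \<Rightarrow> (real \<Rightarrow> 'w \<Rightarrow> real ^ 'd) \<Rightarrow> bool" where
  "gaussian_process M X \<longleftrightarrow> (\<forall>t\<ge>0. X t \<in> borel_measurable M)
     \<and> (\<forall>T a. finite T \<and> T \<subseteq> {0..} \<longrightarrow> gaussian_rv M (\<lambda>\<omega>. \<Sum>t\<in>T. a t \<bullet> X t \<omega>))"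

definition fractional_brownian_motion :: "'w measure \<Rightarrow> real \<Rightarrow> (real \<Rightarrow> 'w \<Rightarrow> real ^ 'd) \<Rightarrow> bool" where
  "fractional_brownian_motion M H X \<longleftrightarrow> prob_space M \<and> gaussian_process M X
     \<and> (\<forall>\<omega>\<in>space M. continuous_on {0..} (\<lambda>t. X t \<omega>))
     \<and> (\<forall>t\<ge>0. prob_space.expectation M (X t) = 0)
     \<and> (\<forall>s\<ge>0. \<forall>t\<ge>0. \<forall>i j. prob_space.expectation M (\<lambda>\<omega>. X s \<omega> $ i * X t \<omega> $ j) =
          (if i = j then (s powr (2 * H) + t powr (2 * H) - \<bar>t - s\<bar> powr (2 * H)) / 2 else 0))"

text \<open>The \<open>\<sigma>\<close>-algebra on the sample space generated by a process. Independence of processes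
  is stated through it because the library's \<open>indep_var\<close> needs both variables to have the same
  value type.\<close>

definition process_algebra :: "'w measure \<Rightarrow> (real \<Rightarrow> 'w \<Rightarrow> 'b::topological_space) \<Rightarrow> 'w measure" where
  "process_algebra M X =
     vimage_algebra (space M) (\<lambda>\<omega>. \<lambda>t\<in>{0..}. X t \<omega>) (PiM {0..} (\<lambda>_. borel))"

definition subordinated_fbm ::
    "'w measure \<Rightarrow> (real \<Rightarrow> real) \<Rightarrow> real \<Rightarrow> (real \<Rightarrow> 'w \<Rightarrow> 'd::finite torus) \<Rightarrow> bool" where
  "subordinated_fbm M B H Z \<longleftrightarrow> (\<exists>X S.
     fractional_brownian_motion M H X \<and> subordinator M B S
     \<and> prob_space.indep_set M (sets (process_algebra M X)) (sets (process_algebra M S))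
     \<and> (\<forall>t\<ge>0. \<forall>\<omega>\<in>space M. Z t \<omega> = torus_proj (X (S t \<omega>) \<omega>)))"

text \<open>The average of Dirac masses along the path: the normalized occupation measure, whose value
  at a Borel set \<open>A\<close> is \<open>1/t\<close> times the Lebesgue measure of the set of those \<open>s\<close> in \<open>[0, t]\<close>
  for which the path is in \<open>A\<close>.\<close>

definition empirical_measure :: "(real \<Rightarrow> 'w \<Rightarrow> 'd::finite torus) \<Rightarrow> real \<Rightarrow> 'w \<Rightarrow> 'd torus measure"
  where "empirical_measure Z t \<omega> =
    scale_measure (ennreal (1 / t)) (distr (restrict_space lborel {0..t}) borel (\<lambda>s. Z s \<omega>))"

end

theory Submission
  imports Defs "HOL-Combinatorics.Multiset_Permutations"
begin

text \<open>
  Every lower bound tests the empirical measure \<open>\<mu>\<close> against one function: if \<open>f\<close> is Hoelder of exponent \<open>p \<le> 1\<close> with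
  constant \<open>1\<close>, then \<open>W\<^sub>p(\<mu>, m) \<ge> \<integral> f d\<mu> - \<integral> f dm\<close>. Since the Bochner integral of a non-measurable function is
  \<open>0\<close>, the expectation is meaningful only because the Wasserstein distance depends measurably on \<open>\<mu>\<close>.

  For part (2), and for \<open>d > 2 (1 + \<alpha>)\<close> in part (1), \<open>f\<close> is minus the \<open>p\<close>-th power of \<open>min r \<rho>\<close>, where \<open>\<rho>\<close> is the
  distance to the \<open>N\<close> positions at the times \<open>i t / N\<close>. If \<open>N\<close> is a small multiple of \<open>r\<^sup>-\<^sup>d\<close>, the balls of radius \<open>r\<close>
  around these positions miss most of the torus, whereas the path stays within \<open>o(r)\<close> of them as long as \<open>t / N\<close> is a
  small multiple of \<open>r\<close> to the power \<open>\<alpha> / H\<close>.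

  For \<open>d \<le> 2 (1 + \<alpha>)\<close> the wave \<open>v\<^sub>k\<close> is the convolution of \<open>\<mu>\<close> with a kernel whose frequencies lie in an annulus of
  size \<open>8\<^sup>k\<close>. Scale \<open>k\<close> of the test function is \<open>8\<^sup>-\<^sup>k\<close> times the convolution of this kernel with the sign of \<open>v\<^sub>k\<close>,
  switched off where the gradient of the previous scales exceeds a multiple of the square root of the number \<open>r\<close> of scales.
  The gradient of the sum is then of order \<open>sqrt r\<close>, and orthogonality of the scales shows that little is switched off, so
  that scale \<open>k\<close> gains about \<open>8\<^sup>-\<^sup>k\<close> times the integral of \<open>\<bar>v\<^sub>k\<bar>\<close>. The second and fourth moments of \<open>v\<^sub>k\<close>, which are
  sums of characteristic functions at ordered times, bound this gain from below by a multiple of \<open>t\<close> to the power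
  \<open>-1/2\<close>. In the critical dimension \<open>r\<close> of order \<open>log t\<close> scales contribute, below it one scale suffices.
\<close>


section \<open>Kantorovich duality on the torus\<close>

text \<open>In the critical dimension a single scale gains about t to the power -1/2 at the price of
  a gradient of order 1. Added blindly, r scales could reach a gradient of order r, and the
  logarithm would be lost. Orthogonality controls the sum by sqrt r, but only in quadratic mean,
  while the duality needs a uniform bound. The switch closes this gap: where the gradient exceeds
  the threshold by E before scale k, the selected points are at distance at least of order E / 8 ^
  k, so the tail of the kernel adds only order 1 / E, and the square of the excess grows by a
  bounded amount per scale. The same quadratic bound, through Chebyshev's inequality, makes the
  switched-off set small. Base 8 keeps the annuli disjoint, since one coordinate ranges from N to 5
  N in modulus.

  A second moment alone gives no lower bound for the mean of the modulus; the fourth moment excludes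
  concentration on small sets. It is bounded by the square of the second moment's order only while 8
  ^ (2 d k) \<le> t, and this limits the number of scales to order log t.\<close>

abbreviation unit_cube :: "(real ^ 'd::finite) measure" where
  "unit_cube \<equiv> uniform_measure lborel (cbox 0 1)"

lemma emeasure_unit_cube: "emeasure lborel (cbox 0 1 :: (real ^ 'd::finite) set) = 1"
proof -
  have 1: "1 \<bullet> b = 1" if "b \<in> Basis" for b :: "real ^ 'd"
    using that by (auto simp: Basis_vec_def inner_axis)
  then show ?thesis by (simp add: emeasure_lborel_cbox_eq)
qed

lemma prob_space_unit_cube: "prob_space (unit_cube :: (real ^ 'd::finite) measure)"
  by (rule prob_space_uniform_measure) (simp_all add: emeasure_unit_cube)

lemma prob_space_torus_uniform: "prob_space (torus_uniform :: 'd::finite torus measure)"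
  unfolding torus_uniform_def
  by (rule prob_space.prob_space_distr[OF prob_space_unit_cube])
     (use measurable_torus_proj in \<open>simp add: uniform_measure_def\<close>)

lemma sets_torus_uniform [simp, measurable_cong]: "sets torus_uniform = sets borel"
  by (simp add: torus_uniform_def)

lemma space_torus_uniform [simp]: "space torus_uniform = UNIV"
  by (simp add: torus_uniform_def)

lemma integral_torus_uniform:
  fixes f :: "'d::finite torus \<Rightarrow> 'b::{banach, second_countable_topology}"
  assumes "f \<in> borel_measurable borel"
  shows "(\<integral>z. f z \<partial>torus_uniform) = (\<integral>x. f (torus_proj x) \<partial>unit_cube)"
  unfolding torus_uniform_def
  by (rule integral_distr) (use assms measurable_torus_proj in \<open>simp_all add: uniform_measure_def\<close>)

lemma torus_dist_le: "dist z (w :: 'd::finite torus) \<le> real CARD('d)"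
proof -
  obtain x y where xy: "z = torus_proj x" "w = torus_proj y"
    using torus_proj_surj by metis
  define k :: "real ^ 'd" where "k = (\<chi> i. of_int (round (x $ i - y $ i)))"
  have k: "k \<in> int_vectors" by (simp add: int_vectors_def k_def)
  have "\<bar>(x - y - k) $ i\<bar> \<le> 1" for i
    using of_int_round_abs_le[of "x $ i - y $ i"] by (simp add: k_def abs_minus_commute)
  then have "norm (x - y - k) \<le> (\<Sum>i\<in>(UNIV::'d set). 1)"
    by (intro order.trans[OF norm_le_l1_cart] sum_mono) simp
  with dist_torus_proj_le[OF k, of x y] show ?thesis by (simp add: xy)
qed

lemma torus_dist_proj_le: "dist (torus_proj x) (torus_proj y) \<le> norm (x - y)"
  using dist_torus_proj_le[OF int_vectors_0, of x y] by simp

lemma couplings_D: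
  assumes "\<pi> \<in> couplings \<mu> \<nu>" "prob_space \<mu>"
  shows "prob_space \<pi>" "sets \<pi> = sets (borel \<Otimes>\<^sub>M borel)"
    "fst \<in> borel_measurable \<pi>" "snd \<in> borel_measurable \<pi>" "distr \<pi> borel fst = \<mu>" "distr \<pi> borel snd = \<nu>"
proof -
  show s: "sets \<pi> = sets (borel \<Otimes>\<^sub>M borel)" and d: "distr \<pi> borel fst = \<mu>" "distr \<pi> borel snd = \<nu>"
    using assms by (auto simp: couplings_def)
  show f: "fst \<in> borel_measurable \<pi>" and "snd \<in> borel_measurable \<pi>"
    by (simp_all add: measurable_cong_sets[OF s refl])
  show "prob_space \<pi>"
    using assms(2) f unfolding d(1)[symmetric] by (rule prob_space_distrD[rotated])
qed

text \<open>The product coupling makes the set nonempty over which the infimum in the distance is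
  taken; without it that infimum would carry no information.\<close>

lemma pair_measure_in_couplings:
  assumes "prob_space \<mu>" "prob_space \<nu>" "sets \<mu> = sets borel" "sets \<nu> = sets borel"
  shows "\<mu> \<Otimes>\<^sub>M \<nu> \<in> couplings \<mu> \<nu>"
proof -
  interpret a: prob_space \<mu> by fact
  interpret b: prob_space \<nu> by fact
  interpret p: pair_prob_space \<mu> \<nu> ..
  have s: "space \<mu> = UNIV" "space \<nu> = UNIV"
    using assms(3,4)[THEN sets_eq_imp_space_eq] by simp_all
  have "distr (\<mu> \<Otimes>\<^sub>M \<nu>) borel fst = distr (\<mu> \<Otimes>\<^sub>M \<nu>) \<mu> fst"
       "distr (\<mu> \<Otimes>\<^sub>M \<nu>) borel snd = distr (\<mu> \<Otimes>\<^sub>M \<nu>) \<nu> snd"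
    using assms by (auto intro!: distr_cong)
  moreover have "distr (\<mu> \<Otimes>\<^sub>M \<nu>) \<mu> fst = \<mu>"
  proof (rule measure_eqI)
    fix A assume "A \<in> sets (distr (\<mu> \<Otimes>\<^sub>M \<nu>) \<mu> fst)"
    then have A: "A \<in> sets \<mu>" by simp
    have "fst -` A \<inter> space (\<mu> \<Otimes>\<^sub>M \<nu>) = A \<times> space \<nu>"
      using A sets.sets_into_space[OF A] by (auto simp: space_pair_measure)
    then show "emeasure (distr (\<mu> \<Otimes>\<^sub>M \<nu>) \<mu> fst) A = emeasure \<mu> A"
      using A by (simp add: emeasure_distr b.emeasure_pair_measure_Times b.emeasure_space_1)
  qed simp
  moreover have "distr (\<mu> \<Otimes>\<^sub>M \<nu>) \<nu> snd = \<nu>"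
  proof (rule measure_eqI)
    fix A assume "A \<in> sets (distr (\<mu> \<Otimes>\<^sub>M \<nu>) \<nu> snd)"
    then have A: "A \<in> sets \<nu>" by simp
    have "snd -` A \<inter> space (\<mu> \<Otimes>\<^sub>M \<nu>) = space \<mu> \<times> A"
      using A sets.sets_into_space[OF A] by (auto simp: space_pair_measure)
    then show "emeasure (distr (\<mu> \<Otimes>\<^sub>M \<nu>) \<nu> snd) A = emeasure \<nu> A"
      using A by (simp add: emeasure_distr b.emeasure_pair_measure_Times a.emeasure_space_1)
  qed simp
  moreover have "sets (\<mu> \<Otimes>\<^sub>M \<nu>) = sets (borel \<Otimes>\<^sub>M borel)"
    using assms by (intro sets_pair_measure_cong)
  ultimately show ?thesis by (simp add: couplings_def)
qed

lemma borel_measurable_torus_dist [measurable]: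
  "(\<lambda>z. dist (fst z) (snd z :: 'd::finite torus)) \<in> borel_measurable (borel \<Otimes>\<^sub>M borel)"
  by measurable

lemma torus_dist_powr_le:
  assumes "0 \<le> p" shows "dist z (w :: 'd::finite torus) powr p \<le> real CARD('d) powr p"
  by (rule powr_mono2[OF assms]) (simp_all add: torus_dist_le)

lemma coupling_cost_integrable:
  fixes \<mu> :: "'d::finite torus measure"
  assumes "\<pi> \<in> couplings \<mu> \<nu>" "prob_space \<mu>" "0 \<le> p"
  shows "integrable \<pi> (\<lambda>z. dist (fst z) (snd z) powr p)"
proof -
  interpret prob_space \<pi> using couplings_D[OF assms(1,2)] by simp
  note [measurable_cong] = couplings_D(2)[OF assms(1,2)]
  show ?thesis
    by (rule integrable_const_bound[where B = "real CARD('d) powr p"])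
       (simp_all add: torus_dist_powr_le assms(3))
qed

lemma coupling_cost_le:
  fixes \<mu> :: "'d::finite torus measure"
  assumes "\<pi> \<in> couplings \<mu> \<nu>" "prob_space \<mu>" "0 \<le> p"
  shows "(\<integral>z. dist (fst z) (snd z) powr p \<partial>\<pi>) \<le> real CARD('d) powr p"
proof -
  interpret prob_space \<pi> using couplings_D[OF assms(1,2)] by simp
  show ?thesis
    by (rule integral_le_const[OF coupling_cost_integrable[OF assms]])
       (simp add: torus_dist_powr_le assms(3))
qed

lemma wasserstein_nonneg:
  assumes "prob_space \<mu>" "prob_space \<nu>" "sets \<mu> = sets borel" "sets \<nu> = sets borel"
  shows "0 \<le> wasserstein p \<mu> \<nu>"
  unfolding wasserstein_def using pair_measure_in_couplings[OF assms]
  by (intro cINF_greatest) auto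

lemma wasserstein_le_cost:
  assumes "\<pi> \<in> couplings \<mu> \<nu>"
  shows "wasserstein p \<mu> \<nu> \<le> (\<integral>z. dist (fst z) (snd z) powr p \<partial>\<pi>) powr (min 1 (1 / p))"
  unfolding wasserstein_def
  by (rule cINF_lower) (use assms in \<open>auto intro!: bdd_belowI[of _ 0]\<close>)

lemma wasserstein_le:
  fixes \<mu> :: "'d::finite torus measure"
  assumes "prob_space \<mu>" "prob_space \<nu>" "sets \<mu> = sets borel" "sets \<nu> = sets borel" "0 < p"
  shows "wasserstein p \<mu> \<nu> \<le> (real CARD('d) powr p) powr (min 1 (1 / p))"
proof -
  have c: "\<mu> \<Otimes>\<^sub>M \<nu> \<in> couplings \<mu> \<nu>" by (rule pair_measure_in_couplings) fact+
  show ?thesis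
    using assms
    by (intro order.trans[OF wasserstein_le_cost[OF c]] powr_mono2 coupling_cost_le[OF c]) auto
qed

lemma wasserstein_ge_dual:
  fixes f :: "'d::finite torus \<Rightarrow> real"
  assumes "prob_space \<mu>" "prob_space \<nu>" "sets \<mu> = sets borel" "sets \<nu> = sets borel" and p: "0 < p" "p \<le> 1"
    and f: "f \<in> borel_measurable borel" "\<And>z w. f z - f w \<le> dist z w powr p"
  shows "(\<integral>z. f z \<partial>\<mu>) - (\<integral>z. f z \<partial>\<nu>) \<le> wasserstein p \<mu> \<nu>"
  unfolding wasserstein_def
proof (rule cINF_greatest)
  show "couplings \<mu> \<nu> \<noteq> {}" using pair_measure_in_couplings[of \<mu> \<nu>] assms by auto
  fix \<pi> assume \<pi>: "\<pi> \<in> couplings \<mu> \<nu>"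
  note D = couplings_D[OF \<pi> assms(1)]
  note [measurable_cong] = D(2)
  note [measurable] = D(3,4) f(1)
  interpret prob_space \<pi> using D(1) .
  have bd: "norm (f z) \<le> \<bar>f undefined\<bar> + real CARD('d) powr p" for z
    using f(2)[of z undefined] f(2)[of undefined z] torus_dist_powr_le[of p z undefined]
      torus_dist_powr_le[of p undefined z] p unfolding real_norm_def by linarith
  have I: "integrable \<pi> (\<lambda>z. f (fst z))" "integrable \<pi> (\<lambda>z. f (snd z))"
    by (rule integrable_const_bound[OF AE_I2[OF bd]], measurable)+
  have "(\<integral>z. f z \<partial>\<mu>) - (\<integral>z. f z \<partial>\<nu>) = (\<integral>z. f (fst z) \<partial>\<pi>) - (\<integral>z. f (snd z) \<partial>\<pi>)"
    by (simp flip: D(5,6) add: integral_distr)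
  also have "\<dots> = (\<integral>z. f (fst z) - f (snd z) \<partial>\<pi>)" using I by simp
  also have "\<dots> \<le> (\<integral>z. dist (fst z) (snd z) powr p \<partial>\<pi>)"
    using I p f(2) by (intro integral_mono coupling_cost_integrable[OF \<pi> assms(1)]) auto
  \<comment> \<open>For \<open>p \<le> 1\<close> the outer exponent \<open>min 1 (1 / p)\<close> is
    1, so the cost integral is already the quantity whose infimum is taken.\<close>
  also have "\<dots> = (\<integral>z. dist (fst z) (snd z) powr p \<partial>\<pi>) powr (min 1 (1 / p))"
    using p by (simp add: min_def Bochner_Integration.integral_nonneg)
  finally show "(\<integral>z. f z \<partial>\<mu>) - (\<integral>z. f z \<partial>\<nu>) \<le> (\<integral>z. dist (fst z) (snd z) powr p \<partial>\<pi>) powr (min 1 (1 / p))" .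
qed

text \<open>Jensen's inequality, obtained by integrating Young's inequality for
  \<open>f x / a\<close> and 1, where \<open>a\<close> is the mean: the left side integrates to 1,
  and \<open>1 - 1 / q = 1 / p\<close> gives the claim.\<close>

lemma (in prob_space) expectation_powr_ge:
  fixes f :: "'a \<Rightarrow> real"
  assumes p: "1 \<le> p" and f: "integrable M f" "integrable M (\<lambda>x. f x powr p)" "\<And>x. 0 \<le> f x"
  shows "expectation f powr p \<le> expectation (\<lambda>x. f x powr p)"
proof (cases "p = 1 \<or> expectation f = 0")
  case True
  moreover have "0 \<le> expectation f"
    by (rule Bochner_Integration.integral_nonneg) (rule f(3))
  moreover have "0 \<le> expectation (\<lambda>x. f x powr p)"
    by (rule Bochner_Integration.integral_nonneg) simp
  moreover have "\<bar>f x\<bar> = f x" for x using f(3) by simp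
  moreover have "(\<lambda>x. f x powr 1) = f" using f(3) by (auto simp: fun_eq_iff)
  ultimately show ?thesis by auto
next
  case False
  define a where "a = expectation f"
  have a: "0 < a" using False f(3) by (auto simp: a_def less_le Bochner_Integration.integral_nonneg)
  have p1: "1 < p" using p False by auto
  define q where "q = p / (p - 1)"
  have q: "1 < q" "1 / p + 1 / q = 1" using p1 by (auto simp: q_def field_simps)
  have Y: "f x / a \<le> (f x powr p) / (a powr p * p) + 1 / q" for x
    using Youngs_inequality[OF p1 q(1,2), of "f x / a" 1] a f(3)[of x]
    by (simp add: powr_divide)
  have "1 = expectation (\<lambda>x. f x / a)" using a by (simp add: a_def)
  also have "\<dots> \<le> expectation (\<lambda>x. (f x powr p) / (a powr p * p) + 1 / q)"
    using f Y by (intro integral_mono) auto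
  also have "\<dots> = expectation (\<lambda>x. f x powr p) / (a powr p * p) + 1 / q"
    using f by (simp add: prob_space)
  finally have "1 / p \<le> expectation (\<lambda>x. f x powr p) / (a powr p * p)" using q by simp
  then have "a powr p \<le> expectation (\<lambda>x. f x powr p)" using p1 a by (simp add: field_simps)
  then show ?thesis by (simp add: a_def)
qed

text \<open>Jensen's inequality under each coupling. It reduces every lower bound for
  \<open>p \<ge> 1\<close> to the case \<open>p = 1\<close>, where the duality bound
  applies.\<close>

lemma wasserstein_1_le:
  fixes \<mu> :: "'d::finite torus measure"
  assumes "prob_space \<mu>" "prob_space \<nu>" "sets \<mu> = sets borel" "sets \<nu> = sets borel" and p: "1 \<le> p"
  shows "wasserstein 1 \<mu> \<nu> \<le> wasserstein p \<mu> \<nu>"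
  unfolding wasserstein_def[of p]
proof (rule cINF_greatest)
  show "couplings \<mu> \<nu> \<noteq> {}" using pair_measure_in_couplings[of \<mu> \<nu>] assms by auto
  fix \<pi> assume \<pi>: "\<pi> \<in> couplings \<mu> \<nu>"
  interpret prob_space \<pi> using couplings_D[OF \<pi> assms(1)] by simp
  let ?e = "\<integral>z. dist (fst z) (snd z) \<partial>\<pi>"
  have I: "integrable \<pi> (\<lambda>z. dist (fst z) (snd z))"
    using coupling_cost_integrable[OF \<pi> assms(1), of 1] by simp
  have "wasserstein 1 \<mu> \<nu> \<le> ?e"
    using wasserstein_le_cost[OF \<pi>, of 1] by (simp add: Bochner_Integration.integral_nonneg)
  also have "\<dots> = (?e powr p) powr (1 / p)"
    using p by (simp add: powr_powr Bochner_Integration.integral_nonneg)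
  also have "\<dots> \<le> (\<integral>z. dist (fst z) (snd z) powr p \<partial>\<pi>) powr (1 / p)"
    using p I by (intro powr_mono2 expectation_powr_ge coupling_cost_integrable[OF \<pi> assms(1)]) auto
  also have "1 / p = min 1 (1 / p)" using p by (simp add: min_def)
  finally show "wasserstein 1 \<mu> \<nu> \<le> (\<integral>z. dist (fst z) (snd z) powr p \<partial>\<pi>) powr (min 1 (1 / p))" .
qed

section \<open>Measurability of the Wasserstein distance\<close>

text \<open>McShane's extension: the infimum over \<open>\<omega>'\<close> of \<open>g \<omega>' + C * (\<Sum>j<n. \<bar>p j \<omega> - p j \<omega>'\<bar>)\<close> depends
  continuously on the finitely many \<open>p j \<omega>\<close> and is within \<open>\<epsilon>\<close> of \<open>g \<omega>\<close>.\<close>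

lemma borel_measurable_lipschitz_approx:
  fixes g :: "'w \<Rightarrow> real"
  assumes ap: "\<And>\<epsilon>. 0 < \<epsilon> \<Longrightarrow> \<exists>n p C. (\<forall>j<n::nat. p j \<in> borel_measurable M) \<and>
      (\<forall>\<omega>\<in>space M. \<forall>\<omega>'\<in>space M. g \<omega> \<le> g \<omega>' + \<epsilon> + C * (\<Sum>j<n. \<bar>p j \<omega> - p j \<omega>'\<bar>))"
    and g0: "\<And>\<omega>. \<omega> \<in> space M \<Longrightarrow> 0 \<le> g \<omega>"
  shows "g \<in> borel_measurable M"
proof (cases "space M = {}")
  case True
  then show ?thesis by (auto simp: measurable_def)
next
  case False
  have "\<exists>h. h \<in> borel_measurable M \<and> (\<forall>\<omega>\<in>space M. \<bar>h \<omega> - g \<omega>\<bar> \<le> \<epsilon>)" if eps: "0 < \<epsilon>" for \<epsilon>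
  proof -
    obtain n :: nat and p C0 where p: "\<And>j. j < n \<Longrightarrow> p j \<in> borel_measurable M"
      and g0': "\<And>\<omega> \<omega>'. \<omega> \<in> space M \<Longrightarrow> \<omega>' \<in> space M \<Longrightarrow>
        g \<omega> \<le> g \<omega>' + \<epsilon> + C0 * (\<Sum>j<n. \<bar>p j \<omega> - p j \<omega>'\<bar>)"
      using ap[OF eps] by metis
    define C where "C = max 0 C0"
    have C: "0 \<le> C" by (simp add: C_def)
    have g: "g \<omega> \<le> g \<omega>' + \<epsilon> + C * (\<Sum>j<n. \<bar>p j \<omega> - p j \<omega>'\<bar>)" if "\<omega> \<in> space M" "\<omega>' \<in> space M" for \<omega> \<omega>'
    proof -
      have "C0 * (\<Sum>j<n. \<bar>p j \<omega> - p j \<omega>'\<bar>) \<le> C * (\<Sum>j<n. \<bar>p j \<omega> - p j \<omega>'\<bar>)"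
        by (intro mult_right_mono sum_nonneg) (auto simp: C_def)
      with g0'[OF that] show ?thesis by linarith
    qed
    \<comment> \<open>Coordinates from \<open>n\<close> on are set to 0, so that the finitely many
      \<open>p j\<close> form one measurable map into the product space and every
      \<open>F \<omega>'\<close> is a continuous function on it.\<close>
    define q :: "'w \<Rightarrow> nat \<Rightarrow> real" where "q \<omega> j = (if j < n then p j \<omega> else 0)" for \<omega> j
    have q: "q \<in> measurable M borel"
    proof (rule measurable_coordinatewise_then_product)
      fix i show "(\<lambda>\<omega>. q \<omega> i) \<in> borel_measurable M"
        using p by (cases "i < n") (auto simp: q_def)
    qed
    define F where "F \<omega>' x = g \<omega>' + C * (\<Sum>j<n. \<bar>x j - p j \<omega>'\<bar>)" for \<omega>' and x :: "nat \<Rightarrow> real"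
    define h where "h \<omega> = (INF \<omega>'\<in>space M. F \<omega>' (q \<omega>))" for \<omega>
    have F0: "0 \<le> F \<omega>' x" if "\<omega>' \<in> space M" for \<omega>' x
      using g0[OF that] C by (auto simp: F_def intro!: add_nonneg_nonneg mult_nonneg_nonneg sum_nonneg)
    have bdd: "bdd_below ((\<lambda>\<omega>'. F \<omega>' x) ` space M)" for x
      using F0 by (auto intro!: bdd_belowI[of _ 0])
    have cF: "continuous_on UNIV (F \<omega>')" for \<omega>'
      unfolding F_def by (intro continuous_intros continuous_on_product_coordinates)
    have "h \<in> borel_measurable M"
    proof (rule borel_measurableI_less)
      fix c
      \<comment> \<open>The infimum may run over uncountably many points, so measurability comes
        from topology: the sublevel set of \<open>h\<close> is the preimage of a union of open
        sets.\<close>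
      have "{\<omega> \<in> space M. h \<omega> < c} = q -` (\<Union>\<omega>'\<in>space M. {x. F \<omega>' x < c}) \<inter> space M"
        unfolding h_def using cINF_less_iff[OF False bdd] by auto
      moreover have "open (\<Union>\<omega>'\<in>space M. {x. F \<omega>' x < c})"
        using cF by (intro open_UN ballI open_Collect_less continuous_intros) auto
      ultimately show "{\<omega> \<in> space M. h \<omega> < c} \<in> sets M"
        using q by (auto intro: measurable_sets)
    qed
    moreover have "\<bar>h \<omega> - g \<omega>\<bar> \<le> \<epsilon>" if w: "\<omega> \<in> space M" for \<omega>
    proof -
      have "h \<omega> \<le> F \<omega> (q \<omega>)" unfolding h_def by (rule cINF_lower[OF bdd w])
      also have "F \<omega> (q \<omega>) = g \<omega>" by (simp add: F_def q_def)
      finally have 1: "h \<omega> \<le> g \<omega>" .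
      have "g \<omega> - \<epsilon> \<le> h \<omega>" unfolding h_def
        using g[OF w] by (intro cINF_greatest False) (force simp: F_def q_def)
      with 1 that show ?thesis using \<open>0 < \<epsilon>\<close> by auto
    qed
    ultimately show ?thesis by blast
  qed
  then have "\<forall>k. \<exists>h. h \<in> borel_measurable M \<and> (\<forall>\<omega>\<in>space M. \<bar>h \<omega> - g \<omega>\<bar> \<le> 1 / Suc k)"
    by (auto simp del: of_nat_Suc)
  then obtain h where h: "\<And>k. h k \<in> borel_measurable M"
    "\<And>k \<omega>. \<omega> \<in> space M \<Longrightarrow> \<bar>h k \<omega> - g \<omega>\<bar> \<le> 1 / Suc k" by metis
  show ?thesis
  proof (rule borel_measurable_LIMSEQ_real[OF _ h(1)])
    fix \<omega> assume w: "\<omega> \<in> space M"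
    show "(\<lambda>k. h k \<omega>) \<longlonglongrightarrow> g \<omega>"
      by (rule LIM_zero_cancel, rule Lim_null_comparison[OF _ LIMSEQ_Suc[OF lim_1_over_n]])
         (use h(2)[OF w] in auto)
  qed
qed

section \<open>Finite partitions of the torus and the transfer of couplings\<close>

lemma compact_torus: "compact (UNIV :: 'd::finite torus set)"
proof -
  have "UNIV = torus_proj ` (cbox 0 1 :: (real ^ 'd) set)"
  proof (intro equalityI subsetI)
    fix z :: "'d torus"
    obtain x where x: "z = torus_proj x" using torus_proj_surj by blast
    define y :: "real ^ 'd" where "y = (\<chi> i. frac (x $ i))"
    have "x - y \<in> int_vectors" by (simp add: int_vectors_def y_def frac_def)
    then have "z = torus_proj y" by (simp add: x torus_proj_eq_iff)
    moreover have "y \<in> cbox 0 1"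
      by (auto simp: mem_box_cart y_def frac_lt_1 less_imp_le)
    ultimately show "z \<in> torus_proj ` cbox 0 1" by blast
  qed simp
  then show ?thesis using compact_continuous_image[OF continuous_torus_proj compact_cbox] by metis
qed

text \<open>A point is sent to the least index of a ball of a finite net that contains it. Taking
  the least index makes the cells disjoint and Borel, and two points that share a ball of radius
  \<open>\<delta> / 2\<close> are close.\<close>

lemma torus_partition:
  assumes "0 < \<delta>"
  obtains J :: "'d::finite torus \<Rightarrow> nat" and n where
    "J \<in> measurable borel (count_space UNIV)" "\<And>x. J x < n" "\<And>x y. J x = J y \<Longrightarrow> dist x y \<le> \<delta>"
proof -
  obtain k where k: "finite k" "(UNIV :: 'd torus set) \<subseteq> (\<Union>x\<in>k. ball x (\<delta> / 2))"
    using compact_torus[unfolded compact_eq_totally_bounded] assms half_gt_zero by blast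
  obtain a :: "nat \<Rightarrow> 'd torus" and n where a: "k = a ` {i. i < n}"
    using finite_imp_nat_seg_image_inj_on[OF k(1)] by metis
  have ex: "\<exists>i<n. dist (a i) x < \<delta> / 2" for x
    using k(2) a by (auto simp: subset_eq)
  define J where "J x = (LEAST i. dist (a i) x < \<delta> / 2)" for x
  have J: "dist (a (J x)) x < \<delta> / 2" "J x < n" for x
  proof -
    obtain i where i: "i < n" "dist (a i) x < \<delta> / 2" using ex by blast
    show "dist (a (J x)) x < \<delta> / 2" unfolding J_def by (rule LeastI[of "\<lambda>i. dist (a i) x < \<delta> / 2", OF i(2)])
    have "J x \<le> i" unfolding J_def by (rule Least_le[of "\<lambda>i. dist (a i) x < \<delta> / 2", OF i(2)])
    with i show "J x < n" by simp
  qed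
  have "J \<in> measurable borel (count_space UNIV)"
    unfolding J_def by measurable
  then show ?thesis
  proof (rule that)
    show "J x < n" for x by (rule J)
    show "dist x y \<le> \<delta>" if "J x = J y" for x y
      using J(1)[of x] J(1)[of y] dist_triangle[of x y "a (J x)"] that by (simp add: dist_commute)
  qed
qed

lemma nn_integral_finite_range:
  assumes J: "J \<in> measurable N (count_space UNIV)" "\<And>x. J x < (n::nat)"
  shows "(\<integral>\<^sup>+x. g (J x) \<partial>N) = (\<Sum>l<n. g l * emeasure N {x\<in>space N. J x = l})"
proof -
  have "(\<integral>\<^sup>+x. g (J x) \<partial>N) = (\<integral>\<^sup>+x. (\<Sum>l<n. g l * indicator {x\<in>space N. J x = l} x) \<partial>N)"
  proof (intro nn_integral_cong)
    fix x assume x: "x \<in> space N"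
    have "(\<Sum>l<n. g l * indicator {x\<in>space N. J x = l} x) = (\<Sum>l<n. if J x = l then g l else 0)"
      using x by (intro sum.cong) (auto simp: indicator_def)
    also have "\<dots> = g (J x)" using J(2) by (subst sum.delta') auto
    finally show "g (J x) = (\<Sum>l<n. g l * indicator {x\<in>space N. J x = l} x)" by simp
  qed
  also have "\<dots> = (\<Sum>l<n. g l * emeasure N {x\<in>space N. J x = l})"
    using J(1) by (subst nn_integral_sum) (auto simp: nn_integral_cmult)
  finally show ?thesis .
qed

lemma sum_ennreal_mult:
  assumes "\<And>j. 0 \<le> u j" "\<And>j. 0 \<le> v j"
  shows "(\<Sum>j\<in>A. ennreal (u j) * ennreal (v j)) = ennreal (\<Sum>j\<in>A. u j * v j)"
  using assms by (simp flip: ennreal_mult)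

text \<open>\<open>\<gamma> j l\<close> is the fraction of the mass of the cell \<open>J = l\<close> that is sent to the cell \<open>J = j\<close>; the second
  marginal is kept, and only the mass that changes its cell costs more than \<open>\<epsilon>\<close>.\<close>

lemma coupling_transfer:
  fixes \<mu> \<mu>' \<nu> :: "'d::finite torus measure" and J :: "'d torus \<Rightarrow> nat" and \<gamma> :: "nat \<Rightarrow> nat \<Rightarrow> real"
  assumes P: "prob_space \<mu>" "prob_space \<mu>'" "prob_space \<nu>"
    and S: "sets \<mu> = sets borel" "sets \<mu>' = sets borel" "sets \<nu> = sets borel"
    and \<pi>: "\<pi> \<in> couplings \<mu> \<nu>" and p: "0 < p"
    and J: "J \<in> measurable borel (count_space UNIV)" "\<And>x. J x < n"
    and \<epsilon>: "0 \<le> \<epsilon>" "\<And>x y z. J x = J y \<Longrightarrow> dist x z powr p \<le> dist y z powr p + \<epsilon>"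
    and \<gamma>: "\<And>j l. 0 \<le> \<gamma> j l" "\<And>l. l < n \<Longrightarrow> (\<Sum>j<n. \<gamma> j l) = 1"
      "\<And>j. j < n \<Longrightarrow> (\<Sum>l<n. \<gamma> j l * measure \<mu> {x. J x = l}) = measure \<mu>' {x. J x = j}"
  shows "\<exists>\<pi>'\<in>couplings \<mu>' \<nu>. (\<integral>z. dist (fst z) (snd z) powr p \<partial>\<pi>') \<le>
    (\<integral>z. dist (fst z) (snd z) powr p \<partial>\<pi>) + \<epsilon> +
     real CARD('d) powr p * (\<Sum>l<n. (1 - \<gamma> l l) * measure \<mu> {x. J x = l})"
proof -
  interpret \<mu>: prob_space \<mu> by fact
  interpret \<mu>': prob_space \<mu>' by fact
  interpret \<nu>: prob_space \<nu> by fact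
  note D = couplings_D[OF \<pi> P(1)]
  interpret \<pi>: prob_space \<pi> by (rule D)
  note [measurable_cong] = S D(2)
  note [measurable] = J(1) D(3,4)
  have sp: "space \<mu> = UNIV" "space \<mu>' = UNIV" "space \<nu> = UNIV"
    using S[THEN sets_eq_imp_space_eq] by simp_all
  have sp\<pi>: "space \<pi> = UNIV" using sets_eq_imp_space_eq[OF D(2)] by (simp add: space_pair_measure)
  interpret pp: pair_prob_space \<mu>' \<pi> ..
  let ?D = "real CARD('d) powr p"
  define w where "w l = measure \<mu> {x. J x = l}" for l
  define w' where "w' l = measure \<mu>' {x. J x = l}" for l
  have w0: "0 \<le> w l" "0 \<le> w' l" for l by (simp_all add: w_def w'_def)
  \<comment> \<open>Density of the new first point given the old pair \<open>z\<close>: a cell is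
    drawn from the column of \<open>\<gamma>\<close> that belongs to the cell of
    \<open>fst z\<close>, then a point from \<open>\<mu>'\<close> conditioned to the drawn cell. On
    a cell without mass under \<open>\<mu>'\<close> the quotient is 0.\<close>
  define k where "k x' z = \<gamma> (J x') (J (fst z)) / w' (J x')" for x' and z :: "'d torus \<times> 'd torus"
  have k0: "0 \<le> k x' z" for x' z using \<gamma>(1) w0 by (simp add: k_def)
  have [measurable]: "(\<lambda>(x', z). k x' z) \<in> borel_measurable (\<mu>' \<Otimes>\<^sub>M \<pi>)"
    "k x' \<in> borel_measurable \<pi>" "(\<lambda>x'. k x' z) \<in> borel_measurable \<mu>'" for x' z
    unfolding k_def by measurable
  \<comment> \<open>Joint law of the new point and the old pair; \<open>\<pi>'\<close> forgets the
    old first point.\<close>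
  define \<rho> where "\<rho> = density (\<mu>' \<Otimes>\<^sub>M \<pi>) (\<lambda>(x', z). ennreal (k x' z))"
  define \<pi>' where "\<pi>' = distr \<rho> (borel \<Otimes>\<^sub>M borel) (\<lambda>(x', z). (x', snd z))"
  have pos: "AE x' in \<mu>'. 0 < w' (J x')"
  proof -
    have "(\<integral>\<^sup>+x'. (if 0 < w' (J x') then 0 else 1) \<partial>\<mu>')
        = (\<Sum>l<n. (if 0 < w' l then 0 else 1) * emeasure \<mu>' {x\<in>space \<mu>'. J x = l})"
      by (rule nn_integral_finite_range) (use J in auto)
    also have "\<dots> = (\<Sum>l<n. 0)"
      using w0 by (intro sum.cong)
        (auto simp: sp w'_def \<mu>'.emeasure_eq_measure not_less order.antisym)
    finally have "(\<integral>\<^sup>+x'. (if 0 < w' (J x') then 0 else 1) \<partial>\<mu>') = 0" by simp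
    then have "AE x' in \<mu>'. (if 0 < w' (J x') then 0 else 1) = (0 :: ennreal)"
      by (subst (asm) nn_integral_0_iff_AE) auto
    then show ?thesis by eventually_elim (auto split: if_splits)
  qed
  have fm: "(\<integral>\<^sup>+z. g (J (fst z)) \<partial>\<pi>) = (\<Sum>l<n. g l * ennreal (w l))" for g
  proof -
    have "(\<integral>\<^sup>+z. g (J (fst z)) \<partial>\<pi>) = (\<integral>\<^sup>+x. g (J x) \<partial>\<mu>)"
      unfolding D(5)[symmetric] by (subst nn_integral_distr) (auto simp: measurable_cong_sets[OF S(1) refl])
    also have "\<dots> = (\<Sum>l<n. g l * emeasure \<mu> {x\<in>space \<mu>. J x = l})"
      by (rule nn_integral_finite_range) (use J in auto)
    finally show ?thesis by (simp add: w_def sp \<mu>.emeasure_eq_measure)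
  qed
  have fm': "(\<integral>\<^sup>+x'. g (J x') \<partial>\<mu>') = (\<Sum>l<n. g l * ennreal (w' l))" for g
  proof -
    have "(\<integral>\<^sup>+x. g (J x) \<partial>\<mu>') = (\<Sum>l<n. g l * emeasure \<mu>' {x\<in>space \<mu>'. J x = l})"
      by (rule nn_integral_finite_range) (use J in auto)
    then show ?thesis by (simp add: w'_def sp \<mu>'.emeasure_eq_measure)
  qed
  have k1: "(\<integral>\<^sup>+z. ennreal (k x' z) \<partial>\<pi>) = 1" if "0 < w' (J x')" for x'
  proof -
    have "(\<integral>\<^sup>+z. ennreal (k x' z) \<partial>\<pi>) = (\<Sum>l<n. ennreal (\<gamma> (J x') l / w' (J x')) * ennreal (w l))"
      unfolding k_def by (rule fm)
    also have "\<dots> = ennreal (\<Sum>l<n. \<gamma> (J x') l / w' (J x') * w l)"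
      using w0 \<gamma>(1) by (intro sum_ennreal_mult) auto
    also have "(\<Sum>l<n. \<gamma> (J x') l / w' (J x') * w l) = (\<Sum>l<n. \<gamma> (J x') l * w l) / w' (J x')"
      by (simp add: sum_divide_distrib)
    also have "\<dots> = 1" using \<gamma>(3)[OF J(2)[of x']] that by (simp add: w_def w'_def)
    finally show ?thesis by simp
  qed
  \<comment> \<open>A cell without mass under \<open>\<mu>'\<close> receives nothing from a charged
    cell, so the division by 0 in \<open>k\<close> loses no mass.\<close>
  have wz: "\<gamma> j l * w l = 0" if "w' j = 0" "j < n" "l < n" for j l
  proof -
    have "(\<Sum>l<n. \<gamma> j l * w l) = 0" using \<gamma>(3)[OF that(2)] that by (simp add: w_def w'_def)
    then show ?thesis using that w0 \<gamma>(1) by (subst (asm) sum_nonneg_eq_0_iff) auto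
  qed
  have k2: "(\<integral>\<^sup>+x'. ennreal (k x' z) \<partial>\<mu>') = 1" if "0 < w (J (fst z))" for z
  proof -
    let ?l = "J (fst z)"
    have "(\<integral>\<^sup>+x'. ennreal (k x' z) \<partial>\<mu>') = (\<Sum>j<n. ennreal (\<gamma> j ?l / w' j) * ennreal (w' j))"
      unfolding k_def by (rule fm'[of "\<lambda>j. ennreal (\<gamma> j ?l / w' j)"])
    also have "\<dots> = ennreal (\<Sum>j<n. \<gamma> j ?l / w' j * w' j)"
      using w0 \<gamma>(1) by (intro sum_ennreal_mult) auto
    also have "(\<Sum>j<n. \<gamma> j ?l / w' j * w' j) = (\<Sum>j<n. \<gamma> j ?l)"
      using wz[OF _ _ J(2)[of "fst z"]] that by (intro sum.cong) fastforce+
    also have "\<dots> = 1" by (rule \<gamma>(2)) (rule J)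
    finally show ?thesis by simp
  qed
  have pos2: "AE z in \<pi>. 0 < w (J (fst z))"
  proof -
    have "(\<integral>\<^sup>+z. (if 0 < w (J (fst z)) then 0 else 1) \<partial>\<pi>) = (\<Sum>l<n. (if 0 < w l then 0 else 1) * ennreal (w l))"
      by (rule fm)
    also have "\<dots> = (\<Sum>l<n. 0)"
      using w0 by (intro sum.cong) (auto simp: not_less order.antisym)
    finally have "(\<integral>\<^sup>+z. (if 0 < w (J (fst z)) then 0 else 1) \<partial>\<pi>) = 0" by simp
    then have "AE z in \<pi>. (if 0 < w (J (fst z)) then 0 else 1) = (0 :: ennreal)"
      by (subst (asm) nn_integral_0_iff_AE) auto
    then show ?thesis by eventually_elim (auto split: if_splits)
  qed
  have int1: "(\<integral>\<^sup>+v. f (fst v) \<partial>\<rho>) = (\<integral>\<^sup>+x'. f x' \<partial>\<mu>')" if [measurable]: "f \<in> borel_measurable borel" for f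
  proof -
    have "(\<integral>\<^sup>+v. f (fst v) \<partial>\<rho>) = (\<integral>\<^sup>+v. (case v of (x', z) \<Rightarrow> ennreal (k x' z)) * f (fst v) \<partial>(\<mu>' \<Otimes>\<^sub>M \<pi>))"
      unfolding \<rho>_def by (subst nn_integral_density) auto
    also have "\<dots> = (\<integral>\<^sup>+x'. \<integral>\<^sup>+z. ennreal (k x' z) * f x' \<partial>\<pi> \<partial>\<mu>')"
      by (subst \<pi>.nn_integral_fst[symmetric]) (auto simp: split_beta')
    also have "\<dots> = (\<integral>\<^sup>+x'. f x' \<partial>\<mu>')"
      by (intro nn_integral_cong_AE, use pos in eventually_elim) (auto simp: nn_integral_multc k1)
    finally show ?thesis .
  qed
  have int2: "(\<integral>\<^sup>+v. f (snd v) \<partial>\<rho>) = (\<integral>\<^sup>+z. f z \<partial>\<pi>)"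
    if [measurable]: "f \<in> borel_measurable (borel \<Otimes>\<^sub>M borel)" for f
  proof -
    have "(\<integral>\<^sup>+v. f (snd v) \<partial>\<rho>) = (\<integral>\<^sup>+v. (case v of (x', z) \<Rightarrow> ennreal (k x' z)) * f (snd v) \<partial>(\<mu>' \<Otimes>\<^sub>M \<pi>))"
      unfolding \<rho>_def by (subst nn_integral_density) auto
    also have "\<dots> = (\<integral>\<^sup>+z. \<integral>\<^sup>+x'. ennreal (k x' z) * f z \<partial>\<mu>' \<partial>\<pi>)"
      by (subst pp.nn_integral_snd[symmetric]) (auto simp: split_beta')
    also have "\<dots> = (\<integral>\<^sup>+z. f z \<partial>\<pi>)"
      by (intro nn_integral_cong_AE, use pos2 in eventually_elim) (auto simp: nn_integral_multc k2)
    finally show ?thesis .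
  qed
  have s\<rho>: "sets \<rho> = sets (borel \<Otimes>\<^sub>M (borel \<Otimes>\<^sub>M borel))"
    unfolding \<rho>_def using S D(2) by (simp cong: sets_pair_measure_cong)
  note [measurable_cong] = s\<rho>
  have sp\<rho>: "space \<rho> = UNIV" using sets_eq_imp_space_eq[OF s\<rho>] by (simp add: space_pair_measure)
  have "distr \<pi>' borel fst = \<mu>'"
  proof (rule measure_eqI)
    fix A assume "A \<in> sets (distr \<pi>' borel fst)"
    then have A[measurable]: "A \<in> sets borel" by simp
    have "emeasure (distr \<pi>' borel fst) A = emeasure (distr \<rho> borel fst) A"
      unfolding \<pi>'_def by (subst distr_distr) (auto simp: comp_def split_beta')
    also have "\<dots> = (\<integral>\<^sup>+x. indicator A x \<partial>(distr \<rho> borel fst))" by simp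
    also have "\<dots> = (\<integral>\<^sup>+x. indicator A x \<partial>\<mu>')"
      using int1[of "indicator A"] by (subst nn_integral_distr) auto
    finally show "emeasure (distr \<pi>' borel fst) A = emeasure \<mu>' A" using S(2) by simp
  qed (simp add: S)
  moreover have "distr \<pi>' borel snd = \<nu>"
  proof (rule measure_eqI)
    fix A assume "A \<in> sets (distr \<pi>' borel snd)"
    then have A[measurable]: "A \<in> sets borel" by simp
    have "emeasure (distr \<pi>' borel snd) A = emeasure (distr \<rho> borel (\<lambda>v. snd (snd v))) A"
      unfolding \<pi>'_def by (subst distr_distr) (auto simp: comp_def split_beta')
    also have "\<dots> = (\<integral>\<^sup>+x. indicator A x \<partial>(distr \<rho> borel (\<lambda>v. snd (snd v))))" by simp
    also have "\<dots> = (\<integral>\<^sup>+z. indicator A (snd z) \<partial>\<pi>)"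
      using int2[of "\<lambda>z. indicator A (snd z)"] by (subst nn_integral_distr) auto
    also have "\<dots> = (\<integral>\<^sup>+x. indicator A x \<partial>(distr \<pi> borel snd))"
      by (subst nn_integral_distr) auto
    finally show "emeasure (distr \<pi>' borel snd) A = emeasure \<nu> A" using S(3) D(6) by simp
  qed (simp add: S)
  ultimately have \<pi>': "\<pi>' \<in> couplings \<mu>' \<nu>" by (simp add: couplings_def \<pi>'_def)
  define c where "c z = dist (fst z) (snd z) powr p" for z :: "'d torus \<times> 'd torus"
  have [measurable]: "c \<in> borel_measurable (borel \<Otimes>\<^sub>M borel)" unfolding c_def by measurable
  have c0: "0 \<le> c z" "c z \<le> ?D" for z using p by (simp_all add: c_def torus_dist_powr_le)
  define R where "R = (\<Sum>l<n. (1 - \<gamma> l l) * w l)"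
  have gle: "\<gamma> l l \<le> 1" if "l < n" for l
    using \<gamma>(2)[OF that] member_le_sum[of l "{..<n}" "\<lambda>j. \<gamma> j l"] \<gamma>(1) that by auto
  have R0: "0 \<le> R" unfolding R_def using gle w0 by (intro sum_nonneg mult_nonneg_nonneg) auto
  have [measurable]: "(\<lambda>v. if J (fst v) = J (fst (snd v)) then 0 else 1 :: ennreal)
      \<in> borel_measurable (borel \<Otimes>\<^sub>M (borel \<Otimes>\<^sub>M borel))"
  proof -
    have [measurable]: "(\<lambda>x. real (J x)) \<in> borel_measurable borel"
      by (rule measurable_compose[OF J(1)]) simp
    have "(\<lambda>v. if real (J (fst v)) = real (J (fst (snd v))) then 0 else 1 :: ennreal)
      \<in> borel_measurable (borel \<Otimes>\<^sub>M (borel \<Otimes>\<^sub>M borel))"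
      by measurable
    then show ?thesis by simp
  qed
  then have [measurable]: "(\<lambda>v. if J (fst v) = J (fst (snd v)) then 0 else 1 :: ennreal)
      \<in> borel_measurable (\<mu>' \<Otimes>\<^sub>M \<pi>)"
    by (simp add: measurable_cong_sets[OF sets_pair_measure_cong[OF S(2) D(2)] refl])
  \<comment> \<open>The mass of the triples whose first point has changed its cell. Only for these
    can the cost grow by more than \<open>\<epsilon>\<close>, and then the diameter bounds
    it.\<close>
  have eq0: "(\<integral>\<^sup>+v. (if J (fst v) = J (fst (snd v)) then 0 else 1) \<partial>\<rho>) = ennreal R"
  proof -
    have in1: "(\<integral>\<^sup>+x'. ennreal (k x' z) * (if J x' = J (fst z) then 0 else 1) \<partial>\<mu>') = ennreal (1 - \<gamma> (J (fst z)) (J (fst z)))"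
      if "0 < w (J (fst z))" for z
    proof -
      let ?l = "J (fst z)"
      have "(\<integral>\<^sup>+x'. ennreal (k x' z) * (if J x' = J (fst z) then 0 else 1) \<partial>\<mu>')
         = (\<Sum>j<n. ennreal (\<gamma> j ?l / w' j) * (if j = ?l then 0 else 1) * ennreal (w' j))"
        unfolding k_def by (rule fm'[of "\<lambda>j. ennreal (\<gamma> j ?l / w' j) * (if j = ?l then 0 else 1)"])
      also have "\<dots> = ennreal (\<Sum>j<n. \<gamma> j ?l / w' j * (if j = ?l then 0 else 1) * w' j)"
        using w0 \<gamma>(1) by (subst sum_ennreal_mult[symmetric]) (auto intro!: sum.cong)
      also have "(\<Sum>j<n. \<gamma> j ?l / w' j * (if j = ?l then 0 else 1) * w' j) = (\<Sum>j<n. \<gamma> j ?l - (if j = ?l then \<gamma> j ?l else 0))"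
        using wz[OF _ _ J(2)[of "fst z"]] that by (intro sum.cong) fastforce+
      also have "\<dots> = 1 - \<gamma> ?l ?l" using J(2)[of "fst z"] \<gamma>(2)[OF J(2)[of "fst z"]]
        by (simp add: sum_subtractf)
      finally show ?thesis .
    qed
    have "(\<integral>\<^sup>+v. (if J (fst v) = J (fst (snd v)) then 0 else 1) \<partial>\<rho>)
      = (\<integral>\<^sup>+v. (case v of (x', z) \<Rightarrow> ennreal (k x' z)) * (if J (fst v) = J (fst (snd v)) then 0 else 1) \<partial>(\<mu>' \<Otimes>\<^sub>M \<pi>))"
      unfolding \<rho>_def by (subst nn_integral_density) auto
    also have "\<dots> = (\<integral>\<^sup>+z. \<integral>\<^sup>+x'. ennreal (k x' z) * (if J x' = J (fst z) then 0 else 1) \<partial>\<mu>' \<partial>\<pi>)"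
      by (subst pp.nn_integral_snd[symmetric]) (auto simp: split_beta')
    also have "\<dots> = (\<integral>\<^sup>+z. ennreal (1 - \<gamma> (J (fst z)) (J (fst z))) \<partial>\<pi>)"
      by (intro nn_integral_cong_AE, use pos2 in eventually_elim) (auto simp: in1)
    also have "\<dots> = (\<Sum>l<n. ennreal (1 - \<gamma> l l) * ennreal (w l))" by (rule fm)
    also have "\<dots> = ennreal R"
    proof -
      have "(\<Sum>l<n. ennreal (1 - \<gamma> l l) * ennreal (w l)) = (\<Sum>l<n. ennreal ((1 - \<gamma> l l) * w l))"
        using w0 gle by (intro sum.cong) (auto simp: ennreal_mult)
      also have "\<dots> = ennreal R" unfolding R_def using w0 gle by (intro sum_ennreal) auto
      finally show ?thesis .
    qed
    finally show ?thesis .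
  qed
  have "(\<integral>\<^sup>+z. ennreal (c z) \<partial>\<pi>') = (\<integral>\<^sup>+v. ennreal (c (fst v, snd (snd v))) \<partial>\<rho>)"
    unfolding \<pi>'_def by (subst nn_integral_distr) (auto simp: split_beta')
  also have "\<dots> \<le> (\<integral>\<^sup>+v. ennreal (c (snd v) + \<epsilon>) + ennreal ?D * (if J (fst v) = J (fst (snd v)) then 0 else 1) \<partial>\<rho>)"
  proof (rule nn_integral_mono)
    fix v :: "'d torus \<times> 'd torus \<times> 'd torus"
    show "ennreal (c (fst v, snd (snd v))) \<le> ennreal (c (snd v) + \<epsilon>) + ennreal ?D * (if J (fst v) = J (fst (snd v)) then 0 else 1)"
    proof (cases "J (fst v) = J (fst (snd v))")
      case True
      then show ?thesis using \<epsilon>(2)[OF True, of "snd (snd v)"] by (simp add: c_def ennreal_leI)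
    next
      case False
      then show ?thesis using c0(2)[of "(fst v, snd (snd v))"]
        by (simp add: ennreal_leI add_increasing)
    qed
  qed
  also have "\<dots> = (\<integral>\<^sup>+v. ennreal (c (snd v) + \<epsilon>) \<partial>\<rho>) + ennreal ?D * ennreal R"
    unfolding eq0[symmetric] by (subst nn_integral_add) (auto simp: nn_integral_cmult)
  also have "(\<integral>\<^sup>+v. ennreal (c (snd v) + \<epsilon>) \<partial>\<rho>) = (\<integral>\<^sup>+z. ennreal (c z + \<epsilon>) \<partial>\<pi>)"
    by (rule int2) measurable
  also have "\<dots> = ennreal (\<integral>z. c z + \<epsilon> \<partial>\<pi>)"
    using coupling_cost_integrable[OF \<pi> P(1), of p] p c0 \<epsilon>(1)
    by (intro nn_integral_eq_integral) (auto simp: c_def)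
  also have "(\<integral>z. c z + \<epsilon> \<partial>\<pi>) = (\<integral>z. c z \<partial>\<pi>) + \<epsilon>"
    using coupling_cost_integrable[OF \<pi> P(1), of p] p by (simp add: c_def \<pi>.prob_space)
  finally have "(\<integral>\<^sup>+z. ennreal (c z) \<partial>\<pi>') \<le> ennreal ((\<integral>z. c z \<partial>\<pi>) + \<epsilon> + ?D * R)"
    using R0 c0 \<epsilon>(1) by (simp add: ennreal_mult[symmetric] ennreal_plus[symmetric] del: ennreal_plus)
  moreover have "(\<integral>\<^sup>+z. ennreal (c z) \<partial>\<pi>') = ennreal (\<integral>z. c z \<partial>\<pi>')"
    using coupling_cost_integrable[OF \<pi>' P(2), of p] p c0
    by (intro nn_integral_eq_integral) (auto simp: c_def)
  ultimately have e: "ennreal (\<integral>z. c z \<partial>\<pi>') \<le> ennreal ((\<integral>z. c z \<partial>\<pi>) + \<epsilon> + ?D * R)"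
    by (simp only:)
  have "0 \<le> (\<integral>z. c z \<partial>\<pi>) + \<epsilon> + ?D * R"
    using R0 c0 \<epsilon>(1) by (intro add_nonneg_nonneg mult_nonneg_nonneg Bochner_Integration.integral_nonneg) auto
  with e have "(\<integral>z. c z \<partial>\<pi>') \<le> (\<integral>z. c z \<partial>\<pi>) + \<epsilon> + ?D * R"
    by (simp only: ennreal_le_iff)
  then show ?thesis using \<pi>' unfolding c_def R_def w_def by blast
qed

text \<open>Each cell keeps the common part \<open>m\<close> of the old and the new mass. The excess
  of the old masses is pooled and distributed in proportion to the deficits
  \<open>w' j - m j\<close>; both total \<open>\<delta>\<close> because the sums agree. Hence no
  more mass moves than the sum of the differences.\<close>

lemma transfer_matrix:
  fixes w w' :: "nat \<Rightarrow> real"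
  assumes "\<And>j. 0 \<le> w j" "\<And>j. 0 \<le> w' j" and s: "(\<Sum>j<n. w j) = (\<Sum>j<n. w' j)"
  obtains \<gamma> :: "nat \<Rightarrow> nat \<Rightarrow> real" where "\<And>j l. 0 \<le> \<gamma> j l" "\<And>l. l < n \<Longrightarrow> (\<Sum>j<n. \<gamma> j l) = 1"
    "\<And>j. j < n \<Longrightarrow> (\<Sum>l<n. \<gamma> j l * w l) = w' j"
    "(\<Sum>l<n. (1 - \<gamma> l l) * w l) \<le> (\<Sum>l<n. \<bar>w l - w' l\<bar>)"
proof -
  define m where "m j = min (w j) (w' j)" for j
  have m: "0 \<le> m j" "m j \<le> w j" "m j \<le> w' j" for j using assms by (auto simp: m_def)
  \<comment> \<open>The default 1 for an empty cell keeps its column sum equal to 1 even when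
    \<open>\<delta> = 0\<close>, where division by 0 makes \<open>v\<close> vanish.\<close>
  define \<rho> where "\<rho> l = (if w l = 0 then 1 else m l / w l)" for l
  have \<rho>: "0 \<le> \<rho> l" "\<rho> l \<le> 1" "\<rho> l * w l = m l" for l
    using m[of l] assms(1)[of l] by (auto simp: \<rho>_def divide_simps)
  define \<delta> where "\<delta> = (\<Sum>j<n. w' j - m j)"
  have \<delta>': "\<delta> = (\<Sum>j<n. w j - m j)" using s by (simp add: \<delta>_def sum_subtractf)
  have \<delta>0: "0 \<le> \<delta>" unfolding \<delta>_def using m by (intro sum_nonneg) auto
  define v where "v j = (w' j - m j) / \<delta>" for j
  have v0: "0 \<le> v j" for j using m[of j] \<delta>0 by (simp add: v_def)
  have z: "w' j = m j \<and> w j = m j" if "\<delta> = 0" "j < n" for j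
  proof -
    have "w' j - m j = 0" using that m sum_nonneg_eq_0_iff[of "{..<n}" "\<lambda>j. w' j - m j"] by (auto simp: \<delta>_def)
    moreover have "w j - m j = 0" using that m sum_nonneg_eq_0_iff[of "{..<n}" "\<lambda>j. w j - m j"] by (auto simp: \<delta>')
    ultimately show ?thesis by simp
  qed
  define \<gamma> where "\<gamma> j l = (if j = l then \<rho> l else 0) + (1 - \<rho> l) * v j" for j l
  have \<gamma>_le: "(1 - \<gamma> l l) * w l \<le> \<bar>w l - w' l\<bar>" for l
  proof -
    have "(1 - \<gamma> l l) * w l \<le> (1 - \<rho> l) * w l"
      using v0[of l] \<rho>(2)[of l] assms(1)[of l] by (intro mult_right_mono) (auto simp: \<gamma>_def)
    also have "\<dots> = w l - m l" using \<rho>(3)[of l] by (simp add: algebra_simps)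
    also have "\<dots> \<le> \<bar>w l - w' l\<bar>" by (auto simp: m_def)
    finally show ?thesis .
  qed
  show ?thesis
  proof (rule that[of \<gamma>])
    show "0 \<le> \<gamma> j l" for j l using \<rho>[of l] v0[of j] by (simp add: \<gamma>_def)
    show "(\<Sum>j<n. \<gamma> j l) = 1" if l: "l < n" for l
    proof -
      have "(\<Sum>j<n. \<gamma> j l) = \<rho> l + (1 - \<rho> l) * (\<Sum>j<n. v j)"
        using l by (simp add: \<gamma>_def sum.distrib sum_distrib_left)
      moreover have "(\<Sum>j<n. v j) = 1" if "\<delta> \<noteq> 0"
        using that by (simp add: v_def \<delta>_def flip: sum_divide_distrib)
      moreover have "\<rho> l = 1" if "\<delta> = 0" using z[OF that l] by (auto simp: \<rho>_def)
      ultimately show ?thesis by (cases "\<delta> = 0") auto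
    qed
    show "(\<Sum>l<n. \<gamma> j l * w l) = w' j" if j: "j < n" for j
    proof -
      have "(\<Sum>l<n. \<gamma> j l * w l) = (\<Sum>l<n. (if l = j then \<rho> l * w l else 0) + v j * (w l - \<rho> l * w l))"
        by (intro sum.cong) (auto simp: \<gamma>_def algebra_simps)
      also have "\<dots> = m j + v j * \<delta>"
        using j by (simp add: sum.distrib \<rho>(3) \<delta>' flip: sum_distrib_left)
      also have "\<dots> = w' j" using z[OF _ j] by (cases "\<delta> = 0") (auto simp: v_def)
      finally show ?thesis .
    qed
    show "(\<Sum>l<n. (1 - \<gamma> l l) * w l) \<le> (\<Sum>l<n. \<bar>w l - w' l\<bar>)"
      by (intro sum_mono \<gamma>_le)
  qed
qed

text \<open>The set of couplings depends on \<omega>, so this is not a countable infimum of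
  measurable functions. Instead, transferring a coupling from \<omega>' to \<omega> shows that the
  optimal cost changes by at most \<epsilon> plus a multiple of the change of finitely many cell
  masses, which is the hypothesis of \<open>borel_measurable_lipschitz_approx\<close>.\<close>

lemma borel_measurable_wasserstein:
  fixes \<mu> :: "'w \<Rightarrow> 'd::finite torus measure"
  assumes \<nu>: "prob_space \<nu>" "sets \<nu> = sets borel" and p: "0 < p"
    and \<mu>: "\<And>\<omega>. \<omega> \<in> space M \<Longrightarrow> prob_space (\<mu> \<omega>)" "\<And>\<omega>. \<omega> \<in> space M \<Longrightarrow> sets (\<mu> \<omega>) = sets borel"
    and meas: "\<And>A. A \<in> sets borel \<Longrightarrow> (\<lambda>\<omega>. measure (\<mu> \<omega>) A) \<in> borel_measurable M"
  shows "(\<lambda>\<omega>. wasserstein p (\<mu> \<omega>) \<nu>) \<in> borel_measurable M"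
proof -
  define c where "c \<pi> = (\<integral>z. dist (fst z) (snd z) powr p \<partial>\<pi>)" for \<pi> :: "('d torus \<times> 'd torus) measure"
  define K where "K \<omega> = (INF \<pi>\<in>couplings (\<mu> \<omega>) \<nu>. c \<pi>)" for \<omega>
  define q where "q = min 1 (1 / p)"
  have q: "0 < q" using p by (simp add: q_def)
  have c0: "0 \<le> c \<pi>" for \<pi> by (simp add: c_def)
  have ne: "couplings (\<mu> \<omega>) \<nu> \<noteq> {}" if "\<omega> \<in> space M" for \<omega>
    using pair_measure_in_couplings[OF \<mu>(1)[OF that] \<nu>(1) \<mu>(2)[OF that] \<nu>(2)] by auto
  have bdd: "bdd_below (c ` A)" for A using c0 by (auto intro!: bdd_belowI[of _ 0])
  have K0: "0 \<le> K \<omega>" if "\<omega> \<in> space M" for \<omega>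
    unfolding K_def using c0 by (intro cINF_greatest ne[OF that])
  have K: "K \<in> borel_measurable M"
  proof (rule borel_measurable_lipschitz_approx[OF _ K0])
    fix \<epsilon> :: real assume \<epsilon>: "0 < \<epsilon>"
    have "uniformly_continuous_on {0..real CARD('d)} (\<lambda>x. x powr p)"
      using p by (intro compact_uniformly_continuous continuous_on_powr' continuous_intros) auto
    then obtain \<delta> where \<delta>: "0 < \<delta>" "\<And>u v. u \<in> {0..real CARD('d)} \<Longrightarrow> v \<in> {0..real CARD('d)} \<Longrightarrow>
        dist u v < \<delta> \<Longrightarrow> dist (u powr p) (v powr p) < \<epsilon>"
      using \<epsilon> unfolding uniformly_continuous_on_def by metis
    obtain J :: "'d torus \<Rightarrow> nat" and n where J: "J \<in> measurable borel (count_space UNIV)" "\<And>x. J x < n"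
      "\<And>x y. J x = J y \<Longrightarrow> dist x y \<le> \<delta> / 2"
      using torus_partition[of "\<delta> / 2"] \<delta>(1) half_gt_zero by blast
    have cc: "dist x z powr p \<le> dist y z powr p + \<epsilon>" if "J x = J y" for x y z
    proof -
      have "dist (dist x z) (dist y z) \<le> dist x y"
        using dist_triangle[of x z y] dist_triangle[of y z x] by (auto simp: dist_real_def dist_commute abs_le_iff)
      also have "\<dots> < \<delta>" using J(3)[OF that] \<delta>(1) by simp
      finally have "dist (dist x z powr p) (dist y z powr p) < \<epsilon>"
        by (intro \<delta>(2)) (auto simp: torus_dist_le)
      then show ?thesis by (simp add: dist_real_def)
    qed
    define P where "P j \<omega> = measure (\<mu> \<omega>) {x. J x = j}" for j \<omega>
    have sJ: "{x. J x = j} \<in> sets borel" for j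
      using measurable_sets[OF J(1), of "{j}"] by (simp add: vimage_def)
    have Psum: "(\<Sum>j<n. P j \<omega>) = 1" if w: "\<omega> \<in> space M" for \<omega>
    proof -
      interpret prob_space "\<mu> \<omega>" by (rule \<mu>(1)[OF w])
      have sp: "space (\<mu> \<omega>) = UNIV" using sets_eq_imp_space_eq[OF \<mu>(2)[OF w]] by simp
      have "(\<Sum>j<n. P j \<omega>) = prob (\<Union>j<n. {x. J x = j})"
        unfolding P_def using sJ by (intro finite_measure_finite_Union[symmetric])
          (auto simp: \<mu>(2)[OF w] disjoint_family_on_def)
      also have "(\<Union>j<n. {x. J x = j}) = space (\<mu> \<omega>)" using J(2) sp by auto
      finally show ?thesis by (simp add: prob_space)
    qed
    have "K \<omega> \<le> K \<omega>' + \<epsilon> + real CARD('d) powr p * (\<Sum>j<n. \<bar>P j \<omega> - P j \<omega>'\<bar>)"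
      if w: "\<omega> \<in> space M" "\<omega>' \<in> space M" for \<omega> \<omega>'
    proof -
      obtain \<gamma> :: "nat \<Rightarrow> nat \<Rightarrow> real" where \<gamma>: "\<And>j l. 0 \<le> \<gamma> j l" "\<And>l. l < n \<Longrightarrow> (\<Sum>j<n. \<gamma> j l) = 1"
        "\<And>j. j < n \<Longrightarrow> (\<Sum>l<n. \<gamma> j l * P l \<omega>') = P j \<omega>"
        "(\<Sum>l<n. (1 - \<gamma> l l) * P l \<omega>') \<le> (\<Sum>l<n. \<bar>P l \<omega>' - P l \<omega>\<bar>)"
        using transfer_matrix[of "\<lambda>l. P l \<omega>'" "\<lambda>l. P l \<omega>" n] Psum[OF w(1)] Psum[OF w(2)]
        by (auto simp: P_def)
      have "K \<omega> - \<epsilon> - real CARD('d) powr p * (\<Sum>j<n. \<bar>P j \<omega> - P j \<omega>'\<bar>) \<le> K \<omega>'"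
        unfolding K_def[of \<omega>']
      proof (rule cINF_greatest[OF ne[OF w(2)]])
        fix \<pi> assume \<pi>: "\<pi> \<in> couplings (\<mu> \<omega>') \<nu>"
        obtain \<pi>' where \<pi>': "\<pi>' \<in> couplings (\<mu> \<omega>) \<nu>"
          "c \<pi>' \<le> c \<pi> + \<epsilon> + real CARD('d) powr p * (\<Sum>l<n. (1 - \<gamma> l l) * P l \<omega>')"
          using coupling_transfer[OF \<mu>(1)[OF w(2)] \<mu>(1)[OF w(1)] \<nu>(1) \<mu>(2)[OF w(2)] \<mu>(2)[OF w(1)] \<nu>(2)
              \<pi> p J(1,2) less_imp_le[OF \<epsilon>] cc \<gamma>(1,2) \<gamma>(3)[unfolded P_def]]
          unfolding c_def P_def by blast
        have "K \<omega> \<le> c \<pi>'" unfolding K_def by (rule cINF_lower[OF bdd \<pi>'(1)])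
        also note \<pi>'(2)
        also have "(\<Sum>l<n. (1 - \<gamma> l l) * P l \<omega>') \<le> (\<Sum>j<n. \<bar>P j \<omega> - P j \<omega>'\<bar>)"
          using \<gamma>(4) by (simp add: abs_minus_commute)
        finally show "K \<omega> - \<epsilon> - real CARD('d) powr p * (\<Sum>j<n. \<bar>P j \<omega> - P j \<omega>'\<bar>) \<le> c \<pi>"
          by (simp add: mult_left_mono)
      qed
      then show ?thesis by simp
    qed
    moreover have "P j \<in> borel_measurable M" for j
      unfolding P_def by (rule meas[OF sJ])
    ultimately show "\<exists>n p C. (\<forall>j<n::nat. p j \<in> borel_measurable M) \<and>
      (\<forall>\<omega>\<in>space M. \<forall>\<omega>'\<in>space M. K \<omega> \<le> K \<omega>' + \<epsilon> + C * (\<Sum>j<n. \<bar>p j \<omega> - p j \<omega>'\<bar>))"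
      by blast
  qed
  \<comment> \<open>The outer power is increasing with an increasing inverse, so it commutes with
    the infimum of the costs.\<close>
  have "wasserstein p (\<mu> \<omega>) \<nu> = K \<omega> powr q" if w: "\<omega> \<in> space M" for \<omega>
  proof (rule antisym)
    show "K \<omega> powr q \<le> wasserstein p (\<mu> \<omega>) \<nu>"
      unfolding wasserstein_def q_def[symmetric] c_def[symmetric]
    proof (rule cINF_greatest[OF ne[OF w]])
      fix \<pi> assume "\<pi> \<in> couplings (\<mu> \<omega>) \<nu>"
      then have "K \<omega> \<le> c \<pi>" unfolding K_def by (intro cINF_lower bdd)
      then show "K \<omega> powr q \<le> c \<pi> powr q" using q K0[OF w] by (intro powr_mono2) auto
    qed
    let ?W = "wasserstein p (\<mu> \<omega>) \<nu>"
    have W0: "0 \<le> ?W" by (rule wasserstein_nonneg) (use \<mu> \<nu> w in auto)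
    have "?W powr (1 / q) \<le> K \<omega>" unfolding K_def
    proof (rule cINF_greatest[OF ne[OF w]])
      fix \<pi> assume \<pi>: "\<pi> \<in> couplings (\<mu> \<omega>) \<nu>"
      have "?W powr (1 / q) \<le> (c \<pi> powr q) powr (1 / q)"
        using wasserstein_le_cost[OF \<pi>, of p] q W0 by (intro powr_mono2) (auto simp: c_def q_def)
      also have "\<dots> = c \<pi>" using q c0 by (simp add: powr_powr)
      finally show "?W powr (1 / q) \<le> c \<pi>" .
    qed
    then have "(?W powr (1 / q)) powr q \<le> K \<omega> powr q" using q by (intro powr_mono2) auto
    then show "?W \<le> K \<omega> powr q" using q W0 by (simp add: powr_powr)
  qed
  moreover have "(\<lambda>\<omega>. K \<omega> powr q) \<in> borel_measurable M" using K by measurable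
  ultimately show ?thesis by (subst measurable_cong) auto
qed

section \<open>Occupation measures\<close>

text \<open>The sum is the integral of the step function \<open>s n\<close> of left end points. This
  converges at every continuity point, hence outside a countable set, and dominated convergence
  applies. Jumps must be allowed because the paths have them.\<close>

lemma riemann_sum_tendsto:
  fixes g :: "real \<Rightarrow> 'b::{banach, second_countable_topology}"
  assumes g[measurable]: "g \<in> borel_measurable borel" and bd: "\<And>u. norm (g u) \<le> K"
    and C: "countable C" "\<And>u. u \<in> {0..1} - C \<Longrightarrow> continuous (at u within {0..1}) g"
  shows "(\<lambda>n. (1 / real n) *\<^sub>R (\<Sum>j<n. g (real j / real n))) \<longlonglongrightarrow> (\<integral>u. indicator {0..1} u *\<^sub>R g u \<partial>lborel)"
proof -
  define s where "s n u = (\<Sum>j<n. indicator {real j / real n ..< (real j + 1) / real n} u *\<^sub>R g (real j / real n))" for n u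
  have s_eq: "s n u = g (real (nat \<lfloor>real n * u\<rfloor>) / real n)" if "n > 0" "0 \<le> u" "u < 1" for n u
  proof -
    define i where "i = nat \<lfloor>real n * u\<rfloor>"
    have fl: "0 \<le> \<lfloor>real n * u\<rfloor>" using that by simp
    have i: "real i \<le> real n * u" "real n * u < real i + 1"
      using fl by (simp_all add: i_def)
    have "i < n"
    proof -
      have "real n * u < real n" using that by simp
      with i show ?thesis by simp
    qed
    have "indicator {real j / real n ..< (real j + 1) / real n} u = (if j = i then 1 else 0 :: real)" for j
    proof -
      have "u \<in> {real j / real n ..< (real j + 1) / real n} \<longleftrightarrow> real j \<le> real n * u \<and> real n * u < real j + 1"
        using that by (simp add: field_simps)
      also have "\<dots> \<longleftrightarrow> j = i" using i by linarith
      finally show ?thesis unfolding indicator_def by (simp only: of_bool_def)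
    qed
    then have "s n u = (\<Sum>j<n. if j = i then g (real j / real n) else 0)"
      unfolding s_def by (intro sum.cong refl) (simp only: split: if_split, simp)
    also have "\<dots> = g (real i / real n)" using \<open>i < n\<close> by simp
    finally show ?thesis by (simp add: i_def)
  qed
  have s_out: "s n u = 0" if "u < 0 \<or> 1 < u" for n u
    unfolding s_def
  proof (rule sum.neutral, safe)
    fix j assume j: "j < n"
    have "u \<notin> {real j / real n ..< (real j + 1) / real n}"
    proof
      assume u: "u \<in> {real j / real n ..< (real j + 1) / real n}"
      have "(real j + 1) / real n \<le> 1" using j by (simp add: field_simps)
      moreover have "0 \<le> real j / real n" by simp
      ultimately show False using u that unfolding atLeastLessThan_iff by linarith
    qed
    then show "indicator {real j / real n..<(real j + 1) / real n} u *\<^sub>R g (real j / real n) = 0" by simp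
  qed
  have int_s: "(\<integral>u. s n u \<partial>lborel) = (1 / real n) *\<^sub>R (\<Sum>j<n. g (real j / real n))" for n
  proof (cases "n = 0")
    case False
    have "has_bochner_integral lborel (\<lambda>u. indicator {real j / real n ..< (real j + 1) / real n} u *\<^sub>R c) ((1 / real n) *\<^sub>R c)"
      for j and c :: 'b
    proof -
      have le: "real j / real n \<le> (real j + 1) / real n" by (simp add: divide_right_mono)
      have "measure lborel {real j / real n ..< (real j + 1) / real n} = 1 / real n"
        using le by (simp add: add_divide_distrib)
      then show ?thesis
        using has_bochner_integral_indicator[of "{real j / real n ..< (real j + 1) / real n}" lborel c] le by simp
    qed
    then have "has_bochner_integral lborel (s n) (\<Sum>j<n. (1 / real n) *\<^sub>R g (real j / real n))"
      unfolding s_def by (intro has_bochner_integral_sum) blast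
    then have "(\<integral>u. s n u \<partial>lborel) = (\<Sum>j<n. (1 / real n) *\<^sub>R g (real j / real n))"
      by (rule has_bochner_integral_integral_eq)
    then show ?thesis by (simp add: scaleR_sum_right)
  qed (simp add: s_def)
  have "(\<lambda>n. \<integral>u. s n u \<partial>lborel) \<longlonglongrightarrow> (\<integral>u. indicator {0..1} u *\<^sub>R g u \<partial>lborel)"
  proof (rule integral_dominated_convergence[where w = "\<lambda>u. indicator {0..1} u * (K + norm (g 1))"])
    have K0: "0 \<le> K" using bd[of 0] norm_ge_zero order.trans by blast
    show "integrable lborel (\<lambda>u. indicator {0..1::real} u * (K + norm (g 1)))" by simp
    show "s n \<in> borel_measurable lborel" for n unfolding s_def by measurable
    show "(\<lambda>u. indicator {0..1} u *\<^sub>R g u) \<in> borel_measurable lborel" by measurable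
    \<comment> \<open>The point 1 joins the exceptional set: all half-open intervals end before it,
      so \<open>s n\<close> vanishes there.\<close>
    have ex: "AE u in lborel. u \<notin> insert 1 C"
      by (rule AE_not_in, rule countable_imp_null_set_lborel) (simp add: C(1))
    show "AE u in lborel. norm (s n u) \<le> indicator {0..1} u * (K + norm (g 1))" for n
      using ex
    proof eventually_elim
      fix u assume u: "u \<notin> insert 1 C"
      show "norm (s n u) \<le> indicator {0..1} u * (K + norm (g 1))"
      proof (cases "n > 0 \<and> 0 \<le> u \<and> u < 1")
        case True
        then show ?thesis using s_eq[of n u] bd[of "real (nat \<lfloor>real n * u\<rfloor>) / real n"]
          by (simp add: add_increasing2)
      next
        case False
        then have "s n u = 0" using s_out[of u n] u by (cases "n = 0") (auto simp: s_def not_less)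
        then show ?thesis using K0 by simp
      qed
    qed
    show "AE u in lborel. (\<lambda>n. s n u) \<longlonglongrightarrow> indicator {0..1} u *\<^sub>R g u"
      using ex
    proof eventually_elim
      fix u assume u: "u \<notin> insert 1 C"
      show "(\<lambda>n. s n u) \<longlonglongrightarrow> indicator {0..1} u *\<^sub>R g u"
      proof (cases "0 \<le> u \<and> u < 1")
        case True
        let ?q = "\<lambda>n. real (nat \<lfloor>real n * u\<rfloor>) / real n"
        have q: "?q n \<le> u" "u - 1 / real n \<le> ?q n" if "n > 0" for n
        proof -
          have "0 \<le> \<lfloor>real n * u\<rfloor>" using True by simp
          then have e: "real (nat \<lfloor>real n * u\<rfloor>) = of_int \<lfloor>real n * u\<rfloor>" by simp
          have "?q n \<le> (real n * u) / real n" unfolding e by (intro divide_right_mono) auto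
          then show "?q n \<le> u" using that by simp
          have "(real n * u - 1) / real n \<le> ?q n" unfolding e
            by (intro divide_right_mono) (linarith, simp)
          then show "u - 1 / real n \<le> ?q n" using that by (simp add: diff_divide_distrib)
        qed
        have lim: "?q \<longlonglongrightarrow> u"
        proof (rule tendsto_sandwich[of "\<lambda>n. u - 1 / real n" ?q sequentially "\<lambda>_. u"])
          show "\<forall>\<^sub>F n in sequentially. u - 1 / real n \<le> ?q n" "\<forall>\<^sub>F n in sequentially. ?q n \<le> u"
            by (rule eventually_sequentiallyI[of 1], rule q, simp)+
          show "(\<lambda>n. u - 1 / real n) \<longlonglongrightarrow> u"
            using tendsto_diff[OF tendsto_const[of u] lim_1_over_n] by simp
        qed simp
        have "continuous (at u within {0..1}) g" using C(2)[of u] True u by auto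
        moreover have "eventually (\<lambda>n. ?q n \<in> {0..1}) sequentially"
        proof (rule eventually_sequentiallyI[of 1])
          fix n :: nat assume "1 \<le> n"
          then have "?q n \<le> u" by (intro q(1)) simp
          then show "?q n \<in> {0..1}" using True by simp
        qed
        ultimately have "(\<lambda>n. g (?q n)) \<longlonglongrightarrow> g u"
          using continuous_within_tendsto_compose[OF _ _ lim] by blast
        moreover have "eventually (\<lambda>n. g (?q n) = s n u) sequentially"
          by (rule eventually_sequentiallyI[of 1]) (use s_eq True in auto)
        ultimately have "(\<lambda>n. s n u) \<longlonglongrightarrow> g u" by (rule Lim_transform_eventually)
        then show ?thesis using True by simp
      next
        case False
        then have "u < 0 \<or> 1 < u" using u by auto
        then show ?thesis using s_out[of u] by (auto simp: fun_eq_iff)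
      qed
    qed
  qed
  then show ?thesis by (simp add: int_s)
qed

text \<open>The clock is only known to increase from 0, without one-sided continuity. A monotone
  function has countably many discontinuities, so such a path is Borel and continuous at almost
  every time, as the Riemann sums require.\<close>

definition regular_path :: "(real \<Rightarrow> 'd::finite torus) \<Rightarrow> bool" where
  "regular_path \<zeta> \<longleftrightarrow> (\<exists>x \<sigma>. continuous_on {0..} x \<and> mono_on {0..} \<sigma> \<and> \<sigma> 0 = (0 :: real)
     \<and> (\<forall>s\<ge>0. \<zeta> s = torus_proj (x (\<sigma> s))))"

lemma regular_path_measurable:
  assumes "regular_path \<zeta>"
  shows "\<zeta> \<in> borel_measurable (restrict_space borel {0..})"
proof -
  obtain x and \<sigma> :: "real \<Rightarrow> real" where *: "continuous_on {0..} x" "mono_on {0..} \<sigma>" "\<sigma> 0 = 0"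
    "\<And>s. s \<ge> 0 \<Longrightarrow> \<zeta> s = torus_proj (x (\<sigma> s))"
    using assms by (auto simp: regular_path_def)
  have nn: "0 \<le> \<sigma> s" if "0 \<le> s" for s using mono_onD[OF *(2), of 0 s] that *(3) by simp
  have "\<sigma> \<in> measurable (restrict_space borel {0..}) (restrict_space borel {0..})"
    by (rule measurable_restrict_space2[OF _ borel_measurable_mono_on_fnc[OF *(2)]])
       (auto simp: space_restrict_space nn)
  from measurable_compose[OF measurable_compose[OF this borel_measurable_continuous_on_restrict[OF *(1)]] measurable_torus_proj]
  show ?thesis by (rule measurable_cong[THEN iffD1, rotated]) (simp add: space_restrict_space *(4))
qed

lemma regular_path_continuous:
  assumes "regular_path \<zeta>"
  shows "countable {s \<in> {0..}. \<not> continuous (at s within {0..}) \<zeta>}"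
proof -
  obtain x and \<sigma> :: "real \<Rightarrow> real" where *: "continuous_on {0..} x" "mono_on {0..} \<sigma>" "\<sigma> 0 = 0"
    "\<And>s. s \<ge> 0 \<Longrightarrow> \<zeta> s = torus_proj (x (\<sigma> s))"
    using assms by (auto simp: regular_path_def)
  have nn: "0 \<le> \<sigma> s" if "0 \<le> s" for s using mono_onD[OF *(2), of 0 s] that *(3) by simp
  have "{s \<in> {0..}. \<not> continuous (at s within {0..}) \<zeta>} \<subseteq> {s \<in> {0..}. \<not> continuous (at s within {0..}) \<sigma>}"
  proof safe
    fix s assume s: "0 \<le> s" "continuous (at s within {0..}) \<sigma>" "\<not> continuous (at s within {0..}) \<zeta>"
    have "continuous (at (\<sigma> s) within \<sigma> ` {0..}) x"
    proof (rule continuous_within_subset)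
      show "continuous (at (\<sigma> s) within {0..}) x"
        using *(1) nn[OF s(1)] by (simp add: continuous_on_eq_continuous_within)
    qed (use nn in auto)
    then have 1: "continuous (at s within {0..}) (\<lambda>s. x (\<sigma> s))"
      using s(2) continuous_within_compose[of s "{0..}" \<sigma> x] by (simp add: comp_def)
    have "isCont torus_proj (x (\<sigma> s))"
      by (rule continuous_on_interior[OF continuous_torus_proj[of UNIV]]) simp
    then have "continuous (at (x (\<sigma> s)) within (\<lambda>s. x (\<sigma> s)) ` {0..}) torus_proj"
      by (rule continuous_at_imp_continuous_at_within)
    with 1 have "continuous (at s within {0..}) (\<lambda>s. torus_proj (x (\<sigma> s)))"
      using continuous_within_compose[of s "{0..}" "\<lambda>s. x (\<sigma> s)" torus_proj] by (simp add: comp_def)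
    then have "continuous (at s within {0..}) \<zeta>"
      by (rule continuous_transform_within[OF _ zero_less_one]) (use s(1) *(4) in auto)
    with s(3) show False ..
  qed
  then show ?thesis using mono_on_ctble_discont[OF *(2)] countable_subset by blast
qed

definition occupation_measure :: "(real \<Rightarrow> 'd::finite torus) \<Rightarrow> real \<Rightarrow> 'd torus measure" where
  "occupation_measure \<zeta> t = scale_measure (ennreal (1 / t)) (distr (restrict_space lborel {0..t}) borel \<zeta>)"

lemma empirical_measure_eq: "empirical_measure Z t \<omega> = occupation_measure (\<lambda>s. Z s \<omega>) t"
  by (simp add: empirical_measure_def occupation_measure_def)

lemma scale_measure_eq_density: "scale_measure r M = density M (\<lambda>_. r)"
  by (rule measure_eqI) (simp_all add: emeasure_density nn_integral_cmult_indicator)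

context
  fixes \<zeta> :: "real \<Rightarrow> 'd::finite torus" and t :: real
  assumes reg: "regular_path \<zeta>" and t: "0 < t"
begin

lemma path_measurable_restrict: "\<zeta> \<in> measurable (restrict_space lborel {0..t}) borel"
proof -
  have "\<zeta> \<in> borel_measurable (restrict_space borel {0..t})"
    by (rule measurable_restrict_mono[OF regular_path_measurable[OF reg]]) auto
  then show ?thesis by (simp add: measurable_cong_sets[OF sets_restrict_space_cong[OF sets_lborel] refl])
qed

lemma sets_occupation_measure: "sets (occupation_measure \<zeta> t) = sets borel"
  by (simp add: occupation_measure_def)

lemma prob_space_occupation_measure: "prob_space (occupation_measure \<zeta> t)"
proof
  have "emeasure (distr (restrict_space lborel {0..t}) borel \<zeta>) UNIV = ennreal t"
    using t by (simp add: emeasure_distr[OF path_measurable_restrict] emeasure_restrict_space space_restrict_space)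
  then show "emeasure (occupation_measure \<zeta> t) (space (occupation_measure \<zeta> t)) = 1"
    using t by (simp add: occupation_measure_def space_scale_measure flip: ennreal_mult ennreal_1)
qed

lemma integral_occupation_measure:
  fixes f :: "'d torus \<Rightarrow> 'b::{banach, second_countable_topology}"
  assumes f[measurable]: "f \<in> borel_measurable borel"
  shows "(\<integral>z. f z \<partial>occupation_measure \<zeta> t) = (\<integral>u. indicator {0..1} u *\<^sub>R f (\<zeta> (t * u)) \<partial>lborel)"
proof -
  note [measurable] = path_measurable_restrict
  have "(\<integral>z. f z \<partial>occupation_measure \<zeta> t) = (\<integral>z. (1 / t) *\<^sub>R f z \<partial>distr (restrict_space lborel {0..t}) borel \<zeta>)"
    unfolding occupation_measure_def scale_measure_eq_density using t
    by (subst integral_density) auto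
  also have "\<dots> = (\<integral>s. (1 / t) *\<^sub>R f (\<zeta> s) \<partial>restrict_space lborel {0..t})"
    by (rule integral_distr) measurable
  also have "\<dots> = (\<integral>s. indicator {0..t} s *\<^sub>R (1 / t) *\<^sub>R f (\<zeta> s) \<partial>lborel)"
    by (subst integral_restrict_space) auto
  also have "\<dots> = \<bar>t\<bar> *\<^sub>R (\<integral>u. indicator {0..t} (0 + t * u) *\<^sub>R (1 / t) *\<^sub>R f (\<zeta> (0 + t * u)) \<partial>lborel)"
    using t by (intro lborel_integral_real_affine) simp
  also have "\<dots> = (\<integral>u. t *\<^sub>R (indicator {0..t} (t * u) *\<^sub>R (1 / t) *\<^sub>R f (\<zeta> (t * u))) \<partial>lborel)"
    using t by (simp only: abs_of_pos add_0 integral_scaleR_right)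
  also have "\<dots> = (\<integral>u. indicator {0..1} u *\<^sub>R f (\<zeta> (t * u)) \<partial>lborel)"
  proof (rule Bochner_Integration.integral_cong)
    fix u
    have "t * u \<in> {0..t} \<longleftrightarrow> u \<in> {0..1}" using t by (auto simp: zero_le_mult_iff mult_le_cancel_left1)
    then show "t *\<^sub>R (indicator {0..t} (t * u) *\<^sub>R (1 / t) *\<^sub>R f (\<zeta> (t * u))) = indicator {0..1} u *\<^sub>R f (\<zeta> (t * u))"
      using t by (simp add: indicator_def)
  qed simp
  finally show ?thesis .
qed

lemma occupation_measure_riemann:
  fixes f :: "'d torus \<Rightarrow> 'b::{banach, second_countable_topology}"
  assumes f: "continuous_on UNIV f"
  shows "(\<lambda>n. (1 / real n) *\<^sub>R (\<Sum>j<n. f (\<zeta> (t * (real j / real n))))) \<longlonglongrightarrow> (\<integral>z. f z \<partial>occupation_measure \<zeta> t)"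
proof -
  define g where "g u = (if u \<in> {0..1} then f (\<zeta> (t * u)) else 0)" for u
  have fm[measurable]: "f \<in> borel_measurable borel" using f by (rule borel_measurable_continuous_onI)
  have "bounded (range f)"
    using compact_continuous_image[OF f compact_torus] by (rule compact_imp_bounded)
  then obtain K where K: "\<And>z. norm (f z) \<le> K" by (auto simp: bounded_iff)
  have bd: "norm (g u) \<le> max K 0" for u using K[of "\<zeta> (t * u)"] by (auto simp: g_def)
  have gm: "g \<in> borel_measurable borel"
  proof -
    have "(\<lambda>u. t * u) \<in> measurable (restrict_space borel {0..1}) (restrict_space borel {0..})"
      using t by (intro measurable_restrict_space2) (auto simp: space_restrict_space intro: measurable_restrict_space1)
    from measurable_compose[OF measurable_compose[OF this regular_path_measurable[OF reg]] fm]
    have "(\<lambda>u. f (\<zeta> (t * u))) \<in> borel_measurable (restrict_space borel {0..1})" .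
    then have "(\<lambda>u. indicator {0..1} u *\<^sub>R f (\<zeta> (t * u))) \<in> borel_measurable borel"
      by (subst (asm) borel_measurable_restrict_space_iff) auto
    moreover have "g = (\<lambda>u. indicator {0..1} u *\<^sub>R f (\<zeta> (t * u)))"
      by (auto simp: g_def fun_eq_iff)
    ultimately show ?thesis by simp
  qed
  define C where "C = {u. t * u \<in> {s \<in> {0..}. \<not> continuous (at s within {0..}) \<zeta>}}"
  have "countable C"
  proof -
    have "C \<subseteq> (\<lambda>s. s / t) ` {s \<in> {0..}. \<not> continuous (at s within {0..}) \<zeta>}"
      using t by (force simp: C_def image_def)
    then show ?thesis using regular_path_continuous[OF reg] by (meson countable_image countable_subset)
  qed
  moreover have "continuous (at u within {0..1}) g" if u: "u \<in> {0..1} - C" for u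
  proof -
    have "continuous (at (t * u) within {0..}) \<zeta>" using u t by (auto simp: C_def)
    then have "continuous (at (t * u) within (\<lambda>u. t * u) ` {0..1}) \<zeta>"
      by (rule continuous_within_subset) (use t in auto)
    moreover have "continuous (at u within {0..1}) (\<lambda>u. t * u)" by (intro continuous_intros)
    ultimately have 1: "continuous (at u within {0..1}) (\<lambda>u. \<zeta> (t * u))"
      using continuous_within_compose[of u "{0..1}" "\<lambda>u. t * u" \<zeta>] by (simp add: comp_def)
    have "isCont f (\<zeta> (t * u))" using f by (simp add: continuous_on_eq_continuous_at)
    then have "continuous (at (\<zeta> (t * u)) within (\<lambda>u. \<zeta> (t * u)) ` {0..1}) f"
      by (rule continuous_at_imp_continuous_at_within)
    with 1 have "continuous (at u within {0..1}) (\<lambda>u. f (\<zeta> (t * u)))"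
      using continuous_within_compose[of u "{0..1}" "\<lambda>u. \<zeta> (t * u)" f] by (simp add: comp_def)
    then show ?thesis
      by (rule continuous_transform_within[OF _ zero_less_one]) (use u in \<open>auto simp: g_def\<close>)
  qed
  ultimately have "(\<lambda>n. (1 / real n) *\<^sub>R (\<Sum>j<n. g (real j / real n))) \<longlonglongrightarrow> (\<integral>u. indicator {0..1} u *\<^sub>R g u \<partial>lborel)"
    by (intro riemann_sum_tendsto[OF gm bd])
  moreover have "(\<Sum>j<n. g (real j / real n)) = (\<Sum>j<n. f (\<zeta> (t * (real j / real n))))" for n
    by (intro sum.cong) (auto simp: g_def)
  moreover have "(\<integral>u. indicator {0..1} u *\<^sub>R g u \<partial>lborel) = (\<integral>z. f z \<partial>occupation_measure \<zeta> t)"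
    unfolding integral_occupation_measure[OF fm]
    by (intro Bochner_Integration.integral_cong) (auto simp: g_def indicator_def)
  ultimately show ?thesis by simp
qed

end

text \<open>Integrals of continuous functions are limits of Riemann sums, which involve the process
  at fixed times only and are measurable in \<omega>. Closed sets follow by approximation, and Borel
  sets because the closed sets form an intersection-stable generator.\<close>

lemma measurable_measure_occupation:
  fixes Z :: "real \<Rightarrow> 'w \<Rightarrow> 'd::finite torus"
  assumes reg: "\<And>\<omega>. \<omega> \<in> space M \<Longrightarrow> regular_path (\<lambda>s. Z s \<omega>)" and t: "0 < t"
    and Z: "\<And>s. 0 \<le> s \<Longrightarrow> Z s \<in> borel_measurable M" and A: "A \<in> sets borel"
  shows "(\<lambda>\<omega>. measure (occupation_measure (\<lambda>s. Z s \<omega>) t) A) \<in> borel_measurable M"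
proof -
  let ?\<mu> = "\<lambda>\<omega>. occupation_measure (\<lambda>s. Z s \<omega>) t"
  have int: "(\<lambda>\<omega>. \<integral>z. f z \<partial>?\<mu> \<omega>) \<in> borel_measurable M" if f: "continuous_on UNIV f" for f :: "'d torus \<Rightarrow> real"
  proof (rule borel_measurable_LIMSEQ_real)
    show "(\<lambda>n. (1 / real n) *\<^sub>R (\<Sum>j<n. f (Z (t * (real j / real n)) \<omega>))) \<longlonglongrightarrow> (\<integral>z. f z \<partial>?\<mu> \<omega>)"
      if "\<omega> \<in> space M" for \<omega>
      by (rule occupation_measure_riemann[OF reg[OF that] t f])
    have [measurable]: "f \<in> borel_measurable borel" using f by (rule borel_measurable_continuous_onI)
    have [measurable]: "Z (t * (real j / real n)) \<in> borel_measurable M" for j n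
      using t by (intro Z) simp
    show "(\<lambda>\<omega>. (1 / real n) *\<^sub>R (\<Sum>j<n. f (Z (t * (real j / real n)) \<omega>))) \<in> borel_measurable M" for n
      by measurable
  qed
  have closed: "(\<lambda>\<omega>. emeasure (?\<mu> \<omega>) A) \<in> borel_measurable M" if A: "closed A" for A
  proof (cases "A = {}")
    case False
    have "(\<lambda>\<omega>. measure (?\<mu> \<omega>) A) \<in> borel_measurable M"
    proof (rule borel_measurable_LIMSEQ_real)
      \<comment> \<open>Continuous functions that decrease to the indicator of the closed
        set.\<close>
      let ?f = "\<lambda>m z. max 0 (1 - real m * infdist z A)"
      have cf: "continuous_on UNIV (?f m)" for m
        by (intro continuous_intros)
      show "(\<lambda>\<omega>. \<integral>z. ?f m z \<partial>?\<mu> \<omega>) \<in> borel_measurable M" for m by (rule int[OF cf])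
      fix \<omega> assume w: "\<omega> \<in> space M"
      interpret prob_space "?\<mu> \<omega>" by (rule prob_space_occupation_measure[OF reg[OF w] t])
      note [measurable_cong] = sets_occupation_measure[OF reg[OF w] t]
      have [measurable]: "A \<in> sets borel" using A by simp
      have "(\<lambda>m. \<integral>z. ?f m z \<partial>?\<mu> \<omega>) \<longlonglongrightarrow> (\<integral>z. indicator A z \<partial>?\<mu> \<omega>)"
      proof (rule integral_dominated_convergence[where w = "\<lambda>_. 1"])
        show "?f m \<in> borel_measurable (?\<mu> \<omega>)" for m
          using borel_measurable_continuous_onI[OF cf]
          by (simp add: measurable_cong_sets[OF sets_occupation_measure[OF reg[OF w] t] refl])
        show "AE z in ?\<mu> \<omega>. norm (?f m z) \<le> 1" for m by (auto simp: infdist_nonneg)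
        show "AE z in ?\<mu> \<omega>. (\<lambda>m. ?f m z) \<longlonglongrightarrow> indicator A z"
        proof (rule AE_I2)
          fix z
          show "(\<lambda>m. ?f m z) \<longlonglongrightarrow> indicator A z"
          proof (cases "z \<in> A")
            case True
            then show ?thesis by simp
          next
            case nz: False
            then have pos: "0 < infdist z A"
              using A False infdist_nonneg[of z A] in_closed_iff_infdist_zero[OF A False, of z] by (simp add: less_le)
            obtain m0 :: nat where m0: "1 / infdist z A < real m0" using reals_Archimedean2 by blast
            have "?f m z = 0" if "m0 \<le> m" for m
            proof -
              have "1 / infdist z A < real m" using m0 that by linarith
              then show ?thesis using pos by (simp add: field_simps)
            qed
            then have "eventually (\<lambda>m. ?f m z = 0) sequentially" unfolding eventually_sequentially by blast
            then show ?thesis using nz by (simp add: tendsto_eventually)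
          qed
        qed
      qed simp_all
      then show "(\<lambda>m. \<integral>z. ?f m z \<partial>?\<mu> \<omega>) \<longlonglongrightarrow> measure (?\<mu> \<omega>) A" by simp
    qed
    then have "(\<lambda>\<omega>. ennreal (measure (?\<mu> \<omega>) A)) \<in> borel_measurable M" by simp
    then show ?thesis
      by (rule measurable_cong[THEN iffD1, rotated])
         (use prob_space_occupation_measure[OF reg t] in \<open>simp add: finite_measure.emeasure_eq_measure prob_space_def\<close>)
  qed simp
  have "?\<mu> \<in> measurable M (prob_algebra borel)"
  proof (rule measurable_prob_algebra_generated[where \<Omega> = UNIV and G = "Collect closed"])
    show "sets (borel :: 'd torus measure) = sigma_sets UNIV (Collect closed)"
      by (simp add: borel_eq_closed)
    show "Int_stable (Collect closed :: 'd torus set set)" by (auto simp: Int_stable_def)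
  qed (use closed sets_occupation_measure[OF reg t] prob_space_occupation_measure[OF reg t] in auto)
  then have "?\<mu> \<in> measurable M (subprob_algebra borel)" by (rule measurable_prob_algebraD)
  from measurable_compose[OF this measurable_measure_subprob_algebra[OF A]]
  show ?thesis .
qed

text \<open>Dyadic index of level \<open>n\<close>. The cap \<open>4 ^ n\<close> gives a finite
  range, so that an expectation splits into finitely many terms; after division by
  \<open>2 ^ n\<close> it still tends to infinity, so every time is eventually below it.\<close>

definition disc :: "nat \<Rightarrow> real \<Rightarrow> nat" where
  "disc n s = nat (min \<lfloor>2 ^ n * s\<rfloor> (4 ^ n))"

abbreviation undisc :: "nat \<Rightarrow> nat \<Rightarrow> real" where
  "undisc n i \<equiv> real i / 2 ^ n"

lemma disc_le: "disc n s \<le> 4 ^ n"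
  by (auto simp: disc_def nat_le_iff)

lemma disc_tendsto:
  assumes "0 \<le> s"
  shows "(\<lambda>n. undisc n (disc n s)) \<longlonglongrightarrow> s"
proof -
  obtain n0 :: nat where n0: "s < 2 ^ n0" using real_arch_pow[of 2 s] by auto
  have "\<bar>undisc n (disc n s) - s\<bar> \<le> (1/2) ^ n" if n: "n0 \<le> n" for n
  proof -
    have "s < 2 ^ n" using n0 power_increasing[OF n, of "2::real"] by linarith
    then have "2 ^ n * s \<le> 2 ^ n * (2 ^ n :: real)" by (intro mult_left_mono) auto
    also have "\<dots> = 4 ^ n" by (simp flip: power_mult_distrib)
    finally have "\<lfloor>2 ^ n * s\<rfloor> \<le> 4 ^ n" by (simp add: floor_le_iff)
    moreover have "0 \<le> \<lfloor>2 ^ n * s\<rfloor>" using assms by simp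
    ultimately have e: "real (disc n s) = of_int \<lfloor>2 ^ n * s\<rfloor>" by (simp add: disc_def)
    have "\<bar>real (disc n s) - 2 ^ n * s\<bar> \<le> 1" unfolding e by linarith
    then have "\<bar>real (disc n s) - 2 ^ n * s\<bar> / 2 ^ n \<le> 1 / 2 ^ n" by (intro divide_right_mono) auto
    moreover have "undisc n (disc n s) - s = (real (disc n s) - 2 ^ n * s) / 2 ^ n"
      by (simp add: field_simps)
    then have "\<bar>real (disc n s) - 2 ^ n * s\<bar> / 2 ^ n = \<bar>undisc n (disc n s) - s\<bar>"
      by simp
    ultimately show ?thesis by (simp add: power_one_over)
  qed
  then have "eventually (\<lambda>n. norm (undisc n (disc n s) - s) \<le> (1/2) ^ n) sequentially"
    unfolding eventually_sequentially by auto
  moreover have "(\<lambda>n. (1/2) ^ n :: real) \<longlonglongrightarrow> 0" by (intro LIMSEQ_realpow_zero) auto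
  ultimately show ?thesis by (rule LIM_zero_cancel[OF Lim_null_comparison])
qed

lemma measurable_disc: "disc n \<in> measurable borel (count_space UNIV)"
  unfolding disc_def by measurable

text \<open>A continuous process at a random time is the limit of the process at dyadic
  approximations, which take countably many values.\<close>

lemma measurable_random_time:
  fixes X :: "real \<Rightarrow> 'w \<Rightarrow> 'b::metric_space"
  assumes X: "\<And>t. 0 \<le> t \<Longrightarrow> X t \<in> borel_measurable M"
    and c: "\<And>\<omega>. \<omega> \<in> space M \<Longrightarrow> continuous_on {0..} (\<lambda>t. X t \<omega>)"
    and \<sigma>: "\<sigma> \<in> borel_measurable M" "\<And>\<omega>. \<omega> \<in> space M \<Longrightarrow> 0 \<le> \<sigma> \<omega>"
  shows "(\<lambda>\<omega>. X (\<sigma> \<omega>) \<omega>) \<in> borel_measurable M"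
proof (rule borel_measurable_LIMSEQ_metric)
  show "(\<lambda>\<omega>. X (undisc n (disc n (\<sigma> \<omega>))) \<omega>) \<in> borel_measurable M" for n
  proof (rule measurable_compose_countable[where f = "\<lambda>i \<omega>. X (undisc n i) \<omega>"])
    show "(\<lambda>\<omega>. disc n (\<sigma> \<omega>)) \<in> measurable M (count_space UNIV)"
      by (rule measurable_compose[OF \<sigma>(1) measurable_disc])
    show "X (undisc n i) \<in> borel_measurable M" for i by (intro X) simp
  qed
  fix \<omega> assume w: "\<omega> \<in> space M"
  have "((\<lambda>t. X t \<omega>) \<longlongrightarrow> X (\<sigma> \<omega>) \<omega>) (at (\<sigma> \<omega>) within {0..})"
    using c[OF w] \<sigma>(2)[OF w] by (auto simp: continuous_on_def)
  then have "continuous (at (\<sigma> \<omega>) within {0..}) (\<lambda>t. X t \<omega>)" by (simp add: continuous_within)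
  then show "(\<lambda>n. X (undisc n (disc n (\<sigma> \<omega>))) \<omega>) \<longlonglongrightarrow> X (\<sigma> \<omega>) \<omega>"
    by (rule continuous_within_tendsto_compose'[OF _ _ disc_tendsto[OF \<sigma>(2)[OF w]]]) simp
qed

section \<open>Gaussian paths at random times\<close>

lemma (in prob_space) gaussian_square_integrable:
  assumes "gaussian_rv M Y"
  shows "integrable M (\<lambda>\<omega>. (Y \<omega>)\<^sup>2)" "integrable M Y"
proof -
  have [measurable]: "Y \<in> borel_measurable M" using assms by (simp add: gaussian_rv_def)
  obtain m where "distr M borel Y = return borel m \<or> (\<exists>\<sigma>>0. distributed M lborel Y (normal_density m \<sigma>))"
    using assms by (auto simp: gaussian_rv_def)
  then have *: "integrable M (\<lambda>\<omega>. (Y \<omega> - m)^2)"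
  proof
    assume r: "distr M borel Y = return borel m"
    have "integrable (distr M borel Y) (\<lambda>y. (y - m)^2)"
      unfolding r by (rule integrableI_bounded) (auto simp: nn_integral_return)
    then show ?thesis by (subst (asm) integrable_distr_eq) auto
  next
    assume "\<exists>\<sigma>>0. distributed M lborel Y (normal_density m \<sigma>)"
    then obtain \<sigma> where \<sigma>: "0 < \<sigma>" "distributed M lborel Y (normal_density m \<sigma>)" by blast
    show ?thesis
      using distributed_integrable[OF \<sigma>(2), of "\<lambda>y. (y - m)^2"] integrable_normal_moment[OF \<sigma>(1), of m 2] by simp
  qed
  have "integrable M (\<lambda>\<omega>. (Y \<omega> - m)^1)"
    by (rule square_integrable_imp_integrable) (use * in auto)
  then have "integrable M (\<lambda>\<omega>. (Y \<omega> - m) + m)" by (intro Bochner_Integration.integrable_add) auto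
  then show Y: "integrable M Y" by simp
  have "integrable M (\<lambda>\<omega>. (Y \<omega> - m)^2 + (2 * m * Y \<omega> - m^2))"
    using * Y by simp
  then show "integrable M (\<lambda>\<omega>. (Y \<omega>)\<^sup>2)" by (simp add: power2_eq_square algebra_simps)
qed

text \<open>The degenerate law is a genuine case: a combination of values of the process can vanish,
  for instance at time 0. The other case is scaled to the standard normal law.\<close>

lemma (in prob_space) gaussian_characteristic:
  assumes Y: "gaussian_rv M Y" and E: "expectation Y = 0"
  shows "expectation (\<lambda>\<omega>. cis (Y \<omega>)) = of_real (exp (- expectation (\<lambda>\<omega>. (Y \<omega>)\<^sup>2) / 2))"
proof -
  have [measurable]: "Y \<in> borel_measurable M" using Y by (simp add: gaussian_rv_def)
  have cis: "cis \<in> borel_measurable borel" by (intro borel_measurable_continuous_onI continuous_intros)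
  obtain m where "distr M borel Y = return borel m \<or> (\<exists>\<sigma>>0. distributed M lborel Y (normal_density m \<sigma>))"
    using Y by (auto simp: gaussian_rv_def)
  then show ?thesis
  proof
    assume r: "distr M borel Y = return borel m"
    have ret: "expectation (\<lambda>\<omega>. f (Y \<omega>)) = f m" if "f \<in> borel_measurable borel"
      for f :: "real \<Rightarrow> 'b::{banach,second_countable_topology}"
    proof -
      have "expectation (\<lambda>\<omega>. f (Y \<omega>)) = integral\<^sup>L (distr M borel Y) f"
        using that by (subst integral_distr) auto
      also have "\<dots> = f m" unfolding r using that by (subst integral_return) auto
      finally show ?thesis .
    qed
    have "m = 0" using ret[of "\<lambda>x. x"] E by simp
    then show ?thesis using ret[of "\<lambda>x. x^2"] ret[OF cis] by simp
  next
    assume "\<exists>\<sigma>>0. distributed M lborel Y (normal_density m \<sigma>)"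
    then obtain \<sigma> where \<sigma>: "0 < \<sigma>" and D: "distributed M lborel Y (normal_density m \<sigma>)" by blast
    have m: "m = 0" using normal_distributed_expectation[OF \<sigma> D] E by simp
    have v: "expectation (\<lambda>\<omega>. (Y \<omega>)\<^sup>2) = \<sigma>\<^sup>2"
      using normal_distributed_variance[OF \<sigma> D] E by simp
    have "distributed M lborel (\<lambda>\<omega>. (Y \<omega> - m) / \<sigma>) std_normal_density"
      using D normal_standard_normal_convert[OF \<sigma>] by blast
    then have "distr M lborel (\<lambda>\<omega>. (Y \<omega> - m) / \<sigma>) = std_normal_distribution"
      by (simp add: distributed_def)
    then have d: "distr M borel (\<lambda>\<omega>. Y \<omega> / \<sigma>) = std_normal_distribution"
      using m by (simp cong: distr_cong)
    have "expectation (\<lambda>\<omega>. cis (Y \<omega>)) = expectation (\<lambda>\<omega>. iexp (\<sigma> * (Y \<omega> / \<sigma>)))"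
      using \<sigma> by (simp add: cis_conv_exp)
    also have "\<dots> = integral\<^sup>L (distr M borel (\<lambda>\<omega>. Y \<omega> / \<sigma>)) (\<lambda>x. iexp (\<sigma> * x))"
      by (subst integral_distr) auto
    also have "\<dots> = char std_normal_distribution \<sigma>" by (simp add: d char_def)
    also have "\<dots> = of_real (exp (- \<sigma>\<^sup>2 / 2))" by (simp add: char_std_normal_distribution)
    finally show ?thesis by (simp add: v)
  qed
qed

text \<open>The minimum of two ordered times is the sum of the increments that precede both.
  Exchanging the sums diagonalises the covariance of Brownian motion: the increment \<open>l\<close>
  meets exactly the indices from \<open>l\<close> on.\<close>

lemma gram_min:
  fixes \<theta> :: "nat \<Rightarrow> 'a::real_inner" and s :: "nat \<Rightarrow> real"
  assumes s: "0 \<le> s 0" "\<And>i. Suc i < m \<Longrightarrow> s i \<le> s (Suc i)"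
  shows "(\<Sum>i<m. \<Sum>j<m. (\<theta> i \<bullet> \<theta> j) * min (s i) (s j))
    = (\<Sum>l<m. (norm (\<Sum>i\<in>{l..<m}. \<theta> i))\<^sup>2 * (s l - (if l = 0 then 0 else s (l - 1))))"
proof -
  define D where "D l = s l - (if l = 0 then 0 else s (l - 1))" for l
  have mono: "i \<le> j \<Longrightarrow> j < m \<Longrightarrow> s i \<le> s j" for i j
  proof (induction j rule: dec_induct)
    case (step n)
    then show ?case using s(2)[of n] by simp
  qed simp
  have tel: "(\<Sum>l\<le>k. D l) = s k" for k by (induction k) (auto simp: D_def)
  have min: "min (s i) (s j) = (\<Sum>l<m. (if l \<le> i \<and> l \<le> j then D l else 0))" if "i < m" "j < m" for i j
  proof -
    have "(\<Sum>l<m. (if l \<le> i \<and> l \<le> j then D l else 0)) = (\<Sum>l\<in>{..<m} \<inter> {l. l \<le> i \<and> l \<le> j}. D l)"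
      by (simp add: sum.inter_restrict)
    also have "{..<m} \<inter> {l. l \<le> i \<and> l \<le> j} = {..min i j}" using that by auto
    also have "(\<Sum>l\<in>{..min i j}. D l) = s (min i j)" by (rule tel)
    also have "\<dots> = min (s i) (s j)" using mono[of i j] mono[of j i] that by (auto simp: min_def)
    finally show ?thesis by simp
  qed
  have "(\<Sum>i<m. \<Sum>j<m. (\<theta> i \<bullet> \<theta> j) * min (s i) (s j))
      = (\<Sum>i<m. \<Sum>j<m. \<Sum>l<m. (if l \<le> i \<and> l \<le> j then (\<theta> i \<bullet> \<theta> j) * D l else 0))"
    by (intro sum.cong refl) (auto simp: min sum_distrib_left intro!: sum.cong)
  also have "\<dots> = (\<Sum>i<m. \<Sum>l<m. \<Sum>j<m. (if l \<le> i \<and> l \<le> j then (\<theta> i \<bullet> \<theta> j) * D l else 0))"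
    by (intro sum.cong refl sum.swap)
  also have "\<dots> = (\<Sum>l<m. \<Sum>i<m. \<Sum>j<m. (if l \<le> i \<and> l \<le> j then (\<theta> i \<bullet> \<theta> j) * D l else 0))"
    by (rule sum.swap)
  also have "\<dots> = (\<Sum>l<m. (norm (\<Sum>i\<in>{l..<m}. \<theta> i))\<^sup>2 * D l)"
  proof (intro sum.cong refl)
    fix l
    have s1: "{l..<m} = {..<m} \<inter> {i. l \<le> i}" by auto
    have "(norm (\<Sum>i\<in>{l..<m}. \<theta> i))\<^sup>2 = (\<Sum>i\<in>{l..<m}. \<Sum>j\<in>{l..<m}. \<theta> i \<bullet> \<theta> j)"
      by (simp add: power2_norm_eq_inner inner_sum_left inner_sum_right) (rule sum.swap)
    also have "\<dots> = (\<Sum>i<m. if l \<le> i then (\<Sum>j<m. if l \<le> j then \<theta> i \<bullet> \<theta> j else 0) else 0)"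
      unfolding s1 by (simp add: sum.inter_restrict)
    finally show "(\<Sum>i<m. \<Sum>j<m. (if l \<le> i \<and> l \<le> j then (\<theta> i \<bullet> \<theta> j) * D l else 0)) = (norm (\<Sum>i\<in>{l..<m}. \<theta> i))\<^sup>2 * D l"
      by (auto simp: sum_distrib_right intro!: sum.cong)
  qed
  finally show ?thesis by (simp add: D_def)
qed

section \<open>The two processes: independence, Gaussian moments and Laplace transforms\<close>

locale subordinated = prob_space M
  for M :: "'w measure" and B :: "real \<Rightarrow> real" and H :: real and X :: "real \<Rightarrow> 'w \<Rightarrow> real ^ 'd::finite"
    and S :: "real \<Rightarrow> 'w \<Rightarrow> real" +
  assumes fbm: "fractional_brownian_motion M H X" and sub: "subordinator M B S"
    and ind: "indep_set (sets (process_algebra M X)) (sets (process_algebra M S))"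
begin

lemma X_meas [measurable]: "0 \<le> t \<Longrightarrow> X t \<in> borel_measurable M"
  using fbm by (auto simp: fractional_brownian_motion_def gaussian_process_def)

lemma X_cont: "\<omega> \<in> space M \<Longrightarrow> continuous_on {0..} (\<lambda>t. X t \<omega>)"
  using fbm by (auto simp: fractional_brownian_motion_def)

lemma X_tendsto:
  assumes "\<omega> \<in> space M" "\<And>n. 0 \<le> s n" "0 \<le> t" "s \<longlonglongrightarrow> t"
  shows "(\<lambda>n. X (s n) \<omega>) \<longlonglongrightarrow> X t \<omega>"
  using continuous_within_tendsto_compose'[of t "{0..}" "\<lambda>t. X t \<omega>" s] assms X_cont[OF assms(1)]
  by (auto simp: continuous_on_eq_continuous_within)

lemma S_meas [measurable]: "0 \<le> t \<Longrightarrow> S t \<in> borel_measurable M"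
  and S_0: "\<omega> \<in> space M \<Longrightarrow> S 0 \<omega> = 0"
  and S_mono: "\<omega> \<in> space M \<Longrightarrow> mono_on {0..} (\<lambda>t. S t \<omega>)"
  and S_stat: "0 \<le> s \<Longrightarrow> 0 \<le> h \<Longrightarrow> distr M borel (\<lambda>\<omega>. S (s + h) \<omega> - S s \<omega>) = distr M borel (S h)"
  and S_indep: "0 \<le> \<tau> 0 \<Longrightarrow> (\<And>i. i < n \<Longrightarrow> \<tau> i \<le> \<tau> (Suc i)) \<Longrightarrow>
          indep_vars (\<lambda>_. borel) (\<lambda>i \<omega>. S (\<tau> (Suc i)) \<omega> - S (\<tau> i) \<omega>) {..<(n::nat)}"
  and S_laplace: "0 \<le> t \<Longrightarrow> 0 \<le> l \<Longrightarrow> expectation (\<lambda>\<omega>. exp (- l * S t \<omega>)) = exp (- t * B l)"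
  using sub unfolding subordinator_def by blast+

lemma S_le: "\<omega> \<in> space M \<Longrightarrow> 0 \<le> s \<Longrightarrow> s \<le> t \<Longrightarrow> S s \<omega> \<le> S t \<omega>"
  using mono_onD[OF S_mono, of \<omega> s t] by simp

lemma S_nonneg: "\<omega> \<in> space M \<Longrightarrow> 0 \<le> t \<Longrightarrow> 0 \<le> S t \<omega>"
  using S_le[of \<omega> 0 t] S_0 by simp

lemma space_process_algebra [simp]: "space (process_algebra M Y) = space M"
  by (simp add: process_algebra_def)

lemma process_algebra_component:
  assumes "0 \<le> t" shows "Y t \<in> borel_measurable (process_algebra M Y)"
proof -
  have 1: "(\<lambda>\<omega>. \<lambda>t\<in>{0..}. Y t \<omega>) \<in> measurable (process_algebra M Y) (PiM {0..} (\<lambda>_. borel))"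
    unfolding process_algebra_def by (rule measurable_vimage_algebra1) (auto simp: space_PiM)
  have "(\<lambda>x. x t) \<in> measurable (PiM {0..} (\<lambda>_. borel)) borel"
    by (rule measurable_component_singleton) (use assms in auto)
  from measurable_compose[OF 1 this] show ?thesis using assms by simp
qed

lemma process_algebra_sub: "sets (process_algebra M X) \<subseteq> sets M" "sets (process_algebra M S) \<subseteq> sets M"
  using ind unfolding indep_set_def indep_sets_def by (auto split: bool.splits)

lemma measurable_X_algebra: "g \<in> measurable (process_algebra M X) N \<Longrightarrow> g \<in> measurable M N"
  using measurable_mono[OF order_refl refl process_algebra_sub(1)] by auto

text \<open>The product rule for the two independent processes enters the development only here, for
  an event of the subordinator and a bounded function of the Gaussian process.\<close>

lemma indep_indicator:
  fixes g :: "'w \<Rightarrow> 'b::{real_normed_field, banach, second_countable_topology}"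
  assumes g: "g \<in> borel_measurable (process_algebra M X)" and bd: "\<And>\<omega>. \<omega> \<in> space M \<Longrightarrow> norm (g \<omega>) \<le> K"
    and A: "A \<in> sets (process_algebra M S)"
  shows "expectation (\<lambda>\<omega>. indicator A \<omega> * g \<omega>) = of_real (prob A) * expectation g"
proof -
  have gM: "g \<in> borel_measurable M" by (rule measurable_X_algebra[OF g])
  have AM[measurable]: "A \<in> sets M" using A process_algebra_sub by blast
  have "indep_var borel (indicator A :: 'w \<Rightarrow> 'b) borel g"
    unfolding indep_var_eq
  proof (intro conjI)
    have "{indicator A -` B \<inter> space M |B. B \<in> sets (borel :: 'b measure)} \<subseteq> sets (process_algebra M S)"
      using A measurable_sets[OF borel_measurable_indicator[OF A]] by auto
    then have 1: "sigma_sets (space M) {indicator A -` B \<inter> space M |B. B \<in> sets (borel :: 'b measure)} \<subseteq> sets (process_algebra M S)"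
      using sets.sigma_sets_subset[of _ "process_algebra M S"] by simp
    have "{g -` B \<inter> space M |B. B \<in> sets borel} \<subseteq> sets (process_algebra M X)"
      using measurable_sets[OF g] by auto
    then have 2: "sigma_sets (space M) {g -` B \<inter> space M |B. B \<in> sets borel} \<subseteq> sets (process_algebra M X)"
      using sets.sigma_sets_subset[of _ "process_algebra M X"] by simp
    show "indep_set (sigma_sets (space M) {indicator A -` B \<inter> space M |B. B \<in> sets (borel :: 'b measure)})
      (sigma_sets (space M) {g -` B \<inter> space M |B. B \<in> sets borel})"
      unfolding indep_sets2_eq
    proof (intro conjI ballI)
      fix a b assume "a \<in> sigma_sets (space M) {indicator A -` B \<inter> space M |B. B \<in> sets (borel :: 'b measure)}"
        "b \<in> sigma_sets (space M) {g -` B \<inter> space M |B. B \<in> sets borel}"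
      then have "prob (b \<inter> a) = prob b * prob a" using ind 1 2 unfolding indep_sets2_eq by blast
      then show "prob (a \<inter> b) = prob a * prob b" by (simp add: Int_commute mult.commute)
    qed (use 1 2 process_algebra_sub in blast)+
  qed (use gM in auto)
  moreover have "integrable M (indicator A :: 'w \<Rightarrow> 'b)"
    by (rule integrable_const_bound[where B = 1]) (auto simp: indicator_def)
  moreover have "integrable M g" using bd gM by (intro integrable_const_bound[where B = K]) auto
  ultimately have "expectation (\<lambda>\<omega>. indicator A \<omega> * g \<omega>) = expectation (indicator A) * expectation g"
    by (rule indep_var_lebesgue_integral)
  moreover have "has_bochner_integral M (\<lambda>\<omega>. indicator A \<omega> *\<^sub>R (1 :: 'b)) (prob A *\<^sub>R 1)"
    by (rule has_bochner_integral_indicator) (auto simp: emeasure_eq_measure)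
  then have "expectation (\<lambda>\<omega>. indicator A \<omega> *\<^sub>R (1 :: 'b)) = of_real (prob A)"
    by (simp add: has_bochner_integral_integral_eq of_real_def)
  moreover have "(\<lambda>\<omega>. indicator A \<omega> *\<^sub>R (1 :: 'b)) = indicator A"
    by (auto simp: indicator_def fun_eq_iff)
  ultimately show ?thesis by simp
qed

text \<open>Freezing the times: given the subordinator, the mean may be taken over the Gaussian
  process alone. Both live on the one space \<open>M\<close> and not on a product, so this is not
  Fubini's theorem. Dyadic times reduce it to finitely many uses of \<open>indep_indicator\<close>;
  continuity in the times and dominated convergence give the limit.\<close>

lemma random_time:
  fixes g :: "(nat \<Rightarrow> real) \<Rightarrow> 'w \<Rightarrow> 'b::{real_normed_field, banach, second_countable_topology}"
  assumes \<tau>: "\<And>i. i < m \<Longrightarrow> 0 \<le> \<tau> i"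
    and gm: "\<And>s. (\<And>i. 0 \<le> s i) \<Longrightarrow> g s \<in> borel_measurable (process_algebra M X)"
    and bd: "\<And>s \<omega>. (\<And>i. 0 \<le> s i) \<Longrightarrow> \<omega> \<in> space M \<Longrightarrow> norm (g s \<omega>) \<le> K"
    and cont: "\<And>s sn \<omega>. \<omega> \<in> space M \<Longrightarrow> (\<And>n i. 0 \<le> sn n i) \<Longrightarrow> (\<And>i. 0 \<le> s i) \<Longrightarrow>
       (\<And>i. (\<lambda>n. sn n i) \<longlonglongrightarrow> s i) \<Longrightarrow> (\<lambda>n. g (sn n) \<omega>) \<longlonglongrightarrow> g s \<omega>"
  defines "Sv \<equiv> \<lambda>\<omega> i. if i < m then S (\<tau> i) \<omega> else 0"
  shows "expectation (\<lambda>\<omega>. g (Sv \<omega>) \<omega>) = expectation (\<lambda>\<omega>. expectation (g (Sv \<omega>)))"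
    "(\<lambda>\<omega>. expectation (g (Sv \<omega>))) \<in> borel_measurable M"
proof -
  define \<phi> where "\<phi> s = expectation (g s)" for s
  define V where "V n \<omega> = (\<lambda>i. if i < m then disc n (S (\<tau> i) \<omega>) else 0)" for n \<omega>
  define u where "u n v = (\<lambda>i::nat. undisc n (v i))" for n v
  \<comment> \<open>A finite set that contains every value of \<open>V n\<close>, by the cap in
    \<open>disc\<close>; the sums over it below are finite decompositions of the
    expectation.\<close>
  define R where "R n = {v. \<forall>i. (i \<in> {..<m} \<longrightarrow> v i \<in> {..4 ^ n}) \<and> (i \<notin> {..<m} \<longrightarrow> v i = (0::nat))}" for n
  have fin: "finite (R n)" for n unfolding R_def by (rule finite_set_of_finite_funs) auto
  have VR: "V n \<omega> \<in> R n" for n \<omega> by (auto simp: V_def R_def disc_le)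
  have u0: "0 \<le> u n v i" for n v i by (simp add: u_def)
  have Sv0: "0 \<le> Sv \<omega> i" if "\<omega> \<in> space M" for \<omega> i using S_nonneg[OF that] \<tau> by (simp add: Sv_def)
  have lim: "(\<lambda>n. u n (V n \<omega>) i) \<longlonglongrightarrow> Sv \<omega> i" if "\<omega> \<in> space M" for \<omega> i
  proof (cases "i < m")
    case True
    then show ?thesis using disc_tendsto[OF S_nonneg[OF that \<tau>[OF True]]] by (simp add: u_def V_def Sv_def)
  qed (simp add: u_def V_def Sv_def)
  have gM: "g s \<in> borel_measurable M" if "\<And>i. 0 \<le> s i" for s by (rule measurable_X_algebra[OF gm[OF that]])
  have gI: "integrable M (g s)" if "\<And>i. 0 \<le> s i" for s
    using bd[OF that] gM[OF that] by (intro integrable_const_bound[where B = K]) auto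
  have \<phi>b: "norm (\<phi> s) \<le> K" if "\<And>i. 0 \<le> s i" for s
  proof -
    have "norm (\<phi> s) \<le> expectation (\<lambda>\<omega>. norm (g s \<omega>))" unfolding \<phi>_def by (rule integral_norm_bound)
    also have "\<dots> \<le> K" using gI[OF that] bd[OF that] by (intro integral_le_const) auto
    finally show ?thesis .
  qed
  have E_in: "{\<omega> \<in> space M. V n \<omega> = v} \<in> sets (process_algebra M S)" for n v
  proof (cases "\<forall>i\<ge>m. v i = 0")
    case True
    have "{\<omega> \<in> space M. V n \<omega> = v} = {\<omega> \<in> space (process_algebra M S). \<forall>i\<in>{..<m}. disc n (S (\<tau> i) \<omega>) = v i}"
      using True by (force simp: V_def fun_eq_iff)
    also have "\<dots> \<in> sets (process_algebra M S)"
    proof (rule sets.sets_Collect_finite_All)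
      fix i assume "i \<in> {..<m}"
      then have "0 \<le> \<tau> i" using \<tau> by simp
      from measurable_compose[OF process_algebra_component[OF this] measurable_disc]
      have "(\<lambda>\<omega>. disc n (S (\<tau> i) \<omega>)) \<in> measurable (process_algebra M S) (count_space UNIV)" .
      from measurable_sets[OF this, of "{v i}"]
      show "{\<omega> \<in> space (process_algebra M S). disc n (S (\<tau> i) \<omega>) = v i} \<in> sets (process_algebra M S)"
        by (simp add: vimage_def Int_def conj_commute)
    qed auto
    finally show ?thesis .
  next
    case False
    then have "{\<omega> \<in> space M. V n \<omega> = v} = {}" by (auto simp: V_def)
    then show ?thesis by (simp only: sets.empty_sets)
  qed
  have step: "h (V n \<omega>) \<omega> = (\<Sum>v\<in>R n. indicator {\<omega> \<in> space M. V n \<omega> = v} \<omega> * h v \<omega>)" if "\<omega> \<in> space M"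
    for h :: "(nat \<Rightarrow> nat) \<Rightarrow> 'w \<Rightarrow> 'b" and n \<omega>
  proof -
    have "(\<Sum>v\<in>R n. indicator {\<omega> \<in> space M. V n \<omega> = v} \<omega> * h v \<omega>) = (\<Sum>v\<in>R n. if v = V n \<omega> then h v \<omega> else 0)"
      using that by (intro sum.cong) auto
    also have "\<dots> = h (V n \<omega>) \<omega>" using fin VR by simp
    finally show ?thesis by simp
  qed
  have AM: "{\<omega> \<in> space M. V n \<omega> = v} \<in> sets M" for n v using E_in process_algebra_sub by blast
  have IE: "integrable M (\<lambda>\<omega>. indicator {\<omega> \<in> space M. V n \<omega> = v} \<omega> * h \<omega>)" if "integrable M h"
    for n v and h :: "'w \<Rightarrow> 'b"
    by (rule Bochner_Integration.integrable_bound[OF that])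
       (use AM that in \<open>auto simp: indicator_def\<close>)
  have eqn: "expectation (\<lambda>\<omega>. g (u n (V n \<omega>)) \<omega>) = expectation (\<lambda>\<omega>. \<phi> (u n (V n \<omega>)))" for n
  proof -
    have "expectation (\<lambda>\<omega>. g (u n (V n \<omega>)) \<omega>)
        = expectation (\<lambda>\<omega>. \<Sum>v\<in>R n. indicator {\<omega> \<in> space M. V n \<omega> = v} \<omega> * g (u n v) \<omega>)"
      by (intro Bochner_Integration.integral_cong refl step[of _ "\<lambda>v. g (u n v)"])
    also have "\<dots> = (\<Sum>v\<in>R n. expectation (\<lambda>\<omega>. indicator {\<omega> \<in> space M. V n \<omega> = v} \<omega> * g (u n v) \<omega>))"
      by (intro Bochner_Integration.integral_sum IE gI u0)
    also have "\<dots> = (\<Sum>v\<in>R n. of_real (prob {\<omega> \<in> space M. V n \<omega> = v}) * \<phi> (u n v))"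
      unfolding \<phi>_def by (intro sum.cong refl indep_indicator[OF gm bd E_in]) (auto simp: u0)
    also have "\<dots> = (\<Sum>v\<in>R n. expectation (\<lambda>\<omega>. indicator {\<omega> \<in> space M. V n \<omega> = v} \<omega> * \<phi> (u n v)))"
    proof (intro sum.cong refl)
      fix v
      have c: "(\<lambda>_. \<phi> (u n v)) \<in> borel_measurable (process_algebra M X)" by simp
      show "of_real (prob {\<omega> \<in> space M. V n \<omega> = v}) * \<phi> (u n v) = expectation (\<lambda>\<omega>. indicator {\<omega> \<in> space M. V n \<omega> = v} \<omega> * \<phi> (u n v))"
        by (rule sym, rule trans[OF indep_indicator[OF c \<phi>b E_in]]) (simp_all add: u0 prob_space)
    qed
    also have "\<dots> = expectation (\<lambda>\<omega>. \<Sum>v\<in>R n. indicator {\<omega> \<in> space M. V n \<omega> = v} \<omega> * \<phi> (u n v))"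
      by (intro Bochner_Integration.integral_sum[symmetric] IE) auto
    also have "\<dots> = expectation (\<lambda>\<omega>. \<phi> (u n (V n \<omega>)))"
      by (intro Bochner_Integration.integral_cong refl step[of _ "\<lambda>v _. \<phi> (u n v)", symmetric])
    finally show ?thesis .
  qed
  have gVm: "(\<lambda>\<omega>. g (u n (V n \<omega>)) \<omega>) \<in> borel_measurable M" for n
  proof (subst measurable_cong[OF step[of _ "\<lambda>v. g (u n v)"]])
    show "(\<lambda>\<omega>. \<Sum>v\<in>R n. indicator {\<omega> \<in> space M. V n \<omega> = v} \<omega> * g (u n v) \<omega>) \<in> borel_measurable M"
      using gM[OF u0] AM by measurable
  qed
  have \<phi>Vm: "(\<lambda>\<omega>. \<phi> (u n (V n \<omega>))) \<in> borel_measurable M" for n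
  proof (subst measurable_cong[OF step[of _ "\<lambda>v _. \<phi> (u n v)"]])
    show "(\<lambda>\<omega>. \<Sum>v\<in>R n. indicator {\<omega> \<in> space M. V n \<omega> = v} \<omega> * \<phi> (u n v)) \<in> borel_measurable M"
      using AM by measurable
  qed
  have \<phi>c: "(\<lambda>n. \<phi> (sn n)) \<longlonglongrightarrow> \<phi> s" if "\<And>n i. 0 \<le> sn n i" "\<And>i. 0 \<le> s i" "\<And>i. (\<lambda>n. sn n i) \<longlonglongrightarrow> s i" for s sn
    unfolding \<phi>_def
    by (rule integral_dominated_convergence[where w = "\<lambda>_. K"])
       (use that gM cont[OF _ that] bd in auto)
  have g_lim: "(\<lambda>n. g (u n (V n \<omega>)) \<omega>) \<longlonglongrightarrow> g (Sv \<omega>) \<omega>" if "\<omega> \<in> space M" for \<omega>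
    using that u0 Sv0[OF that] lim[OF that] by (intro cont) auto
  have \<phi>_lim: "(\<lambda>n. \<phi> (u n (V n \<omega>))) \<longlonglongrightarrow> \<phi> (Sv \<omega>)" if "\<omega> \<in> space M" for \<omega>
    using u0 Sv0[OF that] lim[OF that] by (intro \<phi>c) auto
  have m1: "(\<lambda>\<omega>. g (Sv \<omega>) \<omega>) \<in> borel_measurable M"
    by (rule borel_measurable_LIMSEQ_metric[OF gVm g_lim])
  show m2: "(\<lambda>\<omega>. expectation (g (Sv \<omega>))) \<in> borel_measurable M"
    unfolding \<phi>_def[symmetric] by (rule borel_measurable_LIMSEQ_metric[OF \<phi>Vm \<phi>_lim])
  have "(\<lambda>n. expectation (\<lambda>\<omega>. g (u n (V n \<omega>)) \<omega>)) \<longlonglongrightarrow> expectation (\<lambda>\<omega>. g (Sv \<omega>) \<omega>)"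
    by (rule integral_dominated_convergence[where w = "\<lambda>_. K"])
       (use m1 gVm g_lim bd u0 in auto)
  moreover have "(\<lambda>n. expectation (\<lambda>\<omega>. \<phi> (u n (V n \<omega>)))) \<longlonglongrightarrow> expectation (\<lambda>\<omega>. \<phi> (Sv \<omega>))"
    by (rule integral_dominated_convergence[where w = "\<lambda>_. K"])
       (use m2 \<phi>Vm \<phi>_lim \<phi>b u0 in \<open>auto simp: \<phi>_def\<close>)
  ultimately show "expectation (\<lambda>\<omega>. g (Sv \<omega>) \<omega>) = expectation (\<lambda>\<omega>. expectation (g (Sv \<omega>)))"
    unfolding eqn \<phi>_def[symmetric] by (rule LIMSEQ_unique)
qed

lemma X_gaussian:
  assumes "\<And>i. i < (m::nat) \<Longrightarrow> 0 \<le> s i"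
  shows "gaussian_rv M (\<lambda>\<omega>. \<Sum>i<m. \<theta> i \<bullet> X (s i) \<omega>)"
proof -
  define a where "a t = (\<Sum>i\<in>{i. i < m \<and> s i = t}. \<theta> i)" for t
  have "gaussian_rv M (\<lambda>\<omega>. \<Sum>t\<in>s ` {..<m}. a t \<bullet> X t \<omega>)"
  proof -
    have "\<forall>T a. finite T \<and> T \<subseteq> {0..} \<longrightarrow> gaussian_rv M (\<lambda>\<omega>. \<Sum>t\<in>T. a t \<bullet> X t \<omega>)"
      using fbm by (simp add: fractional_brownian_motion_def gaussian_process_def)
    from this[rule_format, of "s ` {..<m}" a] show ?thesis using assms by auto
  qed
  moreover have "(\<Sum>t\<in>s ` {..<m}. a t \<bullet> X t \<omega>) = (\<Sum>i<m. \<theta> i \<bullet> X (s i) \<omega>)" for \<omega>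
  proof -
    have "(\<Sum>i<m. \<theta> i \<bullet> X (s i) \<omega>) = (\<Sum>t\<in>s ` {..<m}. \<Sum>i\<in>{i. i \<in> {..<m} \<and> s i = t}. \<theta> i \<bullet> X (s i) \<omega>)"
      by (rule sum.image_gen) simp
    also have "\<dots> = (\<Sum>t\<in>s ` {..<m}. a t \<bullet> X t \<omega>)"
      unfolding a_def inner_sum_left by (intro sum.cong) auto
    finally show ?thesis by simp
  qed
  ultimately show ?thesis by simp
qed

lemma X_component_integrable:
  assumes "0 \<le> t"
  shows "integrable M (\<lambda>\<omega>. X t \<omega> $ i)" "integrable M (\<lambda>\<omega>. (X t \<omega> $ i)\<^sup>2)"
proof -
  have "gaussian_rv M (\<lambda>\<omega>. X t \<omega> $ i)"
    using X_gaussian[of 1 "\<lambda>_. t" "\<lambda>_. axis i 1"] assms by (simp add: inner_axis_axis inner_axis')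
  from gaussian_square_integrable[OF this]
  show "integrable M (\<lambda>\<omega>. X t \<omega> $ i)" "integrable M (\<lambda>\<omega>. (X t \<omega> $ i)\<^sup>2)" by auto
qed

lemma X_product_integrable:
  assumes "0 \<le> s" "0 \<le> t"
  shows "integrable M (\<lambda>\<omega>. X s \<omega> $ i * X t \<omega> $ j)"
proof (rule Bochner_Integration.integrable_bound)
  show "integrable M (\<lambda>\<omega>. (X s \<omega> $ i)\<^sup>2 + (X t \<omega> $ j)\<^sup>2)"
    using X_component_integrable assms by simp
  show "AE \<omega> in M. norm (X s \<omega> $ i * X t \<omega> $ j) \<le> norm ((X s \<omega> $ i)\<^sup>2 + (X t \<omega> $ j)\<^sup>2)"
  proof (rule AE_I2)
    fix \<omega>
    have "2 * (\<bar>X s \<omega> $ i\<bar> * \<bar>X t \<omega> $ j\<bar>) \<le> (X s \<omega> $ i)\<^sup>2 + (X t \<omega> $ j)\<^sup>2"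
      using sum_squares_bound[of "\<bar>X s \<omega> $ i\<bar>" "\<bar>X t \<omega> $ j\<bar>"] by simp
    moreover have "0 \<le> \<bar>X s \<omega> $ i\<bar> * \<bar>X t \<omega> $ j\<bar>" by simp
    ultimately show "norm (X s \<omega> $ i * X t \<omega> $ j) \<le> norm ((X s \<omega> $ i)\<^sup>2 + (X t \<omega> $ j)\<^sup>2)"
      unfolding real_norm_def abs_mult by linarith
  qed
  show "(\<lambda>\<omega>. X s \<omega> $ i * X t \<omega> $ j) \<in> borel_measurable M"
    using X_component_integrable(1)[OF assms(1)] X_component_integrable(1)[OF assms(2)] by measurable
qed

lemma X_cov:
  assumes "0 \<le> s" "0 \<le> t"
  shows "expectation (\<lambda>\<omega>. X s \<omega> $ i * X t \<omega> $ j) =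
    (if i = j then (s powr (2 * H) + t powr (2 * H) - \<bar>t - s\<bar> powr (2 * H)) / 2 else 0)"
  using fbm assms by (auto simp: fractional_brownian_motion_def)

lemma X_mean:
  assumes "0 \<le> t" shows "integrable M (\<lambda>\<omega>. a \<bullet> X t \<omega>)" "expectation (\<lambda>\<omega>. a \<bullet> X t \<omega>) = 0"
proof -
  have "integrable M (\<lambda>\<omega>. \<Sum>i\<in>UNIV. X t \<omega> $ i *\<^sub>R axis i 1 :: real ^ 'd)"
    using X_component_integrable(1)[OF assms] by auto
  moreover have "(\<Sum>i\<in>UNIV. X t \<omega> $ i *\<^sub>R axis i 1) = X t \<omega>" for \<omega>
    using basis_expansion[of "X t \<omega>"] by (simp add: scalar_mult_eq_scaleR)
  ultimately have I: "integrable M (X t)" by simp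
  then show "integrable M (\<lambda>\<omega>. a \<bullet> X t \<omega>)" by simp
  have "expectation (X t) = 0" using fbm assms by (auto simp: fractional_brownian_motion_def)
  then show "expectation (\<lambda>\<omega>. a \<bullet> X t \<omega>) = 0" using I by simp
qed

lemma X_inner_cov:
  assumes "0 \<le> s" "0 \<le> t"
  shows "integrable M (\<lambda>\<omega>. (a \<bullet> X s \<omega>) * (b \<bullet> X t \<omega>))"
    "expectation (\<lambda>\<omega>. (a \<bullet> X s \<omega>) * (b \<bullet> X t \<omega>)) =
      (a \<bullet> b) * ((s powr (2 * H) + t powr (2 * H) - \<bar>t - s\<bar> powr (2 * H)) / 2)"
proof -
  let ?R = "(s powr (2 * H) + t powr (2 * H) - \<bar>t - s\<bar> powr (2 * H)) / 2"
  have e: "(a \<bullet> X s \<omega>) * (b \<bullet> X t \<omega>) = (\<Sum>i\<in>UNIV. \<Sum>j\<in>UNIV. (a $ i * b $ j) * (X s \<omega> $ i * X t \<omega> $ j))" for \<omega>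
    by (simp add: inner_vec_def sum_product algebra_simps)
  show "integrable M (\<lambda>\<omega>. (a \<bullet> X s \<omega>) * (b \<bullet> X t \<omega>))"
    unfolding e using X_product_integrable[OF assms] by auto
  have "expectation (\<lambda>\<omega>. (a \<bullet> X s \<omega>) * (b \<bullet> X t \<omega>))
    = (\<Sum>i\<in>UNIV. \<Sum>j\<in>UNIV. (a $ i * b $ j) * expectation (\<lambda>\<omega>. X s \<omega> $ i * X t \<omega> $ j))"
    unfolding e using X_product_integrable[OF assms] by simp
  also have "\<dots> = (\<Sum>i\<in>UNIV. \<Sum>j\<in>UNIV. if j = i then (a $ i * b $ j) * ?R else 0)"
    unfolding X_cov[OF assms] by (intro sum.cong) auto
  also have "\<dots> = (\<Sum>i\<in>UNIV. (a $ i * b $ i) * ?R)" by simp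
  also have "\<dots> = (a \<bullet> b) * ?R" by (simp add: inner_vec_def sum_distrib_right)
  finally show "expectation (\<lambda>\<omega>. (a \<bullet> X s \<omega>) * (b \<bullet> X t \<omega>)) = (a \<bullet> b) * ?R" .
qed

lemma X_increment:
  assumes "0 \<le> s" "0 \<le> t" "0 < H"
  shows "integrable M (\<lambda>\<omega>. (norm (X s \<omega> - X t \<omega>))\<^sup>2)"
    "expectation (\<lambda>\<omega>. (norm (X s \<omega> - X t \<omega>))\<^sup>2) = real CARD('d) * \<bar>s - t\<bar> powr (2 * H)"
proof -
  have e: "(norm (X s \<omega> - X t \<omega>))\<^sup>2 = (\<Sum>i\<in>UNIV. X s \<omega> $ i * X s \<omega> $ i + X t \<omega> $ i * X t \<omega> $ i - 2 * (X s \<omega> $ i * X t \<omega> $ i))" for \<omega>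
    by (simp add: power2_norm_eq_inner inner_vec_def algebra_simps)
  show "integrable M (\<lambda>\<omega>. (norm (X s \<omega> - X t \<omega>))\<^sup>2)"
    unfolding e using X_product_integrable assms by auto
  have "expectation (\<lambda>\<omega>. (norm (X s \<omega> - X t \<omega>))\<^sup>2) = (\<Sum>i\<in>(UNIV::'d set). \<bar>s - t\<bar> powr (2 * H))"
    unfolding e using X_product_integrable assms
    by (simp add: X_cov abs_minus_commute diff_divide_distrib add_divide_distrib)
  then show "expectation (\<lambda>\<omega>. (norm (X s \<omega> - X t \<omega>))\<^sup>2) = real CARD('d) * \<bar>s - t\<bar> powr (2 * H)" by simp
qed

text \<open>Markov's inequality through the Laplace transform at \<open>1 / x\<close>: on the event
  the exponential is at most 1/2, so \<open>2 * (1 - exp (- (1 / x) * S h \<omega>))\<close>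
  dominates the indicator, and \<open>1 - exp (- y) \<le> y\<close> bounds its mean.\<close>

lemma S_tail:
  assumes "0 \<le> s" "0 \<le> h" "0 < x"
  shows "prob {\<omega> \<in> space M. x < S (s + h) \<omega> - S s \<omega>} \<le> 2 * h * B (1 / x)"
proof -
  have [measurable]: "S (s + h) \<in> borel_measurable M" "S s \<in> borel_measurable M" "S h \<in> borel_measurable M"
    using assms by auto
  have "prob {\<omega> \<in> space M. x < S (s + h) \<omega> - S s \<omega>} = measure (distr M borel (\<lambda>\<omega>. S (s + h) \<omega> - S s \<omega>)) {x<..}"
    by (subst measure_distr) (auto simp: vimage_def Int_def conj_commute)
  also have "\<dots> = measure (distr M borel (S h)) {x<..}" using S_stat assms by simp
  also have "\<dots> = prob {\<omega> \<in> space M. x < S h \<omega>}"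
    by (subst measure_distr) (auto simp: vimage_def Int_def conj_commute)
  also have "\<dots> = expectation (indicator {\<omega> \<in> space M. x < S h \<omega>})" by simp
  also have "\<dots> \<le> expectation (\<lambda>\<omega>. 2 * (1 - exp (- (1 / x) * S h \<omega>)))"
  proof (rule integral_mono)
    have I: "integrable M (\<lambda>\<omega>. exp (- (1 / x) * S h \<omega>))"
      using assms S_nonneg by (intro integrable_const_bound[where B = 1]) auto
    then show "integrable M (\<lambda>\<omega>. 2 * (1 - exp (- (1 / x) * S h \<omega>)))" by simp
    fix \<omega> assume w: "\<omega> \<in> space M"
    have "exp (- (1 / x) * S h \<omega>) \<le> 1" using S_nonneg[OF w assms(2)] assms(3) by simp
    moreover have "exp (- (1 / x) * S h \<omega>) \<le> 1 / 2" if "x < S h \<omega>"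
    proof -
      have "1 \<le> (1 / x) * S h \<omega>" using that assms(3) by (simp add: field_simps)
      then have "exp (- (1 / x) * S h \<omega>) \<le> exp (- 1 :: real)" by simp
      also have "\<dots> \<le> 1 / 2" using exp_ge_add_one_self[of "1::real"] by (simp add: exp_minus field_simps)
      finally show ?thesis .
    qed
    ultimately show "indicator {\<omega> \<in> space M. x < S h \<omega>} \<omega> \<le> 2 * (1 - exp (- (1 / x) * S h \<omega>))"
      by (auto simp: indicator_def)
  qed (rule integrable_const_bound[where B = 1], auto simp: indicator_def)
  also have "\<dots> = 2 * (1 - exp (- h * B (1 / x)))"
  proof -
    have I: "integrable M (\<lambda>\<omega>. exp (- (1 / x) * S h \<omega>))"
      using assms S_nonneg by (intro integrable_const_bound[where B = 1]) auto
    have "expectation (\<lambda>\<omega>. 2 * (1 - exp (- (1 / x) * S h \<omega>))) = 2 * (1 - expectation (\<lambda>\<omega>. exp (- (1 / x) * S h \<omega>)))"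
      using I by (simp add: prob_space)
    then show ?thesis using S_laplace[of h "1 / x"] assms by simp
  qed
  also have "\<dots> \<le> 2 * h * B (1 / x)" using exp_ge_add_one_self[of "- h * B (1 / x)"] by simp
  finally show ?thesis .
qed

lemma S_increment_laplace:
  assumes s: "0 \<le> s 0" "\<And>i. Suc i < m \<Longrightarrow> s i \<le> s (Suc i)" and c: "\<And>l. 0 \<le> c l"
  shows "expectation (\<lambda>\<omega>. \<Prod>l<m. exp (- c l * (S (s l) \<omega> - (if l = 0 then 0 else S (s (l - 1)) \<omega>))))
    = (\<Prod>l<m. exp (- (s l - (if l = 0 then 0 else s (l - 1))) * B (c l)))"
proof -
  \<comment> \<open>Shifted times with \<open>T 0 = 0\<close> and \<open>T (Suc l) = s l\<close>,
    which treat the first increment, starting at time 0, like all others.\<close>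
  define T where "T l = (if l = 0 then 0 else s (l - 1))" for l :: nat
  have T: "T 0 = 0" "T (Suc l) = s l" for l by (simp_all add: T_def)
  have mono: "T l \<le> T (Suc l)" if "l < m" for l using s that by (cases l) (auto simp: T_def)
  have T0: "0 \<le> T l" if "l \<le> m" for l
    using that
  proof (induction l)
    case (Suc l)
    then show ?case using mono[of l] by simp
  qed (simp add: T)
  have [measurable]: "S (T l) \<in> borel_measurable M" if "l \<le> m" for l using T0[OF that] by simp
  have "indep_vars (\<lambda>_. borel) (\<lambda>i \<omega>. S (T (Suc i)) \<omega> - S (T i) \<omega>) {..<m}"
    by (rule S_indep) (use mono T in auto)
  then have iv: "indep_vars (\<lambda>_. borel) (\<lambda>i \<omega>. exp (- c i * (S (T (Suc i)) \<omega> - S (T i) \<omega>))) {..<m}"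
    by (rule indep_vars_compose2) measurable
  have I: "integrable M (\<lambda>\<omega>. exp (- c i * (S (T (Suc i)) \<omega> - S (T i) \<omega>)))" if "i < m" for i
  proof (rule integrable_const_bound[where B = 1])
    show "AE \<omega> in M. norm (exp (- c i * (S (T (Suc i)) \<omega> - S (T i) \<omega>))) \<le> 1"
    proof (rule AE_I2)
      fix \<omega> assume "\<omega> \<in> space M"
      then have "S (T i) \<omega> \<le> S (T (Suc i)) \<omega>" using S_le mono[OF that] T0[of i] that by simp
      then show "norm (exp (- c i * (S (T (Suc i)) \<omega> - S (T i) \<omega>))) \<le> 1" using c[of i] by simp
    qed
    have "S (T (Suc i)) \<in> borel_measurable M" "S (T i) \<in> borel_measurable M" using T0 that by auto
    then show "(\<lambda>\<omega>. exp (- c i * (S (T (Suc i)) \<omega> - S (T i) \<omega>))) \<in> borel_measurable M" by measurable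
  qed
  have E: "expectation (\<lambda>\<omega>. exp (- c i * (S (T (Suc i)) \<omega> - S (T i) \<omega>))) = exp (- (T (Suc i) - T i) * B (c i))" if "i < m" for i
  proof -
    let ?h = "T (Suc i) - T i"
    have h: "0 \<le> ?h" using mono[OF that] by simp
    have [measurable]: "S ?h \<in> borel_measurable M" "S (T (Suc i)) \<in> borel_measurable M" "S (T i) \<in> borel_measurable M"
      using h T0 that by auto
    have d: "distr M borel (\<lambda>\<omega>. S (T (Suc i)) \<omega> - S (T i) \<omega>) = distr M borel (S ?h)"
      using S_stat[of "T i" ?h] T0[of i] that h by simp
    have "expectation (\<lambda>\<omega>. exp (- c i * (S (T (Suc i)) \<omega> - S (T i) \<omega>)))
      = integral\<^sup>L (distr M borel (\<lambda>\<omega>. S (T (Suc i)) \<omega> - S (T i) \<omega>)) (\<lambda>x. exp (- c i * x))"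
      by (subst integral_distr) auto
    also have "\<dots> = expectation (\<lambda>\<omega>. exp (- c i * S ?h \<omega>))"
      unfolding d by (subst integral_distr) auto
    also have "\<dots> = exp (- ?h * B (c i))" by (rule S_laplace[OF h c])
    finally show ?thesis .
  qed
  have "expectation (\<lambda>\<omega>. \<Prod>l<m. exp (- c l * (S (s l) \<omega> - (if l = 0 then 0 else S (s (l - 1)) \<omega>))))
     = expectation (\<lambda>\<omega>. \<Prod>i<m. exp (- c i * (S (T (Suc i)) \<omega> - S (T i) \<omega>)))"
    by (intro Bochner_Integration.integral_cong refl prod.cong) (auto simp: T_def S_0)
  also have "\<dots> = (\<Prod>i<m. exp (- (T (Suc i) - T i) * B (c i)))"
    using indep_vars_lebesgue_integral[OF _ iv] I E by simp
  finally show ?thesis by (simp add: T_def)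
qed

end

context subordinated begin

text \<open>With frozen times the exponent is Gaussian, and \<open>gram_min\<close> writes its
  variance as a sum over the increments of the subordinator. These are independent with known
  Laplace transform, which gives the product. The sum of the \<open>\<theta> i\<close> from
  \<open>l\<close> on is the frequency still active during increment \<open>l\<close>.\<close>

lemma characteristic_function:
  assumes H: "H = 1 / 2" and s: "0 \<le> s 0" "\<And>i. Suc i < m \<Longrightarrow> s i \<le> s (Suc i)"
  shows "expectation (\<lambda>\<omega>. cis (\<Sum>i<m. \<theta> i \<bullet> X (S (s i) \<omega>) \<omega>))
    = of_real (\<Prod>l<m. exp (- (s l - (if l = 0 then 0 else s (l - 1))) * B ((norm (\<Sum>i\<in>{l..<m}. \<theta> i))\<^sup>2 / 2)))"
proof -
  define g where "g r \<omega> = cis (\<Sum>i<m. \<theta> i \<bullet> X (r i) \<omega>)" for r \<omega>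
  define Sv where "Sv \<omega> = (\<lambda>i. if i < m then S (s i) \<omega> else 0)" for \<omega>
  have s0: "0 \<le> s i" if "i < m" for i
    using that
  proof (induction i)
    case (Suc i)
    then show ?case using s(2)[of i] by simp
  qed (use s in simp)
  have cis: "cis \<in> borel_measurable borel" by (intro borel_measurable_continuous_onI continuous_intros)
  have "expectation (\<lambda>\<omega>. g (\<lambda>i. if i < m then S (s i) \<omega> else 0) \<omega>)
      = expectation (\<lambda>\<omega>. expectation (g (\<lambda>i. if i < m then S (s i) \<omega> else 0)))"
  proof (rule random_time(1)[where K = 1 and g = g and m = m and \<tau> = s])
    show "g r \<in> borel_measurable (process_algebra M X)" if "\<And>i. 0 \<le> r i" for r
      unfolding g_def
    proof (rule measurable_compose[OF _ cis])
      have [measurable]: "X (r i) \<in> borel_measurable (process_algebra M X)" for i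
        by (rule process_algebra_component[OF that])
      show "(\<lambda>\<omega>. \<Sum>i<m. \<theta> i \<bullet> X (r i) \<omega>) \<in> borel_measurable (process_algebra M X)"
        by measurable
    qed
    show "(\<lambda>n. g (rn n) \<omega>) \<longlonglongrightarrow> g r \<omega>" if "\<omega> \<in> space M" "\<And>n i. 0 \<le> rn n i" "\<And>i. 0 \<le> r i"
       "\<And>i. (\<lambda>n. rn n i) \<longlonglongrightarrow> r i" for r rn \<omega>
      unfolding g_def using X_tendsto[OF that(1,2,3,4)]
      by (intro tendsto_cis tendsto_sum tendsto_inner tendsto_const) auto
    show "norm (g r \<omega>) \<le> 1" for r \<omega> by (simp add: g_def)
  qed (rule s0)
  then have "expectation (\<lambda>\<omega>. g (Sv \<omega>) \<omega>) = expectation (\<lambda>\<omega>. expectation (g (Sv \<omega>)))"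
    by (simp only: Sv_def)
  also have "\<dots> = expectation (\<lambda>\<omega>. of_real (\<Prod>l<m. exp (- ((norm (\<Sum>i\<in>{l..<m}. \<theta> i))\<^sup>2 / 2) *
      (S (s l) \<omega> - (if l = 0 then 0 else S (s (l - 1)) \<omega>)))))"
  proof (intro Bochner_Integration.integral_cong refl)
    fix \<omega> assume w: "\<omega> \<in> space M"
    have r0: "0 \<le> Sv \<omega> i" for i using S_nonneg[OF w] s0 by (simp add: Sv_def)
    \<comment> \<open>The one place where \<open>H = 1 / 2\<close> acts: the covariance becomes the
      minimum, that is, the process has independent increments.\<close>
    have Rmin: "(Sv \<omega> i powr (2 * H) + Sv \<omega> j powr (2 * H) - \<bar>Sv \<omega> j - Sv \<omega> i\<bar> powr (2 * H)) / 2 = min (Sv \<omega> i) (Sv \<omega> j)" for i j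
      using r0[of i] r0[of j] by (simp add: H min_def)
    let ?Y = "\<lambda>\<omega>'. \<Sum>i<m. \<theta> i \<bullet> X (Sv \<omega> i) \<omega>'"
    have "expectation ?Y = 0"
      using X_mean[OF r0] by simp
    moreover have "expectation (\<lambda>\<omega>'. (?Y \<omega>')\<^sup>2) = (\<Sum>i<m. \<Sum>j<m. (\<theta> i \<bullet> \<theta> j) * min (Sv \<omega> i) (Sv \<omega> j))"
      using X_inner_cov[OF r0 r0] by (simp add: power2_eq_square sum_product Rmin)
    moreover have "\<dots> = (\<Sum>l<m. (norm (\<Sum>i\<in>{l..<m}. \<theta> i))\<^sup>2 * (Sv \<omega> l - (if l = 0 then 0 else Sv \<omega> (l - 1))))"
    proof (rule gram_min)
      show "0 \<le> Sv \<omega> 0" by (rule r0)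
      show "Sv \<omega> i \<le> Sv \<omega> (Suc i)" if "Suc i < m" for i
        using that s(2)[OF that] s0[of i] S_le[OF w] by (simp add: Sv_def)
    qed
    moreover have "\<dots> = (\<Sum>l<m. (norm (\<Sum>i\<in>{l..<m}. \<theta> i))\<^sup>2 * (S (s l) \<omega> - (if l = 0 then 0 else S (s (l - 1)) \<omega>)))"
      by (intro sum.cong) (auto simp: Sv_def)
    ultimately have "expectation (g (Sv \<omega>)) = of_real (exp (- (\<Sum>l<m. (norm (\<Sum>i\<in>{l..<m}. \<theta> i))\<^sup>2 * (S (s l) \<omega> - (if l = 0 then 0 else S (s (l - 1)) \<omega>))) / 2))"
      unfolding g_def using gaussian_characteristic[OF X_gaussian[of m "Sv \<omega>" \<theta>]] r0 by simp
    also have "\<dots> = of_real (\<Prod>l<m. exp (- ((norm (\<Sum>i\<in>{l..<m}. \<theta> i))\<^sup>2 / 2) *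
      (S (s l) \<omega> - (if l = 0 then 0 else S (s (l - 1)) \<omega>))))"
      by (simp add: exp_sum[symmetric] sum_negf sum_divide_distrib)
    finally show "expectation (g (Sv \<omega>)) = of_real (\<Prod>l<m. exp (- ((norm (\<Sum>i\<in>{l..<m}. \<theta> i))\<^sup>2 / 2) *
      (S (s l) \<omega> - (if l = 0 then 0 else S (s (l - 1)) \<omega>))))" .
  qed
  also have "\<dots> = of_real (expectation (\<lambda>\<omega>. \<Prod>l<m. exp (- ((norm (\<Sum>i\<in>{l..<m}. \<theta> i))\<^sup>2 / 2) *
      (S (s l) \<omega> - (if l = 0 then 0 else S (s (l - 1)) \<omega>)))))"
    by (rule integral_complex_of_real)
  also have "\<dots> = of_real (\<Prod>l<m. exp (- (s l - (if l = 0 then 0 else s (l - 1))) * B ((norm (\<Sum>i\<in>{l..<m}. \<theta> i))\<^sup>2 / 2)))"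
    by (subst S_increment_laplace[OF s]) auto
  finally have "expectation (\<lambda>\<omega>. g (Sv \<omega>) \<omega>) =
    of_real (\<Prod>l<m. exp (- (s l - (if l = 0 then 0 else s (l - 1))) * B ((norm (\<Sum>i\<in>{l..<m}. \<theta> i))\<^sup>2 / 2)))" .
  moreover have "g (Sv \<omega>) \<omega> = cis (\<Sum>i<m. \<theta> i \<bullet> X (S (s i) \<omega>) \<omega>)" for \<omega>
    by (simp add: g_def Sv_def)
  ultimately show ?thesis by simp
qed

end

section \<open>The lower bound from finitely many positions\<close>

lemma bernstein_pos_nonneg: "B \<in> bernstein_pos \<Longrightarrow> 0 \<le> x \<Longrightarrow> 0 \<le> B x"
  by (auto simp: bernstein_pos_def bernstein_def)

lemma bernstein_pos_DERIV:
  assumes B: "B \<in> bernstein_pos" and x: "0 < x"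
  shows "DERIV B x :> deriv B x" "0 \<le> deriv B x"
proof -
  have 0: "\<forall>k. \<forall>x>0. (deriv ^^ k) B differentiable (at x)"
    and 1: "\<forall>k\<ge>1. \<forall>x>0. 0 \<le> (- 1) ^ (k - 1) * (deriv ^^ k) B x"
    using B by (auto simp: bernstein_pos_def bernstein_def)
  from 0[rule_format, of x 0] x have "B differentiable (at x)" by simp
  then show "DERIV B x :> deriv B x"
    using DERIV_deriv_iff_real_differentiable by blast
  show "0 \<le> deriv B x" using 1[rule_format, of 1 x] x by simp
qed

lemma bernstein_pos_mono:
  assumes B: "B \<in> bernstein_pos" and xy: "0 \<le> x" "x \<le> y"
  shows "B x \<le> B y"
proof (cases "x = 0")
  case True
  then show ?thesis using B bernstein_pos_nonneg[OF B, of y] xy by (simp add: bernstein_pos_def)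
next
  case False
  show ?thesis
  proof (rule DERIV_nonneg_imp_nondecreasing[OF xy(2)])
    fix z assume "x \<le> z" "z \<le> y"
    then have "0 < z" using False xy by simp
    then show "\<exists>D. DERIV B z :> D \<and> 0 \<le> D" using bernstein_pos_DERIV[OF B] by blast
  qed
qed

text \<open>The derivative has a positive limit at 0, so the function increases strictly near 0 and
  stays positive by monotonicity.\<close>

lemma bernstein_pos_pos:
  assumes B: "B \<in> bernstein_pos" and x: "0 < x"
  shows "0 < B x"
proof -
  obtain L :: ereal where L: "((\<lambda>x. ereal (deriv B x)) \<longlongrightarrow> L) (at_right 0)" "0 < L"
    using B by (auto simp: bernstein_pos_def)
  have "eventually (\<lambda>x. 0 < ereal (deriv B x)) (at_right 0)" by (rule order_tendstoD(1)[OF L])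
  then obtain \<delta> where \<delta>: "0 < \<delta>" "\<And>y. 0 < y \<Longrightarrow> y < \<delta> \<Longrightarrow> 0 < deriv B y"
    unfolding eventually_at_right_field by auto
  define a where "a = min x \<delta> / 4"
  have a: "0 < a" "2 * a \<le> x" "2 * a < \<delta>" using x \<delta>(1) by (auto simp: a_def)
  have "B a < B (2 * a)"
  proof (rule DERIV_pos_imp_increasing[of a "2 * a" B])
    fix z assume "a \<le> z" "z \<le> 2 * a"
    then have "0 < z" "z < \<delta>" using a by auto
    then show "\<exists>D. DERIV B z :> D \<and> 0 < D" using bernstein_pos_DERIV(1)[OF B] \<delta>(2) by blast
  qed (use a in simp)
  also have "\<dots> \<le> B x" by (rule bernstein_pos_mono[OF B]) (use a in auto)
  finally show ?thesis using bernstein_pos_nonneg[OF B, of a] a by simp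
qed

text \<open>The upper limit bounds the quotient only beyond some \<open>x0\<close>. On the bounded
  range before it monotonicity suffices, and the constant absorbs both. The lower bound below is the
  mirror image.\<close>

lemma bernstein_upper_bound:
  assumes B: "B \<in> bernstein_upper \<alpha>" and "0 < x1" "0 \<le> \<alpha>"
  obtains C where "0 < C" "\<And>x. x1 \<le> x \<Longrightarrow> B x \<le> C * x powr \<alpha>"
proof -
  have BP: "B \<in> bernstein_pos" using B by (simp add: bernstein_upper_def)
  have "Limsup at_top (\<lambda>x. ereal (x powr (- \<alpha>) * B x)) < \<infinity>" using B by (simp add: bernstein_upper_def)
  then obtain C where "Limsup at_top (\<lambda>x. ereal (x powr (- \<alpha>) * B x)) < ereal C"
    using ereal_dense2 by blast
  then have "eventually (\<lambda>x. ereal (x powr (- \<alpha>) * B x) < ereal C) at_top" by (rule Limsup_lessD)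
  then obtain x0 where x0: "\<And>x. x0 \<le> x \<Longrightarrow> x powr (- \<alpha>) * B x < C"
    unfolding eventually_at_top_linorder by auto
  define y where "y = max x0 x1"
  define C' where "C' = max 1 (max C (B y * x1 powr (- \<alpha>)))"
  show ?thesis
  proof (rule that[of C'])
    show "0 < C'" by (simp add: C'_def)
    fix x assume x: "x1 \<le> x"
    have xp: "0 < x" using x assms by simp
    have "x powr (- \<alpha>) * B x \<le> C'"
    proof (cases "x0 \<le> x")
      case True
      then show ?thesis using x0[OF True] by (simp add: C'_def)
    next
      case False
      have "B x \<le> B y" by (rule bernstein_pos_mono[OF BP]) (use xp False in \<open>auto simp: y_def\<close>)
      moreover have "x powr (- \<alpha>) \<le> x1 powr (- \<alpha>)"
        using assms x by (intro powr_mono2') auto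
      ultimately have "x powr (- \<alpha>) * B x \<le> x1 powr (- \<alpha>) * B y"
        using bernstein_pos_nonneg[OF BP, of x] xp by (intro mult_mono) auto
      then show ?thesis by (simp add: C'_def mult.commute)
    qed
    then have "x powr \<alpha> * (x powr (- \<alpha>) * B x) \<le> x powr \<alpha> * C'" by (intro mult_left_mono) auto
    moreover have "x powr \<alpha> * x powr (- \<alpha>) = 1" using xp by (simp flip: powr_add)
    then have "x powr \<alpha> * (x powr (- \<alpha>) * B x) = B x"
      by (simp only: mult.assoc[symmetric] mult_1_left)
    ultimately show "B x \<le> C' * x powr \<alpha>" by (metis mult.commute)
  qed
qed

lemma bernstein_lower_bound:
  assumes B: "B \<in> bernstein_lower \<alpha>" and "0 < x1" "0 \<le> \<alpha>"
  obtains c where "0 < c" "\<And>x. x1 \<le> x \<Longrightarrow> c * x powr \<alpha> \<le> B x"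
proof -
  have BP: "B \<in> bernstein_pos" using B by (simp add: bernstein_lower_def)
  have "0 < Liminf at_top (\<lambda>x. ereal (x powr (- \<alpha>) * B x))" using B by (simp add: bernstein_lower_def)
  then obtain c where c: "0 < ereal c" "ereal c < Liminf at_top (\<lambda>x. ereal (x powr (- \<alpha>) * B x))"
    using ereal_dense2 by blast
  from less_LiminfD[OF c(2)] obtain x0 where x0: "\<And>x. x0 \<le> x \<Longrightarrow> c < x powr (- \<alpha>) * B x"
    unfolding eventually_at_top_linorder by auto
  define y where "y = max x0 x1"
  have y: "0 < y" using assms by (auto simp: y_def)
  define c' where "c' = min c (B x1 * y powr (- \<alpha>))"
  show ?thesis
  proof (rule that[of c'])
    show "0 < c'" using c(1) bernstein_pos_pos[OF BP assms(2)] y by (simp add: c'_def)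
    fix x assume x: "x1 \<le> x"
    have xp: "0 < x" using x assms by simp
    have "c' \<le> x powr (- \<alpha>) * B x"
    proof (cases "x0 \<le> x")
      case True
      then show ?thesis using x0[OF True] by (simp add: c'_def)
    next
      case False
      have "B x1 \<le> B x" by (rule bernstein_pos_mono[OF BP]) (use assms x in auto)
      moreover have "y powr (- \<alpha>) \<le> x powr (- \<alpha>)"
        using xp False assms by (intro powr_mono2') (auto simp: y_def)
      ultimately have "y powr (- \<alpha>) * B x1 \<le> x powr (- \<alpha>) * B x"
        using bernstein_pos_nonneg[OF BP, of x1] assms by (intro mult_mono) auto
      then show ?thesis by (simp add: c'_def mult.commute)
    qed
    then have "x powr \<alpha> * c' \<le> x powr \<alpha> * (x powr (- \<alpha>) * B x)" by (intro mult_left_mono) auto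
    moreover have "x powr \<alpha> * x powr (- \<alpha>) = 1" using xp by (simp flip: powr_add)
    then have "x powr \<alpha> * (x powr (- \<alpha>) * B x) = B x"
      by (simp only: mult.assoc[symmetric] mult_1_left)
    ultimately show "c' * x powr \<alpha> \<le> B x" by (metis mult.commute)
  qed
qed

section \<open>Lattice boxes, small balls and powers of distances\<close>

definition int_box :: "nat \<Rightarrow> (real ^ 'd) set" where
  "int_box R = {k \<in> int_vectors. \<forall>i. \<bar>k $ i\<bar> \<le> real R}"

lemma finite_card_int_box:
  "finite (int_box R :: (real ^ 'd::finite) set)" "card (int_box R :: (real ^ 'd) set) \<le> (2 * R + 1) ^ CARD('d)"
proof -
  let ?P = "\<Pi>\<^sub>E i\<in>(UNIV :: 'd set). {- int R..int R}"
  have sub: "(int_box R :: (real ^ 'd) set) \<subseteq> (\<lambda>g. \<chi> i. of_int (g i)) ` ?P"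
  proof
    fix k :: "real ^ 'd" assume k: "k \<in> int_box R"
    define g where "g i = \<lfloor>k $ i\<rfloor>" for i
    have g: "k $ i = of_int (g i)" for i
      using k by (auto simp: int_box_def int_vectors_def g_def elim!: Ints_cases)
    then have "k = (\<chi> i. of_int (g i))" by (simp add: vec_eq_iff)
    moreover have "\<bar>real_of_int (g i)\<bar> \<le> real R" for i
      using k unfolding g[symmetric] by (simp add: int_box_def)
    then have "g i \<in> {- int R..int R}" for i by (auto simp: abs_le_iff) (metis abs_le_iff minus_le_iff of_int_le_iff of_int_minus of_int_of_nat_eq)+
    then have "g \<in> ?P" by auto
    ultimately show "k \<in> (\<lambda>g. \<chi> i. of_int (g i)) ` ?P" by blast
  qed
  have f: "finite ?P" by (intro finite_PiE) auto
  show "finite (int_box R :: (real ^ 'd) set)" using sub f finite_surj by blast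
  have "card (int_box R :: (real ^ 'd) set) \<le> card ?P" by (rule surj_card_le[OF f sub])
  also have "\<dots> = (2 * R + 1) ^ CARD('d)" by (simp add: card_PiE nat_add_distrib nat_mult_distrib)
  finally show "card (int_box R :: (real ^ 'd) set) \<le> (2 * R + 1) ^ CARD('d)" .
qed

lemma torus_rep_unit: obtains y :: "real ^ 'd::finite" where "z = torus_proj y" "\<And>i. 0 \<le> y $ i" "\<And>i. y $ i \<le> 1"
proof -
  obtain x where x: "z = torus_proj x" using torus_proj_surj by blast
  define y :: "real ^ 'd" where "y = (\<chi> i. frac (x $ i))"
  have "x - y \<in> int_vectors" by (simp add: int_vectors_def y_def frac_def)
  then have "z = torus_proj y" by (simp add: x torus_proj_eq_iff)
  then show ?thesis by (rule that) (simp_all add: y_def frac_lt_1 less_imp_le)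
qed

text \<open>The preimage of the ball in the unit cube is covered by cubes of side
  \<open>2 * r\<close> around lattice translates of one representative. For \<open>r \<le> 1\<close>
  only translations with entries at most 2 in modulus matter, at most 5 per coordinate, and 5 times
  2 gives the 10.\<close>

lemma torus_ball_measure:
  assumes r: "0 < r" "r \<le> 1"
  shows "measure torus_uniform {w :: 'd::finite torus. dist w z < r} \<le> (10 * r) ^ CARD('d)"
proof -
  obtain y :: "real ^ 'd" where y: "z = torus_proj y" "\<And>i. 0 \<le> y $ i" "\<And>i. y $ i \<le> 1" using torus_rep_unit by metis
  let ?B = "{w. dist w z < r}"
  have B: "?B \<in> sets borel" by (rule borel_open) (intro open_Collect_less continuous_intros)
  let ?rr = "(\<chi> i. r) :: real ^ 'd"
  have sub: "cbox 0 1 \<inter> torus_proj -` ?B \<subseteq> (\<Union>k\<in>int_box 2. cbox (y + k - ?rr) (y + k + ?rr))"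
  proof
    fix x assume "x \<in> cbox 0 1 \<inter> torus_proj -` ?B"
    then have x: "\<And>i. 0 \<le> x $ i" "\<And>i. x $ i \<le> 1" "dist (torus_proj x) (torus_proj y) < r"
      using y by (auto simp: mem_box_cart)
    obtain k where k: "k \<in> int_vectors" "norm (x - y - k) < r"
      using dist_torus_attained[of x y] x(3) by metis
    have c: "\<bar>x $ i - y $ i - k $ i\<bar> < r" for i
      using component_le_norm_cart[of "x - y - k" i] k(2) by simp
    have "\<bar>k $ i\<bar> \<le> real 2" for i using c[of i] x(1,2)[of i] y(2,3)[of i] r by simp
    then have "k \<in> int_box 2" using k by (simp add: int_box_def)
    moreover have "x \<in> cbox (y + k - ?rr) (y + k + ?rr)"
      unfolding mem_box_cart
    proof
      fix i show "(y + k - ?rr) $ i \<le> x $ i \<and> x $ i \<le> (y + k + ?rr) $ i" using c[of i] by (simp add: abs_less_iff)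
    qed
    ultimately show "x \<in> (\<Union>k\<in>int_box 2. cbox (y + k - ?rr) (y + k + ?rr))" by blast
  qed
  have vol: "measure lborel (cbox (y + k - ?rr) (y + k + ?rr)) = (2 * r) ^ CARD('d)" for k
  proof -
    have "cbox (y + k - ?rr) (y + k + ?rr) \<noteq> {}" using r by (auto simp: interval_ne_empty_cart)
    then show ?thesis by (simp add: content_cbox_cart)
  qed
  have m: "torus_proj -` ?B \<in> sets borel"
    using measurable_sets[OF measurable_torus_proj B] by simp
  have "measure torus_uniform ?B = measure unit_cube (torus_proj -` ?B)"
    unfolding torus_uniform_def using B measurable_torus_proj
    by (subst measure_distr) (auto simp: uniform_measure_def)
  also have "\<dots> = measure lborel (cbox 0 1 \<inter> torus_proj -` ?B)"
    using m by (subst measure_uniform_measure) (auto simp: emeasure_unit_cube measure_def)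
  also have "\<dots> \<le> measure lborel (\<Union>k\<in>int_box 2. cbox (y + k - ?rr) (y + k + ?rr))"
  proof (rule measure_mono_fmeasurable[OF sub])
    show "cbox 0 1 \<inter> torus_proj -` ?B \<in> sets lborel" using m by simp
    show "(\<Union>k\<in>int_box 2. cbox (y + k - ?rr) (y + k + ?rr)) \<in> fmeasurable lborel"
      by (intro fmeasurable.finite_UN finite_card_int_box) auto
  qed
  also have "\<dots> \<le> (\<Sum>k\<in>(int_box 2 :: (real ^ 'd) set). measure lborel (cbox (y + k - ?rr) (y + k + ?rr)))"
    by (intro measure_UNION_le finite_card_int_box) auto
  also have "\<dots> = real (card (int_box 2 :: (real ^ 'd) set)) * (2 * r) ^ CARD('d)" by (simp add: vol)
  also have "\<dots> \<le> 5 ^ CARD('d) * (2 * r) ^ CARD('d)"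
  proof (rule mult_right_mono)
    have "card (int_box 2 :: (real ^ 'd) set) \<le> (2 * 2 + 1) ^ CARD('d)" by (rule finite_card_int_box(2))
    then have "real (card (int_box 2 :: (real ^ 'd) set)) \<le> real ((2 * 2 + 1) ^ CARD('d))"
      by (simp only: of_nat_le_iff)
    then show "real (card (int_box 2 :: (real ^ 'd) set)) \<le> 5 ^ CARD('d)" by simp
    show "0 \<le> (2 * r) ^ CARD('d)" using r by (intro zero_le_power) simp
  qed
  also have "\<dots> = (10 * r) ^ CARD('d)"
    by (subst power_mult_distrib[symmetric]) (simp add: mult.assoc[symmetric] del: mult.assoc)
  finally show ?thesis .
qed

text \<open>Subadditivity of the power: on [0, 1] one has \<open>x \<le> x powr p\<close>, applied
  to the two parts \<open>b / a\<close> and \<open>(a - b) / a\<close> of 1.\<close>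

lemma powr_diff_le:
  fixes a b :: real
  assumes "0 \<le> a" "0 \<le> b" "0 < p" "p \<le> 1"
  shows "a powr p - b powr p \<le> \<bar>a - b\<bar> powr p"
proof (cases "a \<le> b")
  case True
  then have "a powr p \<le> b powr p" using assms by (intro powr_mono2) auto
  then show ?thesis by (simp add: diff_le_eq add_increasing)
next
  case False
  have ge: "x \<le> x powr p" if "0 \<le> x" "x \<le> 1" for x :: real
  proof (cases "x = 0")
    case F: False
    then have "x powr 1 \<le> x powr p" using assms that by (intro powr_mono') auto
    then show ?thesis using that by simp
  qed simp
  have "1 = b / a + (a - b) / a" using False assms by (simp add: field_simps)
  also have "\<dots> \<le> (b / a) powr p + ((a - b) / a) powr p"
    using False assms by (intro add_mono ge) (auto simp: field_simps)
  also have "\<dots> = (b powr p + (a - b) powr p) / a powr p"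
    using False assms by (simp add: powr_divide add_divide_distrib)
  finally show ?thesis using False assms by (simp add: field_simps)
qed

section \<open>The process on the torus: displacement and the bound from a time grid\<close>

locale subordinated_torus = subordinated M B H X S
  for M :: "'w measure" and B H and X :: "real \<Rightarrow> 'w \<Rightarrow> real ^ 'd::finite" and S +
  fixes Z :: "real \<Rightarrow> 'w \<Rightarrow> 'd torus"
  assumes Z: "\<And>t \<omega>. 0 \<le> t \<Longrightarrow> \<omega> \<in> space M \<Longrightarrow> Z t \<omega> = torus_proj (X (S t \<omega>) \<omega>)"
begin

lemma X_S_meas: "0 \<le> t \<Longrightarrow> (\<lambda>\<omega>. X (S t \<omega>) \<omega>) \<in> borel_measurable M"
  by (rule measurable_random_time[OF X_meas X_cont S_meas S_nonneg])

lemma Z_meas [measurable]: "0 \<le> t \<Longrightarrow> Z t \<in> borel_measurable M"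
  using measurable_compose[OF X_S_meas measurable_torus_proj]
  by (rule measurable_cong[THEN iffD1, rotated]) (simp_all add: Z)

lemma Z_regular: "\<omega> \<in> space M \<Longrightarrow> regular_path (\<lambda>s. Z s \<omega>)"
  unfolding regular_path_def
  by (intro exI[of _ "\<lambda>s. X s \<omega>"] exI[of _ "\<lambda>s. S s \<omega>"]) (simp add: X_cont S_mono S_0 Z)

abbreviation emp :: "real \<Rightarrow> 'w \<Rightarrow> 'd torus measure" where
  "emp t \<omega> \<equiv> empirical_measure Z t \<omega>"

lemma
  assumes "\<omega> \<in> space M" "0 < t"
  shows prob_space_emp: "prob_space (emp t \<omega>)" and sets_emp: "sets (emp t \<omega>) = sets borel"
  unfolding empirical_measure_eq
  by (rule prob_space_occupation_measure[OF Z_regular[OF assms(1)] assms(2)],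
      rule sets_occupation_measure[OF Z_regular[OF assms(1)] assms(2)])

lemma emp_riemann:
  fixes f :: "'d torus \<Rightarrow> 'b::{banach, second_countable_topology}"
  assumes "\<omega> \<in> space M" "0 < t" "continuous_on UNIV f"
  shows "(\<lambda>n. (1 / real n) *\<^sub>R (\<Sum>j<n. f (Z (t * (real j / real n)) \<omega>))) \<longlonglongrightarrow> (\<integral>z. f z \<partial>emp t \<omega>)"
  unfolding empirical_measure_eq by (rule occupation_measure_riemann[OF Z_regular]) fact+

lemma wasserstein_emp_measurable:
  assumes "0 < t" "0 < p"
  shows "(\<lambda>\<omega>. wasserstein p (emp t \<omega>) torus_uniform) \<in> borel_measurable M"
proof (rule borel_measurable_wasserstein[OF prob_space_torus_uniform sets_torus_uniform assms(2)])
  show "(\<lambda>\<omega>. measure (emp t \<omega>) A) \<in> borel_measurable M" if "A \<in> sets borel" for A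
    unfolding empirical_measure_eq by (rule measurable_measure_occupation[OF Z_regular assms(1) Z_meas that])
qed (simp_all add: prob_space_emp sets_emp assms)

lemma wasserstein_emp_nonneg: "\<omega> \<in> space M \<Longrightarrow> 0 < t \<Longrightarrow> 0 \<le> wasserstein p (emp t \<omega>) torus_uniform"
  by (rule wasserstein_nonneg) (simp_all add: prob_space_emp sets_emp prob_space_torus_uniform)

lemma wasserstein_emp_integrable:
  assumes "0 < t" "0 < p"
  shows "integrable M (\<lambda>\<omega>. wasserstein p (emp t \<omega>) torus_uniform)"
proof (rule integrable_const_bound)
  show "AE \<omega> in M. norm (wasserstein p (emp t \<omega>) torus_uniform) \<le> (real CARD('d) powr p) powr (min 1 (1 / p))"
  proof (rule AE_I2)
    fix \<omega> assume w: "\<omega> \<in> space M"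
    show "norm (wasserstein p (emp t \<omega>) torus_uniform) \<le> (real CARD('d) powr p) powr (min 1 (1 / p))"
      using wasserstein_emp_nonneg[OF w assms(1), of p]
        wasserstein_le[OF prob_space_emp[OF w assms(1)] prob_space_torus_uniform sets_emp[OF w assms(1)] sets_torus_uniform assms(2)]
      by simp
  qed
qed (rule wasserstein_emp_measurable[OF assms])

lemma expectation_wasserstein_1_le:
  assumes "0 < t" "1 \<le> p"
  shows "expectation (\<lambda>\<omega>. wasserstein 1 (emp t \<omega>) torus_uniform) \<le> expectation (\<lambda>\<omega>. wasserstein p (emp t \<omega>) torus_uniform)"
  using assms by (intro integral_mono wasserstein_emp_integrable wasserstein_1_le)
    (auto simp: prob_space_emp sets_emp prob_space_torus_uniform)

text \<open>One term for each case. Either the move is below \<open>\<epsilon> * r\<close>; or the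
  clock has advanced by at most \<open>x\<close>, and Chebyshev's inequality bounds the Gaussian
  increment; or the clock has advanced further, which \<open>S_tail\<close> makes unlikely, and the
  move is counted as \<open>r\<close>.\<close>

lemma displacement_bound:
  assumes H: "0 < H" and BP: "B \<in> bernstein_pos" and s: "0 \<le> s'" "s' \<le> s"
    and p: "0 < p" "p \<le> 1" and r: "0 < r" and \<epsilon>: "0 < \<epsilon>" and x: "0 < x"
  shows "expectation (\<lambda>\<omega>. min r (dist (Z s \<omega>) (Z s' \<omega>)) powr p) \<le>
    (\<epsilon> * r) powr p + r powr p * (real CARD('d) * x powr (2 * H)) / (\<epsilon> * r)\<^sup>2 + r powr p * (2 * (s - s') * B (1 / x))"
proof -
  define \<tau> where "\<tau> i = (if i = 0 then s' else s)" for i :: nat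
  \<comment> \<open>The move is measured before the projection, as a function of the Gaussian
    process to which \<open>random_time\<close> applies; projecting only shortens it.\<close>
  define g where "g v \<omega> = min r (norm (X (v 1) \<omega> - X (v 0) \<omega>)) powr p" for v :: "nat \<Rightarrow> real" and \<omega>
  define Sv where "Sv \<omega> = (\<lambda>i::nat. if i < 2 then S (\<tau> i) \<omega> else 0)" for \<omega>
  have gb: "0 \<le> g v \<omega>" "g v \<omega> \<le> r powr p" for v \<omega>
    using r p by (auto simp: g_def intro!: powr_mono2)
  have gI: "g v \<in> borel_measurable M" if "\<And>i. 0 \<le> v i" for v
  proof -
    have [measurable]: "X (v i) \<in> borel_measurable M" for i using that by simp
    show ?thesis unfolding g_def by measurable
  qed
  have gm: "g v \<in> borel_measurable (process_algebra M X)" if "\<And>i. 0 \<le> v i" for v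
  proof -
    have [measurable]: "X (v i) \<in> borel_measurable (process_algebra M X)" for i
      by (rule process_algebra_component[OF that])
    show ?thesis unfolding g_def by measurable
  qed
  have gc: "(\<lambda>n. g (vn n) \<omega>) \<longlonglongrightarrow> g v \<omega>" if "\<omega> \<in> space M" "\<And>n i. 0 \<le> vn n i" "\<And>i. 0 \<le> v i"
       "\<And>i. (\<lambda>n. vn n i) \<longlonglongrightarrow> v i" for v vn \<omega>
    unfolding g_def
    by (intro tendsto_powr' tendsto_min tendsto_norm tendsto_diff tendsto_const X_tendsto[OF that]) (use p in auto)
  have \<tau>0: "0 \<le> \<tau> i" for i using s by (simp add: \<tau>_def)
  have gn: "norm (g v \<omega>) \<le> r powr p" for v \<omega> using gb by simp
  have Sv: "Sv = (\<lambda>\<omega> i. if i < 2 then S (\<tau> i) \<omega> else 0)" by (simp add: Sv_def fun_eq_iff)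
  have rt: "expectation (\<lambda>\<omega>. g (Sv \<omega>) \<omega>) = expectation (\<lambda>\<omega>. expectation (g (Sv \<omega>)))"
    unfolding Sv by (rule random_time(1)[where g = g and m = 2 and \<tau> = \<tau>, OF \<tau>0 gm gn gc])
  have rm: "(\<lambda>\<omega>. expectation (g (Sv \<omega>))) \<in> borel_measurable M"
    unfolding Sv by (rule random_time(2)[where g = g and m = 2 and \<tau> = \<tau>, OF \<tau>0 gm gn gc])
  have eps: "0 < \<epsilon> * r" using \<epsilon> r by simp
  have gle: "g v \<omega> \<le> (\<epsilon> * r) powr p + r powr p * (norm (X (v 1) \<omega> - X (v 0) \<omega>))\<^sup>2 / (\<epsilon> * r)\<^sup>2" for v \<omega>
  proof -
    let ?y = "norm (X (v 1) \<omega> - X (v 0) \<omega>)"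
    show ?thesis
    proof (cases "?y \<le> \<epsilon> * r")
      case True
      have "g v \<omega> \<le> (\<epsilon> * r) powr p" unfolding g_def using True r p by (intro powr_mono2) auto
      moreover have "0 \<le> r powr p * ?y\<^sup>2 / (\<epsilon> * r)\<^sup>2" by simp
      ultimately show ?thesis by linarith
    next
      case False
      then have "(\<epsilon> * r)\<^sup>2 \<le> ?y\<^sup>2" using eps by (intro power_mono) auto
      then have "1 \<le> ?y\<^sup>2 / (\<epsilon> * r)\<^sup>2"
        using zero_less_power[OF eps, of 2] by (subst le_divide_eq_1_pos)
      then have "r powr p * 1 \<le> r powr p * (?y\<^sup>2 / (\<epsilon> * r)\<^sup>2)" by (intro mult_left_mono) auto
      moreover have "0 \<le> (\<epsilon> * r) powr p" by simp
      moreover have "r powr p * (?y\<^sup>2 / (\<epsilon> * r)\<^sup>2) = r powr p * ?y\<^sup>2 / (\<epsilon> * r)\<^sup>2" by simp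
      ultimately show ?thesis using gb(2)[of v \<omega>] by linarith
    qed
  qed
  define A where "A = (\<epsilon> * r) powr p + r powr p * (real CARD('d) * x powr (2 * H)) / (\<epsilon> * r)\<^sup>2"
  have A0: "0 \<le> A" by (simp add: A_def)
  let ?E = "{\<omega> \<in> space M. x < S (s' + (s - s')) \<omega> - S s' \<omega>}"
  have [measurable]: "S s \<in> borel_measurable M" "S s' \<in> borel_measurable M" using s by auto
  have EM: "?E \<in> sets M" using s by simp
  have pw: "expectation (g (Sv \<omega>)) \<le> A + r powr p * indicator ?E \<omega>" if w: "\<omega> \<in> space M" for \<omega>
  proof (cases "\<omega> \<in> ?E")
    case True
    have "expectation (g (Sv \<omega>)) \<le> r powr p"
    proof (rule integral_le_const)
      show "integrable M (g (Sv \<omega>))"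
        using gb gI[of "Sv \<omega>"] S_nonneg[OF w] s by (intro integrable_const_bound[where B = "r powr p"]) (auto simp: Sv_def \<tau>_def)
    qed (use gb in auto)
    then show ?thesis using True A0 by simp
  next
    case False
    have v0: "0 \<le> Sv \<omega> i" for i using S_nonneg[OF w] s by (simp add: Sv_def \<tau>_def)
    have d: "\<bar>Sv \<omega> 1 - Sv \<omega> 0\<bar> \<le> x"
      using False w S_le[OF w s] by (simp add: Sv_def \<tau>_def not_less)
    note xi = X_increment[OF v0 v0 H, of 1 0]
    have "expectation (g (Sv \<omega>)) \<le> expectation (\<lambda>\<omega>'. (\<epsilon> * r) powr p + r powr p * (norm (X (Sv \<omega> 1) \<omega>' - X (Sv \<omega> 0) \<omega>'))\<^sup>2 / (\<epsilon> * r)\<^sup>2)"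
    proof (rule integral_mono)
      show "integrable M (g (Sv \<omega>))"
        using gb gI[OF v0] by (intro integrable_const_bound[where B = "r powr p"]) auto
      show "integrable M (\<lambda>\<omega>'. (\<epsilon> * r) powr p + r powr p * (norm (X (Sv \<omega> 1) \<omega>' - X (Sv \<omega> 0) \<omega>'))\<^sup>2 / (\<epsilon> * r)\<^sup>2)"
        using xi(1) by simp
    qed (rule gle)
    also have "\<dots> = (\<epsilon> * r) powr p + r powr p * (real CARD('d) * \<bar>Sv \<omega> 1 - Sv \<omega> 0\<bar> powr (2 * H)) / (\<epsilon> * r)\<^sup>2"
      using xi by (simp add: prob_space)
    also have "\<dots> \<le> A"
      unfolding A_def using d H
      by (intro add_left_mono divide_right_mono mult_left_mono powr_mono2) auto
    finally show ?thesis using False by simp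
  qed
  have "expectation (\<lambda>\<omega>. min r (dist (Z s \<omega>) (Z s' \<omega>)) powr p) \<le> expectation (\<lambda>\<omega>. g (Sv \<omega>) \<omega>)"
  proof (rule integral_mono)
    have [measurable]: "Z s \<in> borel_measurable M" "Z s' \<in> borel_measurable M" using s by auto
    show "integrable M (\<lambda>\<omega>. min r (dist (Z s \<omega>) (Z s' \<omega>)) powr p)"
      using r p by (intro integrable_const_bound[where B = "r powr p"]) (auto intro!: powr_mono2)
    have [measurable]: "(\<lambda>\<omega>. X (S s \<omega>) \<omega>) \<in> borel_measurable M" "(\<lambda>\<omega>. X (S s' \<omega>) \<omega>) \<in> borel_measurable M"
      using s X_S_meas by auto
    have "(\<lambda>\<omega>. g (Sv \<omega>) \<omega>) \<in> borel_measurable M"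
      unfolding g_def Sv_def \<tau>_def by simp
    then show "integrable M (\<lambda>\<omega>. g (Sv \<omega>) \<omega>)"
      using gb by (intro integrable_const_bound[where B = "r powr p"]) auto
    fix \<omega> assume "\<omega> \<in> space M"
    then have "dist (Z s \<omega>) (Z s' \<omega>) \<le> norm (X (Sv \<omega> 1) \<omega> - X (Sv \<omega> 0) \<omega>)"
      using torus_dist_proj_le s Z by (simp add: Sv_def \<tau>_def)
    then show "min r (dist (Z s \<omega>) (Z s' \<omega>)) powr p \<le> g (Sv \<omega>) \<omega>"
      unfolding g_def using r p by (intro powr_mono2) auto
  qed
  also have "\<dots> = expectation (\<lambda>\<omega>. expectation (g (Sv \<omega>)))" by (rule rt)
  also have "\<dots> \<le> expectation (\<lambda>\<omega>. A + r powr p * indicator ?E \<omega>)"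
  proof (rule integral_mono)
    note rm
    moreover have "norm (expectation (g (Sv \<omega>))) \<le> A + r powr p" if "\<omega> \<in> space M" for \<omega>
    proof -
      have "0 \<le> expectation (g (Sv \<omega>))" using gb by (intro Bochner_Integration.integral_nonneg) auto
      moreover have "r powr p * indicator ?E \<omega> \<le> r powr p" by (auto simp: indicator_def)
      ultimately show ?thesis using pw[OF that] by simp
    qed
    ultimately show "integrable M (\<lambda>\<omega>. expectation (g (Sv \<omega>)))"
      by (intro integrable_const_bound[where B = "A + r powr p"]) auto
    show "integrable M (\<lambda>\<omega>. A + r powr p * indicator ?E \<omega>)"
      using EM by (intro Bochner_Integration.integrable_add integrable_mult_right integrable_real_indicator)
        (auto simp: emeasure_eq_measure)
  qed (rule pw)
  also have "\<dots> = A + r powr p * prob ?E"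
    using EM by (subst Bochner_Integration.integral_add) (auto simp: prob_space emeasure_eq_measure intro!: integrable_mult_right integrable_real_indicator)
  also have "\<dots> \<le> A + r powr p * (2 * (s - s') * B (1 / x))"
    using S_tail[of s' "s - s'" x] s x by (intro add_left_mono mult_left_mono) auto
  finally show ?thesis by (simp add: A_def)
qed

end

context subordinated_torus begin

text \<open>The function \<open>f\<close> below is the truncated distance to the \<open>N\<close>
  grid positions. By \<open>Nr\<close> the balls of radius \<open>r\<close> around them have total
  measure at most 1/2, so its uniform mean is at least \<open>r powr p / 2\<close>, while along the
  path it is at most the displacement since the last grid time.\<close>

lemma grid_lower_bound:
  assumes t: "0 < t" and N: "0 < (N::nat)" and r: "0 < r" "r \<le> 1" and Nr: "real N * (10 * r) ^ CARD('d) \<le> 1 / 2"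
    and p: "0 < p" "p \<le> 1"
    and \<eta>: "\<And>s s'. 0 \<le> s' \<Longrightarrow> s' \<le> s \<Longrightarrow> s \<le> s' + t / real N \<Longrightarrow>
       expectation (\<lambda>\<omega>. min r (dist (Z s \<omega>) (Z s' \<omega>)) powr p) \<le> \<eta>"
  shows "r powr p / 2 - \<eta> \<le> expectation (\<lambda>\<omega>. wasserstein p (emp t \<omega>) torus_uniform)"
proof -
  define gr where "gr i = t * (real i / real N)" for i :: nat
  \<comment> \<open>Index of the last grid time that is not after the sample time \<open>j\<close>
    out of \<open>n\<close>.\<close>
  define gi where "gi n j = nat \<lfloor>real N * (real j / real n)\<rfloor>" for n j :: nat
  have gi: "gi n j < N" "gr (gi n j) \<le> t * (real j / real n)" "t * (real j / real n) \<le> gr (gi n j) + t / real N"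
    if "j < n" for n j
  proof -
    let ?u = "real j / real n"
    have u: "0 \<le> ?u" "?u < 1" using that by auto
    have "0 \<le> \<lfloor>real N * ?u\<rfloor>" using u by simp
    then have e: "real (gi n j) = of_int \<lfloor>real N * ?u\<rfloor>" by (simp add: gi_def)
    have b: "real (gi n j) \<le> real N * ?u" "real N * ?u \<le> real (gi n j) + 1" unfolding e by linarith+
    have "real N * ?u < real N * 1" using u N by (intro mult_strict_left_mono) auto
    with b show "gi n j < N" by simp
    have "real (gi n j) / real N \<le> ?u" using b(1) N by (simp add: divide_le_eq mult.commute)
    then show "gr (gi n j) \<le> t * ?u" unfolding gr_def using t by (intro mult_left_mono) auto
    have "?u \<le> (real (gi n j) + 1) / real N" using b(2) N by (simp add: le_divide_eq mult.commute)
    then have "t * ?u \<le> t * ((real (gi n j) + 1) / real N)" using t by (intro mult_left_mono) auto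
    then show "t * ?u \<le> gr (gi n j) + t / real N" by (simp add: gr_def add_divide_distrib distrib_left)
  qed
  have gr0: "0 \<le> gr i" for i using t by (simp add: gr_def)
  define A where "A n \<omega> = (1 / real n) * (\<Sum>j<n. min r (dist (Z (t * (real j / real n)) \<omega>) (Z (gr (gi n j)) \<omega>)) powr p)" for n \<omega>
  have A0: "0 \<le> A n \<omega>" for n \<omega> unfolding A_def by (intro mult_nonneg_nonneg sum_nonneg) auto
  have Zm: "Z (t * (real j / real n)) \<in> borel_measurable M" "Z (gr i) \<in> borel_measurable M" for j n i
    using t gr0 by (auto intro!: Z_meas)
  note [measurable] = Zm
  have Am: "A n \<in> borel_measurable M" for n unfolding A_def by measurable
  have I: "integrable M (\<lambda>\<omega>. min r (dist (Z (t * (real j / real n)) \<omega>) (Z (gr i) \<omega>)) powr p)" for j n i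
  proof (rule integrable_const_bound[where B = "r powr p"])
    show "(\<lambda>\<omega>. min r (dist (Z (t * (real j / real n)) \<omega>) (Z (gr i) \<omega>)) powr p) \<in> borel_measurable M"
      by measurable
  qed (use r p in \<open>auto intro!: powr_mono2\<close>)
  have EA: "expectation (A n) \<le> max 0 \<eta>" for n
  proof (cases "n = 0")
    case True
    then have "A n = (\<lambda>_. 0)" by (simp add: A_def fun_eq_iff)
    then show ?thesis by simp
  next
    case False
    have "expectation (A n) = (1 / real n) * (\<Sum>j<n. expectation (\<lambda>\<omega>. min r (dist (Z (t * (real j / real n)) \<omega>) (Z (gr (gi n j)) \<omega>)) powr p))"
      unfolding A_def using I by simp
    also have "\<dots> \<le> (1 / real n) * (\<Sum>j<n. \<eta>)"
      using gi gr0 by (intro mult_left_mono sum_mono \<eta>) auto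
    also have "\<dots> = \<eta>" using False by simp
    finally show ?thesis by simp
  qed
  have AI: "integrable M (A n)" for n unfolding A_def using I by simp
  \<comment> \<open>The averages \<open>A n\<close> are only known to dominate the Riemann sums of
    \<open>f\<close>, not to converge. Hence the lower limit in the extended reals, and Fatou's
    lemma afterwards.\<close>
  have path: "ennreal (r powr p / 2) \<le> ennreal (wasserstein p (emp t \<omega>) torus_uniform) + liminf (\<lambda>n. ennreal (A n \<omega>))"
    if w: "\<omega> \<in> space M" for \<omega>
  proof -
    define G where "G = (\<lambda>i. Z (gr i) \<omega>) ` {..<N}"
    have G: "finite G" "G \<noteq> {}" "card G \<le> N" using N by (auto simp: G_def intro: card_image_le[of "{..<N}", simplified])
    define f where "f z = min r (infdist z G) powr p" for z
    have f0: "0 \<le> f z" for z by (simp add: f_def)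
    have cf: "continuous_on UNIV f"
      unfolding f_def using r p by (intro continuous_on_powr' continuous_intros) (auto simp: infdist_nonneg)
    then have fm[measurable]: "f \<in> borel_measurable borel" by (rule borel_measurable_continuous_onI)
    have flip: "f z - f w \<le> dist z w powr p" for z w
    proof -
      have "f z - f w \<le> \<bar>min r (infdist z G) - min r (infdist w G)\<bar> powr p"
        unfolding f_def using r p by (intro powr_diff_le) (auto simp: infdist_nonneg)
      also have "\<dots> \<le> dist z w powr p"
      proof (rule powr_mono2)
        have "\<bar>min r (infdist z G) - min r (infdist w G)\<bar> \<le> \<bar>infdist z G - infdist w G\<bar>" by linarith
        also have "\<dots> \<le> dist z w" by (rule infdist_triangle_abs)
        finally show "\<bar>min r (infdist z G) - min r (infdist w G)\<bar> \<le> dist z w" .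
      qed (use p in auto)
      finally show ?thesis .
    qed
    interpret U: prob_space "torus_uniform :: 'd torus measure" by (rule prob_space_torus_uniform)
    let ?near = "\<Union>g\<in>G. {z :: 'd torus. dist z g < r}"
    have op: "{z :: 'd torus. dist z g < r} \<in> sets borel" for g
      by (rule borel_open) (intro open_Collect_less continuous_intros)
    have near: "?near \<in> sets borel" using op G(1) by auto
    have "measure torus_uniform ?near \<le> (\<Sum>g\<in>G. measure torus_uniform {z. dist z g < r})"
      using op by (intro measure_UNION_le G(1)) simp
    also have "\<dots> \<le> (\<Sum>g\<in>G. (10 * r) ^ CARD('d))" by (intro sum_mono torus_ball_measure r)
    also have "\<dots> \<le> real N * (10 * r) ^ CARD('d)" using G(3) r by (auto intro!: mult_right_mono)
    finally have mn: "measure torus_uniform ?near \<le> 1 / 2" using Nr by simp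
    have fI: "integrable torus_uniform f"
      using r p by (intro U.integrable_const_bound[where B = "r powr p"])
        (auto simp: f_def infdist_nonneg intro!: powr_mono2)
    have "r powr p / 2 = r powr p * (1 / 2)" by simp
    also have "\<dots> \<le> r powr p * (1 - measure torus_uniform ?near)" using mn by (intro mult_left_mono) auto
    also have "\<dots> = (\<integral>z. r powr p * (1 - indicator ?near z) \<partial>torus_uniform)"
      using near U.prob_space by (simp add: U.emeasure_eq_measure)
    also have "\<dots> \<le> (\<integral>z. f z \<partial>torus_uniform)"
    proof (rule integral_mono[OF _ fI])
      show "integrable torus_uniform (\<lambda>z. r powr p * (1 - indicator ?near z))"
        using near by (intro integrable_mult_right Bochner_Integration.integrable_diff integrable_real_indicator)
          (auto simp: U.emeasure_eq_measure)
      fix z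
      show "r powr p * (1 - indicator ?near z) \<le> f z"
      proof (cases "z \<in> ?near")
        case False
        then have "r \<le> infdist z G"
          unfolding infdist_def using G(2) by (auto simp: not_less intro!: cINF_greatest)
        then show ?thesis using False by (simp add: f_def)
      qed (simp add: f0)
    qed
    finally have fU: "r powr p / 2 \<le> (\<integral>z. f z \<partial>torus_uniform)" .
    \<comment> \<open>The path stays near the grid positions and the uniform law does not, so the
      test function is \<open>- f\<close>.\<close>
    have "(\<integral>z. - f z \<partial>emp t \<omega>) - (\<integral>z. - f z \<partial>torus_uniform) \<le> wasserstein p (emp t \<omega>) torus_uniform"
    proof (rule wasserstein_ge_dual[OF prob_space_emp[OF w t] prob_space_torus_uniform sets_emp[OF w t] sets_torus_uniform p])
      show "- f z - - f w \<le> dist z w powr p" for z w using flip[of w z] by (simp add: dist_commute)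
    qed simp
    then have 1: "r powr p / 2 - (\<integral>z. f z \<partial>emp t \<omega>) \<le> wasserstein p (emp t \<omega>) torus_uniform"
      using fU by simp
    let ?R = "\<lambda>n. (1 / real n) * (\<Sum>j<n. f (Z (t * (real j / real n)) \<omega>))"
    have lim: "?R \<longlonglongrightarrow> (\<integral>z. f z \<partial>emp t \<omega>)" using emp_riemann[OF w t cf] by simp
    have le: "?R n \<le> A n \<omega>" for n
      unfolding A_def
    proof (intro mult_left_mono sum_mono)
      fix j assume "j \<in> {..<n}"
      then have "Z (gr (gi n j)) \<omega> \<in> G" using gi(1) by (auto simp: G_def)
      then have "infdist (Z (t * (real j / real n)) \<omega>) G \<le> dist (Z (t * (real j / real n)) \<omega>) (Z (gr (gi n j)) \<omega>)"
        by (rule infdist_le)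
      then show "f (Z (t * (real j / real n)) \<omega>) \<le> min r (dist (Z (t * (real j / real n)) \<omega>) (Z (gr (gi n j)) \<omega>)) powr p"
        unfolding f_def using r p by (intro powr_mono2) (auto simp: infdist_nonneg)
    qed simp
    have "(\<lambda>n. ennreal (?R n)) \<longlonglongrightarrow> ennreal (\<integral>z. f z \<partial>emp t \<omega>)" using lim by (rule tendsto_ennrealI)
    then have "ennreal (\<integral>z. f z \<partial>emp t \<omega>) = liminf (\<lambda>n. ennreal (?R n))"
      by (rule lim_imp_Liminf[OF sequentially_bot, symmetric])
    also have "\<dots> \<le> liminf (\<lambda>n. ennreal (A n \<omega>))"
      using le by (intro Liminf_mono always_eventually allI ennreal_leI) auto
    finally have 2: "ennreal (\<integral>z. f z \<partial>emp t \<omega>) \<le> liminf (\<lambda>n. ennreal (A n \<omega>))" .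
    have "ennreal (r powr p / 2) \<le> ennreal (wasserstein p (emp t \<omega>) torus_uniform + (\<integral>z. f z \<partial>emp t \<omega>))"
      using 1 by (intro ennreal_leI) simp
    also have "\<dots> = ennreal (wasserstein p (emp t \<omega>) torus_uniform) + ennreal (\<integral>z. f z \<partial>emp t \<omega>)"
      using wasserstein_emp_nonneg[OF w t] f0 by (intro ennreal_plus) auto
    finally show ?thesis using 2 by (meson add_left_mono order.trans)
  qed
  have WI: "integrable M (\<lambda>\<omega>. wasserstein p (emp t \<omega>) torus_uniform)" by (rule wasserstein_emp_integrable[OF t p(1)])
  note [measurable] = wasserstein_emp_measurable[OF t p(1)] Am
  let ?EW = "expectation (\<lambda>\<omega>. wasserstein p (emp t \<omega>) torus_uniform)"
  have EW0: "0 \<le> ?EW" using wasserstein_emp_nonneg[OF _ t] by (intro Bochner_Integration.integral_nonneg) auto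
  have "ennreal (r powr p / 2) = (\<integral>\<^sup>+\<omega>. ennreal (r powr p / 2) \<partial>M)" by (simp add: emeasure_space_1)
  also have "\<dots> \<le> (\<integral>\<^sup>+\<omega>. ennreal (wasserstein p (emp t \<omega>) torus_uniform) + liminf (\<lambda>n. ennreal (A n \<omega>)) \<partial>M)"
    by (intro nn_integral_mono path)
  also have "\<dots> = (\<integral>\<^sup>+\<omega>. ennreal (wasserstein p (emp t \<omega>) torus_uniform) \<partial>M) + (\<integral>\<^sup>+\<omega>. liminf (\<lambda>n. ennreal (A n \<omega>)) \<partial>M)"
    by (rule nn_integral_add) measurable
  also have "(\<integral>\<^sup>+\<omega>. ennreal (wasserstein p (emp t \<omega>) torus_uniform) \<partial>M) = ennreal ?EW"
    using wasserstein_emp_nonneg[OF _ t] by (intro nn_integral_eq_integral WI) auto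
  also have "(\<integral>\<^sup>+\<omega>. liminf (\<lambda>n. ennreal (A n \<omega>)) \<partial>M) \<le> liminf (\<lambda>n. \<integral>\<^sup>+\<omega>. ennreal (A n \<omega>) \<partial>M)"
    by (rule nn_integral_liminf) measurable
  also have "\<dots> \<le> liminf (\<lambda>n. ennreal (max 0 \<eta>))"
  proof (intro Liminf_mono always_eventually allI)
    fix n
    have "(\<integral>\<^sup>+\<omega>. ennreal (A n \<omega>) \<partial>M) = ennreal (expectation (A n))"
      using A0 by (intro nn_integral_eq_integral AI) auto
    also have "\<dots> \<le> ennreal (max 0 \<eta>)" by (intro ennreal_leI EA)
    finally show "(\<integral>\<^sup>+\<omega>. ennreal (A n \<omega>) \<partial>M) \<le> ennreal (max 0 \<eta>)" .
  qed
  also have "\<dots> = ennreal (max 0 \<eta>)" by (simp add: Liminf_const)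
  finally have "ennreal (r powr p / 2) \<le> ennreal ?EW + ennreal (max 0 \<eta>)"
    by (simp add: add_left_mono)
  then have "ennreal (r powr p / 2) \<le> ennreal (?EW + max 0 \<eta>)" using EW0 by simp
  then have le: "r powr p / 2 \<le> ?EW + max 0 \<eta>" using EW0 by (subst (asm) ennreal_le_iff) auto
  \<comment> \<open>Equal times in the hypothesis on \<open>\<eta>\<close> show that
    \<open>\<eta>\<close> is nonnegative, so \<open>max 0 \<eta>\<close> equals
    \<open>\<eta>\<close>.\<close>
  have "0 \<le> expectation (\<lambda>\<omega>. min r (dist (Z 0 \<omega>) (Z 0 \<omega>)) powr p)" by (intro Bochner_Integration.integral_nonneg) simp
  also have "\<dots> \<le> \<eta>" using t N by (intro \<eta>) auto
  finally show ?thesis using le by simp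
qed

text \<open>A grid step of order \<open>r powr (\<alpha> / H)\<close> keeps the displacement small
  compared with \<open>r\<close>, and so asks for about \<open>t * r powr (- (\<alpha> / H))\<close>
  positions. Their balls fill at most half of the torus as long as \<open>r powr q\<close> is a
  small multiple of \<open>1 / t\<close>; taking this multiple gives the rate.\<close>

lemma wasserstein_lower_bound_le1:
  assumes H: "0 < H" "H < 1" and B: "B \<in> bernstein_upper \<alpha>" and \<alpha>: "0 \<le> \<alpha>" and d: "\<alpha> / H < real CARD('d)"
    and p: "0 < p" "p \<le> 1"
  shows "\<exists>C>0. \<exists>t\<^sub>0>1. \<forall>t\<ge>t\<^sub>0. C * t powr (- p / (real CARD('d) - \<alpha> / H))
     \<le> expectation (\<lambda>\<omega>. wasserstein p (emp t \<omega>) torus_uniform)"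
proof -
  let ?d = "real CARD('d)"
  have BP: "B \<in> bernstein_pos" using B by (simp add: bernstein_upper_def)
  obtain C where C: "0 < C" "\<And>x. 1 \<le> x \<Longrightarrow> B x \<le> C * x powr \<alpha>"
    using bernstein_upper_bound[OF B zero_less_one \<alpha>] by metis
  define q where "q = ?d - \<alpha> / H"
  have q: "0 < q" using d by (simp add: q_def)
  \<comment> \<open>The constants make each of the three displacement terms at most
    \<open>r powr p / 16\<close>, and 1/2 - 3/16 exceeds 1/4. This one settles the first
    term.\<close>
  define \<epsilon> where "\<epsilon> = (1 / 16 :: real) powr (1 / p)"
  have \<epsilon>: "0 < \<epsilon>" "\<epsilon> powr p = 1 / 16" "\<epsilon> \<le> 1"
    using p by (auto simp: \<epsilon>_def powr_powr powr_le_one_le powr_le1)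
  \<comment> \<open>In the time \<open>x = \<kappa> * r powr (1 / H)\<close> a path moves a small
    multiple of \<open>r\<close>; this value makes the Chebyshev term equal to
    \<open>r powr p / 16\<close>.\<close>
  define \<kappa> where "\<kappa> = (\<epsilon>\<^sup>2 / (16 * ?d)) powr (1 / (2 * H))"
  have d1: "1 \<le> ?d" by (simp add: Suc_leI)
  have \<kappa>: "0 < \<kappa>" "\<kappa> \<le> 1" "\<kappa> powr (2 * H) = \<epsilon>\<^sup>2 / (16 * ?d)"
  proof -
    have pos: "0 < \<epsilon>\<^sup>2 / (16 * ?d)" using \<epsilon>(1) d1 by simp
    show "0 < \<kappa>" using \<epsilon>(1) d1 by (simp add: \<kappa>_def)
    show "\<kappa> powr (2 * H) = \<epsilon>\<^sup>2 / (16 * ?d)" using pos H by (simp add: \<kappa>_def powr_powr)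
    have "\<epsilon>\<^sup>2 \<le> 1" using \<epsilon> by (simp add: power_le_one)
    then have "\<epsilon>\<^sup>2 \<le> 16 * ?d" using d1 by linarith
    then have "\<epsilon>\<^sup>2 / (16 * ?d) \<le> 1" by (simp add: divide_le_eq)
    then show "\<kappa> \<le> 1" unfolding \<kappa>_def using pos H by (intro powr_le1) auto
  qed
  \<comment> \<open>Grid step in units of \<open>r powr (\<alpha> / H)\<close>, chosen for the tail
    term of the subordinator.\<close>
  define \<kappa>1 where "\<kappa>1 = \<kappa> powr \<alpha> / (32 * C)"
  have \<kappa>1: "0 < \<kappa>1" using \<kappa> C by (simp add: \<kappa>1_def)
  \<comment> \<open>Chosen so that the balls have total measure at most 1/2, allowing a factor 2 for
    rounding \<open>a\<close> up to \<open>N\<close>.\<close>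
  define \<kappa>2 where "\<kappa>2 = \<kappa>1 / (4 * 10 ^ CARD('d))"
  have \<kappa>2: "0 < \<kappa>2" using \<kappa>1 by (simp add: \<kappa>2_def)
  \<comment> \<open>Beyond \<open>\<kappa>1\<close> the real number \<open>a\<close> of grid
    positions is at least 1, and beyond \<open>\<kappa>2\<close> the radius is at most 1.\<close>
  define t0 where "t0 = max 2 (max \<kappa>1 \<kappa>2)"
  have main: "(1 / 4 * \<kappa>2 powr (p / q)) * t powr (- p / q) \<le> expectation (\<lambda>\<omega>. wasserstein p (emp t \<omega>) torus_uniform)"
    if t: "t0 \<le> t" for t
  proof -
    have t': "2 \<le> t" "\<kappa>1 \<le> t" "\<kappa>2 \<le> t" using t by (auto simp: t0_def)
    define r where "r = (\<kappa>2 / t) powr (1 / q)"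
    have r: "0 < r" "r \<le> 1" using \<kappa>2 t' q by (auto simp: r_def intro!: powr_le1)
    have rq: "r powr q = \<kappa>2 / t" using \<kappa>2 t' q by (simp add: r_def powr_powr)
    define a where "a = t * r powr (- (\<alpha> / H)) / \<kappa>1"
    have rp1: "1 \<le> r powr (- (\<alpha> / H))" using r \<alpha> H by (simp add: powr_minus one_le_inverse powr_le1)
    have "\<kappa>1 * 1 \<le> t * r powr (- (\<alpha> / H))" using t' rp1 \<kappa>1 by (intro mult_mono) auto
    then have a1: "1 \<le> a" using \<kappa>1 by (simp add: a_def le_divide_eq)
    define N where "N = nat \<lceil>a\<rceil>"
    have N: "a \<le> real N" "real N \<le> 2 * a" "0 < N"
    proof -
      have "0 < \<lceil>a\<rceil>" using a1 by simp
      then have e: "real N = of_int \<lceil>a\<rceil>" by (simp add: N_def)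
      show "a \<le> real N" unfolding e by simp
      then show "0 < N" using a1 by (cases N) auto
      show "real N \<le> 2 * a" unfolding e using a1 by linarith
    qed
    define x where "x = \<kappa> * r powr (1 / H)"
    have x0: "0 < x" using \<kappa> r by (simp add: x_def)
    have x1: "x \<le> 1" unfolding x_def using \<kappa> r H powr_le1[of "1 / H" r] by (intro mult_le_one) auto
    have rr: "r powr (1 / H * (2 * H)) = r\<^sup>2" using H r by (simp add: powr_numeral)
    have xH: "x powr (2 * H) = \<epsilon>\<^sup>2 / (16 * ?d) * r\<^sup>2"
      using \<kappa> r H rr by (simp add: x_def powr_mult powr_powr)
    have Bx: "B (1 / x) \<le> C * (\<kappa> powr (- \<alpha>) * r powr (- (\<alpha> / H)))"
    proof -
      have "B (1 / x) \<le> C * (1 / x) powr \<alpha>" using x0 x1 by (intro C) simp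
      also have "(1 / x) powr \<alpha> = \<kappa> powr (- \<alpha>) * r powr (- (\<alpha> / H))"
        using \<kappa> r H by (simp add: x_def powr_divide powr_mult powr_powr powr_minus field_simps)
      finally show ?thesis .
    qed
    have bound: "expectation (\<lambda>\<omega>. min r (dist (Z s \<omega>) (Z s' \<omega>)) powr p) \<le> r powr p * (3 / 16)"
      if s: "0 \<le> s'" "s' \<le> s" "s \<le> s' + t / real N" for s s'
    proof -
      have "expectation (\<lambda>\<omega>. min r (dist (Z s \<omega>) (Z s' \<omega>)) powr p) \<le>
         (\<epsilon> * r) powr p + r powr p * (?d * x powr (2 * H)) / (\<epsilon> * r)\<^sup>2 + r powr p * (2 * (s - s') * B (1 / x))"
        by (rule displacement_bound[OF H(1) BP s(1,2) p r(1) \<epsilon>(1) x0])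
      also have "(\<epsilon> * r) powr p = r powr p * (1 / 16)" using \<epsilon> r by (simp add: powr_mult)
      also have "r powr p * (?d * x powr (2 * H)) / (\<epsilon> * r)\<^sup>2 = r powr p * (1 / 16)"
        using \<epsilon>(1) r d1 by (simp add: xH power_mult_distrib)
      also have "r powr p * (2 * (s - s') * B (1 / x)) \<le> r powr p * (1 / 16)"
      proof (rule mult_left_mono)
        have sN: "s - s' \<le> \<kappa>1 * r powr (\<alpha> / H)"
        proof -
          have "s - s' \<le> t / real N" using s by simp
          also have "\<dots> \<le> t / a" using N a1 t' by (intro divide_left_mono) auto
          also have "\<dots> = \<kappa>1 * r powr (\<alpha> / H)" using t' r \<kappa>1 by (simp add: a_def powr_minus field_simps)
          finally show ?thesis .
        qed
        have "2 * (s - s') * B (1 / x) \<le> 2 * (\<kappa>1 * r powr (\<alpha> / H)) * (C * (\<kappa> powr (- \<alpha>) * r powr (- (\<alpha> / H))))"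
          using sN Bx s bernstein_pos_nonneg[OF BP, of "1 / x"] x0 \<kappa>1 by (intro mult_mono) auto
        also have "\<dots> = 1 / 16"
          using r \<kappa> C by (simp add: \<kappa>1_def powr_minus field_simps)
        finally show "2 * (s - s') * B (1 / x) \<le> 1 / 16" .
      qed simp
      finally show ?thesis by simp
    qed
    have Nr: "real N * (10 * r) ^ CARD('d) \<le> 1 / 2"
    proof -
      have rd: "r powr (- (\<alpha> / H)) * r ^ CARD('d) = r powr q"
        using r by (simp add: q_def powr_diff powr_realpow powr_minus field_simps)
      have "real N * (10 * r) ^ CARD('d) \<le> 2 * a * (10 * r) ^ CARD('d)" using N r by (intro mult_right_mono) auto
      also have "\<dots> = 2 * t * 10 ^ CARD('d) / \<kappa>1 * (r powr (- (\<alpha> / H)) * r ^ CARD('d))"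
        by (simp add: a_def power_mult_distrib)
      also have "\<dots> = 1 / 2" unfolding rd rq using t' \<kappa>1 by (simp add: \<kappa>2_def field_simps)
      finally show ?thesis .
    qed
    have "r powr p / 2 - r powr p * (3 / 16) \<le> expectation (\<lambda>\<omega>. wasserstein p (emp t \<omega>) torus_uniform)"
      using t' by (intro grid_lower_bound[OF _ N(3) r Nr p bound]) auto
    moreover have "1 / 4 * r powr p \<le> r powr p / 2 - r powr p * (3 / 16)" by simp
    moreover have "r powr p = \<kappa>2 powr (p / q) * t powr (- p / q)"
    proof -
      have "r powr p = (\<kappa>2 / t) powr (p / q)" using q by (simp add: r_def powr_powr)
      also have "\<dots> = \<kappa>2 powr (p / q) / t powr (p / q)" using \<kappa>2 t' by (simp add: powr_divide)
      also have "\<dots> = \<kappa>2 powr (p / q) * t powr (- (p / q))" by (simp add: powr_minus divide_inverse)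
      finally show ?thesis by simp
    qed
    ultimately have "1 / 4 * (\<kappa>2 powr (p / q) * t powr (- p / q)) \<le> expectation (\<lambda>\<omega>. wasserstein p (emp t \<omega>) torus_uniform)"
      by linarith
    then show ?thesis by (simp only: mult.assoc)
  qed
  show ?thesis
    unfolding q_def[symmetric]
    by (rule exI[of _ "1 / 4 * \<kappa>2 powr (p / q)"], intro conjI, use \<kappa>2 in simp,
        rule exI[of _ t0], intro conjI allI impI) (use main in \<open>auto simp: t0_def\<close>)
qed

lemma wasserstein_lower_bound:
  assumes H: "0 < H" "H < 1" and B: "B \<in> bernstein_upper \<alpha>" and \<alpha>: "0 \<le> \<alpha>" and d: "\<alpha> / H < real CARD('d)"
    and p: "0 < p"
  shows "\<exists>C>0. \<exists>t\<^sub>0>1. \<forall>t\<ge>t\<^sub>0. C * t powr (- min 1 p / (real CARD('d) - \<alpha> / H))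
     \<le> expectation (\<lambda>\<omega>. wasserstein p (emp t \<omega>) torus_uniform)"
proof (cases "p \<le> 1")
  case True
  then show ?thesis using wasserstein_lower_bound_le1[OF H B \<alpha> d p True] by (simp add: min_def)
next
  case False
  then obtain C t0 where C: "0 < C" "1 < t0" "\<And>t. t0 \<le> t \<Longrightarrow> C * t powr (- 1 / (real CARD('d) - \<alpha> / H))
     \<le> expectation (\<lambda>\<omega>. wasserstein 1 (emp t \<omega>) torus_uniform)"
    using wasserstein_lower_bound_le1[OF H B \<alpha> d, of 1] by auto
  have "C * t powr (- 1 / (real CARD('d) - \<alpha> / H)) \<le> expectation (\<lambda>\<omega>. wasserstein p (emp t \<omega>) torus_uniform)"
    if "t0 \<le> t" for t
    using C(3)[OF that] expectation_wasserstein_1_le[of t p] False that C(2) by simp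
  then show ?thesis using C False by (auto simp: min_def)
qed

end

section \<open>Trigonometric polynomials\<close>

definition ee :: "real ^ 'd::finite \<Rightarrow> real ^ 'd \<Rightarrow> complex" where
  "ee \<xi> x = cis (2 * pi * (\<xi> \<bullet> x))"

lemma ee_0 [simp]: "ee 0 x = 1" "ee \<xi> 0 = 1"
  and ee_add: "ee (\<xi> + \<eta>) x = ee \<xi> x * ee \<eta> x"
  and ee_minus: "ee (- \<xi>) x = cnj (ee \<xi> x)"
  and ee_add_right: "ee \<xi> (x + y) = ee \<xi> x * ee \<xi> y"
  and ee_diff_right: "ee \<xi> (x - y) = ee \<xi> x * cnj (ee \<xi> y)"
  and norm_ee [simp]: "norm (ee \<xi> x) = 1"
  by (simp_all add: ee_def inner_add_left inner_add_right inner_diff_right cis_mult cis_cnj algebra_simps)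

lemma ee_diff: "ee (\<xi> - \<eta>) x = ee \<xi> x * cnj (ee \<eta> x)"
  using ee_add[of \<xi> "- \<eta>" x] by (simp add: ee_minus)

lemma int_vectors_inner:
  assumes "\<xi> \<in> int_vectors" "k \<in> int_vectors"
  shows "\<xi> \<bullet> (k :: real ^ 'd::finite) \<in> \<int>"
  using assms by (auto simp: inner_vec_def int_vectors_def intro!: Ints_sum Ints_mult)

lemma ee_int_vectors:
  assumes "\<xi> \<in> int_vectors" "k \<in> int_vectors"
  shows "ee \<xi> k = 1"
proof -
  obtain n where "\<xi> \<bullet> k = of_int n" using int_vectors_inner[OF assms] by (auto elim: Ints_cases)
  then have "ee \<xi> k = cis (2 * pi * of_int n)" by (simp add: ee_def)
  then show ?thesis by (simp add: cis_multiple_2pi)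
qed

lemma continuous_ee [continuous_intros]: "continuous_on S (ee \<xi>)"
  unfolding ee_def by (intro continuous_intros)

lemma measurable_ee [measurable]: "ee \<xi> \<in> borel_measurable borel"
  by (intro borel_measurable_continuous_onI continuous_ee)

lemma integral_circle:
  assumes "m \<in> \<int>"
  shows "integrable lborel (\<lambda>x::real. indicator {0..1} x *\<^sub>R cis (2 * pi * (m * x)))"
    "(\<integral>x. indicator {0..1} x *\<^sub>R cis (2 * pi * (m * x)) \<partial>lborel) = (if m = 0 then 1 else 0)"
proof -
  have cont: "continuous_on {0..1} (\<lambda>x::real. cis (2 * pi * (m * x)))" by (intro continuous_intros)
  show "integrable lborel (\<lambda>x::real. indicator {0..1} x *\<^sub>R cis (2 * pi * (m * x)))"
    by (rule borel_integrable_compact) (use cont in auto)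
  show "(\<integral>x. indicator {0..1} x *\<^sub>R cis (2 * pi * (m * x)) \<partial>lborel) = (if m = 0 then 1 else 0)"
  proof (cases "m = 0")
    case True
    have "(\<integral>x. indicator {0..1::real} x *\<^sub>R (1::complex) \<partial>lborel) = 1"
      using has_bochner_integral_integral_eq[OF has_bochner_integral_indicator[of "{0..1::real}" lborel "1::complex"]] by simp
    then show ?thesis using True by simp
  next
    case False
    define F where "F x = cis (2 * pi * (m * x)) / (2 * pi * m * \<i>)" for x :: real
    have "has_bochner_integral lborel (\<lambda>x. indicator {0..1} x *\<^sub>R cis (2 * pi * (m * x))) (F 1 - F 0)"
    proof (rule has_bochner_integral_FTC_Icc[OF _ _ cont])
      fix x :: real
      have "((\<lambda>x. cis (2 * pi * (m * x)) / (2 * pi * m * \<i>)) has_vector_derivative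
         (2 * pi * m) *\<^sub>R (\<i> * cis (2 * pi * (m * x))) / (2 * pi * m * \<i>)) (at x within {0..1})"
        unfolding cis_conv_exp
        by (auto intro!: derivative_eq_intros has_vector_derivative_real_field simp: scaleR_conv_of_real field_simps)
      then show "(F has_vector_derivative cis (2 * pi * (m * x))) (at x within {0..1})"
        using False by (simp add: F_def[abs_def] scaleR_conv_of_real)
    qed simp
    moreover obtain n where "m = of_int n" using assms by (auto elim: Ints_cases)
    then have "F 1 = F 0" using cis_multiple_2pi[of n] by (simp add: F_def mult.assoc)
    ultimately show ?thesis using False by (simp add: has_bochner_integral_integral_eq)
  qed
qed

lemma integral_unit_cube:
  fixes f :: "real ^ 'd::finite \<Rightarrow> 'b::{banach, second_countable_topology}"
  assumes "f \<in> borel_measurable borel"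
  shows "(\<integral>x. f x \<partial>unit_cube) = (\<integral>x. indicator (cbox 0 1) x *\<^sub>R f x \<partial>lborel)"
proof -
  have "unit_cube = density lborel (\<lambda>x :: real ^ 'd. ennreal (indicator (cbox 0 1) x))"
    unfolding uniform_measure_def
    by (intro density_cong) (auto simp: emeasure_unit_cube indicator_def)
  then show ?thesis using assms by (simp add: integral_density)
qed

interpretation unit_cube: prob_space "unit_cube :: (real ^ 'd::finite) measure"
  by (rule prob_space_unit_cube)

lemma unit_cube_integrable:
  fixes f :: "real ^ 'd::finite \<Rightarrow> 'b::{banach, second_countable_topology}"
  assumes "f \<in> borel_measurable borel" "\<And>x. norm (f x) \<le> K"
  shows "integrable unit_cube f"
  using assms by (intro unit_cube.integrable_const_bound[where B = K]) (auto simp: uniform_measure_def)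

lemma integral_ee:
  fixes \<xi> :: "real ^ 'd::finite"
  assumes \<xi>: "\<xi> \<in> int_vectors"
  shows "(\<integral>x. ee \<xi> x \<partial>unit_cube) = (if \<xi> = 0 then 1 else (0::complex))"
proof -
  interpret product_sigma_finite "\<lambda>_ :: real ^ 'd. lborel :: real measure" ..
  let ?s = "\<lambda>f :: real ^ 'd \<Rightarrow> real. \<Sum>b\<in>Basis. f b *\<^sub>R b"
  have "(\<integral>x. ee \<xi> x \<partial>unit_cube) = (\<integral>x. indicator (cbox 0 1) x *\<^sub>R ee \<xi> x \<partial>(lborel :: (real ^ 'd) measure))"
    by (rule integral_unit_cube) measurable
  also have "\<dots> = (\<integral>f. indicator (cbox 0 1) (?s f) *\<^sub>R ee \<xi> (?s f) \<partial>(\<Pi>\<^sub>M b\<in>(Basis :: (real ^ 'd) set). lborel))"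
    by (subst lborel_eq, subst integral_distr) auto
  also have "\<dots> = (\<integral>f. (\<Prod>b\<in>Basis. indicator {0..1} (f b) *\<^sub>R cis (2 * pi * ((\<xi> \<bullet> b) * f b))) \<partial>(\<Pi>\<^sub>M b\<in>(Basis :: (real ^ 'd) set). lborel))"
  proof (intro Bochner_Integration.integral_cong refl)
    fix f :: "real ^ 'd \<Rightarrow> real"
    have b1: "1 \<bullet> b = 1" if "b \<in> Basis" for b :: "real ^ 'd"
      using that by (auto simp: Basis_vec_def inner_axis)
    have mem: "?s f \<in> cbox 0 1 \<longleftrightarrow> (\<forall>b\<in>Basis. f b \<in> {0..1})"
      by (auto simp: mem_box inner_sum_left_Basis b1)
    have "(\<Prod>b\<in>Basis. cis (2 * pi * ((\<xi> \<bullet> b) * f b))) = cis (\<Sum>b\<in>Basis. 2 * pi * ((\<xi> \<bullet> b) * f b))"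
      by (simp add: cis_conv_exp exp_sum[symmetric] sum_distrib_left)
    also have "\<dots> = ee \<xi> (?s f)"
      by (simp add: ee_def inner_sum_right sum_distrib_left mult.commute)
    finally have p: "(\<Prod>b\<in>Basis. cis (2 * pi * ((\<xi> \<bullet> b) * f b))) = ee \<xi> (?s f)" .
    show "indicator (cbox 0 1) (?s f) *\<^sub>R ee \<xi> (?s f) = (\<Prod>b\<in>Basis. indicator {0..1} (f b) *\<^sub>R cis (2 * pi * ((\<xi> \<bullet> b) * f b)))"
    proof (cases "\<forall>b\<in>Basis. f b \<in> {0..1}")
      case True
      then have "(\<Prod>b\<in>Basis. indicator {0..1} (f b) *\<^sub>R cis (2 * pi * ((\<xi> \<bullet> b) * f b))) = (\<Prod>b\<in>Basis. cis (2 * pi * ((\<xi> \<bullet> b) * f b)))"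
        by (intro prod.cong) auto
      then show ?thesis using True mem p by simp
    next
      case False
      then obtain b where "b \<in> Basis" "f b \<notin> {0..1}" by blast
      then have "(\<Prod>b\<in>Basis. indicator {0..1} (f b) *\<^sub>R cis (2 * pi * ((\<xi> \<bullet> b) * f b))) = 0"
        by (intro prod_zero bexI[of _ b]) auto
      then show ?thesis using False mem by simp
    qed
  qed
  also have "\<dots> = (\<Prod>b\<in>Basis. \<integral>x. indicator {0..1} x *\<^sub>R cis (2 * pi * ((\<xi> \<bullet> b) * x)) \<partial>lborel)"
  proof (rule product_integral_prod)
    fix b :: "real ^ 'd" assume "b \<in> Basis"
    then have "\<xi> \<bullet> b \<in> \<int>" using \<xi> by (auto simp: Basis_vec_def inner_axis int_vectors_def)
    then show "integrable lborel (\<lambda>x. indicator {0..1} x *\<^sub>R cis (2 * pi * ((\<xi> \<bullet> b) * x)))" by (rule integral_circle)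
  qed simp
  also have "\<dots> = (\<Prod>b\<in>Basis. if \<xi> \<bullet> b = 0 then 1 else 0)"
  proof (intro prod.cong refl integral_circle)
    fix b :: "real ^ 'd" assume "b \<in> Basis"
    then show "\<xi> \<bullet> b \<in> \<int>" using \<xi> by (auto simp: Basis_vec_def inner_axis int_vectors_def)
  qed
  also have "\<dots> = (if \<xi> = 0 then 1 else 0)"
    using euclidean_all_zero_iff[of \<xi>] by (auto intro!: prod_zero)
  finally show ?thesis .
qed

definition tp :: "(real ^ 'd::finite) set \<Rightarrow> (real ^ 'd \<Rightarrow> complex) \<Rightarrow> real ^ 'd \<Rightarrow> complex" where
  "tp \<Phi> c x = (\<Sum>\<xi>\<in>\<Phi>. c \<xi> * ee \<xi> x)"

definition freq_set :: "(real ^ 'd::finite) set \<Rightarrow> bool" where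
  "freq_set \<Phi> \<longleftrightarrow> finite \<Phi> \<and> \<Phi> \<subseteq> int_vectors"

text \<open>Only the spectrum is recorded and the coefficients are hidden: products, conjugates and
  derivatives are then followed by adding frequency sets.\<close>

definition trig :: "(real ^ 'd::finite) set \<Rightarrow> (real ^ 'd \<Rightarrow> complex) \<Rightarrow> bool" where
  "trig \<Phi> T \<longleftrightarrow> (\<exists>c. T = tp \<Phi> c)"

lemma continuous_tp: "continuous_on S (tp \<Phi> c)"
  unfolding tp_def by (intro continuous_intros)

lemma measurable_tp [measurable]: "tp \<Phi> c \<in> borel_measurable borel"
  by (intro borel_measurable_continuous_onI continuous_tp)

lemma norm_tp_le: "norm (tp \<Phi> c x) \<le> (\<Sum>\<xi>\<in>\<Phi>. norm (c \<xi>))"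
  unfolding tp_def by (rule order.trans[OF norm_sum]) (simp add: norm_mult)

lemma tp_cnj_product:
  assumes "freq_set \<Phi>" "freq_set \<Psi>"
  shows "(\<integral>x. tp \<Phi> c x * cnj (tp \<Psi> d x) \<partial>unit_cube) = (\<Sum>\<xi>\<in>\<Phi> \<inter> \<Psi>. c \<xi> * cnj (d \<xi>))"
proof -
  have fin: "finite \<Phi>" "finite \<Psi>" using assms by (auto simp: freq_set_def)
  have "(\<integral>x. tp \<Phi> c x * cnj (tp \<Psi> d x) \<partial>unit_cube)
      = (\<integral>x. (\<Sum>\<xi>\<in>\<Phi>. \<Sum>\<eta>\<in>\<Psi>. (c \<xi> * cnj (d \<eta>)) * ee (\<xi> - \<eta>) x) \<partial>unit_cube)"
    by (simp add: tp_def sum_product ee_diff algebra_simps)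
  also have "\<dots> = (\<Sum>\<xi>\<in>\<Phi>. \<Sum>\<eta>\<in>\<Psi>. (c \<xi> * cnj (d \<eta>)) * (\<integral>x. ee (\<xi> - \<eta>) x \<partial>unit_cube))"
    by (subst Bochner_Integration.integral_sum Bochner_Integration.integral_sum integral_mult_right
         | intro Bochner_Integration.integrable_sum integrable_mult_right unit_cube_integrable[where K = 1] sum.cong refl
         | simp)+
  also have "\<dots> = (\<Sum>\<xi>\<in>\<Phi>. \<Sum>\<eta>\<in>\<Psi>. if \<eta> = \<xi> then c \<xi> * cnj (d \<xi>) else 0)"
    using assms by (intro sum.cong refl) (auto simp: integral_ee int_vectors_diff freq_set_def subset_eq)
  also have "\<dots> = (\<Sum>\<xi>\<in>\<Phi>. if \<xi> \<in> \<Psi> then c \<xi> * cnj (d \<xi>) else 0)"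
    using fin by (intro sum.cong refl) (simp add: sum.delta)
  also have "\<dots> = (\<Sum>\<xi>\<in>\<Phi> \<inter> \<Psi>. c \<xi> * cnj (d \<xi>))" using fin by (simp add: sum.inter_restrict)
  finally show ?thesis .
qed

lemma parseval:
  assumes "freq_set \<Phi>"
  shows "(\<integral>x. (norm (tp \<Phi> c x))\<^sup>2 \<partial>unit_cube) = (\<Sum>\<xi>\<in>\<Phi>. (norm (c \<xi>))\<^sup>2)"
proof -
  have "complex_of_real (\<integral>x. (norm (tp \<Phi> c x))\<^sup>2 \<partial>unit_cube) = (\<integral>x. tp \<Phi> c x * cnj (tp \<Phi> c x) \<partial>unit_cube)"
    by (simp only: integral_complex_of_real[symmetric] complex_norm_square)
  also have "\<dots> = complex_of_real (\<Sum>\<xi>\<in>\<Phi>. (norm (c \<xi>))\<^sup>2)"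
    by (subst tp_cnj_product[OF assms assms]) (simp only: Int_absorb of_real_sum complex_norm_square)
  finally show ?thesis by (simp only: of_real_eq_iff)
qed

text \<open>As a function of y the reflected translate is, up to conjugation, a trigonometric
  polynomial with coefficients of the same modulus, so Parseval's identity applies to kernels inside
  convolutions.\<close>

lemma tp_reflect: "tp \<Phi> c (x - y) = cnj (tp \<Phi> (\<lambda>\<xi>. cnj (c \<xi> * ee \<xi> x)) y)"
  by (simp add: tp_def ee_diff_right mult.assoc)

lemma parseval_reflect:
  assumes "freq_set \<Phi>"
  shows "(\<integral>y. (norm (tp \<Phi> c (x - y)))\<^sup>2 \<partial>unit_cube) = (\<Sum>\<xi>\<in>\<Phi>. (norm (c \<xi>))\<^sup>2)"
  using parseval[OF assms] by (simp add: tp_reflect norm_mult)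

lemma trig_mono:
  assumes "trig \<Phi> T" "\<Phi> \<subseteq> \<Psi>" "finite \<Psi>"
  shows "trig \<Psi> T"
proof -
  obtain c where c: "T = tp \<Phi> c" using assms by (auto simp: trig_def)
  have "T = tp \<Psi> (\<lambda>\<xi>. if \<xi> \<in> \<Phi> then c \<xi> else 0)"
  proof
    fix x
    have "tp \<Psi> (\<lambda>\<xi>. if \<xi> \<in> \<Phi> then c \<xi> else 0) x = (\<Sum>\<xi>\<in>\<Psi>. if \<xi> \<in> \<Phi> then c \<xi> * ee \<xi> x else 0)"
      unfolding tp_def by (intro sum.cong) auto
    also have "\<dots> = (\<Sum>\<xi>\<in>\<Psi> \<inter> \<Phi>. c \<xi> * ee \<xi> x)" using assms(3) by (simp add: sum.inter_restrict)
    also have "\<Psi> \<inter> \<Phi> = \<Phi>" using assms(2) by auto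
    finally show "T x = tp \<Psi> (\<lambda>\<xi>. if \<xi> \<in> \<Phi> then c \<xi> else 0) x" by (simp add: c tp_def)
  qed
  then show ?thesis by (auto simp: trig_def)
qed

lemma trig_sum_index:
  assumes "finite I" "finite \<Phi>" "\<And>i. i \<in> I \<Longrightarrow> g i \<in> \<Phi>"
  shows "trig \<Phi> (\<lambda>x. \<Sum>i\<in>I. c i * ee (g i) x)"
proof -
  have "(\<lambda>x. \<Sum>i\<in>I. c i * ee (g i) x) = tp \<Phi> (\<lambda>\<xi>. \<Sum>i\<in>{i\<in>I. g i = \<xi>}. c i)"
  proof
    fix x
    have "(\<Sum>i\<in>I. c i * ee (g i) x) = (\<Sum>\<xi>\<in>\<Phi>. \<Sum>i\<in>{i\<in>I. g i = \<xi>}. c i * ee (g i) x)"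
      using assms by (intro sum.group[symmetric]) auto
    also have "\<dots> = tp \<Phi> (\<lambda>\<xi>. \<Sum>i\<in>{i\<in>I. g i = \<xi>}. c i) x"
      unfolding tp_def sum_distrib_right by (intro sum.cong) auto
    finally show "(\<Sum>i\<in>I. c i * ee (g i) x) = tp \<Phi> (\<lambda>\<xi>. \<Sum>i\<in>{i\<in>I. g i = \<xi>}. c i) x" .
  qed
  then show ?thesis by (auto simp: trig_def)
qed

lemma trig_mult:
  assumes "trig \<Phi> S" "trig \<Psi> T" "finite \<Phi>" "finite \<Psi>" "finite \<Theta>"
    and "\<And>\<xi> \<eta>. \<xi> \<in> \<Phi> \<Longrightarrow> \<eta> \<in> \<Psi> \<Longrightarrow> \<xi> + \<eta> \<in> \<Theta>"
  shows "trig \<Theta> (\<lambda>x. S x * T x)"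
proof -
  obtain c d where "S = tp \<Phi> c" "T = tp \<Psi> d" using assms by (auto simp: trig_def)
  then have "(\<lambda>x. S x * T x) = (\<lambda>x. \<Sum>p\<in>\<Phi> \<times> \<Psi>. (c (fst p) * d (snd p)) * ee (fst p + snd p) x)"
    by (auto simp: tp_def fun_eq_iff sum_product sum.cartesian_product ee_add algebra_simps split_beta intro!: sum.cong)
  moreover have "trig \<Theta> (\<lambda>x. \<Sum>p\<in>\<Phi> \<times> \<Psi>. (c (fst p) * d (snd p)) * ee (fst p + snd p) x)"
    by (rule trig_sum_index) (use assms in auto)
  ultimately show ?thesis by simp
qed

lemma trig_cnj:
  assumes "trig \<Phi> T" "finite \<Phi>" "finite \<Psi>" "\<And>\<xi>. \<xi> \<in> \<Phi> \<Longrightarrow> - \<xi> \<in> \<Psi>"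
  shows "trig \<Psi> (\<lambda>x. cnj (T x))"
proof -
  obtain c where "T = tp \<Phi> c" using assms by (auto simp: trig_def)
  then have "(\<lambda>x. cnj (T x)) = (\<lambda>x. \<Sum>\<xi>\<in>\<Phi>. cnj (c \<xi>) * ee (- \<xi>) x)" by (simp add: tp_def ee_minus)
  then show ?thesis using trig_sum_index[OF assms(2,3), of uminus] assms(4) by simp
qed

lemma trig_add:
  assumes "trig \<Phi> S" "trig \<Phi> T"
  shows "trig \<Phi> (\<lambda>x. S x + T x)"
proof -
  obtain c d where "S = tp \<Phi> c" "T = tp \<Phi> d" using assms by (auto simp: trig_def)
  then have "(\<lambda>x. S x + T x) = tp \<Phi> (\<lambda>\<xi>. c \<xi> + d \<xi>)" by (simp add: tp_def fun_eq_iff sum.distrib algebra_simps)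
  then show ?thesis by (auto simp: trig_def)
qed

lemma trig_cmult:
  assumes "trig \<Phi> T" shows "trig \<Phi> (\<lambda>x. a * T x)"
proof -
  obtain c where "T = tp \<Phi> c" using assms by (auto simp: trig_def)
  then have "(\<lambda>x. a * T x) = tp \<Phi> (\<lambda>\<xi>. a * c \<xi>)" by (simp add: tp_def fun_eq_iff sum_distrib_left algebra_simps)
  then show ?thesis by (auto simp: trig_def)
qed

lemma trig_continuous: "trig \<Phi> T \<Longrightarrow> continuous_on S T"
  by (auto simp: trig_def continuous_tp)

lemma trig_measurable: "trig \<Phi> T \<Longrightarrow> T \<in> borel_measurable borel"
  by (auto simp: trig_def)

lemma trig_bounded: "trig \<Phi> T \<Longrightarrow> \<exists>K. \<forall>x. norm (T x) \<le> K"
  unfolding trig_def using norm_tp_le by blast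

lemma trig_periodic:
  assumes "trig \<Phi> T" "freq_set \<Phi>" "k \<in> int_vectors"
  shows "T (x + k) = T x"
proof -
  obtain c where "T = tp \<Phi> c" using assms by (auto simp: trig_def)
  then show ?thesis using assms(2,3)
    by (auto simp: tp_def ee_add_right ee_int_vectors freq_set_def subset_eq intro!: sum.cong)
qed

lemma trig_orthogonal:
  assumes "trig \<Phi> S" "trig \<Psi> T" "freq_set \<Phi>" "freq_set \<Psi>" "\<Phi> \<inter> \<Psi> = {}"
  shows "(\<integral>x. S x * cnj (T x) \<partial>unit_cube) = 0"
  using assms tp_cnj_product[OF assms(3,4)] by (auto simp: trig_def)

section \<open>Partial derivatives and bounds in quadratic mean\<close>

definition pd :: "'d \<Rightarrow> (real ^ 'd::finite \<Rightarrow> 'b::real_normed_vector) \<Rightarrow> real ^ 'd \<Rightarrow> 'b" where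
  "pd i f x = vector_derivative (\<lambda>s. f (x + s *\<^sub>R axis i 1)) (at 0)"

definition pdiff :: "'d \<Rightarrow> (real ^ 'd::finite \<Rightarrow> 'b::real_normed_vector) \<Rightarrow> bool" where
  "pdiff i f \<longleftrightarrow> (\<forall>x. ((\<lambda>s. f (x + s *\<^sub>R axis i 1)) has_vector_derivative pd i f x) (at 0))"

lemma pd_eqI:
  assumes "\<And>x. ((\<lambda>s. f (x + s *\<^sub>R axis i 1)) has_vector_derivative D x) (at 0)"
  shows "pd i f = D" "pdiff i f"
proof -
  show *: "pd i f = D" unfolding pd_def fun_eq_iff using assms vector_derivative_at by blast
  show "pdiff i f" using assms by (simp add: pdiff_def *)
qed

lemma ee_has_derivative:
  "(ee \<xi> has_derivative (\<lambda>u. (2 * pi * (\<xi> \<bullet> u)) *\<^sub>R (\<i> * ee \<xi> x))) (at x)"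
proof -
  have 1: "((\<lambda>x. 2 * pi * (\<xi> \<bullet> x)) has_derivative (\<lambda>u. 2 * pi * (\<xi> \<bullet> u))) (at x)"
    by (auto intro!: derivative_eq_intros)
  have 2: "(cis has_derivative (\<lambda>h. h *\<^sub>R (\<i> * cis s))) (at s)" for s
  proof -
    have "((\<lambda>s. exp (\<i> * complex_of_real s)) has_vector_derivative \<i> * exp (\<i> * complex_of_real s)) (at s)"
      by (rule has_vector_derivative_real_field) (auto intro!: derivative_eq_intros)
    then show ?thesis by (simp add: has_vector_derivative_def cis_conv_exp[abs_def])
  qed
  show ?thesis unfolding ee_def[abs_def]
    by (rule has_derivative_compose[OF 1 2, unfolded o_def])
qed

lemma tp_has_derivative:
  "(tp \<Phi> c has_derivative (\<lambda>u. \<Sum>\<xi>\<in>\<Phi>. c \<xi> * ((2 * pi * (\<xi> \<bullet> u)) *\<^sub>R (\<i> * ee \<xi> x)))) (at x)"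
  unfolding tp_def[abs_def]
  by (intro has_derivative_sum has_derivative_mult_right ee_has_derivative)

lemma pd_tp: "pd i (tp \<Phi> c) = tp \<Phi> (\<lambda>\<xi>. (2 * pi * (\<xi> $ i)) *\<^sub>R (\<i> * c \<xi>))"
  and pdiff_tp: "pdiff i (tp \<Phi> c)"
proof -
  have "((\<lambda>s. tp \<Phi> c (x + s *\<^sub>R axis i 1)) has_vector_derivative tp \<Phi> (\<lambda>\<xi>. (2 * pi * (\<xi> $ i)) *\<^sub>R (\<i> * c \<xi>)) x) (at 0)" for x
  proof -
    have 1: "((\<lambda>s. x + s *\<^sub>R axis i 1) has_derivative (\<lambda>h. h *\<^sub>R axis i 1)) (at (0::real))"
      by (auto intro!: derivative_eq_intros)
    have 2: "(tp \<Phi> c has_derivative (\<lambda>u. \<Sum>\<xi>\<in>\<Phi>. c \<xi> * ((2 * pi * (\<xi> \<bullet> u)) *\<^sub>R (\<i> * ee \<xi> x)))) (at (x + 0 *\<^sub>R axis i 1))"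
      using tp_has_derivative[of \<Phi> c x] by simp
    have "((\<lambda>s. tp \<Phi> c (x + s *\<^sub>R axis i 1)) has_derivative (\<lambda>h. \<Sum>\<xi>\<in>\<Phi>. c \<xi> * ((2 * pi * (\<xi> \<bullet> (h *\<^sub>R axis i 1))) *\<^sub>R (\<i> * ee \<xi> x)))) (at 0)"
      by (rule has_derivative_compose[OF 1 2])
    moreover have "(\<lambda>h. \<Sum>\<xi>\<in>\<Phi>. c \<xi> * ((2 * pi * (\<xi> \<bullet> (h *\<^sub>R axis i 1))) *\<^sub>R (\<i> * ee \<xi> x))) = (\<lambda>h. h *\<^sub>R tp \<Phi> (\<lambda>\<xi>. (2 * pi * (\<xi> $ i)) *\<^sub>R (\<i> * c \<xi>)) x)"
      by (simp add: fun_eq_iff tp_def scaleR_sum_right inner_axis scaleR_conv_of_real[where 'a = complex] sum_distrib_left algebra_simps)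
    ultimately show ?thesis by (simp add: has_vector_derivative_def)
  qed
  from pd_eqI[of "tp \<Phi> c" i, OF this] show "pd i (tp \<Phi> c) = tp \<Phi> (\<lambda>\<xi>. (2 * pi * (\<xi> $ i)) *\<^sub>R (\<i> * c \<xi>))" "pdiff i (tp \<Phi> c)" by auto
qed

lemma trig_pd: "trig \<Phi> T \<Longrightarrow> trig \<Phi> (pd i T)" and trig_pdiff: "trig \<Phi> T \<Longrightarrow> pdiff i T"
  by (auto simp: trig_def pd_tp pdiff_tp)

lemma pd_mult:
  fixes S T :: "real ^ 'd::finite \<Rightarrow> complex"
  assumes "pdiff i S" "pdiff i T"
  shows "pd i (\<lambda>x. S x * T x) = (\<lambda>x. S x * pd i T x + pd i S x * T x)"
proof (rule pd_eqI(1))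
  fix x
  show "((\<lambda>s. S (x + s *\<^sub>R axis i 1) * T (x + s *\<^sub>R axis i 1)) has_vector_derivative S x * pd i T x + pd i S x * T x) (at 0)"
    using has_vector_derivative_mult[of "\<lambda>s. S (x + s *\<^sub>R axis i 1)" "pd i S x" 0 UNIV "\<lambda>s. T (x + s *\<^sub>R axis i 1)" "pd i T x"]
      assms by (simp add: pdiff_def)
qed

lemma pd_add:
  assumes "pdiff i S" "pdiff i T"
  shows "pd i (\<lambda>x. S x + T x) = (\<lambda>x. pd i S x + pd i T x)"
  by (rule pd_eqI(1)) (use assms in \<open>auto simp: pdiff_def intro!: has_vector_derivative_add\<close>)

lemma pd_linear:
  assumes "bounded_linear L" "pdiff i T"
  shows "pd i (\<lambda>x. L (T x)) = (\<lambda>x. L (pd i T x))" "pdiff i (\<lambda>x. L (T x))"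
proof -
  have "((\<lambda>s. L (T (x + s *\<^sub>R axis i 1))) has_vector_derivative L (pd i T x)) (at 0)" for x
    using bounded_linear.has_vector_derivative[OF assms(1)] assms(2) by (auto simp: pdiff_def)
  from pd_eqI[of "\<lambda>x. L (T x)" i, OF this]
  show "pd i (\<lambda>x. L (T x)) = (\<lambda>x. L (pd i T x))" "pdiff i (\<lambda>x. L (T x))" by auto
qed

text \<open>Bernstein's inequality in quadratic mean, by Parseval: a derivative multiplies every
  coefficient by at most \<open>2 * pi * R\<close> in modulus.\<close>

lemma bernstein_L2:
  assumes \<Phi>: "freq_set \<Phi>" and T: "trig \<Phi> T" and R: "\<And>\<xi>. \<xi> \<in> \<Phi> \<Longrightarrow> \<bar>\<xi> $ i\<bar> \<le> R"
  shows "(\<integral>y. (norm (pd i T (x - y)))\<^sup>2 \<partial>unit_cube) \<le> (2 * pi * R)\<^sup>2 * (\<integral>y. (norm (T y))\<^sup>2 \<partial>unit_cube)"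
proof -
  obtain c where c: "T = tp \<Phi> c" using T by (auto simp: trig_def)
  have "(\<integral>y. (norm (pd i T (x - y)))\<^sup>2 \<partial>unit_cube) = (\<Sum>\<xi>\<in>\<Phi>. (2 * pi * \<bar>\<xi> $ i\<bar>)\<^sup>2 * (norm (c \<xi>))\<^sup>2)"
    unfolding c pd_tp parseval_reflect[OF \<Phi>] by (simp add: norm_mult power_mult_distrib abs_mult)
  also have "\<dots> \<le> (\<Sum>\<xi>\<in>\<Phi>. (2 * pi * R)\<^sup>2 * (norm (c \<xi>))\<^sup>2)"
    using R by (intro sum_mono mult_right_mono power_mono) auto
  also have "\<dots> = (2 * pi * R)\<^sup>2 * (\<integral>y. (norm (T y))\<^sup>2 \<partial>unit_cube)"
    unfolding c parseval[OF \<Phi>] by (simp add: sum_distrib_left)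
  finally show ?thesis .
qed

lemma trig_L2_reflect:
  assumes "freq_set \<Phi>" "trig \<Phi> T"
  shows "(\<integral>y. (norm (T (x - y)))\<^sup>2 \<partial>unit_cube) = (\<integral>y. (norm (T y))\<^sup>2 \<partial>unit_cube)"
  using assms by (auto simp: trig_def parseval parseval_reflect)

text \<open>The Cauchy-Schwarz inequality for given bounds on the two norms, from the weighted
  inequality of arithmetic and geometric means with weight \<open>b / a\<close>.\<close>

lemma cauchy_schwarz_bound:
  fixes f g :: "real ^ 'd::finite \<Rightarrow> real"
  assumes f: "f \<in> borel_measurable borel" "\<And>x. \<bar>f x\<bar> \<le> K" and g: "g \<in> borel_measurable borel" "\<And>x. \<bar>g x\<bar> \<le> L"
    and a: "(\<integral>x. (f x)\<^sup>2 \<partial>unit_cube) \<le> a\<^sup>2" "0 < a" and b: "(\<integral>x. (g x)\<^sup>2 \<partial>unit_cube) \<le> b\<^sup>2" "0 < b"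
  shows "(\<integral>x. \<bar>f x\<bar> * \<bar>g x\<bar> \<partial>unit_cube) \<le> a * b"
proof -
  note [measurable] = f(1) g(1)
  have "\<bar>f x\<bar>\<^sup>2 \<le> K\<^sup>2" for x using f(2)[of x] by (intro power_mono) auto
  then have fI: "integrable unit_cube (\<lambda>x. (f x)\<^sup>2)" by (intro unit_cube_integrable[where K = "K\<^sup>2"]) auto
  have "\<bar>g x\<bar>\<^sup>2 \<le> L\<^sup>2" for x using g(2)[of x] by (intro power_mono) auto
  then have gI: "integrable unit_cube (\<lambda>x. (g x)\<^sup>2)" by (intro unit_cube_integrable[where K = "L\<^sup>2"]) auto
  have fgI: "integrable unit_cube (\<lambda>x. \<bar>f x\<bar> * \<bar>g x\<bar>)"
    using f(2) g(2) by (intro unit_cube_integrable[where K = "K * L"]) (auto intro!: mult_mono intro: order.trans[OF abs_ge_zero])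
  have pw: "\<bar>f x\<bar> * \<bar>g x\<bar> \<le> (b / (2 * a)) * (f x)\<^sup>2 + (a / (2 * b)) * (g x)\<^sup>2" for x
  proof -
    have "0 \<le> (b * \<bar>f x\<bar> - a * \<bar>g x\<bar>)\<^sup>2 / (2 * a * b)" using a b by simp
    also have "\<dots> = (b / (2 * a)) * (f x)\<^sup>2 + (a / (2 * b)) * (g x)\<^sup>2 - \<bar>f x\<bar> * \<bar>g x\<bar>"
      using a b by (simp add: power2_diff power_mult_distrib field_simps power2_eq_square)
    finally show ?thesis by simp
  qed
  have "(\<integral>x. \<bar>f x\<bar> * \<bar>g x\<bar> \<partial>unit_cube) \<le> (\<integral>x. (b / (2 * a)) * (f x)\<^sup>2 + (a / (2 * b)) * (g x)\<^sup>2 \<partial>unit_cube)"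
    using fI gI fgI pw by (intro integral_mono) auto
  also have "\<dots> = (b / (2 * a)) * (\<integral>x. (f x)\<^sup>2 \<partial>unit_cube) + (a / (2 * b)) * (\<integral>x. (g x)\<^sup>2 \<partial>unit_cube)"
    using fI gI by simp
  also have "\<dots> \<le> (b / (2 * a)) * a\<^sup>2 + (a / (2 * b)) * b\<^sup>2"
    using a b by (intro add_mono mult_left_mono) auto
  also have "\<dots> = a * b" using a b by (simp add: power2_eq_square field_simps)
  finally show ?thesis .
qed

section \<open>A kernel with frequencies in an annulus\<close>

lemma pdiff_mult:
  fixes S T :: "real ^ 'd::finite \<Rightarrow> complex"
  assumes "pdiff i S" "pdiff i T"
  shows "pdiff i (\<lambda>x. S x * T x)"
proof (rule pd_eqI(2))
  fix x
  show "((\<lambda>s. S (x + s *\<^sub>R axis i 1) * T (x + s *\<^sub>R axis i 1)) has_vector_derivative S x * pd i T x + pd i S x * T x) (at 0)"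
    using has_vector_derivative_mult[of "\<lambda>s. S (x + s *\<^sub>R axis i 1)" "pd i S x" 0 UNIV "\<lambda>s. T (x + s *\<^sub>R axis i 1)" "pd i T x"]
      assms by (simp add: pdiff_def)
qed

text \<open>Unnormalised Dirichlet kernel with frequencies from 0 to N - 1 in each coordinate. The
  one-sided range lets spectra of products be located by adding intervals.\<close>

definition dirichlet :: "nat \<Rightarrow> real ^ 'd::finite \<Rightarrow> complex" where
  "dirichlet N x = (\<Prod>i\<in>UNIV. \<Sum>a<N. cis (2 * pi * (real a * x $ i)))"

definition dirichlet_freqs :: "nat \<Rightarrow> (real ^ 'd::finite) set" where
  "dirichlet_freqs N = (\<lambda>g. \<chi> i. real (g i)) ` (\<Pi>\<^sub>E i\<in>UNIV. {..<N})"

lemma dirichlet_tp: "dirichlet N = (tp (dirichlet_freqs N) (\<lambda>_. 1) :: real ^ 'd::finite \<Rightarrow> complex)"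
  and card_dirichlet_freqs: "card (dirichlet_freqs N :: (real ^ 'd) set) = N ^ CARD('d)"
proof -
  let ?P = "\<Pi>\<^sub>E i\<in>(UNIV :: 'd set). {..<N}"
  have inj: "inj_on (\<lambda>g. \<chi> i. real (g i) :: real ^ 'd) ?P"
    by (rule inj_onI) (simp add: vec_eq_iff fun_eq_iff)
  show "card (dirichlet_freqs N :: (real ^ 'd) set) = N ^ CARD('d)"
    unfolding dirichlet_freqs_def card_image[OF inj] by (simp add: card_PiE)
  show "dirichlet N = (tp (dirichlet_freqs N) (\<lambda>_. 1) :: real ^ 'd \<Rightarrow> complex)"
  proof
    fix x :: "real ^ 'd"
    have "dirichlet N x = (\<Sum>g\<in>?P. \<Prod>i\<in>UNIV. cis (2 * pi * (real (g i) * x $ i)))"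
      unfolding dirichlet_def by (rule prod_sum_PiE) auto
    also have "\<dots> = (\<Sum>g\<in>?P. ee (\<chi> i. real (g i)) x)"
      by (simp add: ee_def inner_vec_def cis_conv_exp exp_sum[symmetric] sum_distrib_left)
    also have "\<dots> = tp (dirichlet_freqs N) (\<lambda>_. 1) x"
      unfolding tp_def dirichlet_freqs_def by (subst sum.reindex[OF inj]) simp
    finally show "dirichlet N x = tp (dirichlet_freqs N) (\<lambda>_. 1) x" .
  qed
qed

lemma finite_int_box_Collect [simp]: "finite {\<xi> \<in> int_box R. P (\<xi> :: real ^ 'd::finite)}"
  by (rule finite_subset[OF _ finite_card_int_box(1)[of R]]) auto

lemma freq_set_int_box: "freq_set {\<xi> \<in> int_box R. P (\<xi> :: real ^ 'd::finite)}"
  unfolding freq_set_def using finite_int_box_Collect[of R P] by (auto simp: int_box_def)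

lemma trig_dirichlet: "trig {\<xi> \<in> int_box N. \<forall>i. 0 \<le> \<xi> $ i} (dirichlet N)"
proof (rule trig_mono)
  show "trig (dirichlet_freqs N) (dirichlet N)" unfolding dirichlet_tp by (auto simp: trig_def)
  show "dirichlet_freqs N \<subseteq> {\<xi> \<in> int_box N. \<forall>i. 0 \<le> \<xi> $ i}"
    by (auto simp: dirichlet_freqs_def int_box_def int_vectors_def PiE_def Pi_def less_imp_le)
qed simp

lemma dirichlet_L2: "(\<integral>y. (norm (dirichlet N (x - y :: real ^ 'd::finite)))\<^sup>2 \<partial>unit_cube) = real (N ^ CARD('d))"
proof -
  have "freq_set (dirichlet_freqs N :: (real ^ 'd) set)"
    by (auto simp: freq_set_def dirichlet_freqs_def int_vectors_def intro!: finite_imageI finite_PiE)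
  then show ?thesis by (simp add: dirichlet_tp parseval_reflect card_dirichlet_freqs)
qed

lemma norm_dirichlet_le: "norm (dirichlet N (x :: real ^ 'd::finite)) \<le> real N ^ CARD('d)"
proof -
  have "norm (dirichlet N x) = (\<Prod>i\<in>UNIV. norm (\<Sum>a<N. cis (2 * pi * (real a * x $ i))))"
    by (simp add: dirichlet_def prod_norm)
  also have "\<dots> \<le> (\<Prod>i\<in>(UNIV::'d set). real N)"
  proof (intro prod_mono conjI norm_ge_zero)
    fix i show "norm (\<Sum>a<N. cis (2 * pi * (real a * x $ i))) \<le> real N"
      by (rule order.trans[OF norm_sum]) simp
  qed
  finally show ?thesis by simp
qed

lemma dirichlet_0: "dirichlet N (0 :: real ^ 'd::finite) = of_nat (N ^ CARD('d))"
  by (simp add: dirichlet_def)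

lemma norm_1_minus_cis: "norm (1 - cis (2 * t)) = 2 * \<bar>sin t\<bar>"
proof -
  have "(norm (1 - cis (2 * t)))\<^sup>2 = (1 - cos (2 * t))\<^sup>2 + (sin (2 * t))\<^sup>2"
    by (simp add: cmod_power2)
  also have "\<dots> = 2 - 2 * cos (2 * t)"
    using sin_cos_squared_add[of "2 * t"] by (simp add: power2_diff algebra_simps)
  also have "\<dots> = (2 * \<bar>sin t\<bar>)\<^sup>2" by (simp add: cos_double_sin power_mult_distrib)
  finally show ?thesis by (rule power2_eq_imp_eq) auto
qed

text \<open>In coordinate \<open>j\<close> the geometric series bounds the sine times the factor by
  1; every other factor is at most \<open>N\<close>. So the sine gains a factor \<open>N\<close>
  over the trivial bound.\<close>

lemma sin_dirichlet_le:
  assumes N: "0 < N"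
  shows "\<bar>sin (pi * x $ j)\<bar> * norm (dirichlet N (x :: real ^ 'd::finite)) * real N \<le> real N ^ CARD('d)"
proof -
  let ?f = "\<lambda>i. norm (\<Sum>a<N. cis (2 * pi * (real a * x $ i)))"
  have f: "?f i \<le> real N" for i by (rule order.trans[OF norm_sum]) simp
  have g: "\<bar>sin (pi * x $ j)\<bar> * ?f j \<le> 1"
  proof -
    let ?z = "cis (2 * (pi * x $ j))"
    have "(\<Sum>a<N. cis (2 * pi * (real a * x $ j))) = (\<Sum>a<N. ?z ^ a)"
      by (intro sum.cong refl) (simp add: Complex.DeMoivre algebra_simps)
    then have "(1 - ?z) * (\<Sum>a<N. cis (2 * pi * (real a * x $ j))) = 1 - ?z ^ N"
      by (simp add: one_diff_power_eq)
    then have "norm (1 - ?z) * ?f j = norm (1 - ?z ^ N)" by (simp flip: norm_mult)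
    also have "\<dots> \<le> 2" using norm_triangle_ineq4[of 1 "?z ^ N"] by (simp add: norm_power)
    finally show ?thesis unfolding norm_1_minus_cis by simp
  qed
  have "norm (dirichlet N x) = (\<Prod>i\<in>UNIV. ?f i)" by (simp add: dirichlet_def prod_norm)
  also have "\<dots> = ?f j * (\<Prod>i\<in>UNIV - {j}. ?f i)" by (rule prod.remove) auto
  finally have "\<bar>sin (pi * x $ j)\<bar> * norm (dirichlet N x) = (\<bar>sin (pi * x $ j)\<bar> * ?f j) * (\<Prod>i\<in>UNIV - {j}. ?f i)" by simp
  also have "\<dots> \<le> 1 * (\<Prod>i\<in>UNIV - {j}. real N)"
    using g f by (intro mult_mono prod_mono prod_nonneg) auto
  also have "\<dots> = real N ^ (CARD('d) - 1)" by (simp add: card_Diff_singleton)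
  finally have "\<bar>sin (pi * x $ j)\<bar> * norm (dirichlet N x) * real N \<le> real N ^ (CARD('d) - 1) * real N"
    by (intro mult_right_mono) auto
  also have "\<dots> = real N ^ CARD('d)"
    using zero_less_card_finite[where 'a = 'd] by (metis Suc_diff_1 power_Suc2)
  finally show ?thesis .
qed

text \<open>A lower bound in the single coordinate \<open>i0\<close> is enough: for positive
  \<open>N\<close> it excludes the frequency 0, keeps the norm at least \<open>N\<close>, and
  separates the sets for different powers of 8.\<close>

definition annulus :: "'d \<Rightarrow> nat \<Rightarrow> (real ^ 'd::finite) set" where
  "annulus i0 N = {\<xi> \<in> int_box (5 * N). real N \<le> \<bar>\<xi> $ i0\<bar>}"

text \<open>The product with \<open>kerW\<close> is the fourth power of the modulus of the Dirichlet
  kernel, as in Jackson's kernel, shifted by \<open>3 * N\<close> along \<open>i0\<close>: there the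
  intervals [3 N, 5 N] and [- 2 N, 0] add up to [N, 5 N]. It is kept as two squares, each bounded in
  quadratic mean, so that Cauchy-Schwarz bounds the product in mean.\<close>

definition kerU :: "'d \<Rightarrow> nat \<Rightarrow> real ^ 'd::finite \<Rightarrow> complex" where
  "kerU i0 N x = ee (real (3 * N) *\<^sub>R axis i0 1) x * (dirichlet N x * dirichlet N x)"

definition kerW :: "nat \<Rightarrow> real ^ 'd::finite \<Rightarrow> complex" where
  "kerW N x = cnj (dirichlet N x * dirichlet N x)"

text \<open>For positive \<open>N\<close> the normalisation keeps the integral of the modulus at
  most 1, while the value at 0 is \<open>real N ^ CARD('d)\<close>.\<close>

definition ker :: "'d \<Rightarrow> nat \<Rightarrow> real ^ 'd::finite \<Rightarrow> real" where
  "ker i0 N x = Re (kerU i0 N x * kerW N x) / real N ^ (3 * CARD('d))"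

lemma freq_set_annulus: "freq_set (annulus i0 N)"
  unfolding annulus_def by (rule freq_set_int_box)

lemma trig_dirichlet2:
  "trig {\<xi> \<in> int_box (2 * N). \<forall>i. 0 \<le> \<xi> $ i} (\<lambda>x :: real ^ 'd::finite. dirichlet N x * dirichlet N x)"
proof (rule trig_mult[OF trig_dirichlet trig_dirichlet])
  fix \<xi> \<eta> :: "real ^ 'd"
  assume a: "\<xi> \<in> {\<xi> \<in> int_box N. \<forall>i. 0 \<le> \<xi> $ i}" "\<eta> \<in> {\<xi> \<in> int_box N. \<forall>i. 0 \<le> \<xi> $ i}"
  have "\<bar>\<xi> $ i + \<eta> $ i\<bar> \<le> 2 * real N" for i
  proof -
    have "\<bar>\<xi> $ i\<bar> \<le> real N" "\<bar>\<eta> $ i\<bar> \<le> real N" using a by (auto simp: int_box_def)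
    then show ?thesis by linarith
  qed
  then show "\<xi> + \<eta> \<in> {\<xi> \<in> int_box (2 * N). \<forall>i. 0 \<le> \<xi> $ i}"
    using a by (auto simp: int_box_def int_vectors_add)
qed simp_all

abbreviation freqsU :: "'d \<Rightarrow> nat \<Rightarrow> (real ^ 'd::finite) set" where
  "freqsU i0 N \<equiv> {\<xi> \<in> int_box (5 * N). \<forall>i. (if i = i0 then 3 * real N else 0) \<le> \<xi> $ i \<and> \<xi> $ i \<le> (if i = i0 then 5 * real N else 2 * real N)}"

abbreviation freqsW :: "nat \<Rightarrow> (real ^ 'd::finite) set" where
  "freqsW N \<equiv> {\<xi> \<in> int_box (2 * N). \<forall>i. \<xi> $ i \<le> 0}"

lemma trig_kerU:
  fixes i0 :: "'d::finite"
  shows "trig (freqsU i0 N) (kerU i0 N)"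
proof -
  let ?e = "real (3 * N) *\<^sub>R axis i0 1 :: real ^ 'd"
  have fe: "?e \<in> int_vectors" by (auto simp: int_vectors_def axis_def)
  have e: "trig {?e} (ee ?e)" unfolding trig_def by (rule exI[of _ "\<lambda>_. 1"]) (auto simp: tp_def)
  have "trig (freqsU i0 N) (\<lambda>x. ee ?e x * (dirichlet N x * dirichlet N x))"
  proof (rule trig_mult[OF e trig_dirichlet2])
    fix \<xi> \<eta> :: "real ^ 'd"
    assume a: "\<xi> \<in> {?e}" "\<eta> \<in> {\<xi> \<in> int_box (2 * N). \<forall>i. 0 \<le> \<xi> $ i}"
    have \<eta>: "\<eta> \<in> int_vectors" "0 \<le> \<eta> $ i" "\<eta> $ i \<le> 2 * real N" for i
      using a by (auto simp: int_box_def abs_le_iff)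
    have "(\<xi> + \<eta>) $ i = (if i = i0 then 3 * real N else 0) + \<eta> $ i" for i using a by (simp add: axis_def)
    moreover have "\<xi> + \<eta> \<in> int_vectors" using a fe \<eta>(1) by (auto intro: int_vectors_add)
    ultimately show "\<xi> + \<eta> \<in> freqsU i0 N"
      using \<eta>(2,3) by (auto simp: int_box_def abs_le_iff intro: order.trans[OF _ order.trans])
        (smt (verit) of_nat_0_le_iff)+
  qed simp_all
  then show ?thesis by (simp add: kerU_def[abs_def])
qed

lemma trig_kerW: "trig (freqsW N) (kerW N)"
  unfolding kerW_def[abs_def]
  by (rule trig_cnj[OF trig_dirichlet2])
     (simp_all, auto simp: int_box_def int_vectors_minus)

text \<open>The real part is half the sum with the conjugate. Conjugation reflects the spectrum, and
  the modulus in \<open>annulus\<close> makes that set symmetric.\<close>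

lemma trig_ker:
  fixes i0 :: "'d::finite"
  shows "trig (annulus i0 N) (\<lambda>x. complex_of_real (ker i0 N x))"
proof -
  have 1: "trig {\<xi> \<in> int_box (5 * N). real N \<le> \<xi> $ i0} (\<lambda>x. kerU i0 N x * kerW N x)"
  proof (rule trig_mult[OF trig_kerU trig_kerW])
    fix \<xi> \<eta> :: "real ^ 'd" assume a: "\<xi> \<in> freqsU i0 N" "\<eta> \<in> freqsW N"
    have \<xi>: "(if i = i0 then 3 * real N else 0) \<le> \<xi> $ i" "\<xi> $ i \<le> 5 * real N" for i
      using a(1) by (auto simp: int_box_def abs_le_iff)
    have \<eta>: "- 2 * real N \<le> \<eta> $ i" "\<eta> $ i \<le> 0" for i
      using a(2) by (auto simp: int_box_def abs_le_iff) (smt (verit))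
    have "\<bar>\<xi> $ i + \<eta> $ i\<bar> \<le> 5 * real N" for i
      using \<xi>[of i] \<eta>[of i] by (simp add: abs_le_iff split: if_splits)
    moreover have "real N \<le> \<xi> $ i0 + \<eta> $ i0" using \<xi>[of i0] \<eta>[of i0] by simp
    moreover have "\<xi> + \<eta> \<in> int_vectors" using a by (auto simp: int_box_def intro: int_vectors_add)
    ultimately show "\<xi> + \<eta> \<in> {\<xi> \<in> int_box (5 * N). real N \<le> \<xi> $ i0}" by (auto simp: int_box_def)
  qed simp_all
  have fin: "finite (annulus i0 N)" using freq_set_annulus by (auto simp: freq_set_def)
  have 2: "trig (annulus i0 N) (\<lambda>x. kerU i0 N x * kerW N x)"
    by (rule trig_mono[OF 1 _ fin]) (auto simp: annulus_def)
  have 3: "trig (annulus i0 N) (\<lambda>x. cnj (kerU i0 N x * kerW N x))"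
    by (rule trig_cnj[OF 2 fin fin]) (auto simp: annulus_def int_box_def int_vectors_minus)
  have "complex_of_real (Re z / c) = (1 / (2 * complex_of_real c)) * (z + cnj z)" for z c
    by (simp add: complex_add_cnj)
  then have "complex_of_real (ker i0 N x) = (1 / (2 * complex_of_real (real N ^ (3 * CARD('d))))) * (kerU i0 N x * kerW N x + cnj (kerU i0 N x * kerW N x))" for x
    unfolding ker_def by blast
  then show ?thesis by (simp only: trig_cmult[OF trig_add[OF 2 3]])
qed

section \<open>Mean bounds for the kernel and its derivatives\<close>

context
  fixes i0 :: "'d::finite" and N :: nat
  assumes N: "0 < N"
begin

lemma power_cube_eq: "(real N ^ k)\<^sup>2 * real N ^ k = real N ^ (3 * k)"
proof -
  have "3 * k = k * 2 + k" by simp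
  then show ?thesis by (simp only: power_add power_mult)
qed

lemma norm_kerU: "norm (kerU i0 N x) = (norm (dirichlet N x))\<^sup>2"
  and norm_kerW: "norm (kerW N x) = (norm (dirichlet N x))\<^sup>2"
  by (simp_all add: kerU_def kerW_def norm_mult power2_eq_square)

lemma dirichlet_meas: "(\<lambda>y. dirichlet N (x - y :: real ^ 'd)) \<in> borel_measurable borel"
  by (rule measurable_compose[of "\<lambda>y. x - y" _ borel]) (auto intro: trig_measurable[OF trig_dirichlet])

text \<open>One of the two factors in the squared modulus absorbs the weight pointwise, and the
  other is integrated by Parseval's identity.\<close>

lemma weighted_dirichlet_L2:
  assumes w: "w \<in> borel_measurable borel" "\<And>y. 0 \<le> w y" "\<And>y. w y * norm (dirichlet N (x - y :: real ^ 'd)) \<le> A" "0 \<le> A"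
  shows "(\<integral>y. (w y * (norm (dirichlet N (x - y)))\<^sup>2)\<^sup>2 \<partial>unit_cube) \<le> A\<^sup>2 * real N ^ CARD('d)"
proof -
  note [measurable] = dirichlet_meas w(1)
  have le: "(w y * (norm (dirichlet N (x - y)))\<^sup>2)\<^sup>2 \<le> A\<^sup>2 * (norm (dirichlet N (x - y)))\<^sup>2" for y
  proof -
    have "(w y * (norm (dirichlet N (x - y)))\<^sup>2)\<^sup>2 = (w y * norm (dirichlet N (x - y)))\<^sup>2 * (norm (dirichlet N (x - y)))\<^sup>2"
      by (simp add: power2_eq_square)
    also have "\<dots> \<le> A\<^sup>2 * (norm (dirichlet N (x - y)))\<^sup>2"
      using w by (intro mult_right_mono power_mono) auto
    finally show ?thesis .
  qed
  have n2: "A\<^sup>2 * (norm (dirichlet N (x - y)))\<^sup>2 \<le> A\<^sup>2 * (real N ^ CARD('d))\<^sup>2" for y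
    by (intro mult_left_mono power_mono norm_dirichlet_le) auto
  have "(\<integral>y. (w y * (norm (dirichlet N (x - y)))\<^sup>2)\<^sup>2 \<partial>unit_cube) \<le> (\<integral>y. A\<^sup>2 * (norm (dirichlet N (x - y)))\<^sup>2 \<partial>unit_cube)"
  proof (rule integral_mono)
    show "integrable unit_cube (\<lambda>y. (w y * (norm (dirichlet N (x - y)))\<^sup>2)\<^sup>2)"
      using order.trans[OF le n2] by (intro unit_cube_integrable[where K = "A\<^sup>2 * (real N ^ CARD('d))\<^sup>2"]) auto
    show "integrable unit_cube (\<lambda>y. A\<^sup>2 * (norm (dirichlet N (x - y)))\<^sup>2)"
      using n2 by (intro unit_cube_integrable[where K = "A\<^sup>2 * (real N ^ CARD('d))\<^sup>2"]) auto
  qed (rule le)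
  also have "\<dots> = A\<^sup>2 * real N ^ CARD('d)" by (simp add: dirichlet_L2)
  finally show ?thesis .
qed

lemma dirichlet4_L2: "(\<integral>y. ((norm (dirichlet N (x - y :: real ^ 'd)))\<^sup>2)\<^sup>2 \<partial>unit_cube) \<le> (sqrt (real N ^ (3 * CARD('d))))\<^sup>2"
proof -
  have "(\<integral>y. (1 * (norm (dirichlet N (x - y :: real ^ 'd)))\<^sup>2)\<^sup>2 \<partial>unit_cube) \<le> (real N ^ CARD('d))\<^sup>2 * real N ^ CARD('d)"
    by (rule weighted_dirichlet_L2) (auto simp: norm_dirichlet_le)
  also have "\<dots> = (sqrt (real N ^ (3 * CARD('d))))\<^sup>2" by (simp add: power_cube_eq)
  finally show ?thesis by simp
qed

lemma sin_dirichlet4_L2: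
  "(\<integral>y. (\<bar>sin (pi * (x - y) $ j)\<bar> * (norm (dirichlet N (x - y :: real ^ 'd)))\<^sup>2)\<^sup>2 \<partial>unit_cube) \<le> (sqrt (real N ^ (3 * CARD('d))) / real N)\<^sup>2"
proof -
  have "(\<integral>y. (\<bar>sin (pi * (x - y) $ j)\<bar> * (norm (dirichlet N (x - y :: real ^ 'd)))\<^sup>2)\<^sup>2 \<partial>unit_cube)
     \<le> (real N ^ CARD('d) / real N)\<^sup>2 * real N ^ CARD('d)"
  proof (rule weighted_dirichlet_L2)
    show "\<bar>sin (pi * (x - y) $ j)\<bar> * norm (dirichlet N (x - y)) \<le> real N ^ CARD('d) / real N" for y
      using sin_dirichlet_le[OF N, of "x - y" j] N by (simp add: le_divide_eq)
    show "(\<lambda>y. \<bar>sin (pi * (x - y) $ j)\<bar>) \<in> borel_measurable borel"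
      by (intro borel_measurable_continuous_onI continuous_intros)
  qed auto
  also have "\<dots> = (sqrt (real N ^ (3 * CARD('d))) / real N)\<^sup>2" by (simp add: power_divide power_cube_eq[symmetric])
  finally show ?thesis .
qed

lemma trig_product_bound:
  fixes S T :: "real ^ 'd \<Rightarrow> complex"
  assumes S: "trig \<Phi> S" and T: "trig \<Psi> T" and w: "w \<in> borel_measurable borel" "\<And>y. \<bar>w y\<bar> \<le> (1 :: real)"
    and a: "(\<integral>y. (norm (S (x - y)))\<^sup>2 \<partial>unit_cube) \<le> a\<^sup>2" "0 < a"
    and b: "(\<integral>y. (\<bar>w y\<bar> * norm (T (x - y)))\<^sup>2 \<partial>unit_cube) \<le> b\<^sup>2" "0 < b"
  shows "(\<integral>y. \<bar>w y\<bar> * (norm (S (x - y)) * norm (T (x - y))) \<partial>unit_cube) \<le> a * b"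
    "integrable unit_cube (\<lambda>y. \<bar>w y\<bar> * (norm (S (x - y)) * norm (T (x - y))))"
proof -
  obtain K L where K: "\<And>y. norm (S y) \<le> K" and L: "\<And>y. norm (T y) \<le> L"
    using trig_bounded[OF S] trig_bounded[OF T] by auto
  have [measurable]: "(\<lambda>y. S (x - y)) \<in> borel_measurable borel" "(\<lambda>y. T (x - y)) \<in> borel_measurable borel"
    by (rule measurable_compose[of "\<lambda>y. x - y" _ borel], simp, rule trig_measurable, fact)+
  note [measurable] = w(1)
  have L0: "0 \<le> L" "0 \<le> K" using L K norm_ge_zero order.trans by blast+
  have wT: "\<bar>w y\<bar> * norm (T (x - y)) \<le> 1 * L" for y using w(2) L L0 by (intro mult_mono) auto
  have "(\<integral>y. \<bar>norm (S (x - y))\<bar> * \<bar>\<bar>w y\<bar> * norm (T (x - y))\<bar> \<partial>unit_cube) \<le> a * b"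
    by (rule cauchy_schwarz_bound[where K = K and L = L]) (use K wT a b in auto)
  then show "(\<integral>y. \<bar>w y\<bar> * (norm (S (x - y)) * norm (T (x - y))) \<partial>unit_cube) \<le> a * b"
    by (simp add: abs_mult mult.left_commute)
  have "\<bar>w y\<bar> * (norm (S (x - y)) * norm (T (x - y))) \<le> 1 * (K * L)" for y
    using w(2) K L L0 by (intro mult_mono) auto
  then show "integrable unit_cube (\<lambda>y. \<bar>w y\<bar> * (norm (S (x - y)) * norm (T (x - y))))"
    by (intro unit_cube_integrable[where K = "K * L"]) auto
qed

text \<open>A common bound for both factors, so that each derivative, on whichever factor it falls,
  costs the same \<open>10 * pi * real N\<close> in quadratic mean.\<close>

lemma freqs_bound:
  shows "\<xi> \<in> freqsU i0 N \<Longrightarrow> \<bar>\<xi> $ i\<bar> \<le> 5 * real N" and "\<eta> \<in> freqsW N \<Longrightarrow> \<bar>\<eta> $ i\<bar> \<le> 5 * real N"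
proof -
  show "\<bar>\<xi> $ i\<bar> \<le> 5 * real N" if "\<xi> \<in> freqsU i0 N" using that by (simp add: int_box_def)
  have "\<bar>\<eta> $ i\<bar> \<le> 2 * real N" if "\<eta> \<in> freqsW N"
    using that unfolding int_box_def mem_Collect_eq of_nat_mult of_nat_numeral by blast
  then show "\<bar>\<eta> $ i\<bar> \<le> 5 * real N" if "\<eta> \<in> freqsW N" using that by fastforce
qed

lemma kerU_L2:
  "(\<integral>y. (norm (kerU i0 N (x - y)))\<^sup>2 \<partial>unit_cube) \<le> (sqrt (real N ^ (3 * CARD('d))))\<^sup>2"
  "(\<integral>y. (norm (pd i (kerU i0 N) (x - y)))\<^sup>2 \<partial>unit_cube) \<le> (10 * pi * real N * sqrt (real N ^ (3 * CARD('d))))\<^sup>2"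
  "(\<integral>y. (norm (pd j (pd i (kerU i0 N)) (x - y)))\<^sup>2 \<partial>unit_cube) \<le> ((10 * pi * real N)\<^sup>2 * sqrt (real N ^ (3 * CARD('d))))\<^sup>2"
proof -
  show 1: "(\<integral>y. (norm (kerU i0 N (x - y)))\<^sup>2 \<partial>unit_cube) \<le> (sqrt (real N ^ (3 * CARD('d))))\<^sup>2" for x
    unfolding norm_kerU by (rule dirichlet4_L2)
  note F = freq_set_int_box[of "5 * N" "\<lambda>\<xi>. \<forall>i. (if i = i0 then 3 * real N else 0) \<le> \<xi> $ i \<and> \<xi> $ i \<le> (if i = i0 then 5 * real N else 2 * real N)"]
  have step: "(\<integral>y. (norm (pd i T (x - y)))\<^sup>2 \<partial>unit_cube) \<le> (10 * pi * real N * a)\<^sup>2"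
    if T: "trig (freqsU i0 N) T" "\<And>x. (\<integral>y. (norm (T (x - y)))\<^sup>2 \<partial>unit_cube) \<le> a\<^sup>2" for T a i x
  proof -
    have "(\<integral>y. (norm (pd i T (x - y)))\<^sup>2 \<partial>unit_cube) \<le> (2 * pi * (5 * real N))\<^sup>2 * (\<integral>y. (norm (T y))\<^sup>2 \<partial>unit_cube)"
      by (rule bernstein_L2[OF F T(1)]) (rule freqs_bound)
    also have "\<dots> \<le> (2 * pi * (5 * real N))\<^sup>2 * a\<^sup>2"
      using T(2)[of 0] trig_L2_reflect[OF F T(1), of 0] by (intro mult_left_mono) auto
    finally show ?thesis by (simp add: power_mult_distrib)
  qed
  show 2: "(\<integral>y. (norm (pd i (kerU i0 N) (x - y)))\<^sup>2 \<partial>unit_cube) \<le> (10 * pi * real N * sqrt (real N ^ (3 * CARD('d))))\<^sup>2" for x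
    by (rule step[OF trig_kerU 1])
  have "(\<integral>y. (norm (pd j (pd i (kerU i0 N)) (x - y)))\<^sup>2 \<partial>unit_cube) \<le> (10 * pi * real N * (10 * pi * real N * sqrt (real N ^ (3 * CARD('d)))))\<^sup>2"
    by (rule step[OF trig_pd[OF trig_kerU] 2])
  then show "(\<integral>y. (norm (pd j (pd i (kerU i0 N)) (x - y)))\<^sup>2 \<partial>unit_cube) \<le> ((10 * pi * real N)\<^sup>2 * sqrt (real N ^ (3 * CARD('d))))\<^sup>2"
    by (simp add: power2_eq_square mult.assoc)
qed

lemma kerW_L2:
  "(\<integral>y. (norm (kerW N (x - y :: real ^ 'd)))\<^sup>2 \<partial>unit_cube) \<le> (sqrt (real N ^ (3 * CARD('d))))\<^sup>2"
  "(\<integral>y. (norm (pd i (kerW N) (x - y :: real ^ 'd)))\<^sup>2 \<partial>unit_cube) \<le> (10 * pi * real N * sqrt (real N ^ (3 * CARD('d))))\<^sup>2"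
  "(\<integral>y. (norm (pd j (pd i (kerW N)) (x - y :: real ^ 'd)))\<^sup>2 \<partial>unit_cube) \<le> ((10 * pi * real N)\<^sup>2 * sqrt (real N ^ (3 * CARD('d))))\<^sup>2"
proof -
  show 1: "(\<integral>y. (norm (kerW N (x - y :: real ^ 'd)))\<^sup>2 \<partial>unit_cube) \<le> (sqrt (real N ^ (3 * CARD('d))))\<^sup>2" for x
    unfolding norm_kerW by (rule dirichlet4_L2)
  note F = freq_set_int_box[of "2 * N" "\<lambda>\<xi> :: real ^ 'd. \<forall>i. \<xi> $ i \<le> 0"]
  have step: "(\<integral>y. (norm (pd i T (x - y)))\<^sup>2 \<partial>unit_cube) \<le> (10 * pi * real N * a)\<^sup>2"
    if T: "trig (freqsW N) T" "\<And>x. (\<integral>y. (norm (T (x - y)))\<^sup>2 \<partial>unit_cube) \<le> a\<^sup>2" for T :: "real ^ 'd \<Rightarrow> complex" and a i x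
  proof -
    have "(\<integral>y. (norm (pd i T (x - y)))\<^sup>2 \<partial>unit_cube) \<le> (2 * pi * (5 * real N))\<^sup>2 * (\<integral>y. (norm (T y))\<^sup>2 \<partial>unit_cube)"
      by (rule bernstein_L2[OF F T(1)]) (rule freqs_bound)
    also have "\<dots> \<le> (2 * pi * (5 * real N))\<^sup>2 * a\<^sup>2"
      using T(2)[of 0] trig_L2_reflect[OF F T(1), of 0] by (intro mult_left_mono) auto
    finally show ?thesis by (simp add: power_mult_distrib)
  qed
  show 2: "(\<integral>y. (norm (pd i (kerW N) (x - y :: real ^ 'd)))\<^sup>2 \<partial>unit_cube) \<le> (10 * pi * real N * sqrt (real N ^ (3 * CARD('d))))\<^sup>2" for x
    by (rule step[OF trig_kerW 1])
  have "(\<integral>y. (norm (pd j (pd i (kerW N)) (x - y :: real ^ 'd)))\<^sup>2 \<partial>unit_cube) \<le> (10 * pi * real N * (10 * pi * real N * sqrt (real N ^ (3 * CARD('d)))))\<^sup>2"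
    by (rule step[OF trig_pd[OF trig_kerW] 2])
  then show "(\<integral>y. (norm (pd j (pd i (kerW N)) (x - y :: real ^ 'd)))\<^sup>2 \<partial>unit_cube) \<le> ((10 * pi * real N)\<^sup>2 * sqrt (real N ^ (3 * CARD('d))))\<^sup>2"
    by (simp add: power2_eq_square mult.assoc)
qed

lemma bounded_linear_ker: "bounded_linear (\<lambda>z. Re z / (real N ^ (3 * CARD('d))))"
  using bounded_linear_compose[OF bounded_linear_divide bounded_linear_Re] by simp

lemma pd_ker: "pd i (ker i0 N) = (\<lambda>x. Re (kerU i0 N x * pd i (kerW N) x + pd i (kerU i0 N) x * kerW N x) / (real N ^ (3 * CARD('d))))"
  unfolding ker_def[abs_def]
proof -
  have pw: "pdiff i (\<lambda>x. kerU i0 N x * kerW N x)"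
    by (rule pdiff_mult[OF trig_pdiff[OF trig_kerU] trig_pdiff[OF trig_kerW]])
  show "pd i (\<lambda>x. Re (kerU i0 N x * kerW N x) / (real N ^ (3 * CARD('d)))) = (\<lambda>x. Re (kerU i0 N x * pd i (kerW N) x + pd i (kerU i0 N) x * kerW N x) / (real N ^ (3 * CARD('d))))"
    by (subst pd_linear(1)[OF bounded_linear_ker pw])
       (simp add: pd_mult[OF trig_pdiff[OF trig_kerU] trig_pdiff[OF trig_kerW]])
qed

lemma pd_pd_ker: "pd j (pd i (ker i0 N)) = (\<lambda>x. Re (kerU i0 N x * pd j (pd i (kerW N)) x + pd j (kerU i0 N) x * pd i (kerW N) x
   + (pd i (kerU i0 N) x * pd j (kerW N) x + pd j (pd i (kerU i0 N)) x * kerW N x)) / real N ^ (3 * CARD('d)))"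
proof -
  note U = trig_kerU[of N i0] and W = trig_kerW[of N]
  have 1: "pdiff j (\<lambda>x. kerU i0 N x * pd i (kerW N) x)" "pdiff j (\<lambda>x. pd i (kerU i0 N) x * kerW N x)"
    by (intro pdiff_mult trig_pdiff[OF U] trig_pdiff[OF W] trig_pdiff[OF trig_pd[OF U]] trig_pdiff[OF trig_pd[OF W]])+
  have 2: "pdiff j (\<lambda>x. kerU i0 N x * pd i (kerW N) x + pd i (kerU i0 N) x * kerW N x)"
    by (rule pd_eqI(2)) (use 1 in \<open>auto simp: pdiff_def intro!: has_vector_derivative_add\<close>)
  show ?thesis
    unfolding pd_ker
    by (subst pd_linear(1)[OF bounded_linear_ker 2], subst pd_add[OF 1])
       (simp only: pd_mult[OF trig_pdiff[OF U] trig_pdiff[OF trig_pd[OF W]]]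
         pd_mult[OF trig_pdiff[OF trig_pd[OF U]] trig_pdiff[OF W]])
qed

lemma product_bound:
  fixes S T :: "real ^ 'd \<Rightarrow> complex"
  assumes "trig \<Phi> S" "trig \<Psi> T"
    and "(\<integral>y. (norm (S (x - y)))\<^sup>2 \<partial>unit_cube) \<le> (a * sqrt (real N ^ (3 * CARD('d))))\<^sup>2" "0 < a"
    and "(\<integral>y. (norm (T (x - y)))\<^sup>2 \<partial>unit_cube) \<le> (b * sqrt (real N ^ (3 * CARD('d))))\<^sup>2" "0 < b"
  shows "(\<integral>y. norm (S (x - y)) * norm (T (x - y)) \<partial>unit_cube) \<le> a * b * real N ^ (3 * CARD('d))"
    "integrable unit_cube (\<lambda>y. norm (S (x - y)) * norm (T (x - y)))"
proof -
  let ?n = "sqrt (real N ^ (3 * CARD('d)))"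
  have n: "0 < ?n" using N by simp
  have nn: "?n * ?n = real N ^ (3 * CARD('d))" by simp
  have "(\<integral>y. (\<bar>1\<bar> * norm (T (x - y)))\<^sup>2 \<partial>unit_cube) \<le> (b * ?n)\<^sup>2" using assms(5) by simp
  from trig_product_bound[OF assms(1,2) _ _ assms(3) _ this] assms(4,6) n
  have "(\<integral>y. \<bar>1\<bar> * (norm (S (x - y)) * norm (T (x - y))) \<partial>unit_cube) \<le> (a * ?n) * (b * ?n)"
    and I: "integrable unit_cube (\<lambda>y. \<bar>1\<bar> * (norm (S (x - y)) * norm (T (x - y))))" by simp_all
  moreover have "(a * ?n) * (b * ?n) = a * b * (?n * ?n)" by (simp only: mult_ac)
  ultimately show "(\<integral>y. norm (S (x - y)) * norm (T (x - y)) \<partial>unit_cube) \<le> a * b * real N ^ (3 * CARD('d))"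
    unfolding nn by simp
  show "integrable unit_cube (\<lambda>y. norm (S (x - y)) * norm (T (x - y)))" using I by simp
qed

lemma ker_measurable:
  "ker i0 N \<in> borel_measurable borel" "pd i (ker i0 N) \<in> borel_measurable borel"
  "pd j (pd i (ker i0 N)) \<in> borel_measurable borel"
proof -
  note [measurable] = trig_measurable[OF trig_kerU[of N i0]] trig_measurable[OF trig_kerW[of N]]
    trig_measurable[OF trig_pd[OF trig_kerU[of N i0]]] trig_measurable[OF trig_pd[OF trig_kerW[of N]]]
    trig_measurable[OF trig_pd[OF trig_pd[OF trig_kerU[of N i0]]]] trig_measurable[OF trig_pd[OF trig_pd[OF trig_kerW[of N]]]]
  show "ker i0 N \<in> borel_measurable borel" unfolding ker_def[abs_def] by measurable
  show "pd i (ker i0 N) \<in> borel_measurable borel" unfolding pd_ker by measurable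
  show "pd j (pd i (ker i0 N)) \<in> borel_measurable borel" unfolding pd_pd_ker by measurable
qed

lemma integral_dominated_le:
  fixes f g :: "real ^ 'd \<Rightarrow> real"
  assumes "integrable unit_cube g" "(\<integral>y. g y \<partial>unit_cube) \<le> c" "\<And>y. 0 \<le> f y" "\<And>y. f y \<le> g y"
  shows "(\<integral>y. f y \<partial>unit_cube) \<le> c"
  using integral_mono'[OF assms(1) assms(4) order.trans[OF assms(3,4)]] assms(2) by linarith

lemma ker_L1: "(\<integral>y. \<bar>ker i0 N (x - y)\<bar> \<partial>unit_cube) \<le> 1"
proof (rule integral_dominated_le)
  let ?n = "real N ^ (3 * CARD('d))"
  have n: "0 < ?n" using N by simp
  note p = product_bound[OF trig_kerU trig_kerW, where x = x and a = 1 and b = 1]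
  show "integrable unit_cube (\<lambda>y. (norm (kerU i0 N (x - y)) * norm (kerW N (x - y))) / ?n)"
    using p(2) kerU_L2(1) kerW_L2(1) by simp
  show "(\<integral>y. (norm (kerU i0 N (x - y)) * norm (kerW N (x - y))) / ?n \<partial>unit_cube) \<le> 1"
    using p(1) kerU_L2(1) kerW_L2(1) n by (simp add: divide_le_eq)
  show "\<bar>ker i0 N (x - y)\<bar> \<le> (norm (kerU i0 N (x - y)) * norm (kerW N (x - y))) / ?n" for y
    unfolding ker_def abs_divide norm_mult[symmetric]
    using n abs_Re_le_cmod[of "kerU i0 N (x - y) * kerW N (x - y)"] by (simp add: divide_right_mono)
qed simp

lemma pd_ker_abs_le:
  "\<bar>pd i (ker i0 N) z\<bar> \<le> (norm (kerU i0 N z) * norm (pd i (kerW N) z) + norm (pd i (kerU i0 N) z) * norm (kerW N z)) / real N ^ (3 * CARD('d))"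
proof -
  have "\<bar>Re (kerU i0 N z * pd i (kerW N) z + pd i (kerU i0 N) z * kerW N z)\<bar>
     \<le> norm (kerU i0 N z) * norm (pd i (kerW N) z) + norm (pd i (kerU i0 N) z) * norm (kerW N z)"
    unfolding norm_mult[symmetric] by (rule order.trans[OF abs_Re_le_cmod norm_triangle_ineq])
  then show ?thesis unfolding pd_ker by (simp add: divide_right_mono)
qed

text \<open>The product rule leaves two terms of at most \<open>10 * pi * real N\<close> each, by
  Cauchy-Schwarz. For second derivatives there are four terms of at most the square of this.\<close>

lemma pd_ker_L1: "(\<integral>y. \<bar>pd i (ker i0 N) (x - y)\<bar> \<partial>unit_cube) \<le> 20 * pi * real N"
proof (rule integral_dominated_le[OF _ _ _ pd_ker_abs_le])
  let ?n = "real N ^ (3 * CARD('d))"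
  have n: "0 < ?n" using N by simp
  note p = product_bound[OF trig_kerU trig_pd[OF trig_kerW], where x = x and a = 1 and b = "10 * pi * real N"]
  note q = product_bound[OF trig_pd[OF trig_kerU] trig_kerW, where x = x and a = "10 * pi * real N" and b = 1]
  have P: "0 < 10 * pi * real N" using N by simp
  have p': "(\<integral>y. norm (kerU i0 N (x - y)) * norm (pd i (kerW N) (x - y)) \<partial>unit_cube) \<le> 1 * (10 * pi * real N) * ?n"
    "integrable unit_cube (\<lambda>y. norm (kerU i0 N (x - y)) * norm (pd i (kerW N) (x - y)))"
    using p kerU_L2(1) kerW_L2(2) P by auto
  have q': "(\<integral>y. norm (pd i (kerU i0 N) (x - y)) * norm (kerW N (x - y)) \<partial>unit_cube) \<le> (10 * pi * real N) * 1 * ?n"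
    "integrable unit_cube (\<lambda>y. norm (pd i (kerU i0 N) (x - y)) * norm (kerW N (x - y)))"
    using q kerU_L2(2) kerW_L2(1) P by auto
  show "integrable unit_cube (\<lambda>y. (norm (kerU i0 N (x - y)) * norm (pd i (kerW N) (x - y)) + norm (pd i (kerU i0 N) (x - y)) * norm (kerW N (x - y))) / ?n)"
    using p'(2) q'(2) by simp
  show "(\<integral>y. (norm (kerU i0 N (x - y)) * norm (pd i (kerW N) (x - y)) + norm (pd i (kerU i0 N) (x - y)) * norm (kerW N (x - y))) / ?n \<partial>unit_cube) \<le> 20 * pi * real N"
    using p' q' n by (simp add: divide_le_eq)
qed simp

lemma pd_pd_ker_L1: "(\<integral>y. \<bar>pd j (pd i (ker i0 N)) (x - y)\<bar> \<partial>unit_cube) \<le> (20 * pi * real N)\<^sup>2"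
proof (rule integral_dominated_le)
  let ?n = "real N ^ (3 * CARD('d))"
  let ?P = "10 * pi * real N"
  let ?g = "\<lambda>y. (norm (kerU i0 N (x - y)) * norm (pd j (pd i (kerW N)) (x - y)) + norm (pd j (kerU i0 N) (x - y)) * norm (pd i (kerW N) (x - y))
     + (norm (pd i (kerU i0 N) (x - y)) * norm (pd j (kerW N) (x - y)) + norm (pd j (pd i (kerU i0 N)) (x - y)) * norm (kerW N (x - y)))) / ?n"
  have n: "0 < ?n" using N by simp
  have P: "0 < ?P" "0 < ?P\<^sup>2" using N by simp_all
  have a: "(\<integral>y. norm (kerU i0 N (x - y)) * norm (pd j (pd i (kerW N)) (x - y)) \<partial>unit_cube) \<le> 1 * ?P\<^sup>2 * ?n"
    "integrable unit_cube (\<lambda>y. norm (kerU i0 N (x - y)) * norm (pd j (pd i (kerW N)) (x - y)))"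
    by (rule product_bound[OF trig_kerU trig_pd[OF trig_pd[OF trig_kerW]] _ zero_less_one _ P(2)]; use kerU_L2(1) kerW_L2(3) in simp)+
  have b: "(\<integral>y. norm (pd j (kerU i0 N) (x - y)) * norm (pd i (kerW N) (x - y)) \<partial>unit_cube) \<le> ?P * ?P * ?n"
    "integrable unit_cube (\<lambda>y. norm (pd j (kerU i0 N) (x - y)) * norm (pd i (kerW N) (x - y)))" for i j
    by (rule product_bound[OF trig_pd[OF trig_kerU] trig_pd[OF trig_kerW] kerU_L2(2) P(1) kerW_L2(2) P(1)])+
  have c: "(\<integral>y. norm (pd j (pd i (kerU i0 N)) (x - y)) * norm (kerW N (x - y)) \<partial>unit_cube) \<le> ?P\<^sup>2 * 1 * ?n"
    "integrable unit_cube (\<lambda>y. norm (pd j (pd i (kerU i0 N)) (x - y)) * norm (kerW N (x - y)))"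
    by (rule product_bound[OF trig_pd[OF trig_pd[OF trig_kerU]] trig_kerW _ P(2) _ zero_less_one]; use kerU_L2(3) kerW_L2(1) in simp)+
  show "integrable unit_cube ?g" using a(2) b(2) c(2) by simp
  have "(\<integral>y. ?g y \<partial>unit_cube) \<le> (1 * ?P\<^sup>2 * ?n + ?P * ?P * ?n + (?P * ?P * ?n + ?P\<^sup>2 * 1 * ?n)) / ?n"
  proof -
    have "(\<integral>y. ?g y \<partial>unit_cube) = ((\<integral>y. norm (kerU i0 N (x - y)) * norm (pd j (pd i (kerW N)) (x - y)) \<partial>unit_cube)
       + (\<integral>y. norm (pd j (kerU i0 N) (x - y)) * norm (pd i (kerW N) (x - y)) \<partial>unit_cube)
       + ((\<integral>y. norm (pd i (kerU i0 N) (x - y)) * norm (pd j (kerW N) (x - y)) \<partial>unit_cube)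
       + (\<integral>y. norm (pd j (pd i (kerU i0 N)) (x - y)) * norm (kerW N (x - y)) \<partial>unit_cube))) / ?n"
      using a(2) b(2) c(2) by simp
    also have "\<dots> \<le> (1 * ?P\<^sup>2 * ?n + ?P * ?P * ?n + (?P * ?P * ?n + ?P\<^sup>2 * 1 * ?n)) / ?n"
      using n by (intro divide_right_mono add_mono a(1) b(1) c(1)) simp
    finally show ?thesis .
  qed
  also have "\<dots> = (20 * pi * real N)\<^sup>2" using n by (simp add: field_simps power2_eq_square)
  finally show "(\<integral>y. ?g y \<partial>unit_cube) \<le> (20 * pi * real N)\<^sup>2" .
  show "\<bar>pd j (pd i (ker i0 N)) (x - y)\<bar> \<le> ?g y" for y
  proof -
    have tri: "\<bar>Re (a + b + (c + d))\<bar> \<le> norm a + norm b + (norm c + norm d)" for a b c d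
      using abs_Re_le_cmod[of "a + b + (c + d)"] norm_triangle_ineq[of "a + b" "c + d"] norm_triangle_ineq[of a b] norm_triangle_ineq[of c d] by linarith
    have ad: "\<bar>r / c\<bar> \<le> b / c" if "0 < c" "\<bar>r\<bar> \<le> b" for r c b :: real
      using that by (simp add: divide_right_mono)
    show ?thesis unfolding pd_pd_ker norm_mult[symmetric] by (rule ad[OF n tri])
  qed
qed simp

text \<open>The sine vanishes where the kernel peaks. It is put on the factor that is not
  differentiated, where its gain of \<open>1 / real N\<close> cancels the loss from the derivative;
  hence a bound free of \<open>N\<close>.\<close>

lemma sin_pd_ker_L1: "(\<integral>y. \<bar>sin (pi * (x - y) $ j)\<bar> * \<bar>pd i (ker i0 N) (x - y)\<bar> \<partial>unit_cube) \<le> 20 * pi"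
proof (rule integral_dominated_le)
  let ?n = "real N ^ (3 * CARD('d))"
  let ?P = "10 * pi * real N"
  let ?w = "\<lambda>y. sin (pi * (x - y) $ j)"
  let ?g = "\<lambda>y. (\<bar>?w y\<bar> * (norm (pd i (kerW N) (x - y)) * norm (kerU i0 N (x - y))) + \<bar>?w y\<bar> * (norm (pd i (kerU i0 N) (x - y)) * norm (kerW N (x - y)))) / ?n"
  have n: "0 < ?n" using N by simp
  have P: "0 < ?P * sqrt ?n" "0 < sqrt ?n / real N" using N by simp_all
  have w: "?w \<in> borel_measurable borel" by (intro borel_measurable_continuous_onI continuous_intros)
  have w1: "\<bar>?w y\<bar> \<le> 1" for y by simp
  have e: "?P * sqrt ?n * (sqrt ?n / real N) = 10 * pi * ?n"
  proof -
    have "?P * sqrt ?n * (sqrt ?n / real N) = 10 * pi * (sqrt ?n * sqrt ?n)" using N by (simp del: real_sqrt_mult_self)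
    then show ?thesis by simp
  qed
  have a: "(\<integral>y. \<bar>?w y\<bar> * (norm (pd i (kerW N) (x - y)) * norm (kerU i0 N (x - y))) \<partial>unit_cube) \<le> 10 * pi * ?n"
    "integrable unit_cube (\<lambda>y. \<bar>?w y\<bar> * (norm (pd i (kerW N) (x - y)) * norm (kerU i0 N (x - y))))"
    unfolding e[symmetric] using sin_dirichlet4_L2[of x j]
    by (intro trig_product_bound[OF trig_pd[OF trig_kerW] trig_kerU w w1 kerW_L2(2) P(1) _ P(2)]; simp add: norm_kerU)+
  have b: "(\<integral>y. \<bar>?w y\<bar> * (norm (pd i (kerU i0 N) (x - y)) * norm (kerW N (x - y))) \<partial>unit_cube) \<le> 10 * pi * ?n"
    "integrable unit_cube (\<lambda>y. \<bar>?w y\<bar> * (norm (pd i (kerU i0 N) (x - y)) * norm (kerW N (x - y))))"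
    unfolding e[symmetric] using sin_dirichlet4_L2[of x j]
    by (intro trig_product_bound[OF trig_pd[OF trig_kerU] trig_kerW w w1 kerU_L2(2) P(1) _ P(2)]; simp add: norm_kerW)+
  show "integrable unit_cube ?g" using a(2) b(2) by simp
  show "(\<integral>y. ?g y \<partial>unit_cube) \<le> 20 * pi" using a b n by (simp add: divide_le_eq)
  show "\<bar>?w y\<bar> * \<bar>pd i (ker i0 N) (x - y)\<bar> \<le> ?g y" for y
  proof -
    have "\<bar>?w y\<bar> * \<bar>pd i (ker i0 N) (x - y)\<bar> \<le> \<bar>?w y\<bar> * ((norm (kerU i0 N (x - y)) * norm (pd i (kerW N) (x - y)) + norm (pd i (kerU i0 N) (x - y)) * norm (kerW N (x - y))) / ?n)"
      by (intro mult_left_mono pd_ker_abs_le) simp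
    also have "\<dots> = ?g y" by (simp only: distrib_left times_divide_eq_right mult.commute[of "norm (kerU i0 N (x - y))"])
    finally show ?thesis .
  qed
qed simp

text \<open>A coefficient is at most the integral of the modulus, hence at most 1. The value at 0 is
  the sum of the coefficients, and Cauchy-Schwarz over at most
  \<open>(11 * real N) ^ CARD('d)\<close> frequencies bounds the sum of squares from below;
  \<open>11 * N\<close> dominates the side \<open>2 * (5 * N) + 1\<close> of the box.\<close>

lemma ker_coefficients:
  obtains a where "\<And>x. complex_of_real (ker i0 N x) = tp (annulus i0 N) a x"
    "\<And>\<xi>. \<xi> \<in> annulus i0 N \<Longrightarrow> norm (a \<xi>) \<le> 1"
    "real N ^ CARD('d) / 11 ^ CARD('d) \<le> (\<Sum>\<xi>\<in>annulus i0 N. (norm (a \<xi>))\<^sup>2)"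
    "real (card (annulus i0 N)) \<le> (11 * real N) ^ CARD('d)"
proof -
  let ?A = "annulus i0 N"
  obtain a where a: "(\<lambda>x. complex_of_real (ker i0 N x)) = tp ?A a" using trig_ker[of i0 N] by (auto simp: trig_def)
  then have ax: "complex_of_real (ker i0 N x) = tp ?A a x" for x by (rule fun_cong)
  have a1: "norm (a \<xi>) \<le> 1" if \<xi>: "\<xi> \<in> ?A" for \<xi>
  proof -
    have fs: "freq_set {\<xi>}" using \<xi> freq_set_annulus[of i0 N] by (auto simp: freq_set_def)
    have r: "tp ?A (\<lambda>\<xi>. cnj (a \<xi>)) y = complex_of_real (ker i0 N (0 - y))" for y
    proof -
      have "cnj (tp ?A (\<lambda>\<xi>. cnj (a \<xi>)) y) = complex_of_real (ker i0 N (0 - y))"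
        using tp_reflect[of ?A a 0 y] ax[of "0 - y"] by simp
      then have "cnj (cnj (tp ?A (\<lambda>\<xi>. cnj (a \<xi>)) y)) = cnj (complex_of_real (ker i0 N (0 - y)))" by (rule arg_cong)
      then show ?thesis by simp
    qed
    have "cnj (a \<xi>) = (\<integral>y. tp ?A (\<lambda>\<xi>. cnj (a \<xi>)) y * cnj (tp {\<xi>} (\<lambda>_. 1) y) \<partial>unit_cube)"
      unfolding tp_cnj_product[OF freq_set_annulus fs] using \<xi> by simp
    then have "norm (cnj (a \<xi>)) \<le> (\<integral>y. norm (tp ?A (\<lambda>\<xi>. cnj (a \<xi>)) y * cnj (tp {\<xi>} (\<lambda>_. 1) y)) \<partial>unit_cube)"
      using integral_norm_bound by metis
    also have "\<dots> = (\<integral>y. \<bar>ker i0 N (0 - y)\<bar> \<partial>unit_cube)"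
      unfolding r by (simp add: norm_mult tp_def)
    also have "\<dots> \<le> 1" by (rule ker_L1)
    finally show ?thesis by simp
  qed
  have fin: "finite ?A" using freq_set_annulus[of i0 N] by (simp add: freq_set_def)
  have c: "real (card ?A) \<le> (11 * real N) ^ CARD('d)"
  proof -
    have "card ?A \<le> card (int_box (5 * N) :: (real ^ 'd) set)"
      by (intro card_mono finite_card_int_box(1)) (auto simp: annulus_def)
    also have "\<dots> \<le> (2 * (5 * N) + 1) ^ CARD('d)" by (rule finite_card_int_box(2))
    also have "\<dots> \<le> (11 * N) ^ CARD('d)" using N by (intro power_mono) auto
    finally have "real (card ?A) \<le> real ((11 * N) ^ CARD('d))" by (simp only: of_nat_le_iff)
    then show ?thesis by simp
  qed
  let ?n = "real N ^ CARD('d)"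
  have n: "0 < ?n" using N by simp
  have k0: "ker i0 N 0 = ?n"
  proof -
    have "kerU i0 N 0 * kerW N (0 :: real ^ 'd) = complex_of_real (?n ^ 4)"
      by (simp add: kerU_def kerW_def dirichlet_0 power4_eq_xxxx)
    then have "ker i0 N 0 = ?n ^ 4 / real N ^ (3 * CARD('d))" unfolding ker_def by (simp only: Re_complex_of_real)
    also have "\<dots> = ?n" using n power_cube_eq[of "CARD('d)"] N
      by (simp add: divide_eq_eq power4_eq_xxxx power2_eq_square mult.assoc)
    finally show ?thesis .
  qed
  have "?n = norm (tp ?A a 0)" using ax[of 0] k0 n by (metis abs_of_pos norm_of_real)
  also have "\<dots> \<le> (\<Sum>\<xi>\<in>?A. norm (a \<xi>))" by (rule norm_tp_le)
  finally have "?n\<^sup>2 \<le> (\<Sum>\<xi>\<in>?A. norm (a \<xi>))\<^sup>2" using n by (intro power_mono) auto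
  also have "\<dots> = (\<Sum>\<xi>\<in>?A. norm (a \<xi>) * 1)\<^sup>2" by simp
  also have "\<dots> \<le> (\<Sum>\<xi>\<in>?A. (norm (a \<xi>))\<^sup>2) * (\<Sum>\<xi>\<in>?A. 1\<^sup>2)" by (rule Cauchy_Schwarz_ineq_sum)
  also have "\<dots> = (\<Sum>\<xi>\<in>?A. (norm (a \<xi>))\<^sup>2) * real (card ?A)" by simp
  also have "\<dots> \<le> (\<Sum>\<xi>\<in>?A. (norm (a \<xi>))\<^sup>2) * (11 * real N) ^ CARD('d)"
    by (intro mult_left_mono c sum_nonneg) auto
  finally have "?n * ?n \<le> ((\<Sum>\<xi>\<in>?A. (norm (a \<xi>))\<^sup>2) * 11 ^ CARD('d)) * ?n"
    by (simp add: power2_eq_square power_mult_distrib mult.assoc)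
  then have "?n \<le> (\<Sum>\<xi>\<in>?A. (norm (a \<xi>))\<^sup>2) * 11 ^ CARD('d)" using n by (simp only: mult_le_cancel_right_pos)
  then have "?n / 11 ^ CARD('d) \<le> (\<Sum>\<xi>\<in>?A. (norm (a \<xi>))\<^sup>2)" by (simp add: divide_le_eq)
  from that[OF ax a1 this c] show ?thesis .
qed

end

section \<open>The multiscale test function\<close>

lemma torus_proj_rep: "torus_proj (rep_torus z) = z"
  by (rule Quotient3_abs_rep[OF Quotient3_torus])

lemma rep_torus_proj: "rep_torus (torus_proj x) - x \<in> int_vectors"
  using torus_proj_rep[of "torus_proj x"] by (simp add: torus_proj_eq_iff)

lemma periodic_rep_proj:
  assumes "\<And>x k. k \<in> int_vectors \<Longrightarrow> f (x + k) = f x"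
  shows "f (rep_torus (torus_proj x)) = f x"
  using assms[OF rep_torus_proj[of x], of x] by simp

text \<open>The representatives \<open>rep_torus\<close> are chosen arbitrarily and need not vary
  continuously. A periodic function does not see the choice, and the projection is open.\<close>

lemma continuous_periodic_rep:
  fixes f :: "real ^ 'd::finite \<Rightarrow> 'b::real_normed_vector"
  assumes "\<And>x k. k \<in> int_vectors \<Longrightarrow> f (x + k) = f x" and c: "continuous_on UNIV f"
  shows "continuous_on UNIV (\<lambda>z. f (rep_torus z))"
  unfolding continuous_on_open_vimage[OF open_UNIV]
proof (intro allI impI)
  fix U :: "'b set" assume U: "open U"
  have "(\<lambda>z. f (rep_torus z)) -` U \<inter> UNIV = torus_proj ` (f -` U)"
  proof (intro equalityI subsetI)
    fix z assume "z \<in> (\<lambda>z. f (rep_torus z)) -` U \<inter> UNIV"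
    then have "rep_torus z \<in> f -` U" by simp
    then show "z \<in> torus_proj ` (f -` U)" using torus_proj_rep[of z] by (metis imageI)
  qed (auto simp: periodic_rep_proj[OF assms(1)])
  moreover have "open (f -` U)" by (rule open_vimage[OF U c])
  ultimately show "open ((\<lambda>z. f (rep_torus z)) -` U \<inter> UNIV)" by (simp add: open_image_torus_proj)
qed

section \<open>Real trigonometric polynomials, gradients and convolutions\<close>

abbreviation rtrig :: "(real ^ 'd::finite) set \<Rightarrow> (real ^ 'd \<Rightarrow> real) \<Rightarrow> bool" where
  "rtrig \<Phi> f \<equiv> trig \<Phi> (\<lambda>x. complex_of_real (f x))"

lemma rtrig_pd:
  fixes f :: "real ^ 'd::finite \<Rightarrow> real" and i :: 'd
  assumes "rtrig \<Phi> f"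
  shows "complex_of_real (pd i f x) = pd i (\<lambda>x. complex_of_real (f x)) x" "rtrig \<Phi> (pd i f)" "pdiff i f"
proof -
  let ?T = "\<lambda>x. complex_of_real (f x)"
  note d = trig_pdiff[OF assms, of i]
  have re: "pd i (\<lambda>x. Re (?T x)) = (\<lambda>x. Re (pd i ?T x))" "pdiff i (\<lambda>x. Re (?T x))" by (rule pd_linear[OF bounded_linear_Re d])+
  have im: "pd i (\<lambda>x. Im (?T x)) = (\<lambda>x. Im (pd i ?T x))" by (rule pd_linear[OF bounded_linear_Im d])
  have "pd i (\<lambda>x :: real ^ 'd. 0 :: real) = (\<lambda>_. 0)" by (rule pd_eqI(1)) simp
  then have im0: "Im (pd i ?T x) = 0" for x using im by (simp add: fun_eq_iff)
  show e: "complex_of_real (pd i f x) = pd i ?T x" for x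
    using re im0[of x] by (simp add: complex_eq_iff)
  show "rtrig \<Phi> (pd i f)" unfolding e using trig_pd[OF assms] by simp
  show "pdiff i f" using re(2) by simp
qed

lemma rtrig_measurable: "rtrig \<Phi> f \<Longrightarrow> f \<in> borel_measurable borel"
proof -
  assume "rtrig \<Phi> f"
  from trig_measurable[OF this] have [measurable]: "(\<lambda>x. complex_of_real (f x)) \<in> borel_measurable borel" .
  have "(\<lambda>x. Re (complex_of_real (f x))) \<in> borel_measurable borel" by measurable
  then show ?thesis by simp
qed

lemma rtrig_continuous: "rtrig \<Phi> f \<Longrightarrow> continuous_on UNIV f"
  using continuous_on_Re[OF trig_continuous[of \<Phi> "\<lambda>x. complex_of_real (f x)" UNIV]] by simp

lemma rtrig_bounded: "rtrig \<Phi> f \<Longrightarrow> \<exists>K. \<forall>x. \<bar>f x\<bar> \<le> K"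
  using trig_bounded[of \<Phi> "\<lambda>x. complex_of_real (f x)"] by simp

lemma rtrig_periodic: "rtrig \<Phi> f \<Longrightarrow> freq_set \<Phi> \<Longrightarrow> k \<in> int_vectors \<Longrightarrow> f (x + k) = f x"
  using trig_periodic[of \<Phi> "\<lambda>x. complex_of_real (f x)" k x] by simp

lemma rtrig_add: "rtrig \<Phi> f \<Longrightarrow> rtrig \<Phi> g \<Longrightarrow> rtrig \<Phi> (\<lambda>x. f x + g x)"
  using trig_add[of \<Phi> "\<lambda>x. complex_of_real (f x)" "\<lambda>x. complex_of_real (g x)"] by simp

lemma rtrig_orthogonal:
  assumes "rtrig \<Phi> f" "rtrig \<Psi> g" "freq_set \<Phi>" "freq_set \<Psi>" "\<Phi> \<inter> \<Psi> = {}"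
  shows "(\<integral>x. f x * g x \<partial>unit_cube) = 0"
proof -
  have "complex_of_real (\<integral>x. f x * g x \<partial>unit_cube) = (\<integral>x. complex_of_real (f x) * cnj (complex_of_real (g x)) \<partial>unit_cube)"
    by (simp flip: integral_complex_of_real)
  also have "\<dots> = 0" by (rule trig_orthogonal[OF assms])
  finally show ?thesis by simp
qed

lemma rtrig_has_derivative:
  assumes "rtrig \<Phi> f"
  shows "(f has_derivative (\<lambda>u. \<Sum>i\<in>UNIV. u $ i * pd i f x)) (at x)"
proof -
  obtain c where c: "(\<lambda>x. complex_of_real (f x)) = tp \<Phi> c" using assms by (auto simp: trig_def)
  have "((\<lambda>x. Re (tp \<Phi> c x)) has_derivative (\<lambda>u. Re (\<Sum>\<xi>\<in>\<Phi>. c \<xi> * ((2 * pi * (\<xi> \<bullet> u)) *\<^sub>R (\<i> * ee \<xi> x))))) (at x)"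
    by (rule bounded_linear.has_derivative[OF bounded_linear_Re tp_has_derivative])
  moreover have "Re (\<Sum>\<xi>\<in>\<Phi>. c \<xi> * ((2 * pi * (\<xi> \<bullet> u)) *\<^sub>R (\<i> * ee \<xi> x))) = (\<Sum>i\<in>UNIV. u $ i * pd i f x)" for u
  proof -
    have "(\<Sum>i\<in>UNIV. u $ i * pd i f x) = Re (\<Sum>i\<in>UNIV. u $ i *\<^sub>R complex_of_real (pd i f x))" by simp
    also have "(\<Sum>i\<in>UNIV. u $ i *\<^sub>R complex_of_real (pd i f x)) = (\<Sum>i\<in>UNIV. u $ i *\<^sub>R (\<Sum>\<xi>\<in>\<Phi>. (2 * pi * (\<xi> $ i)) *\<^sub>R (\<i> * c \<xi>) * ee \<xi> x))"
      unfolding rtrig_pd(1)[OF assms] c pd_tp by (simp only: tp_def)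
    also have "\<dots> = (\<Sum>\<xi>\<in>\<Phi>. \<Sum>i\<in>UNIV. u $ i *\<^sub>R ((2 * pi * (\<xi> $ i)) *\<^sub>R (\<i> * c \<xi>) * ee \<xi> x))"
      unfolding scaleR_sum_right by (rule sum.swap)
    also have "\<dots> = (\<Sum>\<xi>\<in>\<Phi>. c \<xi> * ((2 * pi * (\<xi> \<bullet> u)) *\<^sub>R (\<i> * ee \<xi> x)))"
    proof (intro sum.cong refl)
      fix \<xi>
      have "u $ i *\<^sub>R ((2 * pi * (\<xi> $ i)) *\<^sub>R (\<i> * c \<xi>) * ee \<xi> x) = (2 * pi * (\<xi> $ i * u $ i)) *\<^sub>R (c \<xi> * (\<i> * ee \<xi> x))" for i
        by (simp add: mult_ac)
      then have "(\<Sum>i\<in>UNIV. u $ i *\<^sub>R ((2 * pi * (\<xi> $ i)) *\<^sub>R (\<i> * c \<xi>) * ee \<xi> x))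
          = (\<Sum>i\<in>UNIV. 2 * pi * (\<xi> $ i * u $ i)) *\<^sub>R (c \<xi> * (\<i> * ee \<xi> x))"
        by (simp only: scaleR_sum_left)
      also have "(\<Sum>i\<in>UNIV. 2 * pi * (\<xi> $ i * u $ i)) = 2 * pi * (\<xi> \<bullet> u)"
        by (simp add: inner_vec_def sum_distrib_left)
      finally show "(\<Sum>i\<in>UNIV. u $ i *\<^sub>R ((2 * pi * (\<xi> $ i)) *\<^sub>R (\<i> * c \<xi>) * ee \<xi> x)) = c \<xi> * ((2 * pi * (\<xi> \<bullet> u)) *\<^sub>R (\<i> * ee \<xi> x))"
        by (simp only: mult_scaleR_right)
    qed
    finally show ?thesis by simp
  qed
  moreover have "(\<lambda>x. Re (tp \<Phi> c x)) = f" unfolding c[symmetric] by simp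
  ultimately show ?thesis by simp
qed

definition grad :: "(real ^ 'd::finite \<Rightarrow> real) \<Rightarrow> real ^ 'd \<Rightarrow> real ^ 'd" where
  "grad f x = (\<chi> i. pd i f x)"

lemma rtrig_lipschitz:
  assumes f: "rtrig \<Phi> f" and L: "\<And>x. norm (grad f x) \<le> L"
  shows "\<bar>f x - f y\<bar> \<le> L * norm (x - y)"
proof -
  have "norm (f x - f y) \<le> L * norm (x - y)"
  proof (rule differentiable_bound[where S = UNIV and f' = "\<lambda>x u. \<Sum>i\<in>UNIV. u $ i * pd i f x"])
    show "(f has_derivative (\<lambda>u. \<Sum>i\<in>UNIV. u $ i * pd i f x)) (at x within UNIV)" for x
      using rtrig_has_derivative[OF f] by simp
    show "onorm (\<lambda>u. \<Sum>i\<in>UNIV. u $ i * pd i f x) \<le> L" for x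
    proof (rule onorm_le)
      fix u
      have "(\<Sum>i\<in>UNIV. u $ i * pd i f x) = u \<bullet> grad f x" by (simp add: grad_def inner_vec_def)
      also have "norm \<dots> \<le> norm u * norm (grad f x)" by (simp add: Cauchy_Schwarz_ineq2)
      also have "\<dots> \<le> norm u * L" by (intro mult_left_mono L) simp
      finally show "norm (\<Sum>i\<in>UNIV. u $ i * pd i f x) \<le> L * norm u" by (simp add: mult.commute)
    qed
  qed auto
  then show ?thesis by simp
qed

lemma norm_grad_le: "(\<And>i. \<bar>pd i f x\<bar> \<le> c) \<Longrightarrow> norm (grad f (x :: real ^ 'd::finite)) \<le> real CARD('d) * c"
  by (rule order.trans[OF norm_le_l1_cart], rule order.trans[OF sum_mono[of UNIV _ "\<lambda>_. c"]]) (auto simp: grad_def)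

definition conv :: "(real ^ 'd::finite \<Rightarrow> real) \<Rightarrow> (real ^ 'd \<Rightarrow> real) \<Rightarrow> real ^ 'd \<Rightarrow> real" where
  "conv \<kappa> h x = (\<integral>y. h y * \<kappa> (x - y) \<partial>unit_cube)"

lemma conv_tp:
  assumes \<kappa>: "\<And>x. complex_of_real (\<kappa> x) = tp \<Phi> a x" and h: "h \<in> borel_measurable borel" "\<And>y. \<bar>h y\<bar> \<le> 1"
  shows "complex_of_real (conv \<kappa> h x) = tp \<Phi> (\<lambda>\<xi>. a \<xi> * (\<integral>y. complex_of_real (h y) * cnj (ee \<xi> y) \<partial>unit_cube)) x"
proof -
  note [measurable] = h(1)
  have I: "integrable unit_cube (\<lambda>y. complex_of_real (h y) * cnj (ee \<xi> y))" for \<xi>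
  proof (rule unit_cube_integrable[where K = 1])
    show "(\<lambda>y. complex_of_real (h y) * cnj (ee \<xi> y)) \<in> borel_measurable borel" unfolding ee_minus[symmetric] by measurable
  qed (use h(2) in \<open>simp add: norm_mult\<close>)
  have "complex_of_real (conv \<kappa> h x) = (\<integral>y. (\<Sum>\<xi>\<in>\<Phi>. (a \<xi> * ee \<xi> x) * (complex_of_real (h y) * cnj (ee \<xi> y))) \<partial>unit_cube)"
    unfolding conv_def integral_complex_of_real[symmetric] of_real_mult \<kappa> tp_def
    by (simp add: ee_diff_right sum_distrib_left algebra_simps)
  also have "\<dots> = (\<Sum>\<xi>\<in>\<Phi>. (a \<xi> * ee \<xi> x) * (\<integral>y. complex_of_real (h y) * cnj (ee \<xi> y) \<partial>unit_cube))"
    using I by simp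
  finally show ?thesis by (simp add: tp_def algebra_simps)
qed

lemma conv_rtrig:
  assumes "rtrig \<Phi> \<kappa>" "h \<in> borel_measurable borel" "\<And>y. \<bar>h y\<bar> \<le> 1"
  shows "rtrig \<Phi> (conv \<kappa> h)"
proof -
  obtain a where "(\<lambda>x. complex_of_real (\<kappa> x)) = tp \<Phi> a" using assms(1) by (auto simp: trig_def)
  then have "complex_of_real (\<kappa> x) = tp \<Phi> a x" for x by (rule fun_cong)
  from conv_tp[OF this assms(2,3)] show ?thesis unfolding trig_def by blast
qed

text \<open>Differentiation under the integral is read off from the coefficients: both sides are the
  same finite Fourier sum.\<close>

lemma pd_conv:
  assumes \<kappa>: "rtrig \<Phi> \<kappa>" and h: "h \<in> borel_measurable borel" "\<And>y. \<bar>h y\<bar> \<le> 1"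
  shows "pd i (conv \<kappa> h) = conv (pd i \<kappa>) h"
proof
  fix x
  obtain a where a: "(\<lambda>x. complex_of_real (\<kappa> x)) = tp \<Phi> a" using \<kappa> by (auto simp: trig_def)
  then have ax: "complex_of_real (\<kappa> x) = tp \<Phi> a x" for x by (rule fun_cong)
  have pax: "complex_of_real (pd i \<kappa> x) = tp \<Phi> (\<lambda>\<xi>. (2 * pi * (\<xi> $ i)) *\<^sub>R (\<i> * a \<xi>)) x" for x
    unfolding rtrig_pd(1)[OF \<kappa>] a pd_tp ..
  let ?h = "\<lambda>\<xi>. \<integral>y. complex_of_real (h y) * cnj (ee \<xi> y) \<partial>unit_cube"
  have "complex_of_real (pd i (conv \<kappa> h) x) = pd i (tp \<Phi> (\<lambda>\<xi>. a \<xi> * ?h \<xi>)) x"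
    unfolding rtrig_pd(1)[OF conv_rtrig[OF \<kappa> h]] conv_tp[OF ax h] ..
  also have "\<dots> = tp \<Phi> (\<lambda>\<xi>. ((2 * pi * (\<xi> $ i)) *\<^sub>R (\<i> * a \<xi>)) * ?h \<xi>) x"
    unfolding pd_tp by (simp add: mult.assoc)
  also have "\<dots> = complex_of_real (conv (pd i \<kappa>) h x)" unfolding conv_tp[OF pax h] ..
  finally show "pd i (conv \<kappa> h) x = conv (pd i \<kappa>) h x" by simp
qed

lemma conv_abs_le:
  assumes k: "\<kappa> \<in> borel_measurable borel" "\<And>x. \<bar>\<kappa> x\<bar> \<le> K" and h: "h \<in> borel_measurable borel" "\<And>y. \<bar>h y\<bar> \<le> 1"
    and c: "(\<integral>y. \<bar>\<kappa> (x - y)\<bar> \<partial>unit_cube) \<le> c"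
  shows "\<bar>conv \<kappa> h x\<bar> \<le> c"
proof -
  have [measurable]: "(\<lambda>y. \<kappa> (x - y)) \<in> borel_measurable borel" by (rule measurable_compose[OF _ k(1)]) measurable
  note [measurable] = h(1)
  have "\<bar>conv \<kappa> h x\<bar> \<le> (\<integral>y. \<bar>h y * \<kappa> (x - y)\<bar> \<partial>unit_cube)" unfolding conv_def by (rule integral_abs_bound)
  also have "\<dots> \<le> (\<integral>y. \<bar>\<kappa> (x - y)\<bar> \<partial>unit_cube)"
  proof (rule integral_mono)
    have le: "\<bar>h y * \<kappa> (x - y)\<bar> \<le> \<bar>\<kappa> (x - y)\<bar>" for y
      using mult_right_mono[OF h(2)[of y], of "\<bar>\<kappa> (x - y)\<bar>"] by (simp add: abs_mult)
    then show "\<bar>h y * \<kappa> (x - y)\<bar> \<le> \<bar>\<kappa> (x - y)\<bar>" for y .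
    show "integrable unit_cube (\<lambda>y. \<bar>h y * \<kappa> (x - y)\<bar>)" "integrable unit_cube (\<lambda>y. \<bar>\<kappa> (x - y)\<bar>)"
      using order.trans[OF le k(2)] k(2) by (auto intro!: unit_cube_integrable[where K = K])
  qed
  finally show ?thesis using c by linarith
qed

text \<open>Jordan's inequality, from the concavity of the sine on [0, pi] and its values at 0 and
  pi / 2.\<close>

lemma sin_pi_ge: "\<bar>u\<bar> \<le> 1 / 2 \<Longrightarrow> 2 * \<bar>u\<bar> \<le> \<bar>sin (pi * u)\<bar>"
proof -
  have pos: "2 * u \<le> sin (pi * u)" if u: "0 \<le> u" "u \<le> 1 / 2" for u :: real
  proof -
    have "concave_on {0..pi} sin"
    proof (rule f''_le0_imp_concave)
      show "(sin has_real_derivative cos x) (at x)" "(cos has_real_derivative - sin x) (at x)" for x :: real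
        by (auto intro!: derivative_eq_intros)
      show "- sin x \<le> 0" if "x \<in> {0..pi}" for x :: real using that sin_ge_zero by auto
    qed simp
    then have "(1 - 2 * u) * sin 0 + (2 * u) * sin (pi / 2) \<le> sin ((1 - 2 * u) *\<^sub>R 0 + (2 * u) *\<^sub>R (pi / 2))"
      using u by (intro concave_onD) auto
    then show ?thesis by (simp add: mult.commute)
  qed
  assume "\<bar>u\<bar> \<le> 1 / 2"
  then show ?thesis using pos[of u] pos[of "- u"] by (cases "0 \<le> u") auto
qed

text \<open>Turns a distance to the lattice into the sine weights for which
  \<open>sin_pd_ker_L1\<close> holds: every coordinate is rounded to the nearest integer and
  \<open>sin_pi_ge\<close> is applied to the remainder.\<close>

lemma periodic_distance:
  obtains l where "l \<in> int_vectors" "2 * norm (z - l) \<le> (\<Sum>j\<in>UNIV. \<bar>sin (pi * (z :: real ^ 'd::finite) $ j)\<bar>)"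
proof -
  define l :: "real ^ 'd" where "l = (\<chi> j. of_int (round (z $ j)))"
  have l: "l \<in> int_vectors" by (simp add: l_def int_vectors_def)
  have "2 * \<bar>(z - l) $ j\<bar> \<le> \<bar>sin (pi * z $ j)\<bar>" for j
  proof -
    have "\<bar>z $ j - of_int (round (z $ j))\<bar> \<le> 1 / 2" using of_int_round_abs_le[of "z $ j"] by (simp add: abs_minus_commute)
    then have "2 * \<bar>z $ j - of_int (round (z $ j))\<bar> \<le> \<bar>sin (pi * (z $ j - of_int (round (z $ j))))\<bar>" by (rule sin_pi_ge)
    also have "\<dots> = \<bar>sin (pi * z $ j)\<bar>"
    proof -
      have "sin (pi * (z $ j - of_int (round (z $ j)))) = sin (pi * z $ j) * cos (pi * of_int (round (z $ j)))"
        by (simp add: right_diff_distrib sin_diff sin_npi_int)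
      moreover have "\<bar>cos (pi * of_int m)\<bar> = 1" for m
        using sin_cos_squared_add[of "pi * of_int m"] sin_npi_int[of m] by (simp add: power2_eq_1_iff abs_if)
      ultimately show ?thesis by (simp add: abs_mult)
    qed
    finally show ?thesis by (simp add: l_def)
  qed
  then have "2 * (\<Sum>j\<in>UNIV. \<bar>(z - l) $ j\<bar>) \<le> (\<Sum>j\<in>UNIV. \<bar>sin (pi * z $ j)\<bar>)"
    unfolding sum_distrib_left by (intro sum_mono)
  then show ?thesis using norm_le_l1_cart[of "z - l"] by (intro that[OF l]) linarith
qed

section \<open>The recursive test function and its gradient\<close>

context
  fixes i0 :: "'d::finite"
begin

definition wave :: "'d torus measure \<Rightarrow> nat \<Rightarrow> real ^ 'd \<Rightarrow> real" where
  "wave \<mu> k y = (\<integral>z. ker i0 (8 ^ k) (rep_torus z - y) \<partial>\<mu>)"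

definition select :: "(real ^ 'd \<Rightarrow> real) \<Rightarrow> real \<Rightarrow> (real ^ 'd \<Rightarrow> real) \<Rightarrow> real ^ 'd \<Rightarrow> real" where
  "select v A f y = sgn (v y) * (if norm (grad f y) \<le> A then 1 else 0)"

text \<open>The division by \<open>8 ^ k\<close> balances the derivative of the kernel, whose
  modulus has a mean of order \<open>8 ^ k\<close>, so that every scale adds a gradient of order
  1.\<close>

primrec test_fun :: "'d torus measure \<Rightarrow> real \<Rightarrow> nat \<Rightarrow> real ^ 'd \<Rightarrow> real" where
  "test_fun \<mu> A 0 = (\<lambda>_. 0)"
| "test_fun \<mu> A (Suc k) = (\<lambda>x. test_fun \<mu> A k x +
     conv (ker i0 (8 ^ k)) (select (wave \<mu> k) A (test_fun \<mu> A k)) x / 8 ^ k)"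

lemma fourier_integrable:
  assumes "prob_space \<mu>" "sets \<mu> = sets borel" "\<xi> \<in> int_vectors"
  shows "integrable \<mu> (\<lambda>z. ee \<xi> (rep_torus z))"
proof -
  interpret prob_space \<mu> by fact
  have "continuous_on UNIV (\<lambda>z. ee \<xi> (rep_torus z))"
    by (rule continuous_periodic_rep) (auto simp: ee_add_right ee_int_vectors assms(3) continuous_ee)
  then have "(\<lambda>z. ee \<xi> (rep_torus z)) \<in> borel_measurable \<mu>"
    using borel_measurable_continuous_onI by (simp add: measurable_cong_sets[OF assms(2) refl])
  then show ?thesis by (intro integrable_const_bound[where B = 1]) auto
qed

lemma wave_tp:
  assumes \<mu>: "prob_space \<mu>" "sets \<mu> = sets borel"
    and a: "\<And>x. complex_of_real (ker i0 (8 ^ k) x) = tp (annulus i0 (8 ^ k)) a x"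
  shows "complex_of_real (wave \<mu> k y) = (\<Sum>\<xi>\<in>annulus i0 (8 ^ k). a \<xi> * (\<integral>z. ee \<xi> (rep_torus z) \<partial>\<mu>) * cnj (ee \<xi> y))"
proof -
  have "complex_of_real (wave \<mu> k y) = (\<integral>z. (\<Sum>\<xi>\<in>annulus i0 (8 ^ k). (a \<xi> * cnj (ee \<xi> y)) * ee \<xi> (rep_torus z)) \<partial>\<mu>)"
    unfolding wave_def integral_complex_of_real[symmetric] a tp_def by (simp add: ee_diff_right algebra_simps)
  also have "\<dots> = (\<Sum>\<xi>\<in>annulus i0 (8 ^ k). (a \<xi> * cnj (ee \<xi> y)) * (\<integral>z. ee \<xi> (rep_torus z) \<partial>\<mu>))"
    using fourier_integrable[OF \<mu>] freq_set_annulus[of i0 "8 ^ k"]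
    by (subst Bochner_Integration.integral_sum) (auto simp: freq_set_def)
  finally show ?thesis by (simp add: algebra_simps)
qed

lemma wave_rtrig:
  assumes \<mu>: "prob_space \<mu>" "sets \<mu> = sets borel"
  shows "rtrig (annulus i0 (8 ^ k)) (wave \<mu> k)"
proof -
  obtain a where "(\<lambda>x. complex_of_real (ker i0 (8 ^ k) x)) = tp (annulus i0 (8 ^ k)) a"
    using trig_ker[of i0 "8 ^ k"] by (auto simp: trig_def)
  then have a: "complex_of_real (ker i0 (8 ^ k) x) = tp (annulus i0 (8 ^ k)) a x" for x by (rule fun_cong)
  have "trig (annulus i0 (8 ^ k)) (\<lambda>x. \<Sum>\<xi>\<in>annulus i0 (8 ^ k). (a \<xi> * (\<integral>z. ee \<xi> (rep_torus z) \<partial>\<mu>)) * ee (- \<xi>) x)"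
    by (rule trig_sum_index) (use freq_set_annulus[of i0 "8 ^ k"] in \<open>auto simp: freq_set_def annulus_def int_box_def int_vectors_minus\<close>)
  then show ?thesis unfolding wave_tp[OF \<mu> a] by (simp add: ee_minus)
qed

definition freqs_upto :: "nat \<Rightarrow> (real ^ 'd) set" where
  "freqs_upto k = (\<Union>j<k. annulus i0 (8 ^ j))"

lemma freq_set_upto: "freq_set (freqs_upto k)"
  using freq_set_annulus by (auto simp: freqs_upto_def freq_set_def)

text \<open>In coordinate \<open>i0\<close> an earlier annulus reaches at most
  \<open>5 * 8 ^ j\<close>, which is below \<open>8 ^ Suc j\<close> and hence below the inner size
  of the new one.\<close>

lemma freqs_disjoint: "freqs_upto k \<inter> annulus i0 (8 ^ k) = {}"
proof -
  have "\<not> (\<xi> \<in> annulus i0 (8 ^ j) \<and> \<xi> \<in> annulus i0 (8 ^ k))" if "j < k" for j \<xi>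
  proof
    assume a: "\<xi> \<in> annulus i0 (8 ^ j) \<and> \<xi> \<in> annulus i0 (8 ^ k)"
    have "(8::real) ^ Suc j \<le> 8 ^ k" using that by (intro power_increasing) auto
    moreover have "\<bar>\<xi> $ i0\<bar> \<le> 5 * 8 ^ j" "8 ^ k \<le> \<bar>\<xi> $ i0\<bar>" using a by (auto simp: annulus_def int_box_def)
    moreover have "(0::real) < 8 ^ j" by simp
    ultimately show False by simp
  qed
  then show ?thesis by (auto simp: freqs_upto_def)
qed

context
  fixes \<mu> :: "'d torus measure" and A :: real
  assumes \<mu>: "prob_space \<mu>" "sets \<mu> = sets borel" and A: "0 < A"
begin

abbreviation "acc \<equiv> test_fun \<mu> A"
abbreviation "sel k \<equiv> select (wave \<mu> k) A (acc k)"
abbreviation "inc k \<equiv> conv (ker i0 (8 ^ k)) (sel k)"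

lemma sel_le: "\<bar>sel k y\<bar> \<le> 1"
  by (simp add: select_def sgn_if)

text \<open>The two claims depend on each other: the selection is measurable because the accumulated
  function is a trigonometric polynomial, and the next accumulated function is one because the
  selection is measurable and bounded.\<close>

lemma acc_rtrig: "rtrig (freqs_upto k) (acc k)" and sel_measurable: "sel k \<in> borel_measurable borel"
proof -
  have hm: "sel k \<in> borel_measurable borel" if acc: "rtrig (freqs_upto k) (acc k)" for k
  proof -
    have [measurable]: "wave \<mu> k \<in> borel_measurable borel" by (rule rtrig_measurable[OF wave_rtrig[OF \<mu>]])
    have "continuous_on UNIV (grad (acc k))"
      unfolding grad_def[abs_def] by (intro continuous_on_vec_lambda rtrig_continuous[OF rtrig_pd(2)[OF acc]])
    then have [measurable]: "grad (acc k) \<in> borel_measurable borel" by (rule borel_measurable_continuous_onI)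
    show ?thesis unfolding select_def[abs_def] by measurable
  qed
  show acc: "rtrig (freqs_upto k) (acc k)" for k
  proof (induction k)
    case 0
    have "(\<lambda>x. complex_of_real (acc 0 x)) = tp (freqs_upto 0) (\<lambda>_. 0)" by (simp add: tp_def fun_eq_iff)
    then show ?case unfolding trig_def by blast
  next
    case (Suc k)
    have sub: "freqs_upto k \<subseteq> freqs_upto (Suc k)" "annulus i0 (8 ^ k) \<subseteq> freqs_upto (Suc k)"
      by (auto simp: freqs_upto_def lessThan_Suc)
    have fin: "finite (freqs_upto (Suc k))" using freq_set_upto by (auto simp: freq_set_def)
    have "rtrig (annulus i0 (8 ^ k)) (inc k)" by (rule conv_rtrig[OF trig_ker hm[OF Suc] sel_le])
    from trig_cmult[OF this, of "complex_of_real (1 / 8 ^ k)"]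
    have "rtrig (annulus i0 (8 ^ k)) (\<lambda>x. inc k x / 8 ^ k)" by simp
    from rtrig_add[OF trig_mono[OF Suc sub(1) fin] trig_mono[OF this sub(2) fin]]
    show ?case by (simp add: test_fun.simps(2))
  qed
  show "sel k \<in> borel_measurable borel" by (rule hm[OF acc])
qed

lemma inc_rtrig: "rtrig (annulus i0 (8 ^ k)) (inc k)"
  by (rule conv_rtrig[OF trig_ker sel_measurable sel_le])

lemma inc_scaled_rtrig: "rtrig (annulus i0 (8 ^ k)) (\<lambda>x. inc k x / 8 ^ k)"
  using trig_cmult[OF inc_rtrig, of k "complex_of_real (1 / 8 ^ k)"] by simp

lemma pd_f: "pd i (inc k) = conv (pd i (ker i0 (8 ^ k))) (sel k)" "pd j (pd i (inc k)) = conv (pd j (pd i (ker i0 (8 ^ k)))) (sel k)"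
  by (simp_all add: pd_conv[OF trig_ker sel_measurable sel_le] pd_conv[OF rtrig_pd(2)[OF trig_ker] sel_measurable sel_le])

lemma pd_scale: "pdiff i g \<Longrightarrow> pd i (\<lambda>x. g x / c) = (\<lambda>x. pd i g x / (c :: real))"
  using pd_linear(1)[OF bounded_linear_divide[of c]] by blast

lemma pd_S_Suc: "pd i (acc (Suc k)) = (\<lambda>x. pd i (acc k) x + pd i (inc k) x / 8 ^ k)"
  using pd_add[OF rtrig_pd(3)[OF acc_rtrig] rtrig_pd(3)[OF inc_scaled_rtrig], of i k k]
    pd_scale[OF rtrig_pd(3)[OF inc_rtrig], of i k "8 ^ k"] by simp

lemma pd_pd_S_Suc: "pd j (pd i (acc (Suc k))) = (\<lambda>x. pd j (pd i (acc k)) x + pd j (pd i (inc k)) x / 8 ^ k)"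
proof -
  have r: "rtrig (annulus i0 (8 ^ k)) (\<lambda>x. pd i (inc k) x / 8 ^ k)"
    using trig_cmult[OF rtrig_pd(2)[OF inc_rtrig, of k i], of "complex_of_real (1 / 8 ^ k)"] by simp
  show ?thesis
    unfolding pd_S_Suc
    using pd_add[OF rtrig_pd(3)[OF rtrig_pd(2)[OF acc_rtrig]] rtrig_pd(3)[OF r], of j i k]
      pd_scale[OF rtrig_pd(3)[OF rtrig_pd(2)[OF inc_rtrig]], of j i k "8 ^ k"] by simp
qed

lemma pd_f_le: "\<bar>pd i (inc k) x / 8 ^ k\<bar> \<le> 20 * pi"
proof -
  obtain K where K: "\<And>x. \<bar>pd i (ker i0 (8 ^ k)) x\<bar> \<le> K" using rtrig_bounded[OF rtrig_pd(2)[OF trig_ker]] by metis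
  have "\<bar>pd i (inc k) x\<bar> \<le> 20 * pi * real (8 ^ k)" unfolding pd_f
    by (rule conv_abs_le[OF ker_measurable(2) K sel_measurable sel_le pd_ker_L1]) simp_all
  then show ?thesis by (simp add: divide_le_eq)
qed

lemma pd_pd_f_le: "\<bar>pd j (pd i (inc k)) x / 8 ^ k\<bar> \<le> (20 * pi)\<^sup>2 * 8 ^ k"
proof -
  obtain K where K: "\<And>x. \<bar>pd j (pd i (ker i0 (8 ^ k))) x\<bar> \<le> K" using rtrig_bounded[OF rtrig_pd(2)[OF rtrig_pd(2)[OF trig_ker]]] by metis
  have "\<bar>pd j (pd i (inc k)) x\<bar> \<le> (20 * pi * real (8 ^ k))\<^sup>2" unfolding pd_f(2)
    by (rule conv_abs_le[OF ker_measurable(3) K sel_measurable sel_le pd_pd_ker_L1]) simp_all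
  then show ?thesis by (simp add: divide_le_eq power2_eq_square mult_ac)
qed

text \<open>The second derivatives of the scales grow geometrically, so the sum over all earlier
  scales is no larger than the bound for a single new one.\<close>

lemma pd_pd_S_le: "\<bar>pd j (pd i (acc k)) x\<bar> \<le> (20 * pi)\<^sup>2 * 8 ^ k"
proof -
  have "\<bar>pd j (pd i (acc k)) x\<bar> \<le> (20 * pi)\<^sup>2 * (\<Sum>m<k. 8 ^ m)"
  proof (induction k)
    case 0
    have "pd i (\<lambda>x :: real ^ 'd. 0 :: real) = (\<lambda>_. 0)" for i by (rule pd_eqI(1)) simp
    then show ?case by simp
  next
    case (Suc k)
    show ?case unfolding pd_pd_S_Suc
      using order.trans[OF abs_triangle_ineq add_mono[OF Suc pd_pd_f_le[of j i k x]]] by (simp add: distrib_left)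
  qed
  also have "(\<Sum>m<k. 8 ^ m) \<le> (8 ^ k :: real)"
  proof (induction k)
    case (Suc k)
    moreover have "(0 :: real) \<le> 8 ^ k" by simp
    ultimately show ?case unfolding sum.lessThan_Suc power_Suc by linarith
  qed simp
  finally show ?thesis by (simp add: mult_left_mono)
qed

text \<open>\<open>Lam * 8 ^ k\<close> is the Lipschitz constant of the gradient accumulated before
  scale \<open>k\<close>. The dimension enters once for the gradient of each partial derivative and
  once for the sum over them.\<close>

definition "Lam = real CARD('d) * (real CARD('d) * (20 * pi)\<^sup>2)"

lemma Lam_pos: "0 < Lam" by (simp add: Lam_def)

lemma grad_S_lipschitz: "norm (grad (acc k) x - grad (acc k) y) \<le> Lam * 8 ^ k * norm (x - y)"
proof -
  have "\<bar>pd i (acc k) x - pd i (acc k) y\<bar> \<le> (real CARD('d) * ((20 * pi)\<^sup>2 * 8 ^ k)) * norm (x - y)" for i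
    by (rule rtrig_lipschitz[OF rtrig_pd(2)[OF acc_rtrig]]) (intro norm_grad_le pd_pd_S_le)
  then have "norm (grad (acc k) x - grad (acc k) y) \<le> (\<Sum>i\<in>(UNIV :: 'd set). (real CARD('d) * ((20 * pi)\<^sup>2 * 8 ^ k)) * norm (x - y))"
    by (intro order.trans[OF norm_le_l1_cart] sum_mono) (simp add: grad_def)
  then show ?thesis by (simp add: Lam_def mult.assoc)
qed

lemma grad_S_periodic: "l \<in> int_vectors \<Longrightarrow> grad (acc k) (x + l) = grad (acc k) x"
  using rtrig_periodic[OF rtrig_pd(2)[OF acc_rtrig] freq_set_upto] by (simp add: grad_def)

lemma grad_S_Suc: "grad (acc (Suc k)) x = grad (acc k) x + grad (\<lambda>x. inc k x / 8 ^ k) x"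
  unfolding grad_def pd_S_Suc pd_scale[OF rtrig_pd(3)[OF inc_rtrig]] by (simp add: vec_eq_iff)

text \<open>Where the accumulated gradient exceeds the threshold, the new term is not selected in a whole
  neighbourhood, so only the tail of the kernel contributes.\<close>

lemma pd_f_tail:
  assumes E: "0 < E" "A + E \<le> norm (grad (acc k) x)"
  shows "\<bar>pd i (inc k) x / 8 ^ k\<bar> \<le> real CARD('d) * (10 * pi) * Lam / E"
proof -
  \<comment> \<open>At a smaller distance than this from \<open>x\<close> modulo the lattice, the
    accumulated gradient still exceeds \<open>A\<close>, by its Lipschitz bound.\<close>
  define \<delta> where "\<delta> = E / (Lam * 8 ^ k)"
  have \<delta>: "0 < \<delta>" using E Lam_pos by (simp add: \<delta>_def)
  let ?s = "\<lambda>y. \<Sum>j\<in>UNIV. \<bar>sin (pi * (x - y) $ j)\<bar>"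
  \<comment> \<open>A selected point has distance at least \<open>\<delta>\<close> from
    \<open>x\<close> modulo the lattice, where the sine sum is at least \<open>2 * \<delta>\<close>.
    The quotient replaces the indicator of such points by weights under which the kernel is
    integrable uniformly in the scale.\<close>
  have key: "\<bar>sel k y\<bar> \<le> ?s y / (2 * \<delta>)" for y
  proof (cases "norm (grad (acc k) y) \<le> A")
    case False
    then show ?thesis using \<delta> by (simp add: select_def sum_nonneg)
  next
    case True
    obtain l where l: "l \<in> int_vectors" "2 * norm (x - y - l) \<le> ?s y" using periodic_distance by metis
    have "E \<le> norm (grad (acc k) x) - norm (grad (acc k) (y + l))" using E True grad_S_periodic[OF l(1)] by simp
    also have "\<dots> \<le> norm (grad (acc k) x - grad (acc k) (y + l))" by (rule norm_triangle_ineq2)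
    also have "\<dots> \<le> Lam * 8 ^ k * norm (x - (y + l))" by (rule grad_S_lipschitz)
    finally have "\<delta> \<le> norm (x - y - l)" using Lam_pos by (simp add: \<delta>_def divide_le_eq algebra_simps)
    with l(2) have "2 * \<delta> \<le> ?s y" by linarith
    then have "1 \<le> ?s y / (2 * \<delta>)" using \<delta> by simp
    then show ?thesis using sel_le[of k y] by linarith
  qed
  obtain K where K: "\<And>x. \<bar>pd i (ker i0 (8 ^ k)) x\<bar> \<le> K" using rtrig_bounded[OF rtrig_pd(2)[OF trig_ker]] by metis
  have km: "pd i (ker i0 (8 ^ k)) \<in> borel_measurable borel" by (rule ker_measurable(2)) simp
  have [measurable]: "(\<lambda>y. pd i (ker i0 (8 ^ k)) (x - y)) \<in> borel_measurable borel"
    by (rule measurable_compose[OF _ km]) measurable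
  have [measurable]: "(\<lambda>y. \<bar>sin (pi * (x - y) $ j)\<bar>) \<in> borel_measurable borel" for j
    by (intro borel_measurable_continuous_onI continuous_intros)
  note [measurable] = sel_measurable
  let ?g = "\<lambda>y. \<bar>pd i (ker i0 (8 ^ k)) (x - y)\<bar>"
  have sI: "integrable unit_cube (\<lambda>y. \<bar>sin (pi * (x - y) $ j)\<bar> * ?g y)" for j
  proof (rule unit_cube_integrable[where K = "1 * K"])
    show "norm (\<bar>sin (pi * (x - y) $ j)\<bar> * ?g y) \<le> 1 * K" for y
      unfolding real_norm_def abs_mult abs_abs by (intro mult_mono K) auto
  qed measurable
  have "\<bar>pd i (inc k) x\<bar> \<le> (\<integral>y. \<bar>sel k y * pd i (ker i0 (8 ^ k)) (x - y)\<bar> \<partial>unit_cube)"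
    unfolding pd_f conv_def by (rule integral_abs_bound)
  also have "\<dots> \<le> (\<integral>y. (1 / (2 * \<delta>)) * (\<Sum>j\<in>UNIV. \<bar>sin (pi * (x - y) $ j)\<bar> * ?g y) \<partial>unit_cube)"
  proof (rule integral_mono)
    have "\<bar>sel k y\<bar> * ?g y \<le> 1 * K" for y by (intro mult_mono sel_le K) auto
    then show "integrable unit_cube (\<lambda>y. \<bar>sel k y * pd i (ker i0 (8 ^ k)) (x - y)\<bar>)"
      by (intro unit_cube_integrable[where K = K]) (simp_all add: abs_mult)
    show "integrable unit_cube (\<lambda>y. (1 / (2 * \<delta>)) * (\<Sum>j\<in>UNIV. \<bar>sin (pi * (x - y) $ j)\<bar> * ?g y))"
      using sI by (intro integrable_mult_right Bochner_Integration.integrable_sum)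
    fix y
    have "\<bar>sel k y * pd i (ker i0 (8 ^ k)) (x - y)\<bar> \<le> ?s y / (2 * \<delta>) * ?g y"
      unfolding abs_mult by (intro mult_right_mono key) simp
    then show "\<bar>sel k y * pd i (ker i0 (8 ^ k)) (x - y)\<bar> \<le> (1 / (2 * \<delta>)) * (\<Sum>j\<in>UNIV. \<bar>sin (pi * (x - y) $ j)\<bar> * ?g y)"
      by (simp add: sum_distrib_right)
  qed
  also have "\<dots> = (1 / (2 * \<delta>)) * (\<Sum>j\<in>UNIV. \<integral>y. \<bar>sin (pi * (x - y) $ j)\<bar> * ?g y \<partial>unit_cube)"
    by (simp only: integral_mult_right_zero Bochner_Integration.integral_sum[OF sI])
  also have "\<dots> \<le> (1 / (2 * \<delta>)) * (\<Sum>j\<in>(UNIV :: 'd set). 20 * pi)"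
    using \<delta> by (intro mult_left_mono sum_mono sin_pd_ker_L1) auto
  also have "\<dots> = (real CARD('d) * (10 * pi) * Lam / E) * 8 ^ k"
    using E Lam_pos by (simp add: \<delta>_def field_simps)
  finally show ?thesis by (simp add: divide_le_eq)
qed

text \<open>The growth of the squared excess per scale. For an excess b and an increment m it bounds
  2 b m by the tail estimate, where b cancels, and m ^ 2 by the crude bound on one scale.\<close>

definition "Cgrow = 2 * (real CARD('d) * (real CARD('d) * (10 * pi) * Lam)) + (real CARD('d) * (20 * pi))\<^sup>2"

lemma Cgrow_pos: "0 < Cgrow" using Lam_pos by (simp add: Cgrow_def add_pos_pos)

text \<open>Induction on the square of the excess over \<open>A\<close>, which grows by at most
  \<open>Cgrow\<close>. A large excess b meets an increment of order 1 / b only, and therefore the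
  growth is that of a square root instead of linear.\<close>

lemma grad_S_bound: "norm (grad (acc k) x) \<le> A + sqrt (real k * Cgrow)"
proof (induction k)
  case 0
  have "pd i (\<lambda>x :: real ^ 'd. 0 :: real) = (\<lambda>_. 0)" for i by (rule pd_eqI(1)) simp
  then have "grad (acc 0) x = 0" by (simp add: grad_def vec_eq_iff)
  then show ?case using A by simp
next
  case (Suc k)
  let ?D = "real CARD('d)"
  let ?a = "norm (grad (acc k) x)" and ?m = "norm (grad (\<lambda>x. inc k x / 8 ^ k) x)"
  have pf: "pd i (\<lambda>x. inc k x / 8 ^ k) x = pd i (inc k) x / 8 ^ k" for i
    using pd_scale[OF rtrig_pd(3)[OF inc_rtrig]] by metis
  have le: "norm (grad (acc (Suc k)) x) \<le> ?a + ?m" unfolding grad_S_Suc by (rule norm_triangle_ineq)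
  have m1: "?m \<le> ?D * (20 * pi)" by (rule norm_grad_le) (unfold pf, rule pd_f_le)
  have m0: "0 \<le> ?m" by simp
  have sq: "sqrt (real (Suc k) * Cgrow) = sqrt (real k * Cgrow + Cgrow)" by (simp add: distrib_right)
  show ?case
  proof (cases "?a \<le> A")
    case True
    have "?m\<^sup>2 \<le> (?D * (20 * pi))\<^sup>2" using m1 by (intro power_mono) auto
    also have "\<dots> \<le> real k * Cgrow + Cgrow" using Cgrow_pos Lam_pos by (simp add: Cgrow_def add_nonneg_nonneg)
    finally have "?m \<le> sqrt (real k * Cgrow + Cgrow)" by (rule real_le_rsqrt)
    then show ?thesis using le True sq by linarith
  next
    case False
    define b where "b = ?a - A"
    have b: "0 < b" using False by (simp add: b_def)
    have m2: "?m \<le> ?D * (?D * (10 * pi) * Lam / b)"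
      by (rule norm_grad_le) (unfold pf, rule pd_f_tail[OF b], simp add: b_def)
    have "b * ?m \<le> b * (?D * (?D * (10 * pi) * Lam / b))" using m2 b by (intro mult_left_mono) auto
    also have "\<dots> = ?D * (?D * (10 * pi) * Lam)" using b by simp
    finally have bm: "b * ?m \<le> ?D * (?D * (10 * pi) * Lam)" .
    have "b \<le> sqrt (real k * Cgrow)" using Suc by (simp add: b_def)
    then have "b\<^sup>2 \<le> (sqrt (real k * Cgrow))\<^sup>2" using b by (intro power_mono) auto
    also have "\<dots> = real k * Cgrow" using Cgrow_pos by simp
    finally have b2: "b\<^sup>2 \<le> real k * Cgrow" .
    have "?m\<^sup>2 \<le> (?D * (20 * pi))\<^sup>2" using m1 by (intro power_mono) auto
    then have "(b + ?m)\<^sup>2 \<le> real k * Cgrow + Cgrow"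
      using b2 bm unfolding power2_sum Cgrow_def by linarith
    then have "b + ?m \<le> sqrt (real k * Cgrow + Cgrow)" by (rule real_le_rsqrt)
    then show ?thesis using le sq by (simp add: b_def)
  qed
qed

text \<open>Pythagoras: the spectrum of a new scale is disjoint from all earlier ones, so the mixed
  term vanishes and the squares of the scales add up.\<close>

lemma pd_S_L2: "(\<integral>x. (pd i (acc k) x)\<^sup>2 \<partial>unit_cube) \<le> real k * (20 * pi)\<^sup>2"
proof (induction k)
  case 0
  have "pd i (\<lambda>x :: real ^ 'd. 0 :: real) = (\<lambda>_. 0)" by (rule pd_eqI(1)) simp
  then show ?case by simp
next
  case (Suc k)
  let ?p = "pd i (acc k)" and ?q = "\<lambda>x. pd i (inc k) x / 8 ^ k"
  have rp: "rtrig (freqs_upto k) ?p" by (rule rtrig_pd(2)[OF acc_rtrig])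
  have rq: "rtrig (annulus i0 (8 ^ k)) ?q"
    using trig_cmult[OF rtrig_pd(2)[OF inc_rtrig, of k i], of "complex_of_real (1 / 8 ^ k)"] by simp
  obtain K L where K: "\<And>x. \<bar>?p x\<bar> \<le> K" and L: "\<And>x. \<bar>?q x\<bar> \<le> L" using rtrig_bounded[OF rp] rtrig_bounded[OF rq] by metis
  have KL: "0 \<le> K" "0 \<le> L" using K L abs_ge_zero order.trans by blast+
  note [measurable] = rtrig_measurable[OF rp] rtrig_measurable[OF rq]
  have I1: "integrable unit_cube (\<lambda>x. ?p x * ?p x)" and I2: "integrable unit_cube (\<lambda>x. ?q x * ?q x)" and I3: "integrable unit_cube (\<lambda>x. ?p x * ?q x)"
    by (rule unit_cube_integrable[where K = "K * K"] unit_cube_integrable[where K = "L * L"] unit_cube_integrable[where K = "K * L"],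
        measurable, unfold real_norm_def abs_mult, intro mult_mono K L KL abs_ge_zero)+
  have "(\<integral>x. (pd i (acc (Suc k)) x)\<^sup>2 \<partial>unit_cube) = (\<integral>x. ?p x * ?p x + ?q x * ?q x + 2 * (?p x * ?q x) \<partial>unit_cube)"
    unfolding pd_S_Suc by (intro Bochner_Integration.integral_cong refl) (simp add: power2_eq_square algebra_simps)
  also have "\<dots> = (\<integral>x. ?p x * ?p x \<partial>unit_cube) + (\<integral>x. ?q x * ?q x \<partial>unit_cube) + 2 * (\<integral>x. ?p x * ?q x \<partial>unit_cube)"
  proof -
    have gen: "(\<integral>x. a x + b x + 2 * c x \<partial>unit_cube) = (\<integral>x. a x \<partial>unit_cube) + (\<integral>x. b x \<partial>unit_cube) + 2 * (\<integral>x. c x \<partial>unit_cube)"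
      if "integrable unit_cube a" "integrable unit_cube b" "integrable unit_cube c" for a b c :: "real ^ 'd \<Rightarrow> real"
      using that by simp
    show ?thesis by (rule gen[OF I1 I2 I3])
  qed
  also have "(\<integral>x. ?p x * ?q x \<partial>unit_cube) = 0"
    by (rule rtrig_orthogonal[OF rp rq freq_set_upto freq_set_annulus freqs_disjoint])
  also have "(\<integral>x. ?q x * ?q x \<partial>unit_cube) \<le> (20 * pi)\<^sup>2"
  proof (rule unit_cube.integral_le_const[OF I2])
    have "?q x * ?q x \<le> (20 * pi)\<^sup>2" for x
      using power_mono[OF pd_f_le[of i k x], of 2] by (simp add: power2_eq_square)
    then show "AE x in unit_cube. ?q x * ?q x \<le> (20 * pi)\<^sup>2" by simp
  qed
  finally show ?case using Suc by (simp add: power2_eq_square distrib_right)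
qed

text \<open>Chebyshev's inequality. Once \<open>A\<close> is proportional to the square root of the
  number of scales, the points that are switched off form a uniformly small set.\<close>

lemma bad_set_measure:
  "measure unit_cube {x. A < norm (grad (acc k) x)} \<le> real CARD('d) * (20 * pi)\<^sup>2 * real k / A\<^sup>2"
proof -
  have pm[measurable]: "pd i (acc k) \<in> borel_measurable borel" for i by (rule rtrig_measurable[OF rtrig_pd(2)[OF acc_rtrig]])
  obtain K where K: "\<And>i x. \<bar>pd i (acc k) x\<bar> \<le> K"
  proof -
    have "\<forall>i. \<exists>K. \<forall>x. \<bar>pd i (acc k) x\<bar> \<le> K" using rtrig_bounded[OF rtrig_pd(2)[OF acc_rtrig]] by metis
    then obtain K where K: "\<And>i x. \<bar>pd i (acc k) x\<bar> \<le> K i" by metis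
    have "K i \<le> Max (range K)" for i by (rule Max_ge) auto
    then show ?thesis using K that order.trans by meson
  qed
  have sqI: "integrable unit_cube (\<lambda>x. (pd i (acc k) x)\<^sup>2)" for i
  proof (rule unit_cube_integrable[where K = "K\<^sup>2"])
    show "norm ((pd i (acc k) x)\<^sup>2) \<le> K\<^sup>2" for x using power_mono[OF K[of i x] abs_ge_zero, of 2] by simp
  qed measurable
  have ng: "(norm (grad (acc k) x))\<^sup>2 = (\<Sum>i\<in>UNIV. (pd i (acc k) x)\<^sup>2)" for x
    unfolding power2_norm_eq_inner grad_def inner_vec_def by (simp add: power2_eq_square)
  have set: "{x. A < norm (grad (acc k) x)} = {x. A\<^sup>2 < (\<Sum>i\<in>UNIV. (pd i (acc k) x)\<^sup>2)}"
    unfolding ng[symmetric] using A by (auto simp: power_strict_mono dest: power_less_imp_less_base)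
  have m: "{x. A\<^sup>2 < (\<Sum>i\<in>UNIV. (pd i (acc k) x)\<^sup>2)} \<in> sets borel" by measurable
  have "measure unit_cube {x. A\<^sup>2 < (\<Sum>i\<in>UNIV. (pd i (acc k) x)\<^sup>2)} = (\<integral>x. indicator {x. A\<^sup>2 < (\<Sum>i\<in>UNIV. (pd i (acc k) x)\<^sup>2)} x \<partial>unit_cube)"
    by simp
  also have "\<dots> \<le> (\<integral>x. (\<Sum>i\<in>UNIV. (pd i (acc k) x)\<^sup>2) / A\<^sup>2 \<partial>unit_cube)"
  proof (rule integral_mono)
    show "integrable unit_cube (indicator {x. A\<^sup>2 < (\<Sum>i\<in>UNIV. (pd i (acc k) x)\<^sup>2)} :: _ \<Rightarrow> real)"
      using m by (intro unit_cube_integrable[where K = 1]) (auto simp: indicator_def)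
    show "integrable unit_cube (\<lambda>x. (\<Sum>i\<in>UNIV. (pd i (acc k) x)\<^sup>2) / A\<^sup>2)" using sqI by simp
    show "indicator {x. A\<^sup>2 < (\<Sum>i\<in>UNIV. (pd i (acc k) x)\<^sup>2)} x \<le> (\<Sum>i\<in>UNIV. (pd i (acc k) x)\<^sup>2) / A\<^sup>2" for x
      using A by (auto simp: indicator_def le_divide_eq intro!: divide_nonneg_nonneg sum_nonneg)
  qed
  also have "\<dots> = (\<Sum>i\<in>UNIV. \<integral>x. (pd i (acc k) x)\<^sup>2 \<partial>unit_cube) / A\<^sup>2" using sqI by simp
  also have "\<dots> \<le> (\<Sum>i\<in>(UNIV :: 'd set). real k * (20 * pi)\<^sup>2) / A\<^sup>2"
    by (intro divide_right_mono sum_mono pd_S_L2) auto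
  finally show ?thesis unfolding set by (simp add: mult_ac)
qed

end

end

section \<open>Pairing the test function with the measure\<close>

lemma rtrig_rep_integrable:
  assumes "rtrig \<Phi> g" "freq_set \<Phi>" "prob_space \<mu>" "sets \<mu> = sets borel"
  shows "integrable \<mu> (\<lambda>z. g (rep_torus z))" "(\<lambda>z. g (rep_torus z)) \<in> borel_measurable borel"
proof -
  interpret prob_space \<mu> by fact
  have "continuous_on UNIV (\<lambda>z. g (rep_torus z))"
    by (rule continuous_periodic_rep[OF _ rtrig_continuous[OF assms(1)]]) (rule rtrig_periodic[OF assms(1,2)])
  then show m: "(\<lambda>z. g (rep_torus z)) \<in> borel_measurable borel" by (rule borel_measurable_continuous_onI)
  obtain K where "\<And>x. \<bar>g x\<bar> \<le> K" using rtrig_bounded[OF assms(1)] by metis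
  then show "integrable \<mu> (\<lambda>z. g (rep_torus z))"
    using m by (intro integrable_const_bound[where B = K]) (auto simp: measurable_cong_sets[OF assms(4) refl])
qed

text \<open>With \<open>s = \<bar>v\<bar> / (\<theta> * \<sigma>)\<close> the case \<open>P\<close> is \<open>s\<^sup>2 - s ^ 4 \<le> s\<close>; otherwise \<open>\<bar>v\<bar>\<close> is absorbed by the last two terms
  (arithmetic and geometric means).\<close>

lemma truncated_abs_ge:
  fixes v \<sigma> \<theta> \<zeta> :: real
  assumes "0 < \<sigma>" "0 < \<theta>" "0 < \<zeta>"
  shows "v\<^sup>2 / (\<theta> * \<sigma>) - v ^ 4 / (\<theta> * \<sigma>) ^ 3 - \<zeta> * v\<^sup>2 / (2 * \<sigma>) - (if P then 0 else \<sigma> / (2 * \<zeta>)) \<le> \<bar>v\<bar> * (if P then 1 else 0)"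
proof -
  define s where "s = \<bar>v\<bar> / (\<theta> * \<sigma>)"
  have s0: "0 \<le> s" using assms by (simp add: s_def)
  have v: "\<bar>v\<bar> = s * (\<theta> * \<sigma>)" using assms by (simp add: s_def)
  have v2: "v\<^sup>2 = s\<^sup>2 * (\<theta> * \<sigma>)\<^sup>2" using v by (metis power2_abs power_mult_distrib)
  have v4: "v ^ 4 = s ^ 4 * (\<theta> * \<sigma>) ^ 4" using v by (metis power_even_abs even_numeral power_mult_distrib)
  have e2: "v\<^sup>2 / (\<theta> * \<sigma>) = s\<^sup>2 * (\<theta> * \<sigma>)" unfolding v2 using assms by (simp add: power2_eq_square)
  have e4: "v ^ 4 / (\<theta> * \<sigma>) ^ 3 = s ^ 4 * (\<theta> * \<sigma>)" unfolding v4 using assms by (simp add: power4_eq_xxxx power3_eq_cube)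
  have "s\<^sup>2 - s ^ 4 \<le> s"
  proof -
    have c: "0 \<le> 1 - s + s ^ 3"
    proof (cases "s \<le> 1")
      case True
      then show ?thesis using s0 by simp
    next
      case False
      then have "s * 1 \<le> s * s\<^sup>2" using s0 by (intro mult_left_mono) (auto simp: power2_eq_square intro: mult_ge1_I)
      then show ?thesis by (simp add: power2_eq_square power3_eq_cube)
    qed
    have "s - (s\<^sup>2 - s ^ 4) = s * (1 - s + s ^ 3)"
      by (simp add: power2_eq_square power3_eq_cube power4_eq_xxxx algebra_simps)
    then show ?thesis using mult_nonneg_nonneg[OF s0 c] by linarith
  qed
  then have "(s\<^sup>2 - s ^ 4) * (\<theta> * \<sigma>) \<le> s * (\<theta> * \<sigma>)" using assms by (intro mult_right_mono) auto
  then have m: "v\<^sup>2 / (\<theta> * \<sigma>) - v ^ 4 / (\<theta> * \<sigma>) ^ 3 \<le> \<bar>v\<bar>" unfolding e2 e4 v by (simp add: left_diff_distrib)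
  have "0 \<le> (\<zeta> * \<bar>v\<bar> - \<sigma>)\<^sup>2 / (2 * \<sigma> * \<zeta>)" using assms by simp
  also have "\<dots> = \<zeta> * v\<^sup>2 / (2 * \<sigma>) + \<sigma> / (2 * \<zeta>) - \<bar>v\<bar>"
    using assms by (simp add: power2_diff power_mult_distrib field_simps power2_eq_square)
  finally have am: "\<bar>v\<bar> \<le> \<zeta> * v\<^sup>2 / (2 * \<sigma>) + \<sigma> / (2 * \<zeta>)" by simp
  have nn: "0 \<le> \<zeta> * v\<^sup>2 / (2 * \<sigma>)" using assms by simp
  show ?thesis using m am nn by (cases P) simp_all
qed

context
  fixes i0 :: "'d::finite" and \<mu> :: "'d torus measure" and A :: real
  assumes \<mu>: "prob_space \<mu>" "sets \<mu> = sets borel" and A: "0 < A"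
begin

text \<open>The kernel moves from the selection to the measure. Both sides are the same finite sum
  over frequencies, so exchanging the two integrals is exchanging finite sums.\<close>

lemma integral_inc:
  "(\<integral>z. conv (ker i0 (8 ^ k)) (select (wave i0 \<mu> k) A (test_fun i0 \<mu> A k)) (rep_torus z) \<partial>\<mu>)
    = (\<integral>y. select (wave i0 \<mu> k) A (test_fun i0 \<mu> A k) y * wave i0 \<mu> k y \<partial>unit_cube)"
proof -
  let ?h = "select (wave i0 \<mu> k) A (test_fun i0 \<mu> A k)"
  let ?A = "annulus i0 (8 ^ k)"
  note hm[measurable] = sel_measurable[OF \<mu> A, of i0 k] and hl = sel_le[OF \<mu> A, of i0 k]
  obtain a where "(\<lambda>x. complex_of_real (ker i0 (8 ^ k) x)) = tp ?A a" using trig_ker[of i0 "8 ^ k"] by (auto simp: trig_def)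
  then have a: "complex_of_real (ker i0 (8 ^ k) x) = tp ?A a x" for x by (rule fun_cong)
  let ?hh = "\<lambda>\<xi>. \<integral>y. complex_of_real (?h y) * cnj (ee \<xi> y) \<partial>unit_cube"
  let ?m = "\<lambda>\<xi>. \<integral>z. ee \<xi> (rep_torus z) \<partial>\<mu>"
  have fin: "finite ?A" "?A \<subseteq> int_vectors" using freq_set_annulus[of i0 "8 ^ k"] by (auto simp: freq_set_def)
  have hI: "integrable unit_cube (\<lambda>y. complex_of_real (?h y) * cnj (ee \<xi> y))" for \<xi>
  proof (rule unit_cube_integrable[where K = 1])
    show "(\<lambda>y. complex_of_real (?h y) * cnj (ee \<xi> y)) \<in> borel_measurable borel" unfolding ee_minus[symmetric] by measurable
  qed (use hl in \<open>simp add: norm_mult\<close>)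
  have "complex_of_real (\<integral>z. conv (ker i0 (8 ^ k)) ?h (rep_torus z) \<partial>\<mu>) = (\<integral>z. (\<Sum>\<xi>\<in>?A. (a \<xi> * ?hh \<xi>) * ee \<xi> (rep_torus z)) \<partial>\<mu>)"
    unfolding integral_complex_of_real[symmetric] conv_tp[OF a hm hl] tp_def ..
  also have "\<dots> = (\<Sum>\<xi>\<in>?A. (a \<xi> * ?hh \<xi>) * ?m \<xi>)"
    using fourier_integrable[OF \<mu>] fin by (subst Bochner_Integration.integral_sum) auto
  also have "\<dots> = (\<integral>y. (\<Sum>\<xi>\<in>?A. (a \<xi> * ?m \<xi>) * (complex_of_real (?h y) * cnj (ee \<xi> y))) \<partial>unit_cube)"
    by (simp only: Bochner_Integration.integral_sum[OF integrable_mult_right[OF hI]] integral_mult_right_zero) (simp add: mult_ac)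
  also have "\<dots> = (\<integral>y. complex_of_real (?h y) * complex_of_real (wave i0 \<mu> k y) \<partial>unit_cube)"
    unfolding wave_tp[OF \<mu> a] by (simp add: sum_distrib_left mult_ac)
  also have "\<dots> = complex_of_real (\<integral>y. ?h y * wave i0 \<mu> k y \<partial>unit_cube)"
    by (simp flip: integral_complex_of_real)
  finally show ?thesis by (simp only: of_real_eq_iff)
qed

lemma integral_test_fun:
  "(\<integral>z. test_fun i0 \<mu> A r (rep_torus z) \<partial>\<mu>)
    = (\<Sum>k<r. (\<integral>y. select (wave i0 \<mu> k) A (test_fun i0 \<mu> A k) y * wave i0 \<mu> k y \<partial>unit_cube) / 8 ^ k)"
proof (induction r)
  case (Suc r)
  have I1: "integrable \<mu> (\<lambda>z. test_fun i0 \<mu> A r (rep_torus z))"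
    by (rule rtrig_rep_integrable(1)[OF acc_rtrig[OF \<mu> A] freq_set_upto \<mu>])
  have I2: "integrable \<mu> (\<lambda>z. conv (ker i0 (8 ^ r)) (select (wave i0 \<mu> r) A (test_fun i0 \<mu> A r)) (rep_torus z))"
    by (rule rtrig_rep_integrable(1)[OF inc_rtrig[OF \<mu> A] freq_set_annulus \<mu>])
  have gen: "(\<integral>z. F z + G z / c \<partial>\<mu>) = (\<integral>z. F z \<partial>\<mu>) + (\<integral>z. G z \<partial>\<mu>) / c" if "integrable \<mu> F" "integrable \<mu> G"
    for F G and c :: real using that by simp
  show ?case unfolding test_fun.simps(2) gen[OF I1 I2] Suc integral_inc by simp
qed simp

text \<open>Divided by the uniform gradient bound the test function is Lipschitz with constant 1 on
  the torus. Its uniform mean vanishes because no annulus contains the frequency 0.\<close>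

lemma wasserstein_test_fun:
  "(\<integral>z. test_fun i0 \<mu> A r (rep_torus z) \<partial>\<mu>) \<le> (A + sqrt (real r * Cgrow TYPE('d))) * wasserstein 1 \<mu> torus_uniform"
proof -
  let ?L = "A + sqrt (real r * Cgrow TYPE('d))"
  let ?S = "test_fun i0 \<mu> A r"
  have L: "0 < ?L" using A Cgrow_pos[OF \<mu> A] by (intro add_pos_nonneg) auto
  note S = acc_rtrig[OF \<mu> A, of i0 r]
  have lip: "\<bar>?S x - ?S y\<bar> \<le> ?L * norm (x - y)" for x y
    by (rule rtrig_lipschitz[OF S]) (rule grad_S_bound[OF \<mu> A])
  have per: "?S (x + k) = ?S x" if "k \<in> int_vectors" for x k by (rule rtrig_periodic[OF S freq_set_upto that])
  have Fm: "(\<lambda>z. ?S (rep_torus z) / ?L) \<in> borel_measurable borel"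
    using rtrig_rep_integrable(2)[OF S freq_set_upto \<mu>] by measurable
  have "(\<integral>z. ?S (rep_torus z) / ?L \<partial>\<mu>) - (\<integral>z. ?S (rep_torus z) / ?L \<partial>torus_uniform) \<le> wasserstein 1 \<mu> torus_uniform"
  proof (rule wasserstein_ge_dual[OF \<mu>(1) prob_space_torus_uniform \<mu>(2) sets_torus_uniform _ _ Fm])
    fix z w :: "'d torus"
    have z: "z = torus_proj (rep_torus z)" and w: "w = torus_proj (rep_torus w)" by (simp_all add: torus_proj_rep)
    obtain k where k: "k \<in> int_vectors" "dist (torus_proj (rep_torus z)) (torus_proj (rep_torus w)) = norm (rep_torus z - rep_torus w - k)"
      using dist_torus_attained by blast
    have "?S (rep_torus z) - ?S (rep_torus w) = ?S (rep_torus z) - ?S (rep_torus w + k)" using per[OF k(1)] by simp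
    also have "\<dots> \<le> ?L * norm (rep_torus z - (rep_torus w + k))" using lip[of "rep_torus z" "rep_torus w + k"] by linarith
    also have "\<dots> = ?L * dist z w" using k(2) z w by (simp add: diff_diff_add)
    finally have "(?S (rep_torus z) - ?S (rep_torus w)) / ?L \<le> dist z w" using L by (simp add: divide_le_eq mult.commute)
    then show "?S (rep_torus z) / ?L - ?S (rep_torus w) / ?L \<le> dist z w powr 1" by (simp add: diff_divide_distrib)
  qed simp_all
  moreover have "(\<integral>z. ?S (rep_torus z) / ?L \<partial>torus_uniform) = 0"
  proof -
    have unif: "(\<integral>z. ?S (rep_torus z) / ?L \<partial>torus_uniform) = (\<integral>x. ?S x / ?L \<partial>unit_cube)"
      by (subst integral_torus_uniform[OF Fm]) (simp only: periodic_rep_proj[OF per])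
    have one: "rtrig {0} (\<lambda>_. 1)" unfolding trig_def by (rule exI[of _ "\<lambda>_. 1"]) (auto simp: tp_def fun_eq_iff)
    have dis: "freqs_upto i0 r \<inter> {0} = {}"
      by (auto simp: freqs_upto_def annulus_def) (metis not_le zero_less_power zero_less_numeral)
    have f0: "freq_set {0 :: real ^ 'd}" by (simp add: freq_set_def int_vectors_0)
    have "(\<integral>x. ?S x * 1 \<partial>unit_cube) = 0" by (rule rtrig_orthogonal[OF S one freq_set_upto f0 dis])
    then show ?thesis unfolding unif by simp
  qed
  ultimately show ?thesis using L by (simp add: divide_le_eq mult.commute)
qed

text \<open>The selection times the wave is the modulus of the wave where nothing is switched off,
  and 0 elsewhere. Integrating \<open>truncated_abs_ge\<close> leaves the two moments;
  \<open>\<zeta>\<^sup>2\<close> bounds the switched-off set and \<open>\<sigma>\<close> stands for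
  the typical size of the wave.\<close>

lemma selected_wave_ge:
  assumes \<sigma>: "0 < \<sigma>" and \<theta>: "0 < \<theta>" and \<zeta>: "0 < \<zeta>" and bad: "real CARD('d) * (20 * pi)\<^sup>2 * real k / A\<^sup>2 \<le> \<zeta>\<^sup>2"
  defines "V2 \<equiv> \<integral>y. (wave i0 \<mu> k y)\<^sup>2 \<partial>unit_cube" and "V4 \<equiv> \<integral>y. (wave i0 \<mu> k y) ^ 4 \<partial>unit_cube"
  shows "V2 / (\<theta> * \<sigma>) - V4 / (\<theta> * \<sigma>) ^ 3 - \<zeta> / 2 * (V2 / \<sigma> + \<sigma>)
    \<le> (\<integral>y. select (wave i0 \<mu> k) A (test_fun i0 \<mu> A k) y * wave i0 \<mu> k y \<partial>unit_cube)"
proof -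
  let ?v = "wave i0 \<mu> k"
  let ?G = "\<lambda>y. norm (grad (test_fun i0 \<mu> A k) y) \<le> A"
  let ?h = "select ?v A (test_fun i0 \<mu> A k)"
  note hm[measurable] = sel_measurable[OF \<mu> A, of i0 k] and hl = sel_le[OF \<mu> A, of i0 k]
  note r = wave_rtrig[OF \<mu>, of i0 k]
  note [measurable] = rtrig_measurable[OF r]
  obtain K where K: "\<And>x. \<bar>?v x\<bar> \<le> K" using rtrig_bounded[OF r] by metis
  have I2: "integrable unit_cube (\<lambda>y. (?v y)\<^sup>2)"
    using power_mono[OF K abs_ge_zero, where n = 2] by (intro unit_cube_integrable[where K = "K\<^sup>2"]) auto
  have I4: "integrable unit_cube (\<lambda>y. (?v y) ^ 4)"
    using power_mono[OF K abs_ge_zero, where n = 4] by (intro unit_cube_integrable[where K = "K ^ 4"]) auto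
  have "continuous_on UNIV (grad (test_fun i0 \<mu> A k))"
    unfolding grad_def[abs_def] by (intro continuous_on_vec_lambda rtrig_continuous[OF rtrig_pd(2)[OF acc_rtrig[OF \<mu> A]]])
  then have gm[measurable]: "grad (test_fun i0 \<mu> A k) \<in> borel_measurable borel" by (rule borel_measurable_continuous_onI)
  have Ib: "integrable unit_cube (\<lambda>y. if ?G y then 0 else \<sigma> / (2 * \<zeta>))"
    using \<sigma> \<zeta> by (intro unit_cube_integrable[where K = "\<sigma> / (2 * \<zeta>)"]) auto
  have Ih: "integrable unit_cube (\<lambda>y. ?h y * ?v y)"
  proof (rule unit_cube_integrable[where K = "1 * K"])
    show "norm (?h y * ?v y) \<le> 1 * K" for y
      unfolding real_norm_def abs_mult using hl[of y] K[of y] by (intro mult_mono) auto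
  qed measurable
  have hv: "?h y * ?v y = \<bar>?v y\<bar> * (if ?G y then 1 else 0)" for y by (auto simp: select_def abs_sgn mult.commute)
  have bint: "(\<integral>y. (if ?G y then 0 else \<sigma> / (2 * \<zeta>)) \<partial>unit_cube) \<le> \<sigma> * \<zeta> / 2"
  proof -
    have m: "{y. A < norm (grad (test_fun i0 \<mu> A k) y)} \<in> sets borel" by measurable
    have "(\<integral>y. (if ?G y then 0 else \<sigma> / (2 * \<zeta>)) \<partial>unit_cube) = (\<integral>y. (\<sigma> / (2 * \<zeta>)) * indicator {y. A < norm (grad (test_fun i0 \<mu> A k) y)} y \<partial>unit_cube)"
      by (intro Bochner_Integration.integral_cong) (auto simp: indicator_def)
    also have "\<dots> = (\<sigma> / (2 * \<zeta>)) * measure unit_cube {y. A < norm (grad (test_fun i0 \<mu> A k) y)}"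
      by (subst integral_mult_right_zero) simp
    also have "\<dots> \<le> (\<sigma> / (2 * \<zeta>)) * \<zeta>\<^sup>2"
      using \<sigma> \<zeta> order.trans[OF bad_set_measure[OF \<mu> A] bad] by (intro mult_left_mono) auto
    also have "\<dots> = \<sigma> * \<zeta> / 2" using \<zeta> by (simp add: power2_eq_square)
    finally show ?thesis .
  qed
  have "V2 / (\<theta> * \<sigma>) - V4 / (\<theta> * \<sigma>) ^ 3 - \<zeta> / 2 * (V2 / \<sigma> + \<sigma>)
     \<le> V2 / (\<theta> * \<sigma>) - V4 / (\<theta> * \<sigma>) ^ 3 - \<zeta> * V2 / (2 * \<sigma>) - (\<integral>y. (if ?G y then 0 else \<sigma> / (2 * \<zeta>)) \<partial>unit_cube)"
  proof -
    have "\<zeta> / 2 * (V2 / \<sigma> + \<sigma>) = \<zeta> * V2 / (2 * \<sigma>) + \<sigma> * \<zeta> / 2" by (simp add: distrib_left mult.commute)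
    then show ?thesis using bint by linarith
  qed
  also have "\<dots> = (\<integral>y. (?v y)\<^sup>2 / (\<theta> * \<sigma>) - (?v y) ^ 4 / (\<theta> * \<sigma>) ^ 3 - \<zeta> * (?v y)\<^sup>2 / (2 * \<sigma>) - (if ?G y then 0 else \<sigma> / (2 * \<zeta>)) \<partial>unit_cube)"
    using I2 I4 Ib by (simp add: V2_def V4_def)
  also have "\<dots> \<le> (\<integral>y. ?h y * ?v y \<partial>unit_cube)"
  proof (rule integral_mono[OF _ Ih])
    show "integrable unit_cube (\<lambda>y. (?v y)\<^sup>2 / (\<theta> * \<sigma>) - (?v y) ^ 4 / (\<theta> * \<sigma>) ^ 3 - \<zeta> * (?v y)\<^sup>2 / (2 * \<sigma>) - (if ?G y then 0 else \<sigma> / (2 * \<zeta>)))"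
      using I2 I4 Ib by simp
    show "(?v y)\<^sup>2 / (\<theta> * \<sigma>) - (?v y) ^ 4 / (\<theta> * \<sigma>) ^ 3 - \<zeta> * (?v y)\<^sup>2 / (2 * \<sigma>) - (if ?G y then 0 else \<sigma> / (2 * \<zeta>)) \<le> ?h y * ?v y" for y
      unfolding hv by (rule truncated_abs_ge[OF \<sigma> \<theta> \<zeta>])
  qed
  finally show ?thesis .
qed

end

lemma multiscale_bound:
  fixes i0 :: "'d::finite" and \<mu> :: "'d torus measure"
  assumes \<mu>: "prob_space \<mu>" "sets \<mu> = sets borel" and M: "0 < M" and r: "0 < r" and \<sigma>: "\<And>k. 0 < \<sigma> k" and \<theta>: "0 < \<theta>"
  defines "V2 \<equiv> \<lambda>k. \<integral>y. (wave i0 \<mu> k y)\<^sup>2 \<partial>unit_cube" and "V4 \<equiv> \<lambda>k. \<integral>y. (wave i0 \<mu> k y) ^ 4 \<partial>unit_cube"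
  shows "(\<Sum>k<r. (V2 k / (\<theta> * \<sigma> k) - V4 k / (\<theta> * \<sigma> k) ^ 3 - 10 * pi * sqrt (real CARD('d)) / M * (V2 k / \<sigma> k + \<sigma> k)) / 8 ^ k)
     \<le> (M + sqrt (Cgrow TYPE('d))) * sqrt (real r) * wasserstein 1 \<mu> torus_uniform"
proof -
  \<comment> \<open>Proportional to \<open>sqrt (real r)\<close>, so that the bound of
    \<open>bad_set_measure\<close> at every scale below \<open>r\<close> is at most the constant
    \<open>\<zeta>\<^sup>2\<close>.\<close>
  define A where "A = M * sqrt (real r)"
  have A: "0 < A" using M r by (simp add: A_def)
  define \<zeta> where "\<zeta> = 20 * pi * sqrt (real CARD('d)) / M"
  have \<zeta>: "0 < \<zeta>" using M by (simp add: \<zeta>_def)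
  have bad: "real CARD('d) * (20 * pi)\<^sup>2 * real k / A\<^sup>2 \<le> \<zeta>\<^sup>2" if "k < r" for k
  proof -
    have "real CARD('d) * (20 * pi)\<^sup>2 * real k / A\<^sup>2 \<le> real CARD('d) * (20 * pi)\<^sup>2 * real r / A\<^sup>2"
      using that by (intro divide_right_mono mult_left_mono) auto
    also have "\<dots> = \<zeta>\<^sup>2" using r M by (simp add: A_def \<zeta>_def power_divide power_mult_distrib)
    finally show ?thesis .
  qed
  have z2: "\<zeta> / 2 = 10 * pi * sqrt (real CARD('d)) / M" by (simp add: \<zeta>_def)
  have "(\<Sum>k<r. (V2 k / (\<theta> * \<sigma> k) - V4 k / (\<theta> * \<sigma> k) ^ 3 - \<zeta> / 2 * (V2 k / \<sigma> k + \<sigma> k)) / 8 ^ k)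
    \<le> (\<Sum>k<r. (\<integral>y. select (wave i0 \<mu> k) A (test_fun i0 \<mu> A k) y * wave i0 \<mu> k y \<partial>unit_cube) / 8 ^ k)"
    unfolding V2_def V4_def
    by (intro sum_mono divide_right_mono selected_wave_ge[OF \<mu> A \<sigma> \<theta> \<zeta> bad]) auto
  also have "\<dots> = (\<integral>z. test_fun i0 \<mu> A r (rep_torus z) \<partial>\<mu>)" by (rule integral_test_fun[OF \<mu> A, symmetric])
  also have "\<dots> \<le> (A + sqrt (real r * Cgrow TYPE('d))) * wasserstein 1 \<mu> torus_uniform" by (rule wasserstein_test_fun[OF \<mu> A])
  also have "A + sqrt (real r * Cgrow TYPE('d)) = (M + sqrt (Cgrow TYPE('d))) * sqrt (real r)"
    by (simp add: A_def real_sqrt_mult algebra_simps)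
  finally show ?thesis unfolding z2 .
qed

section \<open>Moments of the waves\<close>

lemma sum_lessThan_4: "(\<Sum>i<4. f i) = f 0 + f 1 + f 2 + f (3::nat)" for f :: "nat \<Rightarrow> 'a::comm_monoid_add"
  by (simp add: numeral_eq_Suc)

lemma prod_lessThan_4: "(\<Prod>i<4. f i) = f 0 * f 1 * f 2 * f (3::nat)" for f :: "nat \<Rightarrow> 'a::comm_monoid_mult"
  by (simp add: numeral_eq_Suc)

lemma ee_eq_cis: "ee \<xi> x = cis (((2 * pi) *\<^sub>R \<xi>) \<bullet> x)"
  by (simp add: ee_def mult.assoc)

section \<open>Correlations of the process at four ordered times\<close>

context subordinated_torus begin

text \<open>The rate at which the frequency \<xi> is forgotten when \<open>H = 1 / 2\<close>:
  \<open>B\<close> is evaluated at half the squared norm of \<open>(2 * pi) *\<^sub>R \<xi>\<close>,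
  as in \<open>characteristic_function\<close>.\<close>

abbreviation psi :: "real ^ 'd \<Rightarrow> real" where
  "psi \<xi> \<equiv> B (2 * pi\<^sup>2 * (norm \<xi>)\<^sup>2)"

text \<open>The frequencies sum to 0, so nothing decays before the first time. In the three gaps the
  frequencies still to come sum to - \<xi>0, to \<xi>2 + \<xi>3 and to \<xi>3.\<close>

lemma correlation:
  assumes H: "H = 1 / 2" and BP: "B \<in> bernstein_pos"
    and s: "0 \<le> s0" "s0 \<le> s1" "s1 \<le> s2" "s2 \<le> s3" and \<xi>: "\<xi>0 + \<xi>1 + \<xi>2 + \<xi>3 = 0"
  shows "expectation (\<lambda>\<omega>. ee \<xi>0 (X (S s0 \<omega>) \<omega>) * ee \<xi>1 (X (S s1 \<omega>) \<omega>) * ee \<xi>2 (X (S s2 \<omega>) \<omega>) * ee \<xi>3 (X (S s3 \<omega>) \<omega>))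
    = of_real (exp (- (s1 - s0) * psi \<xi>0) * exp (- (s2 - s1) * psi (\<xi>2 + \<xi>3)) * exp (- (s3 - s2) * psi \<xi>3))"
proof -
  let ?s = "\<lambda>i::nat. if i = 0 then s0 else if i = 1 then s1 else if i = 2 then s2 else s3"
  let ?\<xi> = "\<lambda>i::nat. if i = 0 then \<xi>0 else if i = 1 then \<xi>1 else if i = 2 then \<xi>2 else \<xi>3"
  let ?\<theta> = "\<lambda>i. (2 * pi) *\<^sub>R ?\<xi> i"
  have B0: "B 0 = 0" using BP by (simp add: bernstein_pos_def)
  have nrm: "(norm ((2 * pi) *\<^sub>R \<eta>))\<^sup>2 / 2 = 2 * pi\<^sup>2 * (norm \<eta>)\<^sup>2" for \<eta> :: "real ^ 'd"
    by (simp add: power_mult_distrib)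
  have sets: "{0..<4} = {0,1,2,3::nat}" "{1..<4} = {1,2,3::nat}" "{2..<4} = {2,3::nat}" "{3..<4} = {3::nat}" by auto
  have x0: "\<xi>1 + (\<xi>2 + \<xi>3) = - \<xi>0" using \<xi> by (metis add.assoc add_eq_0_iff)
  have x00: "\<xi>0 + (\<xi>1 + (\<xi>2 + \<xi>3)) = 0" using \<xi> by (simp add: add.assoc)
  have S: "(\<Sum>i\<in>{0..<4}. ?\<theta> i) = (2 * pi) *\<^sub>R 0" "(\<Sum>i\<in>{1..<4}. ?\<theta> i) = (2 * pi) *\<^sub>R (- \<xi>0)"
    "(\<Sum>i\<in>{2..<4}. ?\<theta> i) = (2 * pi) *\<^sub>R (\<xi>2 + \<xi>3)" "(\<Sum>i\<in>{3..<4}. ?\<theta> i) = (2 * pi) *\<^sub>R \<xi>3"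
    unfolding sets x0[symmetric] x00[symmetric] by (simp_all add: scaleR_right_distrib)
  have "expectation (\<lambda>\<omega>. cis (\<Sum>i<4. ?\<theta> i \<bullet> X (S (?s i) \<omega>) \<omega>)) = of_real (\<Prod>l<4. exp (- (?s l - (if l = 0 then 0 else ?s (l - 1))) * B ((norm (\<Sum>i\<in>{l..<4}. ?\<theta> i))\<^sup>2 / 2)))"
    by (rule characteristic_function[OF H]) (use s in auto)
  also have "\<dots> = of_real (exp (- (s1 - s0) * psi \<xi>0) * exp (- (s2 - s1) * psi (\<xi>2 + \<xi>3)) * exp (- (s3 - s2) * psi \<xi>3))"
    unfolding prod_lessThan_4 S nrm by (simp add: B0)
  finally show ?thesis
    unfolding sum_lessThan_4 ee_eq_cis cis_mult by simp
qed

end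

lemma sum_product_4:
  fixes p q r s :: "'i \<Rightarrow> 'a::comm_semiring_1"
  shows "(\<Sum>i\<in>A. p i) * (\<Sum>i\<in>A. q i) * (\<Sum>i\<in>A. r i) * (\<Sum>i\<in>A. s i)
    = (\<Sum>i\<in>A. \<Sum>j\<in>A. \<Sum>k\<in>A. \<Sum>l\<in>A. p i * q j * r k * s l)"
proof -
  have "(\<Sum>i\<in>A. p i) * ((\<Sum>i\<in>A. q i) * ((\<Sum>i\<in>A. r i) * (\<Sum>i\<in>A. s i)))
    = (\<Sum>i\<in>A. \<Sum>j\<in>A. \<Sum>k\<in>A. \<Sum>l\<in>A. p i * (q j * (r k * s l)))"
    by (simp only: sum_distrib_right) (simp only: sum_distrib_left)
  then show ?thesis by (simp only: mult.assoc)
qed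

lemma integral_sum_4:
  fixes G :: "'i \<Rightarrow> 'i \<Rightarrow> 'i \<Rightarrow> 'i \<Rightarrow> 'w \<Rightarrow> 'b::{banach, second_countable_topology}"
  assumes "\<And>i j k l. i \<in> A \<Longrightarrow> j \<in> A \<Longrightarrow> k \<in> A \<Longrightarrow> l \<in> A \<Longrightarrow> integrable N (G i j k l)"
  shows "(\<integral>y. (\<Sum>i\<in>A. \<Sum>j\<in>A. \<Sum>k\<in>A. \<Sum>l\<in>A. G i j k l y) \<partial>N) = (\<Sum>i\<in>A. \<Sum>j\<in>A. \<Sum>k\<in>A. \<Sum>l\<in>A. \<integral>y. G i j k l y \<partial>N)"
  using assms by (simp add: Bochner_Integration.integral_sum)

text \<open>Integrating over the shift y keeps exactly the quadruples of frequencies with sum 0, the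
  ones to which \<open>correlation\<close> applies.\<close>

lemma integral_product_4:
  assumes A: "freq_set A" and f: "\<And>x. complex_of_real (f x) = tp A a x"
  shows "complex_of_real (\<integral>y. f (x0 - y) * f (x1 - y) * f (x2 - y) * f (x3 - y) \<partial>unit_cube)
    = (\<Sum>i\<in>A. \<Sum>j\<in>A. \<Sum>k\<in>A. \<Sum>l\<in>A. if i + j + k + l = 0 then (a i * a j * a k * a l) * (ee i x0 * ee j x1 * ee k x2 * ee l x3) else 0)"
proof -
  have fx: "complex_of_real (f (x - y)) = (\<Sum>\<xi>\<in>A. a \<xi> * ee \<xi> x * ee (- \<xi>) y)" for x y
    unfolding f tp_def by (simp add: ee_diff_right ee_minus mult.assoc)
  define c where "c i j k l = (a i * a j * a k * a l) * (ee i x0 * ee j x1 * ee k x2 * ee l x3)" for i j k l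
  have I: "integrable unit_cube (\<lambda>y. c i j k l * ee (- (i + j + k + l)) y)" for i j k l
    by (rule unit_cube_integrable[where K = "norm (c i j k l)"]) (simp_all add: norm_mult)
  have int0: "i + j + k + l \<in> int_vectors" if "i \<in> A" "j \<in> A" "k \<in> A" "l \<in> A" for i j k l
    using A that by (auto simp: freq_set_def intro!: int_vectors_add)
  have "complex_of_real (\<integral>y. f (x0 - y) * f (x1 - y) * f (x2 - y) * f (x3 - y) \<partial>unit_cube)
    = (\<integral>y. (\<Sum>i\<in>A. \<Sum>j\<in>A. \<Sum>k\<in>A. \<Sum>l\<in>A. c i j k l * ee (- (i + j + k + l)) y) \<partial>unit_cube)"
    unfolding integral_complex_of_real[symmetric] of_real_mult fx sum_product_4 c_def
    unfolding ee_minus ee_add complex_cnj_mult by (intro Bochner_Integration.integral_cong sum.cong refl) (simp only: mult_ac)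
  also have "\<dots> = (\<Sum>i\<in>A. \<Sum>j\<in>A. \<Sum>k\<in>A. \<Sum>l\<in>A. \<integral>y. c i j k l * ee (- (i + j + k + l)) y \<partial>unit_cube)"
    by (rule integral_sum_4[OF I])
  also have "\<dots> = (\<Sum>i\<in>A. \<Sum>j\<in>A. \<Sum>k\<in>A. \<Sum>l\<in>A. if i + j + k + l = 0 then c i j k l else 0)"
  proof (intro sum.cong refl)
    fix i j k l assume "i \<in> A" "j \<in> A" "k \<in> A" "l \<in> A"
    then show "(\<integral>y. c i j k l * ee (- (i + j + k + l)) y \<partial>unit_cube) = (if i + j + k + l = 0 then c i j k l else 0)"
      using integral_ee[OF int_vectors_minus[OF int0]] by (simp only: integral_mult_right_zero) (simp only: neg_equal_0_iff_equal mult_1_right mult_zero_right split: if_split, simp)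
  qed
  finally show ?thesis by (simp only: c_def)
qed

text \<open>Quadruples with \<open>k + l = 0\<close> split into two opposite pairs, which leaves two
  free choices. All others are counted crudely and carry the weight \<open>E\<close>.\<close>

lemma count_quadruples:
  fixes A :: "'a::ab_group_add set"
  assumes "finite A" "0 \<le> (E::real)"
  shows "(\<Sum>i\<in>A. \<Sum>j\<in>A. \<Sum>k\<in>A. \<Sum>l\<in>A. if i + j + k + l = 0 then (if k + l = 0 then 1 else E) else 0)
    \<le> real (card A) ^ 2 + real (card A) ^ 4 * E"
proof -
  define u where "u i j = (if j = - i then 1 else 0 :: real)" for i j :: 'a
  have u0: "0 \<le> u i j" for i j by (simp add: u_def)
  have 1: "(\<Sum>k\<in>A. \<Sum>l\<in>A. u k l) \<le> real (card A)"
  proof -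
    have "(\<Sum>l\<in>A. u k l) \<le> 1" for k using assms(1) by (simp add: u_def sum.delta)
    then have "(\<Sum>k\<in>A. \<Sum>l\<in>A. u k l) \<le> (\<Sum>k\<in>A. 1)" by (intro sum_mono)
    then show ?thesis by simp
  qed
  have "(\<Sum>i\<in>A. \<Sum>j\<in>A. \<Sum>k\<in>A. \<Sum>l\<in>A. if i + j + k + l = 0 then (if k + l = 0 then 1 else E) else 0)
    \<le> (\<Sum>i\<in>A. \<Sum>j\<in>A. \<Sum>k\<in>A. \<Sum>l\<in>A. u i j * u k l + E)"
  proof (intro sum_mono)
    fix i j k l :: 'a
    show "(if i + j + k + l = 0 then (if k + l = 0 then 1 else E) else 0) \<le> u i j * u k l + E"
    proof (cases "i + j + k + l = 0 \<and> k + l = 0")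
      case True
      moreover have "i + j = (i + j + k + l) - (k + l)" by (simp add: algebra_simps)
      ultimately have "i + j = 0" "k + l = 0" by simp_all
      then have "l = - k" "j = - i" by (simp_all add: eq_neg_iff_add_eq_0 add.commute)
      then show ?thesis using assms(2) True by (simp add: u_def)
    next
      case False
      have "0 \<le> u i j * u k l" by (simp add: u0)
      then show ?thesis using False assms(2) by (cases "i + j + k + l = 0") (simp_all add: add_nonneg_nonneg)
    qed
  qed
  also have "\<dots> = (\<Sum>i\<in>A. \<Sum>j\<in>A. u i j) * (\<Sum>k\<in>A. \<Sum>l\<in>A. u k l) + real (card A) ^ 4 * E"
  proof -
    have "(\<Sum>i\<in>A. \<Sum>j\<in>A. \<Sum>k\<in>A. \<Sum>l\<in>A. u i j * u k l) = (\<Sum>i\<in>A. \<Sum>j\<in>A. u i j) * (\<Sum>k\<in>A. \<Sum>l\<in>A. u k l)"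
      by (simp only: sum_distrib_left[symmetric] sum_distrib_right[symmetric])
    moreover have "(\<Sum>i\<in>A. \<Sum>j\<in>A. \<Sum>k\<in>A. \<Sum>l\<in>A. E) = real (card A) ^ 4 * E"
      by (simp add: power4_eq_xxxx)
    ultimately show ?thesis by (simp only: sum.distrib)
  qed
  also have "\<dots> \<le> real (card A) * real (card A) + real (card A) ^ 4 * E"
    using 1 by (intro add_right_mono mult_mono sum_nonneg u0) auto
  finally show ?thesis by (simp add: power2_eq_square)
qed

context subordinated_torus begin

text \<open>Each outer gap carries a single frequency of \<open>A\<close> and decays at the rate
  \<open>b1\<close>. The middle gap carries \<open>k + l\<close>: it does not decay when this is 0,
  and otherwise decays at least at the spectral gap \<open>b0\<close>.\<close>

lemma expectation_product_4:
  assumes H: "H = 1 / 2" and BP: "B \<in> bernstein_pos"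
    and A: "freq_set A" and f: "\<And>x. complex_of_real (f x) = tp A a x" and a: "\<And>\<xi>. \<xi> \<in> A \<Longrightarrow> norm (a \<xi>) \<le> 1"
    and b1: "\<And>\<xi>. \<xi> \<in> A \<Longrightarrow> b1 \<le> psi \<xi>" and b0: "\<And>\<xi>. \<xi> \<in> int_vectors \<Longrightarrow> \<xi> \<noteq> 0 \<Longrightarrow> b0 \<le> psi \<xi>"
    and s: "0 \<le> s0" "s0 \<le> s1" "s1 \<le> s2" "s2 \<le> s3"
  shows "expectation (\<lambda>\<omega>. \<integral>y. f (X (S s0 \<omega>) \<omega> - y) * f (X (S s1 \<omega>) \<omega> - y) * f (X (S s2 \<omega>) \<omega> - y) * f (X (S s3 \<omega>) \<omega> - y) \<partial>unit_cube)
    \<le> exp (- (s1 - s0) * b1) * exp (- (s3 - s2) * b1) * (real (card A) ^ 2 + real (card A) ^ 4 * exp (- (s2 - s1) * b0))"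
    (is "?L \<le> ?R")
proof -
  let ?x = "\<lambda>s \<omega>. X (S s \<omega>) \<omega>"
  let ?E = "\<lambda>i j k l \<omega>. ee i (?x s0 \<omega>) * ee j (?x s1 \<omega>) * ee k (?x s2 \<omega>) * ee l (?x s3 \<omega>)"
  let ?c = "\<lambda>i j k l. a i * a j * a k * a l"
  let ?q = "\<lambda>i k l. exp (- (s1 - s0) * psi i) * exp (- (s2 - s1) * psi (k + l)) * exp (- (s3 - s2) * psi l)"
  let ?r = "exp (- (s1 - s0) * b1) * exp (- (s3 - s2) * b1)"
  have s': "0 \<le> s1" "0 \<le> s2" "0 \<le> s3" using s by linarith+
  note xm[measurable] = X_S_meas[OF s(1)] X_S_meas[OF s'(1)] X_S_meas[OF s'(2)] X_S_meas[OF s'(3)]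
  have EI: "integrable M (?E i j k l)" for i j k l
    by (rule integrable_const_bound[where B = 1]) (simp_all add: norm_mult)
  have gI: "integrable M (\<lambda>\<omega>. if i + j + k + l = 0 then ?c i j k l * ?E i j k l \<omega> else 0)" for i j k l
  proof (cases "i + j + k + l = 0")
    case True
    show ?thesis unfolding if_P[OF True] by (rule integrable_mult_right[OF EI])
  qed simp
  have Ev: "(\<integral>\<omega>. (if i + j + k + l = 0 then ?c i j k l * ?E i j k l \<omega> else 0) \<partial>M)
    = (if i + j + k + l = 0 then ?c i j k l * of_real (?q i k l) else 0)" for i j k l
  proof (cases "i + j + k + l = 0")
    case True
    show ?thesis unfolding if_P[OF True] integral_mult_right_zero correlation[OF H BP s True] ..
  qed simp
  have "complex_of_real ?L = (\<integral>\<omega>. (\<Sum>i\<in>A. \<Sum>j\<in>A. \<Sum>k\<in>A. \<Sum>l\<in>A. if i + j + k + l = 0 then ?c i j k l * ?E i j k l \<omega> else 0) \<partial>M)"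
    unfolding integral_product_4[OF A f, symmetric] by (rule integral_complex_of_real[symmetric])
  also have "\<dots> = (\<Sum>i\<in>A. \<Sum>j\<in>A. \<Sum>k\<in>A. \<Sum>l\<in>A. if i + j + k + l = 0 then ?c i j k l * of_real (?q i k l) else 0)"
    unfolding Ev[symmetric] by (rule integral_sum_4[OF gI])
  finally have eq: "complex_of_real ?L = \<dots>" .
  have "?L \<le> norm (complex_of_real ?L)" by simp
  also have "\<dots> \<le> (\<Sum>i\<in>A. \<Sum>j\<in>A. \<Sum>k\<in>A. \<Sum>l\<in>A. ?r * (if i + j + k + l = 0 then (if k + l = 0 then 1 else exp (- (s2 - s1) * b0)) else 0))"
    unfolding eq
  proof (intro sum_norm_le)
    fix i j k l assume in_A: "i \<in> A" "j \<in> A" "k \<in> A" "l \<in> A"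
    have n1: "norm (?c i j k l) \<le> 1"
      unfolding norm_mult using a in_A by (intro mult_le_one mult_nonneg_nonneg norm_ge_zero) auto
    have kl: "k + l \<in> int_vectors" using A in_A by (auto simp: freq_set_def intro: int_vectors_add)
    have mid: "exp (- (s2 - s1) * psi (k + l)) \<le> (if k + l = 0 then 1 else exp (- (s2 - s1) * b0))"
    proof (cases "k + l = 0")
      case True
      then show ?thesis using BP by (simp add: bernstein_pos_def)
    next
      case False
      then show ?thesis using mult_left_mono[OF b0[OF kl False], of "s2 - s1"] s by (simp add: algebra_simps)
    qed
    have q1: "?q i k l \<le> exp (- (s1 - s0) * b1) * (if k + l = 0 then 1 else exp (- (s2 - s1) * b0)) * exp (- (s3 - s2) * b1)"
    proof (intro mult_mono mid)
      show "exp (- (s1 - s0) * psi i) \<le> exp (- (s1 - s0) * b1)"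
        using mult_left_mono[OF b1[OF in_A(1)], of "s1 - s0"] s by (simp add: algebra_simps)
      show "exp (- (s3 - s2) * psi l) \<le> exp (- (s3 - s2) * b1)"
        using mult_left_mono[OF b1[OF in_A(4)], of "s3 - s2"] s by (simp add: algebra_simps)
    qed auto
    have q2: "norm (?c i j k l * of_real (?q i k l)) \<le> 1 * ?q i k l"
      unfolding norm_mult[of "?c i j k l"] using n1 by (intro mult_mono) (auto simp: norm_mult)
    have "norm (?c i j k l * of_real (?q i k l)) \<le> ?q i k l" using q2 by (simp only: mult_1)
    also note q1
    also have "exp (- (s1 - s0) * b1) * (if k + l = 0 then 1 else exp (- (s2 - s1) * b0)) * exp (- (s3 - s2) * b1)
      = ?r * (if k + l = 0 then 1 else exp (- (s2 - s1) * b0))" by (simp only: mult_ac)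
    finally have fin: "norm (?c i j k l * of_real (?q i k l)) \<le> ?r * (if k + l = 0 then 1 else exp (- (s2 - s1) * b0))" .
    show "norm (if i + j + k + l = 0 then ?c i j k l * of_real (?q i k l) else 0)
       \<le> ?r * (if i + j + k + l = 0 then (if k + l = 0 then 1 else exp (- (s2 - s1) * b0)) else 0)"
    proof (cases "i + j + k + l = 0")
      case True
      show ?thesis unfolding if_P[OF True] by (rule fin)
    qed simp
  qed
  also have "\<dots> = ?r * (\<Sum>i\<in>A. \<Sum>j\<in>A. \<Sum>k\<in>A. \<Sum>l\<in>A. (if i + j + k + l = 0 then (if k + l = 0 then 1 else exp (- (s2 - s1) * b0)) else 0))"
    by (simp only: sum_distrib_left)
  also have "\<dots> \<le> ?R"
    using A by (intro mult_left_mono count_quadruples) (auto simp: freq_set_def)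
  finally show ?thesis .
qed

end

section \<open>Sums over ordered times\<close>

lemma sum_power_lists:
  fixes g :: "nat \<Rightarrow> 'a::comm_semiring_1"
  shows "(\<Sum>j<n. g j) ^ m = (\<Sum>xs | set xs \<subseteq> {..<n} \<and> length xs = m. prod_list (map g xs))"
proof (induction m)
  case 0
  have "{xs. set xs \<subseteq> {..<n} \<and> length xs = 0} = {[]}" by auto
  then show ?case by simp
next
  case (Suc m)
  have inj: "inj_on (\<lambda>(xs, j). j # xs) ({xs. set xs \<subseteq> {..<n} \<and> length xs = m} \<times> {..<n})"
    by (auto simp: inj_on_def)
  have "(\<Sum>j<n. g j) ^ Suc m = (\<Sum>xs | set xs \<subseteq> {..<n} \<and> length xs = m. prod_list (map g xs)) * (\<Sum>j<n. g j)"
    by (simp only: Suc power_Suc mult.commute)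
  also have "\<dots> = (\<Sum>(xs, j)\<in>{xs. set xs \<subseteq> {..<n} \<and> length xs = m} \<times> {..<n}. prod_list (map g (j # xs)))"
    by (simp only: sum_product sum.cartesian_product) (simp add: case_prod_unfold mult.commute)
  also have "\<dots> = (\<Sum>xs | set xs \<subseteq> {..<n} \<and> length xs = Suc m. prod_list (map g xs))"
    unfolding lists_length_Suc_eq by (subst sum.reindex[OF inj]) (simp add: case_prod_unfold)
  finally show ?case .
qed

lemma card_same_sort: "card {xs :: nat list. sort xs = ys} \<le> fact (length ys)" "finite {xs :: nat list. sort xs = ys}"
proof -
  have sub: "{xs. sort xs = ys} \<subseteq> permutations_of_multiset (mset ys)"
    by (auto simp: permutations_of_multiset_def)
  then show "finite {xs. sort xs = ys}" by (rule finite_subset) simp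
  have "card {xs. sort xs = ys} \<le> card (permutations_of_multiset (mset ys))"
    by (rule card_mono[OF _ sub]) simp
  also have "\<dots> \<le> card (permutations_of_multiset (mset ys)) * (\<Prod>x\<in>set_mset (mset ys). fact (count (mset ys) x))"
    by (simp add: Suc_leI prod_pos)
  also have "\<dots> = fact (length ys)"
    using card_permutations_of_multiset_aux[of "mset ys"] by (simp add: mult.commute)
  finally show "card {xs :: nat list. sort xs = ys} \<le> fact (length ys)" .
qed

text \<open>Correlations are known for ordered times only. Every list is replaced by its sorted
  version, which it shares with at most \<open>fact m\<close> lists.\<close>

lemma sum_lists_symmetric_le:
  fixes T g :: "nat list \<Rightarrow> real" and n m :: nat
  assumes T: "\<And>xs. T (sort xs) = T xs" and g: "\<And>xs. sorted xs \<Longrightarrow> length xs = m \<Longrightarrow> T xs \<le> g xs" "\<And>xs. 0 \<le> g xs"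
  defines "L \<equiv> {xs. set xs \<subseteq> {..<n} \<and> length xs = m}"
  shows "(\<Sum>xs\<in>L. T xs) \<le> fact m * (\<Sum>xs | xs \<in> L \<and> sorted xs. g xs)"
proof -
  have fin: "finite L" unfolding L_def by (intro finite_lists_length_eq) simp
  have im: "sort ` L \<subseteq> {xs. xs \<in> L \<and> sorted xs}" by (auto simp: L_def)
  have "(\<Sum>xs\<in>L. T xs) \<le> (\<Sum>xs\<in>L. g (sort xs))"
    using g(1) by (intro sum_mono) (subst T[symmetric], simp add: L_def)
  also have "\<dots> = (\<Sum>ys | ys \<in> L \<and> sorted ys. \<Sum>xs | xs \<in> L \<and> sort xs = ys. g (sort xs))"
    by (rule sum.group[symmetric, OF fin _ im]) (simp add: fin)
  also have "\<dots> \<le> (\<Sum>ys | ys \<in> L \<and> sorted ys. fact m * g ys)"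
  proof (rule sum_mono)
    fix ys assume ys: "ys \<in> {ys. ys \<in> L \<and> sorted ys}"
    have "card {xs. xs \<in> L \<and> sort xs = ys} \<le> card {xs. sort xs = ys}"
      by (rule card_mono[OF card_same_sort(2)]) auto
    also have "\<dots> \<le> fact m" using card_same_sort(1)[of ys] ys by (simp add: L_def)
    finally have c: "real (card {xs. xs \<in> L \<and> sort xs = ys}) \<le> fact m" by (metis of_nat_fact of_nat_le_iff)
    have "(\<Sum>xs | xs \<in> L \<and> sort xs = ys. g (sort xs)) = (\<Sum>xs | xs \<in> L \<and> sort xs = ys. g ys)" by (rule sum.cong) auto
    also have "\<dots> \<le> fact m * g ys" using mult_right_mono[OF c g(2)[of ys]] by simp
    finally show "(\<Sum>xs | xs \<in> L \<and> sort xs = ys. g (sort xs)) \<le> fact m * g ys" .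
  qed
  finally show ?thesis by (simp add: sum_distrib_left)
qed

text \<open>A sorted list is determined by its first entry and three gaps. Letting all of them range
  below \<open>n\<close> overcounts, which is harmless for nonnegative terms and makes the sum
  factor over the gaps.\<close>

lemma sum_sorted_lists_4_le:
  fixes g :: "nat list \<Rightarrow> real"
  assumes "\<And>xs. 0 \<le> g xs"
  shows "(\<Sum>xs | xs \<in> {xs. set xs \<subseteq> {..<n} \<and> length xs = 4} \<and> sorted xs. g xs)
    \<le> (\<Sum>j<n. \<Sum>k<n. \<Sum>l<n. \<Sum>m<n. g [j, j + k, j + k + l, j + k + l + m])"
proof -
  let ?f = "\<lambda>(j, k, l, m). [j, j + k, j + k + l, j + k + l + m]"
  let ?I = "{..<n} \<times> {..<n} \<times> {..<n} \<times> {..<n}"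
  have "{xs. xs \<in> {xs. set xs \<subseteq> {..<n} \<and> length xs = 4} \<and> sorted xs} \<subseteq> ?f ` ?I"
  proof
    fix xs assume "xs \<in> {xs. xs \<in> {xs. set xs \<subseteq> {..<n} \<and> length xs = 4} \<and> sorted xs}"
    then have xs: "set xs \<subseteq> {..<n}" "length xs = 4" "sorted xs" by auto
    obtain a b c d where abcd: "xs = [a, b, c, d]"
      using xs(2) by (auto simp: numeral_eq_Suc length_Suc_conv)
    have "xs = ?f (a, b - a, c - b, d - c)" using xs(3) by (simp add: abcd)
    moreover have "(a, b - a, c - b, d - c) \<in> ?I" using xs(1) by (auto simp: abcd)
    ultimately show "xs \<in> ?f ` ?I" by (rule image_eqI)
  qed
  then have "(\<Sum>xs | xs \<in> {xs. set xs \<subseteq> {..<n} \<and> length xs = 4} \<and> sorted xs. g xs) \<le> (\<Sum>xs\<in>?f ` ?I. g xs)"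
    using assms by (intro sum_mono2) auto
  also have "\<dots> \<le> (\<Sum>p\<in>?I. g (?f p))" using assms by (intro order.trans[OF sum_image_le]) auto
  also have "\<dots> = (\<Sum>j<n. \<Sum>k<n. \<Sum>l<n. \<Sum>m<n. g [j, j + k, j + k + l, j + k + l + m])"
    by (simp add: sum.cartesian_product case_prod_unfold)
  finally show ?thesis .
qed

text \<open>A geometric series with ratio \<open>exp (- h)\<close>: from
  \<open>1 + h \<le> exp h\<close> its sum is at most \<open>1 + 1 / h\<close>. The term
  \<open>1 / real n\<close> is the discretisation error, which disappears in the limit.\<close>

lemma geometric_average_le:
  fixes t b :: real
  assumes "0 < t" "0 < b" "0 < n"
  shows "(\<Sum>k<n. exp (- (t * real k / real n) * b)) \<le> real n * (1 / real n + 1 / (t * b))"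
proof -
  define h where "h = t * b / real n"
  have h: "0 < h" using assms by (simp add: h_def)
  define q where "q = exp (- h)"
  have q: "0 < q" "q < 1" using h by (simp_all add: q_def)
  have "(\<Sum>k<n. exp (- (t * real k / real n) * b)) = (\<Sum>k<n. q ^ k)"
    by (intro sum.cong refl) (simp add: q_def h_def exp_of_nat_mult[symmetric] mult_ac)
  also have "\<dots> = (1 - q ^ n) / (1 - q)" using q by (simp add: sum_gp_strict)
  also have "\<dots> \<le> 1 / (1 - q)" using q by (intro divide_right_mono) auto
  also have "\<dots> \<le> 1 + 1 / h"
  proof -
    have "1 + h \<le> exp h" using exp_ge_add_one_self by simp
    then have "q * (1 + h) \<le> 1" unfolding q_def exp_minus by (simp add: divide_simps)
    then have "h \<le> (1 + h) * (1 - q)" by (simp add: algebra_simps)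
    then have "h / (1 - q) \<le> 1 + h" using q by (simp add: divide_le_eq)
    then have "h / (1 - q) / h \<le> (1 + h) / h" using h by (intro divide_right_mono) auto
    then show ?thesis using h by (simp add: add_divide_distrib)
  qed
  also have "\<dots> = real n * (1 / real n + 1 / (t * b))" using assms by (simp add: h_def distrib_left)
  finally show ?thesis .
qed

lemma unit_cube_abs_integral_le:
  fixes f :: "real ^ 'd::finite \<Rightarrow> real"
  assumes "f \<in> borel_measurable borel" "\<And>x. \<bar>f x\<bar> \<le> K"
  shows "\<bar>\<integral>x. f x \<partial>unit_cube\<bar> \<le> K"
proof -
  have "integrable unit_cube (\<lambda>x. \<bar>f x\<bar>)" by (rule unit_cube_integrable[where K = K]) (use assms in auto)
  then have "(\<integral>x. \<bar>f x\<bar> \<partial>unit_cube) \<le> K" using assms(2) by (intro unit_cube.integral_le_const) auto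
  then show ?thesis using integral_abs_bound[of "unit_cube" f] by linarith
qed

section \<open>Moments of a convolution with the empirical measure as limits\<close>

context subordinated_torus begin

abbreviation pos :: "real \<Rightarrow> nat \<Rightarrow> nat \<Rightarrow> 'w \<Rightarrow> real ^ 'd" where
  "pos t n j \<omega> \<equiv> X (S (t * (real j / real n)) \<omega>) \<omega>"

context
  fixes f :: "real ^ 'd \<Rightarrow> real" and C :: real
  assumes fc: "continuous_on UNIV f" and fb: "\<And>x. \<bar>f x\<bar> \<le> C" and fper: "\<And>x k. k \<in> int_vectors \<Longrightarrow> f (x + k) = f x"
begin

lemma fm [measurable]: "f \<in> borel_measurable borel"
  by (rule borel_measurable_continuous_onI[OF fc])

lemma f_shift_measurable [measurable]: "(\<lambda>y. f (x - y)) \<in> borel_measurable borel"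
  by (rule measurable_compose[OF _ fm]) measurable

lemma f_pos_measurable:
  assumes "0 \<le> t"
  shows "(\<lambda>(\<omega>, y). f (pos t n j \<omega> - y)) \<in> borel_measurable (M \<Otimes>\<^sub>M unit_cube)"
proof -
  have [measurable]: "pos t n j \<in> borel_measurable M" using assms by (intro X_S_meas) simp
  have "snd \<in> M \<Otimes>\<^sub>M unit_cube \<rightarrow>\<^sub>M unit_cube" by (rule measurable_snd)
  then have [measurable]: "snd \<in> borel_measurable (M \<Otimes>\<^sub>M unit_cube)" by simp
  show ?thesis unfolding case_prod_unfold by (rule measurable_compose[OF _ fm]) measurable
qed

lemma prod_pos_integrable:
  assumes "0 \<le> t"
  shows "integrable unit_cube (\<lambda>y. prod_list (map (\<lambda>j. f (pos t n j \<omega> - y)) xs))"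
    and "integrable M (\<lambda>\<omega>. \<integral>y. prod_list (map (\<lambda>j. f (pos t n j \<omega> - y)) xs) \<partial>unit_cube)"
proof -
  have m1: "(\<lambda>y. prod_list (map (\<lambda>j. f (pos t n j \<omega> - y)) xs)) \<in> borel_measurable borel" for \<omega>
    by (induction xs) simp_all
  have m2: "(\<lambda>(\<omega>, y). prod_list (map (\<lambda>j. f (pos t n j \<omega> - y)) xs)) \<in> borel_measurable (M \<Otimes>\<^sub>M unit_cube)"
    using f_pos_measurable[OF assms] unfolding case_prod_unfold by (induction xs) simp_all
  have b: "\<bar>prod_list (map (\<lambda>j. f (pos t n j \<omega> - y)) xs)\<bar> \<le> C ^ length xs" for \<omega> y
  proof (induction xs)
    case (Cons j xs)
    have "0 \<le> C" using fb[of 0] by linarith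
    then show ?case unfolding list.map prod_list.Cons abs_mult length_Cons power_Suc by (intro mult_mono fb Cons) auto
  qed simp
  show "integrable unit_cube (\<lambda>y. prod_list (map (\<lambda>j. f (pos t n j \<omega> - y)) xs))"
    using m1 b by (intro unit_cube_integrable) auto
  show "integrable M (\<lambda>\<omega>. \<integral>y. prod_list (map (\<lambda>j. f (pos t n j \<omega> - y)) xs) \<partial>unit_cube)"
    using unit_cube_abs_integral_le[OF m1 b] unit_cube.borel_measurable_lebesgue_integral[OF m2]
    by (intro integrable_const_bound[where B = "C ^ length xs"]) auto
qed

lemma wave_riemann:
  assumes "\<omega> \<in> space M" "0 < t"
  shows "(\<lambda>n. (1 / real n) * (\<Sum>j<n. f (pos t n j \<omega> - y))) \<longlonglongrightarrow> (\<integral>z. f (rep_torus z - y) \<partial>emp t \<omega>)"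
proof -
  let ?g = "\<lambda>x. f (x - y)"
  have per: "?g (x + k) = ?g x" if "k \<in> int_vectors" for x k
    using fper[OF that, of "x - y"] by (simp add: algebra_simps)
  have "continuous_on UNIV ?g" by (rule continuous_on_compose2[OF fc]) (auto intro!: continuous_intros)
  then have c: "continuous_on UNIV (\<lambda>z. ?g (rep_torus z))" by (intro continuous_periodic_rep[of ?g]) (auto simp: per)
  have "?g (rep_torus (Z (t * (real j / real n)) \<omega>)) = f (pos t n j \<omega> - y)" for j n
  proof -
    have "Z (t * (real j / real n)) \<omega> = torus_proj (pos t n j \<omega>)" using assms by (intro Z) auto
    then show ?thesis using periodic_rep_proj[of ?g, OF per] by simp
  qed
  with emp_riemann[OF assms c] show ?thesis by simp
qed

lemma average_le: "\<bar>(1 / real n) * (\<Sum>j<n. f (x j))\<bar> \<le> C"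
proof (cases "n = 0")
  case True
  then show ?thesis using fb[of 0] by simp
next
  case False
  have "\<bar>\<Sum>j<n. f (x j)\<bar> \<le> real n * C" using sum_norm_le[of "{..<n}" "\<lambda>j. f (x j)" "\<lambda>_. C"] fb by simp
  then show ?thesis using False by (simp add: abs_mult divide_le_eq mult.commute)
qed

text \<open>Riemann sums involve finitely many positions, whose correlations can be computed.
  Dominated convergence is used twice with the bound \<open>C ^ p\<close>, over the cube for fixed
  \<omega> and then over \<open>M\<close>.\<close>

lemma
  assumes "0 < t"
  shows power_moment_integrable: "integrable M (\<lambda>\<omega>. \<integral>y. (\<integral>z. f (rep_torus z - y) \<partial>emp t \<omega>) ^ p \<partial>unit_cube)"
    and power_moment_limit: "(\<lambda>n. expectation (\<lambda>\<omega>. \<integral>y. ((1 / real n) * (\<Sum>j<n. f (pos t n j \<omega> - y))) ^ p \<partial>unit_cube))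
       \<longlonglongrightarrow> expectation (\<lambda>\<omega>. \<integral>y. (\<integral>z. f (rep_torus z - y) \<partial>emp t \<omega>) ^ p \<partial>unit_cube)"
proof -
  let ?v = "\<lambda>n \<omega> y. ((1 / real n) * (\<Sum>j<n. f (pos t n j \<omega> - y))) ^ p"
  let ?w = "\<lambda>\<omega> y. (\<integral>z. f (rep_torus z - y) \<partial>emp t \<omega>) ^ p"
  have b: "\<bar>?v n \<omega> y\<bar> \<le> C ^ p" for n \<omega> y
    unfolding power_abs by (intro power_mono average_le) simp
  have lim: "(\<lambda>n. ?v n \<omega> y) \<longlonglongrightarrow> ?w \<omega> y" if "\<omega> \<in> space M" for \<omega> y
    by (intro tendsto_power wave_riemann that assms)
  have m1: "?v n \<omega> \<in> borel_measurable borel" for n \<omega> by measurable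
  have m2: "(\<lambda>(\<omega>, y). ?v n \<omega> y) \<in> borel_measurable (M \<Otimes>\<^sub>M unit_cube)" for n
  proof -
    have [measurable]: "(\<lambda>p. f (pos t n j (fst p) - snd p)) \<in> borel_measurable (M \<Otimes>\<^sub>M unit_cube)" for j
      using f_pos_measurable[of t j n] assms by (simp add: case_prod_unfold)
    show ?thesis unfolding case_prod_unfold by measurable
  qed
  have wm: "?w \<omega> \<in> borel_measurable borel" if "\<omega> \<in> space M" for \<omega>
    by (rule borel_measurable_LIMSEQ_real[OF lim[OF that] m1])
  have inner: "(\<lambda>n. \<integral>y. ?v n \<omega> y \<partial>unit_cube) \<longlonglongrightarrow> (\<integral>y. ?w \<omega> y \<partial>unit_cube)" if "\<omega> \<in> space M" for \<omega>
    by (rule integral_dominated_convergence[where w = "\<lambda>_. C ^ p"]) (use lim[OF that] wm[OF that] m1 b in auto)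
  have om: "(\<lambda>\<omega>. \<integral>y. ?v n \<omega> y \<partial>unit_cube) \<in> borel_measurable M" for n
    by (rule unit_cube.borel_measurable_lebesgue_integral[OF m2])
  have im: "(\<lambda>\<omega>. \<integral>y. ?w \<omega> y \<partial>unit_cube) \<in> borel_measurable M"
    by (rule borel_measurable_LIMSEQ_real[OF inner om])
  have ob: "\<bar>\<integral>y. ?v n \<omega> y \<partial>unit_cube\<bar> \<le> C ^ p" for n \<omega> by (rule unit_cube_abs_integral_le[OF m1 b])
  show "integrable M (\<lambda>\<omega>. \<integral>y. ?w \<omega> y \<partial>unit_cube)"
    by (rule integrable_dominated_convergence[where s = "\<lambda>n \<omega>. \<integral>y. ?v n \<omega> y \<partial>unit_cube" and w = "\<lambda>_. C ^ p"])
      (use im om inner ob in auto)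
  show "(\<lambda>n. expectation (\<lambda>\<omega>. \<integral>y. ?v n \<omega> y \<partial>unit_cube)) \<longlonglongrightarrow> expectation (\<lambda>\<omega>. \<integral>y. ?w \<omega> y \<partial>unit_cube)"
    by (rule integral_dominated_convergence[where w = "\<lambda>_. C ^ p"]) (use im om inner ob in auto)
qed

end

end

lemma LIMSEQ_inverse_real_add: "(\<lambda>n. 1 / real n + c) \<longlonglongrightarrow> c"
  using tendsto_add[OF lim_1_over_n tendsto_const[of c]] by simp

text \<open>Times at distance at most \<open>1 / b2\<close> contribute at least
  \<open>exp (- 1)\<close> each. The condition \<open>2 \<le> t * b2\<close> makes this band so
  narrow that at least half of the rows contain a full one-sided piece of it.\<close>

lemma near_diagonal_sum_ge:
  fixes t b b2 :: real
  assumes t: "0 < t" and b: "0 \<le> b" "b \<le> b2" and tb: "2 \<le> t * b2" and n: "0 < n"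
  shows "(real n)\<^sup>2 * (exp (- 1) / (2 * (t * b2))) \<le> (\<Sum>j<n. \<Sum>l<n. exp (- \<bar>t * (real j / real n) - t * (real l / real n)\<bar> * b))"
proof -
  \<comment> \<open>Number of grid steps that fit into the time \<open>1 / b2\<close>; a row then
    has \<open>m + 1\<close> good columns, which rounds the quotient up.\<close>
  define m where "m = nat \<lfloor>real n / (t * b2)\<rfloor>"
  have q0: "0 \<le> real n / (t * b2)" using tb by simp
  have m1: "real m \<le> real n / (t * b2)" "real n / (t * b2) \<le> real m + 1" using q0 by (simp_all add: m_def)
  have "real n / (t * b2) \<le> real n / 2" using tb by (intro divide_left_mono) auto
  then have m2: "real m \<le> real n / 2" using m1 by linarith
  then have mn: "m \<le> n" by linarith
  let ?w = "\<lambda>j l. exp (- \<bar>t * (real j / real n) - t * (real l / real n)\<bar> * b)"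
  have w: "exp (- 1) \<le> ?w j l" if l: "l \<in> {j..j + m}" for j l
  proof -
    have d: "\<bar>real j - real l\<bar> \<le> real m" using l by auto
    have "\<bar>t * (real j / real n) - t * (real l / real n)\<bar> * b = t * \<bar>real j - real l\<bar> / real n * b"
      using t n by (simp add: right_diff_distrib[symmetric] diff_divide_distrib[symmetric] abs_mult)
    also have "\<dots> \<le> t * (real n / (t * b2)) / real n * b2"
      using d m1(1) t b by (intro mult_mono divide_right_mono mult_left_mono) auto
    also have "\<dots> = 1" using t n tb by auto
    finally show ?thesis by simp
  qed
  have "(real n)\<^sup>2 * (exp (- 1) / (2 * (t * b2))) = real n / 2 * (real n / (t * b2) * exp (- 1))"
    by (simp add: power2_eq_square)
  also have "\<dots> \<le> real (n - m) * ((real m + 1) * exp (- 1))"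
    using m1(2) m2 mn q0 mult_nonneg_nonneg[OF q0 exp_ge_zero[of "- 1"]] by (intro mult_mono mult_right_mono) (auto simp: of_nat_diff)
  also have "\<dots> = (\<Sum>j<n - m. \<Sum>l\<in>{j..j + m}. exp (- 1))" by simp
  also have "\<dots> \<le> (\<Sum>j<n - m. \<Sum>l\<in>{j..j + m}. ?w j l)" by (intro sum_mono w)
  also have "\<dots> \<le> (\<Sum>j<n - m. \<Sum>l<n. ?w j l)" by (intro sum_mono sum_mono2) auto
  also have "\<dots> \<le> (\<Sum>j<n. \<Sum>l<n. ?w j l)" by (intro sum_mono2) (auto intro: sum_nonneg)
  finally show ?thesis .
qed

section \<open>Bounds for the second and the fourth moment\<close>

context subordinated_torus begin

context
  fixes f :: "real ^ 'd \<Rightarrow> real" and A and a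
  assumes H: "H = 1 / 2" and BP: "B \<in> bernstein_pos"
    and A: "freq_set A" and f: "\<And>x. complex_of_real (f x) = tp A a x"
begin

lemma f_rtrig: "rtrig A f"
  unfolding trig_def f[abs_def] by blast

lemma f_cont: "continuous_on UNIV f" by (rule rtrig_continuous[OF f_rtrig])

lemma f_per: "k \<in> int_vectors \<Longrightarrow> f (x + k) = f x" by (rule rtrig_periodic[OF f_rtrig A])

text \<open>The 24 counts the orderings of four times. Then the sum factors over the gaps: the outer
  two give \<open>1 / (t * b1)\<close> each, and the middle one averages to 1 for opposite pairs and
  to at most \<open>1 / (t * b0)\<close> for the other quadruples.\<close>

lemma fourth_moment_le:
  assumes a: "\<And>\<xi>. \<xi> \<in> A \<Longrightarrow> norm (a \<xi>) \<le> 1"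
    and b1: "\<And>\<xi>. \<xi> \<in> A \<Longrightarrow> b1 \<le> psi \<xi>" and b0: "\<And>\<xi>. \<xi> \<in> int_vectors \<Longrightarrow> \<xi> \<noteq> 0 \<Longrightarrow> b0 \<le> psi \<xi>"
    and pos: "0 < b1" "0 < b0" "0 < t"
  shows "expectation (\<lambda>\<omega>. \<integral>y. (\<integral>z. f (rep_torus z - y) \<partial>emp t \<omega>) ^ 4 \<partial>unit_cube)
    \<le> 24 * (1 / (t * b1))\<^sup>2 * (real (card A) ^ 2 + real (card A) ^ 4 * (1 / (t * b0)))"
proof -
  obtain C where C: "\<And>x. \<bar>f x\<bar> \<le> C" using rtrig_bounded[OF f_rtrig] by metis
  note I = prod_pos_integrable[OF f_cont C f_per] and lim = power_moment_limit[OF f_cont C f_per pos(3), of 4]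
  let ?K = "real (card A)"
  let ?u = "\<lambda>n b. 1 / real n + 1 / (t * b)"
  have "expectation (\<lambda>\<omega>. \<integral>y. ((1 / real n) * (\<Sum>j<n. f (pos t n j \<omega> - y))) ^ 4 \<partial>unit_cube)
    \<le> 24 * (?u n b1)\<^sup>2 * (?K ^ 2 + ?K ^ 4 * ?u n b0)" if n: "0 < n" for n
  proof -
    let ?L = "{xs :: nat list. set xs \<subseteq> {..<n} \<and> length xs = 4}"
    let ?p = "\<lambda>xs \<omega> y. prod_list (map (\<lambda>j. f (pos t n j \<omega> - y)) xs)"
    define T where "T xs = expectation (\<lambda>\<omega>. \<integral>y. ?p xs \<omega> y \<partial>unit_cube)" for xs
    define e where "e b k = exp (- (t * real k / real n) * b)" for b k
    define g where "g xs = e b1 (xs ! 1 - xs ! 0) * e b1 (xs ! 3 - xs ! 2) * (?K ^ 2 + ?K ^ 4 * e b0 (xs ! 2 - xs ! 1))" for xs :: "nat list"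
    have "expectation (\<lambda>\<omega>. \<integral>y. ((1 / real n) * (\<Sum>j<n. f (pos t n j \<omega> - y))) ^ 4 \<partial>unit_cube)
      = expectation (\<lambda>\<omega>. (1 / real n) ^ 4 * (\<Sum>xs\<in>?L. \<integral>y. ?p xs \<omega> y \<partial>unit_cube))"
      unfolding power_mult_distrib sum_power_lists using I(1)[of t] pos(3)
      by (simp only: integral_mult_right_zero) (simp add: Bochner_Integration.integral_sum)
    also have "\<dots> = (1 / real n) ^ 4 * (\<Sum>xs\<in>?L. T xs)"
      unfolding T_def using I(2)[of t] pos(3)
      by (simp only: integral_mult_right_zero) (simp add: Bochner_Integration.integral_sum)
    also have "(\<Sum>xs\<in>?L. T xs) \<le> fact 4 * (\<Sum>xs | xs \<in> ?L \<and> sorted xs. g xs)"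
    proof (rule sum_lists_symmetric_le)
      show "T (sort xs) = T xs" for xs
      proof -
        have "prod_list (map h (sort xs)) = prod_list (map h xs)" for h :: "nat \<Rightarrow> real"
          by (metis mset_map mset_sort prod_mset_prod_list)
        then show ?thesis by (simp only: T_def)
      qed
      show "0 \<le> g xs" for xs by (simp add: g_def e_def)
      show "T xs \<le> g xs" if xs: "sorted xs" "length xs = 4" for xs
      proof -
        obtain k0 k1 k2 k3 where k: "xs = [k0, k1, k2, k3]"
          using xs(2) by (auto simp: numeral_eq_Suc length_Suc_conv)
        have le: "k0 \<le> k1" "k1 \<le> k2" "k2 \<le> k3" using xs(1) by (auto simp: k)
        let ?s = "\<lambda>k. t * (real k / real n)"
        have ediff: "exp (- (?s l - ?s k) * b) = e b (l - k)" if "k \<le> l" for k l b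
          using that n by (simp add: e_def of_nat_diff diff_divide_distrib right_diff_distrib)
        have mono: "?s k \<le> ?s l" if "k \<le> l" for k l
          using that pos n by (intro mult_left_mono divide_right_mono) auto
        have "T xs = expectation (\<lambda>\<omega>. \<integral>y. f (X (S (?s k0) \<omega>) \<omega> - y) * f (X (S (?s k1) \<omega>) \<omega> - y) * f (X (S (?s k2) \<omega>) \<omega> - y) * f (X (S (?s k3) \<omega>) \<omega> - y) \<partial>unit_cube)"
          by (simp add: T_def k mult.assoc)
        also have "\<dots> \<le> exp (- (?s k1 - ?s k0) * b1) * exp (- (?s k3 - ?s k2) * b1) * (?K ^ 2 + ?K ^ 4 * exp (- (?s k2 - ?s k1) * b0))"
        proof (rule expectation_product_4[OF H BP A f a b1 b0 _ mono[OF le(1)] mono[OF le(2)] mono[OF le(3)]])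
          show "0 \<le> ?s k0" using pos by simp
        qed
        also have "\<dots> = g xs" unfolding ediff[OF le(1)] ediff[OF le(2)] ediff[OF le(3)] by (simp add: g_def k)
        finally show ?thesis .
      qed
    qed
    also have "(\<Sum>xs | xs \<in> ?L \<and> sorted xs. g xs) \<le> (\<Sum>j<n. \<Sum>k<n. \<Sum>l<n. \<Sum>m<n. g [j, j + k, j + k + l, j + k + l + m])"
      by (rule sum_sorted_lists_4_le) (simp add: g_def e_def)
    \<comment> \<open>The first index is free and gives the factor \<open>real n\<close>; the rest
      factors over the three gaps.\<close>
    also have "\<dots> = real n * ((\<Sum>k<n. e b1 k) * ((\<Sum>l<n. ?K ^ 2 + ?K ^ 4 * e b0 l) * (\<Sum>m<n. e b1 m)))"
    proof -
      have "(\<Sum>j<n. \<Sum>k<n. \<Sum>l<n. \<Sum>m<n. g [j, j + k, j + k + l, j + k + l + m])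
        = (\<Sum>j<n. \<Sum>k<n. \<Sum>l<n. \<Sum>m<n. e b1 k * ((?K ^ 2 + ?K ^ 4 * e b0 l) * e b1 m))"
        by (intro sum.cong refl) (simp add: g_def numeral_eq_Suc mult_ac)
      also have "\<dots> = (\<Sum>j<n. (\<Sum>k<n. e b1 k) * ((\<Sum>l<n. ?K ^ 2 + ?K ^ 4 * e b0 l) * (\<Sum>m<n. e b1 m)))"
        by (simp only: sum_distrib_left[symmetric] sum_distrib_right[symmetric])
      finally show ?thesis by simp
    qed
    also have "\<dots> \<le> real n * ((real n * ?u n b1) * ((real n * (?K ^ 2 + ?K ^ 4 * ?u n b0)) * (real n * ?u n b1)))"
    proof (intro mult_left_mono mult_mono)
      have G: "(\<Sum>k<n. e b k) \<le> real n * ?u n b" if "0 < b" for b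
        unfolding e_def by (rule geometric_average_le[OF pos(3) that n])
      show "(\<Sum>k<n. e b1 k) \<le> real n * ?u n b1" "(\<Sum>k<n. e b1 k) \<le> real n * ?u n b1" using G pos by auto
      have "(\<Sum>l<n. ?K ^ 2 + ?K ^ 4 * e b0 l) = real n * ?K ^ 2 + ?K ^ 4 * (\<Sum>l<n. e b0 l)"
        by (simp add: sum.distrib sum_distrib_left)
      also have "\<dots> \<le> real n * ?K ^ 2 + ?K ^ 4 * (real n * ?u n b0)"
        using G[OF pos(2)] by (intro add_left_mono mult_left_mono) auto
      finally show "(\<Sum>l<n. ?K ^ 2 + ?K ^ 4 * e b0 l) \<le> real n * (?K ^ 2 + ?K ^ 4 * ?u n b0)"
        by (simp only: distrib_left mult.left_commute)
    qed (use pos in \<open>auto simp: e_def intro!: sum_nonneg mult_nonneg_nonneg add_nonneg_nonneg\<close>)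
    finally have "expectation (\<lambda>\<omega>. \<integral>y. ((1 / real n) * (\<Sum>j<n. f (pos t n j \<omega> - y))) ^ 4 \<partial>unit_cube)
      \<le> (1 / real n) ^ 4 * (fact 4 * (real n * ((real n * ?u n b1) * ((real n * (?K ^ 2 + ?K ^ 4 * ?u n b0)) * (real n * ?u n b1)))))"
      by (simp add: mult_left_mono)
    also have "\<dots> = ((1 / real n) * real n) ^ 4 * (24 * (?u n b1)\<^sup>2 * (?K ^ 2 + ?K ^ 4 * ?u n b0))"
      unfolding power4_eq_xxxx power2_eq_square by (simp only: fact_numeral mult_ac) (simp add: fact_numeral)
    finally show ?thesis using n by simp
  qed
  then have ev: "\<forall>\<^sub>F n in sequentially. expectation (\<lambda>\<omega>. \<integral>y. ((1 / real n) * (\<Sum>j<n. f (pos t n j \<omega> - y))) ^ 4 \<partial>unit_cube)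
    \<le> 24 * (?u n b1)\<^sup>2 * (?K ^ 2 + ?K ^ 4 * ?u n b0)"
    using eventually_gt_at_top[of 0] by (rule eventually_mono[rotated])
  have "(\<lambda>n. 24 * (?u n b1)\<^sup>2 * (?K ^ 2 + ?K ^ 4 * ?u n b0)) \<longlonglongrightarrow> 24 * (1 / (t * b1))\<^sup>2 * (?K ^ 2 + ?K ^ 4 * (1 / (t * b0)))"
    by (intro tendsto_intros LIMSEQ_inverse_real_add)
  from tendsto_le[OF _ this lim ev] show ?thesis by simp
qed

lemma pair_correlation:
  assumes s: "0 \<le> s0" "0 \<le> s1"
  shows "expectation (\<lambda>\<omega>. Re (ee \<xi> (X (S s0 \<omega>) \<omega>) * cnj (ee \<xi> (X (S s1 \<omega>) \<omega>)))) = exp (- \<bar>s0 - s1\<bar> * psi \<xi>)"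
proof -
  have le: "expectation (\<lambda>\<omega>. Re (ee \<xi> (X (S r1 \<omega>) \<omega>) * cnj (ee \<xi> (X (S r0 \<omega>) \<omega>)))) = exp (- (r1 - r0) * psi \<xi>)"
    if r: "0 \<le> r0" "r0 \<le> r1" for r0 r1
  proof -
    have [measurable]: "(\<lambda>\<omega>. X (S r0 \<omega>) \<omega>) \<in> borel_measurable M" "(\<lambda>\<omega>. X (S r1 \<omega>) \<omega>) \<in> borel_measurable M"
      using r by (auto intro: X_S_meas)
    have I: "integrable M (\<lambda>\<omega>. ee \<xi> (X (S r1 \<omega>) \<omega>) * ee (- \<xi>) (X (S r0 \<omega>) \<omega>))"
      by (rule integrable_const_bound[where B = 1]) (simp_all add: norm_mult)
    have "expectation (\<lambda>\<omega>. ee \<xi> (X (S r1 \<omega>) \<omega>) * ee (- \<xi>) (X (S r0 \<omega>) \<omega>)) = of_real (exp (- (r1 - r0) * psi \<xi>))"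
      \<comment> \<open>The two middle slots are dummies: they carry the frequency 0 at the earlier
        of the two times.\<close>
      using correlation[OF H BP r(1) order_refl order_refl r(2), of "- \<xi>" 0 0 \<xi>] by (simp add: mult.commute)
    then show ?thesis using integral_Re[OF I] by (simp add: ee_minus)
  qed
  show ?thesis
  proof (cases "s1 \<le> s0")
    case True
    then show ?thesis using le[OF s(2) True] by simp
  next
    case False
    have "Re (ee \<xi> x * cnj (ee \<xi> y)) = Re (ee \<xi> y * cnj (ee \<xi> x))" for x y by (simp add: mult.commute)
    then show ?thesis using le[OF s(1), of s1] False by (simp add: mult.commute)
  qed
qed

text \<open>Parseval's identity in y turns the square into exponential sums over the positions, one
  for each frequency. Their means are double sums of pair correlations, all positive, and
  \<open>near_diagonal_sum_ge\<close> bounds these uniformly over \<open>A\<close>.\<close>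

lemma second_moment_ge:
  assumes b2: "\<And>\<xi>. \<xi> \<in> A \<Longrightarrow> psi \<xi> \<le> b2" and t: "0 < t" "2 \<le> t * b2"
  shows "(\<Sum>\<xi>\<in>A. (norm (a \<xi>))\<^sup>2) * (exp (- 1) / (2 * (t * b2)))
    \<le> expectation (\<lambda>\<omega>. \<integral>y. (\<integral>z. f (rep_torus z - y) \<partial>emp t \<omega>)\<^sup>2 \<partial>unit_cube)"
proof -
  obtain C where C: "\<And>x. \<bar>f x\<bar> \<le> C" using rtrig_bounded[OF f_rtrig] by metis
  note lim = power_moment_limit[OF f_cont C f_per t(1), of 2]
  have "(\<Sum>\<xi>\<in>A. (norm (a \<xi>))\<^sup>2) * (exp (- 1) / (2 * (t * b2)))
     \<le> expectation (\<lambda>\<omega>. \<integral>y. ((1 / real n) * (\<Sum>j<n. f (pos t n j \<omega> - y)))\<^sup>2 \<partial>unit_cube)" if n: "0 < n" for n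
  proof -
    have xm[measurable]: "pos t n j \<in> borel_measurable M" for j using t by (intro X_S_meas) simp
    have par: "(\<integral>y. ((1 / real n) * (\<Sum>j<n. f (x j - y)))\<^sup>2 \<partial>unit_cube)
      = (1 / real n)\<^sup>2 * (\<Sum>\<xi>\<in>A. (norm (a \<xi>))\<^sup>2 * (\<Sum>j<n. \<Sum>l<n. Re (ee \<xi> (x j) * cnj (ee \<xi> (x l)))))" for x
    proof -
      have e: "(\<Sum>j<n. f (x j - y))\<^sup>2 = (norm (tp A (\<lambda>\<xi>. \<Sum>j<n. cnj (a \<xi> * ee \<xi> (x j))) y))\<^sup>2" for y
      proof -
        have q: "complex_of_real (\<Sum>j<n. f (x j - y)) = cnj (tp A (\<lambda>\<xi>. \<Sum>j<n. cnj (a \<xi> * ee \<xi> (x j))) y)"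
        proof -
          have r: "complex_of_real (f (x j - y)) = cnj (tp A (\<lambda>\<xi>. cnj (a \<xi> * ee \<xi> (x j))) y)" for j
            unfolding f by (rule tp_reflect)
          show ?thesis unfolding of_real_sum r tp_def sum_distrib_right cnj_sum by (rule sum.swap)
        qed
        have "\<bar>\<Sum>j<n. f (x j - y)\<bar> = norm (tp A (\<lambda>\<xi>. \<Sum>j<n. cnj (a \<xi> * ee \<xi> (x j))) y)"
          using arg_cong[OF q, of norm] unfolding complex_mod_cnj norm_of_real .
        then show ?thesis by (simp only: power2_abs[of "\<Sum>j<n. f (x j - y)", symmetric])
      qed
      have n2: "(norm (\<Sum>j<n. cnj (a \<xi> * ee \<xi> (x j))))\<^sup>2 = (norm (a \<xi>))\<^sup>2 * (\<Sum>j<n. \<Sum>l<n. Re (ee \<xi> (x j) * cnj (ee \<xi> (x l))))" for \<xi>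
      proof -
        have "(norm (\<Sum>j<n. cnj (a \<xi> * ee \<xi> (x j))))\<^sup>2 = (norm (a \<xi>) * norm (\<Sum>j<n. ee \<xi> (x j)))\<^sup>2"
          by (simp only: cnj_sum[symmetric] complex_mod_cnj sum_distrib_left[symmetric] norm_mult)
        also have "(norm (\<Sum>j<n. ee \<xi> (x j)))\<^sup>2 = Re ((\<Sum>j<n. ee \<xi> (x j)) * cnj (\<Sum>j<n. ee \<xi> (x j)))"
          by (simp only: complex_norm_square[symmetric] Re_complex_of_real)
        then have "(norm (a \<xi>) * norm (\<Sum>j<n. ee \<xi> (x j)))\<^sup>2 = (norm (a \<xi>))\<^sup>2 * (\<Sum>j<n. \<Sum>l<n. Re (ee \<xi> (x j) * cnj (ee \<xi> (x l))))"
          by (simp only: power_mult_distrib cnj_sum sum_product Re_sum)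
        finally show ?thesis .
      qed
      show ?thesis unfolding power_mult_distrib e by (simp only: integral_mult_right_zero parseval[OF A] n2)
    qed
    have RI: "integrable M (\<lambda>\<omega>. Re (ee \<xi> (pos t n j \<omega>) * cnj (ee \<xi> (pos t n l \<omega>))))" for \<xi> j l
    proof (rule integrable_const_bound[where B = 1])
      show "AE \<omega> in M. norm (Re (ee \<xi> (pos t n j \<omega>) * cnj (ee \<xi> (pos t n l \<omega>)))) \<le> 1"
        using abs_Re_le_cmod[of "ee \<xi> (pos t n j \<omega>) * cnj (ee \<xi> (pos t n l \<omega>))" for \<omega>] by (intro AE_I2) (simp add: norm_mult)
      show "(\<lambda>\<omega>. Re (ee \<xi> (pos t n j \<omega>) * cnj (ee \<xi> (pos t n l \<omega>)))) \<in> borel_measurable M"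
        unfolding ee_minus[symmetric] by measurable
    qed
    have "expectation (\<lambda>\<omega>. \<integral>y. ((1 / real n) * (\<Sum>j<n. f (pos t n j \<omega> - y)))\<^sup>2 \<partial>unit_cube)
      = (1 / real n)\<^sup>2 * (\<Sum>\<xi>\<in>A. (norm (a \<xi>))\<^sup>2 * (\<Sum>j<n. \<Sum>l<n. exp (- \<bar>t * (real j / real n) - t * (real l / real n)\<bar> * psi \<xi>)))"
    proof -
      have pc: "expectation (\<lambda>\<omega>. Re (ee \<xi> (pos t n j \<omega>) * cnj (ee \<xi> (pos t n l \<omega>)))) = exp (- \<bar>t * (real j / real n) - t * (real l / real n)\<bar> * psi \<xi>)" for \<xi> j l
        using t by (intro pair_correlation) auto
      show ?thesis unfolding par integral_mult_right_zero pc[symmetric]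
        using RI by (subst Bochner_Integration.integral_sum) (simp_all add: Bochner_Integration.integral_sum)
    qed
    moreover have "(\<Sum>\<xi>\<in>A. (norm (a \<xi>))\<^sup>2 * ((real n)\<^sup>2 * (exp (- 1) / (2 * (t * b2)))))
      \<le> (\<Sum>\<xi>\<in>A. (norm (a \<xi>))\<^sup>2 * (\<Sum>j<n. \<Sum>l<n. exp (- \<bar>t * (real j / real n) - t * (real l / real n)\<bar> * psi \<xi>)))"
      by (intro sum_mono mult_left_mono near_diagonal_sum_ge[OF t(1) _ b2 t(2) n] bernstein_pos_nonneg[OF BP]) auto
    then have "(1 / real n)\<^sup>2 * (\<Sum>\<xi>\<in>A. (norm (a \<xi>))\<^sup>2 * ((real n)\<^sup>2 * (exp (- 1) / (2 * (t * b2)))))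
      \<le> (1 / real n)\<^sup>2 * (\<Sum>\<xi>\<in>A. (norm (a \<xi>))\<^sup>2 * (\<Sum>j<n. \<Sum>l<n. exp (- \<bar>t * (real j / real n) - t * (real l / real n)\<bar> * psi \<xi>)))"
      by (intro mult_left_mono) auto
    moreover have "(1 / real n)\<^sup>2 * (\<Sum>\<xi>\<in>A. (norm (a \<xi>))\<^sup>2 * ((real n)\<^sup>2 * (exp (- 1) / (2 * (t * b2))))) = (\<Sum>\<xi>\<in>A. (norm (a \<xi>))\<^sup>2) * (exp (- 1) / (2 * (t * b2)))"
    proof -
      have "(1 / real n)\<^sup>2 * (\<Sum>\<xi>\<in>A. (norm (a \<xi>))\<^sup>2 * ((real n)\<^sup>2 * (exp (- 1) / (2 * (t * b2)))))
        = ((1 / real n)\<^sup>2 * (real n)\<^sup>2) * ((\<Sum>\<xi>\<in>A. (norm (a \<xi>))\<^sup>2) * (exp (- 1) / (2 * (t * b2))))"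
        by (simp only: sum_distrib_right[symmetric]) (simp only: mult_ac)
      also have "(1 / real n)\<^sup>2 * (real n)\<^sup>2 = 1" using n by (simp add: power_divide)
      finally show ?thesis by simp
    qed
    ultimately show ?thesis by linarith
  qed
  then have ev: "\<forall>\<^sub>F n in sequentially. (\<Sum>\<xi>\<in>A. (norm (a \<xi>))\<^sup>2) * (exp (- 1) / (2 * (t * b2)))
     \<le> expectation (\<lambda>\<omega>. \<integral>y. ((1 / real n) * (\<Sum>j<n. f (pos t n j \<omega> - y)))\<^sup>2 \<partial>unit_cube)"
    using eventually_gt_at_top[of 0] by (rule eventually_mono[rotated])
  from tendsto_le[OF _ lim tendsto_const ev] show ?thesis by simp
qed

end

end

section \<open>The low and critical dimensions\<close>

lemma annulus_norm_bounds:
  assumes "\<xi> \<in> annulus i0 N"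
  shows "(real N)\<^sup>2 \<le> (norm \<xi>)\<^sup>2" "(norm (\<xi> :: real ^ 'd::finite))\<^sup>2 \<le> 25 * real CARD('d) * (real N)\<^sup>2"
proof -
  have c: "real N \<le> \<bar>\<xi> $ i0\<bar>" "\<bar>\<xi> $ i\<bar> \<le> 5 * real N" for i using assms by (auto simp: annulus_def int_box_def)
  have "real N \<le> norm \<xi>" using c(1) component_le_norm_cart[of \<xi> i0] by linarith
  then show "(real N)\<^sup>2 \<le> (norm \<xi>)\<^sup>2" by (intro power_mono) auto
  have "(norm \<xi>)\<^sup>2 = (\<Sum>i\<in>UNIV. (\<xi> $ i)\<^sup>2)" unfolding power2_norm_eq_inner inner_vec_def by (simp add: power2_eq_square)
  also have "\<dots> \<le> (\<Sum>i\<in>(UNIV :: 'd set). (5 * real N)\<^sup>2)"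
    using c(2) by (intro sum_mono) (metis abs_ge_zero power2_abs power_mono)
  finally show "(norm \<xi>)\<^sup>2 \<le> 25 * real CARD('d) * (real N)\<^sup>2" by (simp add: power_mult_distrib)
qed

lemma int_vectors_norm_ge_1:
  assumes "\<xi> \<in> int_vectors" "\<xi> \<noteq> (0 :: real ^ 'd::finite)"
  shows "1 \<le> norm \<xi>"
proof -
  obtain i where "\<xi> $ i \<noteq> 0" using assms(2) by (auto simp: vec_eq_iff)
  moreover have "\<xi> $ i \<in> \<int>" using assms(1) by (simp add: int_vectors_def)
  ultimately have "1 \<le> \<bar>\<xi> $ i\<bar>" using Ints_nonzero_abs_ge1 by blast
  then show ?thesis using component_le_norm_cart[of \<xi> i] by linarith
qed

section \<open>Waves of the empirical measure and the number of scales\<close>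

context subordinated_torus begin

lemma wave_moment_integrable:
  assumes "0 < t"
  shows "integrable M (\<lambda>\<omega>. \<integral>y. (wave i0 (emp t \<omega>) k y) ^ p \<partial>unit_cube)"
proof -
  have r: "rtrig (annulus i0 (8 ^ k)) (ker i0 (8 ^ k))" by (rule trig_ker)
  obtain C where C: "\<And>x. \<bar>ker i0 (8 ^ k) x\<bar> \<le> C" using rtrig_bounded[OF r] by metis
  show ?thesis unfolding wave_def
    by (rule power_moment_integrable[OF rtrig_continuous[OF r] C rtrig_periodic[OF r freq_set_annulus] assms])
qed

text \<open>On the annulus of size N = 8 ^ k the two hypotheses on \<open>B\<close> make
  \<open>psi\<close> comparable to N to the power 2 \<alpha>. The squared coefficients add up to at
  least a multiple of N ^ d, which gives the second moment. In the fourth moment the unpaired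
  quadruples enter with the relative weight N ^ (2 d) / t, which the size condition bounds by
  1.\<close>

lemma wave_moments:
  fixes i0 :: 'd
  assumes H: "H = 1 / 2" and B: "B \<in> bernstein_upper \<alpha>" "B \<in> bernstein_lower \<alpha>" and \<alpha>: "0 \<le> \<alpha>"
  obtains c2 C4 T where "0 < c2" "0 < C4" "1 < T"
    "\<And>t k. T \<le> t \<Longrightarrow> c2 * ((8 ^ k) powr (real CARD('d) - 2 * \<alpha>) / t) \<le> expectation (\<lambda>\<omega>. \<integral>y. (wave i0 (emp t \<omega>) k y)\<^sup>2 \<partial>unit_cube)"
    "\<And>t k. T \<le> t \<Longrightarrow> (8 ^ k) ^ (2 * CARD('d)) \<le> t \<Longrightarrow>
      expectation (\<lambda>\<omega>. \<integral>y. (wave i0 (emp t \<omega>) k y) ^ 4 \<partial>unit_cube) \<le> C4 * ((8 ^ k) powr (real CARD('d) - 2 * \<alpha>) / t)\<^sup>2"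
proof -
  let ?D = "CARD('d)"
  have BP: "B \<in> bernstein_pos" using B(1) by (simp add: bernstein_upper_def)
  obtain C1 where C1: "0 < C1" "\<And>x. 1 \<le> x \<Longrightarrow> B x \<le> C1 * x powr \<alpha>" using bernstein_upper_bound[OF B(1), of 1] \<alpha> by auto
  obtain c1 where c1: "0 < c1" "\<And>x. 1 \<le> x \<Longrightarrow> c1 * x powr \<alpha> \<le> B x" using bernstein_lower_bound[OF B(2), of 1] \<alpha> by auto
  define b0 where "b0 = B (2 * pi\<^sup>2)"
  have b0: "0 < b0" unfolding b0_def by (rule bernstein_pos_pos[OF BP]) simp
  have b0': "b0 \<le> psi \<xi>" if "\<xi> \<in> int_vectors" "\<xi> \<noteq> 0" for \<xi>
    unfolding b0_def using int_vectors_norm_ge_1[OF that] by (intro bernstein_pos_mono[OF BP]) (auto simp: power2_eq_square intro!: mult_ge1_I)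
  \<comment> \<open>The constant by which \<open>25 * real ?D\<close> from
    \<open>annulus_norm_bounds\<close> and \<open>2 * pi\<^sup>2\<close> from \<open>psi\<close>
    enlarge the upper bound for the rate.\<close>
  define G where "G = (2 * pi\<^sup>2 * (25 * real ?D)) powr \<alpha>"
  have pi1: "1 \<le> 2 * pi\<^sup>2" using pi_ge_two by (metis mult_ge1_I numeral_One numeral_le_iff one_le_numeral one_le_power order_trans)
  have "0 < ?D" by simp
  then have D1: "1 \<le> 25 * real ?D" by linarith
  have G: "1 \<le> G" unfolding G_def using mult_ge1_I[OF pi1 D1] \<alpha> by (intro ge_one_powr_ge_zero) auto
  have cC: "c1 \<le> C1" using c1(2)[of 1] C1(2)[of 1] by simp
  define E where "E = (11::real) ^ ?D"
  have E: "0 < E" by (simp add: E_def)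
  define c2 where "c2 = exp (- 1) / (E * (2 * (C1 * G)))"
  define C4 where "C4 = 24 / c1\<^sup>2 * (E\<^sup>2 + E ^ 4 / b0)"
  \<comment> \<open>From \<open>2 / c1\<close> on one has \<open>2 \<le> t * c1\<close>, and
    \<open>c1\<close> is below the upper rate \<open>C1 * G * Q\<close>, so
    \<open>second_moment_ge\<close> applies at every scale.\<close>
  define T where "T = max 2 (2 / c1)"
  have main: "c2 * (real N powr (real ?D - 2 * \<alpha>) / t) \<le> expectation (\<lambda>\<omega>. \<integral>y. (wave i0 (emp t \<omega>) k y)\<^sup>2 \<partial>unit_cube)
      \<and> (real N ^ (2 * ?D) \<le> t \<longrightarrow> expectation (\<lambda>\<omega>. \<integral>y. (wave i0 (emp t \<omega>) k y) ^ 4 \<partial>unit_cube) \<le> C4 * (real N powr (real ?D - 2 * \<alpha>) / t)\<^sup>2)"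
    if t: "T \<le> t" and N: "N = 8 ^ k" for t k and N :: nat
  proof -
    have N1: "1 \<le> real N" "0 < N" by (simp_all add: N)
    have t0: "0 < t" "2 / c1 \<le> t" using t by (simp_all add: T_def)
    have tc1: "2 \<le> t * c1" using t0(2) c1(1) by (simp add: divide_le_eq)
    obtain a where a: "\<And>x. complex_of_real (ker i0 N x) = tp (annulus i0 N) a x"
      "\<And>\<xi>. \<xi> \<in> annulus i0 N \<Longrightarrow> norm (a \<xi>) \<le> 1"
      "real N ^ ?D / 11 ^ ?D \<le> (\<Sum>\<xi>\<in>annulus i0 N. (norm (a \<xi>))\<^sup>2)"
      "real (card (annulus i0 N)) \<le> (11 * real N) ^ ?D"
      using ker_coefficients[OF N1(2)] by metis
    define P where "P = real N ^ ?D"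
    define Q where "Q = real N powr (2 * \<alpha>)"
    have P: "0 < P" using N1 by (simp add: P_def)
    have Q: "1 \<le> Q" unfolding Q_def using N1 \<alpha> by (intro ge_one_powr_ge_zero) auto
    have PQ: "real N powr (real ?D - 2 * \<alpha>) = P / Q"
      unfolding P_def Q_def using N1 by (simp add: powr_diff powr_realpow)
    have Q2: "((real N)\<^sup>2) powr \<alpha> = Q" unfolding Q_def using N1 by (simp add: powr_powr flip: powr_numeral)
    have x1: "(real N)\<^sup>2 \<le> 2 * pi\<^sup>2 * (norm \<xi>)\<^sup>2" if "\<xi> \<in> annulus i0 N" for \<xi>
      using order.trans[OF annulus_norm_bounds(1)[OF that] mult_right_mono[OF pi1, of "(norm \<xi>)\<^sup>2", unfolded mult_1]] by simp
    have x2: "1 \<le> 2 * pi\<^sup>2 * (norm \<xi>)\<^sup>2" if "\<xi> \<in> annulus i0 N" for \<xi>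
      using x1[OF that] one_le_power[OF N1(1), of 2] by linarith
    have b1: "c1 * Q \<le> psi \<xi>" if "\<xi> \<in> annulus i0 N" for \<xi>
    proof -
      have "c1 * Q \<le> c1 * (2 * pi\<^sup>2 * (norm \<xi>)\<^sup>2) powr \<alpha>"
        unfolding Q2[symmetric] using x1[OF that] c1(1) \<alpha> by (intro mult_left_mono powr_mono2) auto
      then show ?thesis using c1(2)[OF x2[OF that]] by linarith
    qed
    have b2: "psi \<xi> \<le> C1 * G * Q" if "\<xi> \<in> annulus i0 N" for \<xi>
    proof -
      have "2 * pi\<^sup>2 * (norm \<xi>)\<^sup>2 \<le> 2 * pi\<^sup>2 * (25 * real ?D * (real N)\<^sup>2)"
        using annulus_norm_bounds(2)[OF that] by (intro mult_left_mono) auto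
      then have "(2 * pi\<^sup>2 * (norm \<xi>)\<^sup>2) powr \<alpha> \<le> (2 * pi\<^sup>2 * (25 * real ?D) * (real N)\<^sup>2) powr \<alpha>"
        using \<alpha> by (intro powr_mono2) (auto simp: mult.assoc)
      also have "\<dots> = G * Q" unfolding G_def Q2[symmetric] by (rule powr_mult)
      finally have "C1 * (2 * pi\<^sup>2 * (norm \<xi>)\<^sup>2) powr \<alpha> \<le> C1 * (G * Q)" using C1(1) by (intro mult_left_mono) auto
      then show ?thesis using C1(2)[OF x2[OF that]] by (simp add: mult.assoc)
    qed
    have "c1 * 1 * 1 \<le> C1 * G * Q" using cC c1(1) G Q by (intro mult_mono) auto
    then have "t * c1 \<le> t * (C1 * G * Q)" using t0 by (intro mult_left_mono) auto
    then have tb2: "2 \<le> t * (C1 * G * Q)" using tc1 by linarith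
    have w2: "expectation (\<lambda>\<omega>. \<integral>y. (wave i0 (emp t \<omega>) k y)\<^sup>2 \<partial>unit_cube)
        = expectation (\<lambda>\<omega>. \<integral>y. (\<integral>z. ker i0 N (rep_torus z - y) \<partial>emp t \<omega>)\<^sup>2 \<partial>unit_cube)"
      and w4: "expectation (\<lambda>\<omega>. \<integral>y. (wave i0 (emp t \<omega>) k y) ^ 4 \<partial>unit_cube)
        = expectation (\<lambda>\<omega>. \<integral>y. (\<integral>z. ker i0 N (rep_torus z - y) \<partial>emp t \<omega>) ^ 4 \<partial>unit_cube)"
      unfolding wave_def N by (rule refl)+
    show ?thesis
    proof (intro conjI impI)
      have "c2 * (P / Q / t) = P / E * (exp (- 1) / (2 * (t * (C1 * G * Q))))"
        by (simp add: c2_def mult_ac)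
      also have "\<dots> \<le> (\<Sum>\<xi>\<in>annulus i0 N. (norm (a \<xi>))\<^sup>2) * (exp (- 1) / (2 * (t * (C1 * G * Q))))"
        using a(3) tb2 by (intro mult_right_mono) (auto simp: P_def E_def)
      also have "\<dots> \<le> expectation (\<lambda>\<omega>. \<integral>y. (\<integral>z. ker i0 N (rep_torus z - y) \<partial>emp t \<omega>)\<^sup>2 \<partial>unit_cube)"
        by (rule second_moment_ge[OF H BP freq_set_annulus a(1) b2 t0(1) tb2])
      finally show "c2 * (real N powr (real ?D - 2 * \<alpha>) / t) \<le> expectation (\<lambda>\<omega>. \<integral>y. (wave i0 (emp t \<omega>) k y)\<^sup>2 \<partial>unit_cube)"
        unfolding PQ w2 .
    next
      assume Pt: "real N ^ (2 * ?D) \<le> t"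
      have P2: "P\<^sup>2 \<le> t" using Pt by (simp add: P_def power_mult mult.commute)
      have K: "real (card (annulus i0 N)) \<le> E * P" using a(4) by (simp add: E_def P_def power_mult_distrib)
      have K2: "real (card (annulus i0 N)) ^ 2 \<le> (E * P) ^ 2" and K4: "real (card (annulus i0 N)) ^ 4 \<le> (E * P) ^ 4"
        using K by (auto intro: power_mono)
      have c1Q: "0 < c1 * Q" using c1(1) Q by simp
      have "expectation (\<lambda>\<omega>. \<integral>y. (\<integral>z. ker i0 N (rep_torus z - y) \<partial>emp t \<omega>) ^ 4 \<partial>unit_cube)
        \<le> 24 * (1 / (t * (c1 * Q)))\<^sup>2 * (real (card (annulus i0 N)) ^ 2 + real (card (annulus i0 N)) ^ 4 * (1 / (t * b0)))"
        by (rule fourth_moment_le[OF H BP freq_set_annulus a(1,2) b1 b0' c1Q b0 t0(1)])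
      also have "\<dots> \<le> 24 * (1 / (t * (c1 * Q)))\<^sup>2 * (P\<^sup>2 * (E\<^sup>2 + E ^ 4 / b0))"
      proof (intro mult_left_mono)
        have "real (card (annulus i0 N)) ^ 4 * (1 / (t * b0)) \<le> (E * P) ^ 4 * (1 / (t * b0))"
          using K4 t0 b0 by (intro mult_right_mono) auto
        \<comment> \<open>Here \<open>P\<^sup>2 \<le> t\<close> brings the count of all quadruples
          down to the order of the opposite pairs.\<close>
        also have "\<dots> = E ^ 4 * P\<^sup>2 * (P\<^sup>2 / t) / b0"
          by (simp add: power_mult_distrib power4_eq_xxxx power2_eq_square)
        also have "\<dots> \<le> E ^ 4 * P\<^sup>2 * 1 / b0"
          using P2 t0 b0 E by (intro divide_right_mono mult_left_mono) auto
        finally show "real (card (annulus i0 N)) ^ 2 + real (card (annulus i0 N)) ^ 4 * (1 / (t * b0)) \<le> P\<^sup>2 * (E\<^sup>2 + E ^ 4 / b0)"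
          using K2 by (simp add: power_mult_distrib algebra_simps)
      qed simp
      also have "\<dots> = C4 * (P / Q / t)\<^sup>2"
      proof -
        have "24 * (1 / (t * (c1 * Q)))\<^sup>2 * (P\<^sup>2 * F) = 24 / c1\<^sup>2 * F * (P / Q / t)\<^sup>2" for F
          by (simp add: power_divide power_mult_distrib mult_ac)
        then show ?thesis unfolding C4_def .
      qed
      finally show "expectation (\<lambda>\<omega>. \<integral>y. (wave i0 (emp t \<omega>) k y) ^ 4 \<partial>unit_cube) \<le> C4 * (real N powr (real ?D - 2 * \<alpha>) / t)\<^sup>2"
        unfolding PQ w4 .
    qed
  qed
  show ?thesis
  proof (rule that)
    show "0 < c2" using E C1(1) G by (simp add: c2_def)
    show "0 < C4" using E c1(1) b0 by (simp add: C4_def add_pos_pos)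
    show "1 < T" by (simp add: T_def)
    show "c2 * ((8 ^ k) powr (real ?D - 2 * \<alpha>) / t) \<le> expectation (\<lambda>\<omega>. \<integral>y. (wave i0 (emp t \<omega>) k y)\<^sup>2 \<partial>unit_cube)" if "T \<le> t" for t k
      using main[OF that refl, of k] by simp
    show "expectation (\<lambda>\<omega>. \<integral>y. (wave i0 (emp t \<omega>) k y) ^ 4 \<partial>unit_cube) \<le> C4 * ((8 ^ k) powr (real ?D - 2 * \<alpha>) / t)\<^sup>2"
      if "T \<le> t" "(8 ^ k) ^ (2 * ?D) \<le> t" for t k
      using main[OF that(1) refl, of k] that(2) by simp
  qed
qed

text \<open>The condition on the powers says that all scales used contribute equally. It holds at
  every scale in the critical dimension, and at \<open>k = 0\<close> in any dimension, where both
  sides are 1. So one statement serves the logarithmic case and the plain rate.\<close>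

lemma wasserstein_multiscale:
  assumes H: "H = 1 / 2" and B: "B \<in> bernstein_upper \<alpha>" "B \<in> bernstein_lower \<alpha>" and \<alpha>: "0 \<le> \<alpha>"
  obtains \<kappa> T where "0 < \<kappa>" "1 < T"
    "\<And>t r. T \<le> t \<Longrightarrow> 0 < r
      \<Longrightarrow> (\<And>k. k < r \<Longrightarrow> (8 ^ k) ^ (2 * CARD('d)) \<le> t \<and> (8 ^ k) powr (real CARD('d) - 2 * \<alpha>) = (8 ^ k)\<^sup>2)
      \<Longrightarrow> \<kappa> * sqrt (real r / t) \<le> expectation (\<lambda>\<omega>. wasserstein 1 (emp t \<omega>) torus_uniform)"
proof -
  let ?D = "CARD('d)"
  obtain i0 :: 'd where True by simp
  obtain c2 C4 T where c: "0 < c2" "0 < C4" "1 < T"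
    and V2: "\<And>t k. T \<le> t \<Longrightarrow> c2 * ((8 ^ k) powr (real ?D - 2 * \<alpha>) / t) \<le> expectation (\<lambda>\<omega>. \<integral>y. (wave i0 (emp t \<omega>) k y)\<^sup>2 \<partial>unit_cube)"
    and V4: "\<And>t k. T \<le> t \<Longrightarrow> (8 ^ k) ^ (2 * ?D) \<le> t \<Longrightarrow>
      expectation (\<lambda>\<omega>. \<integral>y. (wave i0 (emp t \<omega>) k y) ^ 4 \<partial>unit_cube) \<le> C4 * ((8 ^ k) powr (real ?D - 2 * \<alpha>) / t)\<^sup>2"
    using wave_moments[OF H B \<alpha>, of i0] by metis
  \<comment> \<open>Makes the fourth-moment term at most
    \<open>c2 / 8 * (\<sigma> k / \<theta>)\<close>.\<close>
  define \<theta> where "\<theta> = sqrt (8 * C4 / c2)"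
  have \<theta>: "0 < \<theta>" "\<theta>\<^sup>2 = 8 * C4 / c2" using c by (simp_all add: \<theta>_def)
  \<comment> \<open>The first bound spends at most half of the second-moment term and leaves
    \<open>c2 / 2 * (\<sigma> k / \<theta>)\<close>. The second spends one more
    \<open>c2 / 8\<close> of this unit, like the fourth moment, so \<open>c2 / 4\<close>
    remains.\<close>
  define \<zeta> where "\<zeta> = min (1 / (2 * \<theta>)) (c2 / (8 * \<theta>))"
  have \<zeta>: "0 < \<zeta>" "\<zeta> \<le> 1 / (2 * \<theta>)" "\<zeta> \<le> c2 / (8 * \<theta>)" using c \<theta> by (auto simp: \<zeta>_def)
  \<comment> \<open>Solves for the threshold factor at which the coefficient in
    \<open>multiscale_bound\<close> equals \<open>\<zeta>\<close>.\<close>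
  define m where "m = 10 * pi * sqrt (real ?D) / \<zeta>"
  have m: "0 < m" using \<zeta> by (simp add: m_def)
  have m\<zeta>: "10 * pi * sqrt (real ?D) / m = \<zeta>" using \<zeta> by (simp add: m_def)
  define L where "L = m + sqrt (Cgrow TYPE('d))"
  show ?thesis
  proof (rule that)
    have Cg: "0 \<le> Cgrow TYPE('d)"
      by (rule less_imp_le[OF Cgrow_pos[OF prob_space_torus_uniform sets_torus_uniform zero_less_one]])
    then have L: "0 < L" using m by (simp add: L_def add_pos_nonneg)
    show "0 < c2 / (4 * \<theta>) / L" using c \<theta> L by simp
    show "1 < T" by fact
    fix t :: real and r :: nat
    assume t: "T \<le> t" and r: "0 < r" and k: "\<And>k. k < r \<Longrightarrow> (8 ^ k) ^ (2 * ?D) \<le> t \<and> (8 ^ k) powr (real ?D - 2 * \<alpha>) = (8 ^ k)\<^sup>2"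
    have t0: "0 < t" using t c by simp
    \<comment> \<open>Typical size of the wave at scale \<open>k\<close>; divided by
      \<open>8 ^ k\<close> it is \<open>1 / sqrt t\<close> at every scale.\<close>
    define \<sigma> where "\<sigma> k = 8 ^ k / sqrt t" for k :: nat
    have \<sigma>: "0 < \<sigma> k" for k using t0 by (simp add: \<sigma>_def)
    have \<sigma>2: "(8 ^ k) powr (real ?D - 2 * \<alpha>) / t = (\<sigma> k)\<^sup>2" if "k < r" for k
      using k[OF that] t0 by (simp add: \<sigma>_def power_divide)
    define v where "v k \<omega> = (\<integral>y. (wave i0 (emp t \<omega>) k y)\<^sup>2 \<partial>unit_cube)" for k \<omega>
    define w where "w k \<omega> = (\<integral>y. (wave i0 (emp t \<omega>) k y) ^ 4 \<partial>unit_cube)" for k \<omega>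
    note vI = wave_moment_integrable[OF t0, of i0 _ 2, folded v_def] and wI = wave_moment_integrable[OF t0, of i0 _ 4, folded w_def]
    let ?term = "\<lambda>k \<omega>. (v k \<omega> / (\<theta> * \<sigma> k) - w k \<omega> / (\<theta> * \<sigma> k) ^ 3 - \<zeta> * (v k \<omega> / \<sigma> k + \<sigma> k)) / 8 ^ k"
    have I: "integrable M (?term k)" for k using vI wI by simp
    have W: "integrable M (\<lambda>\<omega>. wasserstein 1 (emp t \<omega>) torus_uniform)" by (rule wasserstein_emp_integrable[OF t0]) simp
    have term_ge: "c2 / (4 * \<theta>) / sqrt t \<le> expectation (?term k)" if kr: "k < r" for k
    proof -
      let ?v = "expectation (v k)" and ?w = "expectation (w k)"
      have v: "c2 * (\<sigma> k)\<^sup>2 \<le> ?v" using V2[OF t, of k] unfolding \<sigma>2[OF kr] v_def .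
      have w: "?w \<le> C4 * ((\<sigma> k)\<^sup>2)\<^sup>2" using V4[OF t, of k] k[OF kr] unfolding \<sigma>2[OF kr] w_def by blast
      have "?w / (\<theta> * \<sigma> k) ^ 3 \<le> C4 * ((\<sigma> k)\<^sup>2)\<^sup>2 / (\<theta> * \<sigma> k) ^ 3" using w \<theta> \<sigma>[of k] by (intro divide_right_mono) auto
      also have "\<dots> = C4 / \<theta>\<^sup>2 * (\<sigma> k / \<theta>)"
        using \<sigma>[of k] \<theta>(1) by (simp add: power2_eq_square power3_eq_cube)
      also have "\<dots> = c2 / 8 * (\<sigma> k / \<theta>)" using \<theta>(2) c by simp
      finally have w': "?w / (\<theta> * \<sigma> k) ^ 3 \<le> c2 / 8 * (\<sigma> k / \<theta>)" .
      have "\<zeta> * (?v / \<sigma> k) \<le> 1 / (2 * \<theta>) * (?v / \<sigma> k)"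
        using \<zeta> \<sigma>[of k] order.trans[OF _ v] c by (intro mult_right_mono divide_nonneg_nonneg) auto
      moreover have "\<zeta> * \<sigma> k \<le> c2 / (8 * \<theta>) * \<sigma> k" using \<zeta> \<sigma>[of k] by (intro mult_right_mono) auto
      moreover have "c2 * (\<sigma> k)\<^sup>2 / (2 * \<theta> * \<sigma> k) \<le> ?v / (2 * \<theta> * \<sigma> k)" using v \<theta> \<sigma>[of k] by (intro divide_right_mono) auto
      moreover have "c2 * (\<sigma> k)\<^sup>2 / (2 * \<theta> * \<sigma> k) = c2 / 2 * (\<sigma> k / \<theta>)" using \<sigma>[of k] by (simp add: power2_eq_square)
      moreover have "?v / (\<theta> * \<sigma> k) = 1 / (2 * \<theta>) * (?v / \<sigma> k) + ?v / (2 * \<theta> * \<sigma> k)" by simp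
      ultimately have "c2 / 4 * (\<sigma> k / \<theta>) \<le> ?v / (\<theta> * \<sigma> k) - ?w / (\<theta> * \<sigma> k) ^ 3 - \<zeta> * (?v / \<sigma> k + \<sigma> k)"
        using w' by (simp add: distrib_left)
      then have "c2 / 4 * (\<sigma> k / \<theta>) / 8 ^ k \<le> (?v / (\<theta> * \<sigma> k) - ?w / (\<theta> * \<sigma> k) ^ 3 - \<zeta> * (?v / \<sigma> k + \<sigma> k)) / 8 ^ k"
        by (intro divide_right_mono) auto
      also have "\<dots> = expectation (?term k)" using vI[of k] wI[of k] by (simp add: prob_space)
      finally have "c2 / 4 * (\<sigma> k / \<theta>) / 8 ^ k \<le> expectation (?term k)" .
      moreover have "c2 / 4 * (\<sigma> k / \<theta>) / 8 ^ k = c2 / (4 * \<theta>) / sqrt t" by (simp add: \<sigma>_def)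
      ultimately show ?thesis by linarith
    qed
    have "real r * (c2 / (4 * \<theta>) / sqrt t) = (\<Sum>k<r. c2 / (4 * \<theta>) / sqrt t)" by simp
    also have "\<dots> \<le> (\<Sum>k<r. expectation (?term k))" using term_ge by (intro sum_mono) auto
    also have "\<dots> = expectation (\<lambda>\<omega>. \<Sum>k<r. ?term k \<omega>)" using I by (subst Bochner_Integration.integral_sum) auto
    also have "\<dots> \<le> expectation (\<lambda>\<omega>. L * sqrt (real r) * wasserstein 1 (emp t \<omega>) torus_uniform)"
    proof (intro integral_mono)
      show "integrable M (\<lambda>\<omega>. \<Sum>k<r. ?term k \<omega>)" using I by (intro Bochner_Integration.integrable_sum)
      show "integrable M (\<lambda>\<omega>. L * sqrt (real r) * wasserstein 1 (emp t \<omega>) torus_uniform)" using W by simp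
      show "(\<Sum>k<r. ?term k \<omega>) \<le> L * sqrt (real r) * wasserstein 1 (emp t \<omega>) torus_uniform" if "\<omega> \<in> space M" for \<omega>
        using multiscale_bound[OF prob_space_emp[OF that t0] sets_emp[OF that t0] m r \<sigma> \<theta>(1), of i0]
        unfolding m\<zeta> L_def v_def w_def .
    qed
    also have "\<dots> = L * sqrt (real r) * expectation (\<lambda>\<omega>. wasserstein 1 (emp t \<omega>) torus_uniform)" by simp
    finally have "real r * (c2 / (4 * \<theta>) / sqrt t) \<le> L * sqrt (real r) * expectation (\<lambda>\<omega>. wasserstein 1 (emp t \<omega>) torus_uniform)" .
    moreover have "x / (L * sqrt (real r)) \<le> y" if "x \<le> L * sqrt (real r) * y" for x y
      using L r that by (simp add: pos_divide_le_eq mult.commute)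
    ultimately have "real r * (c2 / (4 * \<theta>) / sqrt t) / (L * sqrt (real r)) \<le> expectation (\<lambda>\<omega>. wasserstein 1 (emp t \<omega>) torus_uniform)"
      by blast
    \<comment> \<open>A total gain of \<open>r\<close> equal terms against a Lipschitz constant of
      order \<open>sqrt (real r)\<close> leaves a factor \<open>sqrt (real r)\<close>.\<close>
    moreover have "real r * (c2 / (4 * \<theta>) / sqrt t) / (L * sqrt (real r)) = c2 / (4 * \<theta>) / L * sqrt (real r / t)"
    proof -
      define R where "R = sqrt (real r)"
      have R: "0 < R" "real r = R * R" using r by (simp_all add: R_def)
      have "R * R * (c2 / (4 * \<theta>) / sqrt t) / (L * R) = c2 / (4 * \<theta>) / L * (R / sqrt t)" using R(1) by (simp add: mult_ac)
      then show ?thesis unfolding R(2) using R(1) by (simp add: real_sqrt_divide real_sqrt_mult)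
    qed
    ultimately show "c2 / (4 * \<theta>) / L * sqrt (real r / t) \<le> expectation (\<lambda>\<omega>. wasserstein 1 (emp t \<omega>) torus_uniform)" by simp
  qed
qed

lemma wasserstein_1_lower_bound:
  assumes H: "H = 1 / 2" and B: "B \<in> bernstein_upper \<alpha>" "B \<in> bernstein_lower \<alpha>" and \<alpha>: "0 \<le> \<alpha>"
  shows "\<exists>C>0. \<exists>t\<^sub>0>1. \<forall>t\<ge>t\<^sub>0. C * t powr (- 1 / 2) \<le> expectation (\<lambda>\<omega>. wasserstein 1 (emp t \<omega>) torus_uniform)" (is ?A)
    and "real CARD('d) = 2 * (1 + \<alpha>) \<Longrightarrow>
      \<exists>C>0. \<exists>t\<^sub>0>1. \<forall>t\<ge>t\<^sub>0. C * (ln t / t) powr (1 / 2) \<le> expectation (\<lambda>\<omega>. wasserstein 1 (emp t \<omega>) torus_uniform)" (is "_ \<Longrightarrow> ?B")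
proof -
  let ?D = "CARD('d)"
  obtain \<kappa> T where \<kappa>: "0 < \<kappa>" "1 < T"
    "\<And>t r. T \<le> t \<Longrightarrow> 0 < r
      \<Longrightarrow> (\<And>k. k < r \<Longrightarrow> (8 ^ k) ^ (2 * ?D) \<le> t \<and> (8 ^ k) powr (real ?D - 2 * \<alpha>) = (8 ^ k)\<^sup>2)
      \<Longrightarrow> \<kappa> * sqrt (real r / t) \<le> expectation (\<lambda>\<omega>. wasserstein 1 (emp t \<omega>) torus_uniform)"
    using wasserstein_multiscale[OF H B \<alpha>] by metis
  have "\<kappa> * t powr (- 1 / 2) \<le> expectation (\<lambda>\<omega>. wasserstein 1 (emp t \<omega>) torus_uniform)" if "T \<le> t" for t
  proof -
    \<comment> \<open>With \<open>r = 1\<close> only the scale 0 occurs, where both conditions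
      reduce to \<open>1 \<le> t\<close> and \<open>1 = 1\<close>; no relation between the dimension
      and \<alpha> enters.\<close>
    have "sqrt (real 1 / t) = t powr (- 1 / 2)"
      using that \<kappa>(2) by (simp add: real_sqrt_divide powr_minus_divide powr_half_sqrt)
    then show ?thesis using \<kappa>(3)[OF that, of 1] that \<kappa>(2) by simp
  qed
  then show ?A using \<kappa>(1,2) by blast
  show ?B if D: "real ?D = 2 * (1 + \<alpha>)"
  proof -
    let ?q = "2 * real ?D * ln 8"
    have q: "0 < ?q" by simp
    have "\<kappa> / sqrt ?q * (ln t / t) powr (1 / 2) \<le> expectation (\<lambda>\<omega>. wasserstein 1 (emp t \<omega>) torus_uniform)" if t: "T \<le> t" for t
    proof -
      have t1: "1 < t" using t \<kappa>(2) by simp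
      \<comment> \<open>The scales below \<open>r\<close> are exactly those with
        \<open>(8 ^ k) ^ (2 * ?D) \<le> t\<close>; the \<open>Suc\<close> counts scale 0 and makes
        \<open>r\<close> at least \<open>ln t / ?q\<close>.\<close>
      define r where "r = Suc (nat \<lfloor>ln t / ?q\<rfloor>)"
      have l0: "0 \<le> ln t / ?q" using t1 by simp
      have r: "ln t / ?q \<le> real r" using l0 unfolding r_def by linarith
      have "\<kappa> * sqrt (real r / t) \<le> expectation (\<lambda>\<omega>. wasserstein 1 (emp t \<omega>) torus_uniform)"
      proof (rule \<kappa>(3)[OF t])
        fix k assume "k < r"
        then have "real k \<le> ln t / ?q" using l0 unfolding r_def by linarith
        then have "real k * ?q \<le> ln t" using q by (simp only: le_divide_eq if_True)
        moreover have "ln (((8::real) ^ k) ^ (2 * ?D)) = real k * ?q" by (simp add: ln_realpow)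
        ultimately have "ln (((8::real) ^ k) ^ (2 * ?D)) \<le> ln t" by simp
        then have "((8::real) ^ k) ^ (2 * ?D) \<le> t" using t1 by (subst (asm) ln_le_cancel_iff) auto
        moreover have "(8 ^ k) powr (real ?D - 2 * \<alpha>) = ((8::real) ^ k)\<^sup>2" unfolding D by simp
        ultimately show "(8 ^ k) ^ (2 * ?D) \<le> t \<and> (8 ^ k) powr (real ?D - 2 * \<alpha>) = (8 ^ k)\<^sup>2" ..
      qed (simp add: r_def)
      moreover have "\<kappa> / sqrt ?q * (ln t / t) powr (1 / 2) \<le> \<kappa> * sqrt (real r / t)"
      proof -
        have "\<kappa> / sqrt ?q * (ln t / t) powr (1 / 2) = \<kappa> * sqrt (ln t / ?q / t)"
          using t1 by (simp add: powr_half_sqrt real_sqrt_divide real_sqrt_mult)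
        also have "\<dots> \<le> \<kappa> * sqrt (real r / t)"
          using r t1 \<kappa>(1) by (intro mult_left_mono real_sqrt_le_mono divide_right_mono) auto
        finally show ?thesis .
      qed
      ultimately show ?thesis by linarith
    qed
    moreover have "0 < \<kappa> / sqrt ?q" using \<kappa>(1) q by simp
    ultimately show ?B using \<kappa>(2) by blast
  qed
qed

end

theorem theorem1p3:
  fixes M :: "'w measure"
    and B :: "real \<Rightarrow> real"
    and H :: real
    and Z :: "real \<Rightarrow> 'w \<Rightarrow> 'd::finite torus"
  assumes H: "0 < H" "H < 1"
    and B: "B \<in> bernstein_pos"
    and Z: "subordinated_fbm M B H Z"
  shows "(\<forall>\<alpha>. H = 1 / 2 \<and> 0 \<le> \<alpha> \<and> \<alpha> \<le> 1 \<and> B \<in> bernstein_upper \<alpha> \<inter> bernstein_lower \<alpha> \<longrightarrow>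
           (\<forall>p\<ge>1. \<exists>C>0. \<exists>t\<^sub>0>1. \<forall>t\<ge>t\<^sub>0.
              prob_space.expectation M (\<lambda>\<omega>. wasserstein p (empirical_measure Z t \<omega>) torus_uniform)
              \<ge> C * (if real CARD('d) < 2 * (1 + \<alpha>) then t powr (- 1 / 2)
                     else if real CARD('d) = 2 * (1 + \<alpha>) then (ln t / t) powr (1 / 2)
                     else t powr (- 1 / (real CARD('d) - 2 * \<alpha>)))))
       \<and> (\<forall>\<alpha>. 0 < \<alpha> \<and> \<alpha> \<le> 1 \<and> B \<in> bernstein_upper \<alpha> \<and> real CARD('d) > \<alpha> / H \<longrightarrow>
           (\<forall>p>0. \<exists>C>0. \<exists>t\<^sub>0>1. \<forall>t\<ge>t\<^sub>0.
              prob_space.expectation M (\<lambda>\<omega>. wasserstein p (empirical_measure Z t \<omega>) torus_uniform)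
              \<ge> C * t powr (- min 1 p / (real CARD('d) - \<alpha> / H))))"
proof -
  obtain X S where XS: "fractional_brownian_motion M H X" "subordinator M B S"
      "prob_space.indep_set M (sets (process_algebra M X)) (sets (process_algebra M S))"
      "\<And>t \<omega>. 0 \<le> t \<Longrightarrow> \<omega> \<in> space M \<Longrightarrow> Z t \<omega> = torus_proj (X (S t \<omega>) \<omega>)"
    using Z unfolding subordinated_fbm_def by blast
  interpret prob_space M using XS(1) by (simp add: fractional_brownian_motion_def)
  interpret subordinated_torus M B H X S Z
    by unfold_locales (use XS in auto)
  \<comment> \<open>Stated from \<alpha> = 0 on, because the case \<open>gt\<close> of part (1)
    draws on it too.\<close>
  have 2: "\<exists>C>0. \<exists>t\<^sub>0>1. \<forall>t\<ge>t\<^sub>0. C * t powr (- min 1 p / (real CARD('d) - \<alpha> / H))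
      \<le> expectation (\<lambda>\<omega>. wasserstein p (emp t \<omega>) torus_uniform)"
    if "0 \<le> \<alpha>" "B \<in> bernstein_upper \<alpha>" "\<alpha> / H < real CARD('d)" "0 < p" for \<alpha> p
    by (rule wasserstein_lower_bound[OF H that(2,1,3,4)])
  have 1: "\<exists>C>0. \<exists>t\<^sub>0>1. \<forall>t\<ge>t\<^sub>0. C * (if real CARD('d) < 2 * (1 + \<alpha>) then t powr (- 1 / 2)
        else if real CARD('d) = 2 * (1 + \<alpha>) then (ln t / t) powr (1 / 2)
        else t powr (- 1 / (real CARD('d) - 2 * \<alpha>)))
      \<le> expectation (\<lambda>\<omega>. wasserstein p (emp t \<omega>) torus_uniform)"
    if H2: "H = 1 / 2" and \<alpha>: "0 \<le> \<alpha>" and BB: "B \<in> bernstein_upper \<alpha>" "B \<in> bernstein_lower \<alpha>" and p: "1 \<le> p" for \<alpha> p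
  proof -
    \<comment> \<open>The distance increases with \<open>p\<close> for \<open>p \<ge> 1\<close>, so
      the rates of part (1) may be proved for \<open>p = 1\<close> alone.\<close>
    have le: "\<exists>C>0. \<exists>t\<^sub>0>1. \<forall>t\<ge>t\<^sub>0. C * g t \<le> expectation (\<lambda>\<omega>. wasserstein p (emp t \<omega>) torus_uniform)"
      if W: "\<exists>C>0. \<exists>t\<^sub>0>1. \<forall>t\<ge>t\<^sub>0. C * g t \<le> expectation (\<lambda>\<omega>. wasserstein 1 (emp t \<omega>) torus_uniform)" for g :: "real \<Rightarrow> real"
    proof -
      obtain C t0 where C: "0 < C" "1 < t0" "\<And>t. t0 \<le> t \<Longrightarrow> C * g t \<le> expectation (\<lambda>\<omega>. wasserstein 1 (emp t \<omega>) torus_uniform)"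
        using W by blast
      have "C * g t \<le> expectation (\<lambda>\<omega>. wasserstein p (emp t \<omega>) torus_uniform)" if "t0 \<le> t" for t
        using C(3)[OF that] expectation_wasserstein_1_le[of t p] p C(2) that by simp
      then show ?thesis using C by blast
    qed
    note low = wasserstein_1_lower_bound[OF H2 BB \<alpha>]
    consider (lt) "real CARD('d) < 2 * (1 + \<alpha>)" | (eq) "real CARD('d) = 2 * (1 + \<alpha>)" | (gt) "2 * (1 + \<alpha>) < real CARD('d)"
      by linarith
    then show ?thesis
    proof cases
      case lt
      then show ?thesis using le[OF low(1)] by simp
    next
      case eq
      then show ?thesis using le[OF low(2)[OF eq]] by simp
    next
      case gt
      \<comment> \<open>At \<open>H = 1 / 2\<close> the exponents of the two parts agree, and d > 2
        (1 + \<alpha>) implies the condition d > \<alpha> / H.\<close>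
      have h: "\<alpha> / H = 2 * \<alpha>" unfolding H2 by simp
      have "\<alpha> / H < real CARD('d)" unfolding h by (rule order.strict_trans[OF _ gt]) simp
      from 2[OF \<alpha> BB(1) this, of p] show ?thesis unfolding h using gt p by (simp add: min_def)
    qed
  qed
  show ?thesis using 1 2 by (intro conjI allI impI) (auto simp: less_imp_le)
qed

end
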